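(* Let $n\ge1$, $1\le p\le2$, $a\ge0$, $b\ge0$ and $a+b\ge1$. Let $K$ and $L$ be smooth uniformly h-convex bounded domains in $\mathbb{H}^{n+1}$, and let $\Omega=a\cdot K+_p^{\mathcal H}b\cdot L$ be their hyperbolic $p$-sum. Then $$\mathcal{V}^{\frac p{n+1}}(\Omega)\ \ge\ a\,\mathcal{V}^{\frac p{n+1}}(K)+b\,\mathcal{V}^{\frac p{n+1}}(L).$$ When $p=1$, equality holds if $K$ and $L$ are hyperbolic dilates. When $1<p\le2$ and $ab\ne0$, equality holds if and only if $K$ and $L$ are hyperbolic dilates.
   Context: $\mathbb{R}^{n+1,1}$ is $\mathbb{R}^{n+2}$ with $\langle X,Y\rangle=\sum_{i=0}^nx_iy_i-x_{n+1}y_{n+1}$; $\mathbb{H}^{n+1}=\{X=(x,x_{n+1}):\langle X,X\rangle=-1,x_{n+1}>0\}$ with origin $N=(0,1)$; $\mathbb{S}^n\subset\mathbb{R}^{n+1}$ is the unit sphere. A smooth bounded domain (compact, connected, nonempty interior, smooth boundary) is uniformly h-convex if for some $\delta>0$ all principal curvatures $\kappa_i$ of its boundary (outward unit normal $\nu$) exceed $1+\delta$. An h-convex bounded domain is a nonempty bounded intersection of closed horo-balls $\{X:\log(-\langle X,(z,1)\rangle)\le s\}$. Horospherical support function: $u_\Omega(z)=\sup_{X\in\Omega}\log(-\langle X,(z,1)\rangle)$. Hyperbolic $p$-sum: $a\cdot K+_p^{\mathcal H}b\cdot L$ is the (unique) h-convex bounded domain with horospherical support function $\frac1p\log(ae^{pu_K}+be^{pu_L})$;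 here it is smooth and uniformly h-convex. For $c\ge1$, $c\cdot_1K$ is the domain with horospherical support function $u_K+\log c$; $K$ and $L$ are hyperbolic dilates if $K=c\cdot_1L$ or $L=c\cdot_1K$ for some $c\ge1$. With $r$ the distance to $N$, $\tilde u=\langle\sinh r\,\partial_r,\nu\rangle$ and $p_n(\cosh r\,\kappa-\tilde u)=\prod_{i=1}^n(\cosh r\,\kappa_i-\tilde u)$, $$\mathcal{V}(K)=\frac1{n+1}\int_{\partial K}\frac{p_n(\cosh r\,\kappa-\tilde u)}{(\cosh r-\tilde u)^{n+1}}\,d\mu .$$ *)

theory Defs
  imports "HOL-Analysis.Analysis"
begin

section \<open>Smooth maps\<close>

text \<open>
  Only meaningful on open sets: all derivatives are taken with respect to a full neighbourhood.
\<close>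

primrec Ck_on :: "nat \<Rightarrow> 'a::real_normed_vector set \<Rightarrow> ('a \<Rightarrow> 'b::real_normed_vector) \<Rightarrow> bool" where
  "Ck_on 0 U f \<longleftrightarrow> continuous_on U f"
| "Ck_on (Suc k) U f \<longleftrightarrow> (\<forall>x\<in>U. f differentiable (at x)) \<and>
     (\<forall>v. Ck_on k U (\<lambda>x. frechet_derivative f (at x) v))"

definition smooth_on :: "'a::real_normed_vector set \<Rightarrow> ('a \<Rightarrow> 'b::real_normed_vector) \<Rightarrow> bool" where
  "smooth_on U f \<longleftrightarrow> (\<forall>k. Ck_on k U f)"

section \<open>The hyperboloid model\<close>

text \<open>
  With \<open>n = CARD('n)\<close>, the Euclidean space of dimension \<open>n + 1\<close> is \<open>(real ^ 'n) \<times> real\<close> with its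
  product inner product, and a point \<open>(x, t)\<close> of \<open>'n minkowski\<close> has spatial part \<open>x\<close> of
  dimension \<open>n + 1\<close> and time coordinate \<open>t\<close>. The type \<open>real ^ 'n\<close> serves as the
  parameter space of hypersurfaces of hyperbolic space. As \<open>'n\<close> is nonempty, \<open>n \<ge> 1\<close>.
\<close>

type_synonym 'n euclid1 = "(real ^ 'n) \<times> real"
type_synonym 'n minkowski = "'n euclid1 \<times> real"

definition mink :: "'n::finite minkowski \<Rightarrow> 'n minkowski \<Rightarrow> real" where
  "mink X Y = fst X \<bullet> fst Y - snd X * snd Y"

definition hyp :: "'n::finite minkowski set" where
  "hyp = {X. mink X X = -1 \<and> snd X > 0}"

definition hyp_origin :: "'n::finite minkowski" where
  "hyp_origin = (0, 1)"

definition hyp_dist :: "'n::finite minkowski \<Rightarrow> 'n minkowski \<Rightarrow> real" where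
  "hyp_dist X Y = arcosh (- mink X Y)"

definition hyp_tangent :: "'n::finite minkowski \<Rightarrow> 'n minkowski set" where
  "hyp_tangent X = {v. mink X v = 0}"

text \<open>The geodesic of \<open>hyp\<close> starting at \<open>X\<close> with unit initial velocity \<open>v\<close>.\<close>

definition hyp_geodesic :: "'n::finite minkowski \<Rightarrow> 'n minkowski \<Rightarrow> real \<Rightarrow> 'n minkowski" where
  "hyp_geodesic X v t = cosh t *\<^sub>R X + sinh t *\<^sub>R v"

definition radius :: "'n::finite minkowski \<Rightarrow> real" where
  "radius X = hyp_dist hyp_origin X"

text \<open>
  In polar coordinates \<open>X = (sinh r *\<^sub>R \<theta>, cosh r)\<close> with \<open>\<theta> = sgn (fst X)\<close>, so the
  coordinate field is the derivative in \<open>r\<close>. Its value at the origin is irrelevant, since it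
  is only used multiplied by \<open>sinh r\<close>.
\<close>

definition radial_field :: "'n::finite minkowski \<Rightarrow> 'n minkowski" where
  "radial_field X = (cosh (radius X) *\<^sub>R sgn (fst X), sinh (radius X))"

section \<open>Smooth bounded domains and the geometry of their boundaries\<close>

definition bd :: "'n::finite minkowski set \<Rightarrow> 'n minkowski set" where
  "bd K = (top_of_set hyp) frontier_of K"

text \<open>
  Smooth boundary: near each boundary point, \<open>K\<close> is a sublevel set in \<open>hyp\<close> of a smooth
  function whose differential on the tangent space of \<open>hyp\<close> does not vanish there.
\<close>

definition smooth_boundary :: "'n::finite minkowski set \<Rightarrow> bool" where
  "smooth_boundary K \<longleftrightarrow>
     (\<forall>X\<in>bd K. \<exists>U (f :: 'n minkowski \<Rightarrow> real).
        open U \<and> X \<in> U \<and> smooth_on U f \<and> K \<inter> U = {Y \<in> hyp \<inter> U. f Y \<le> 0} \<and>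
        (\<exists>v\<in>hyp_tangent X. frechet_derivative f (at X) v \<noteq> 0))"

definition smooth_bounded_domain :: "'n::finite minkowski set \<Rightarrow> bool" where
  "smooth_bounded_domain K \<longleftrightarrow>
     K \<subseteq> hyp \<and> compact K \<and> connected K \<and> (top_of_set hyp) interior_of K \<noteq> {} \<and>
     smooth_boundary K"

definition bd_tangent :: "'n::finite minkowski set \<Rightarrow> 'n minkowski \<Rightarrow> 'n minkowski set" where
  "bd_tangent K X = {v. \<exists>(\<gamma> :: real \<Rightarrow> 'n minkowski) e. e > 0 \<and> \<gamma> 0 = X \<and>
     (\<forall>t. \<bar>t\<bar> < e \<longrightarrow> \<gamma> t \<in> bd K) \<and> (\<gamma> has_vector_derivative v) (at 0)}"

definition outward_normal :: "'n::finite minkowski set \<Rightarrow> 'n minkowski \<Rightarrow> 'n minkowski" where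
  "outward_normal K X = (THE v. v \<in> hyp_tangent X \<and> mink v v = 1 \<and>
     (\<forall>w\<in>bd_tangent K X. mink v w = 0) \<and>
     (\<exists>e>0. \<forall>t. 0 < t \<and> t < e \<longrightarrow> hyp_geodesic X v t \<notin> K))"

text \<open>
  The Weingarten map sends \<open>v\<close> to the covariant derivative of the outward unit normal field in
  direction \<open>v\<close>. This is the ordinary derivative in the ambient space: differentiating
  \<open>mink X \<nu> = 0\<close> along the boundary shows that the derivative is already tangent to \<open>hyp\<close>.
  With this sign, geodesic spheres of radius \<open>R\<close> have principal curvatures \<open>coth R\<close>.
  The derivative within \<open>bd K\<close> is determined on \<open>bd_tangent K X\<close> only, and the map must
  not be applied to other vectors.
\<close>

definition weingarten :: "'n::finite minkowski set \<Rightarrow> 'n minkowski \<Rightarrow> 'n minkowski \<Rightarrow> 'n minkowski" where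
  "weingarten K X = frechet_derivative (outward_normal K) (at X within bd K)"

definition principal_space :: "'n::finite minkowski set \<Rightarrow> 'n minkowski \<Rightarrow> real \<Rightarrow> 'n minkowski set" where
  "principal_space K X k = {v \<in> bd_tangent K X. weingarten K X v = k *\<^sub>R v}"

definition principal_curvatures :: "'n::finite minkowski set \<Rightarrow> 'n minkowski \<Rightarrow> real set" where
  "principal_curvatures K X = {k. \<exists>v\<in>principal_space K X k. v \<noteq> 0}"

definition uniformly_h_convex :: "'n::finite minkowski set \<Rightarrow> bool" where
  "uniformly_h_convex K \<longleftrightarrow>
     (\<exists>\<delta>>0. \<forall>X\<in>bd K. \<forall>k\<in>principal_curvatures K X. k > 1 + \<delta>)"

text \<open>
  The induced Riemannian area measure is the Borel measure on \<open>bd K\<close> with density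
  \<open>sqrt (det g)\<close> in every smooth local parametrization.
\<close>

definition local_parametrization ::
  "'n::finite minkowski set \<Rightarrow> (real ^ 'n) set \<Rightarrow> (real ^ 'n \<Rightarrow> 'n minkowski) \<Rightarrow> bool" where
  "local_parametrization S U \<phi> \<longleftrightarrow>
     open U \<and> smooth_on U \<phi> \<and> (\<forall>x\<in>U. inj (frechet_derivative \<phi> (at x))) \<and>
     openin (top_of_set S) (\<phi> ` U) \<and> (\<exists>\<psi>. homeomorphism U (\<phi> ` U) \<phi> \<psi>)"

definition gram_matrix :: "(real ^ 'n \<Rightarrow> 'n::finite minkowski) \<Rightarrow> real ^ 'n \<Rightarrow> real ^ 'n ^ 'n" where
  "gram_matrix \<phi> x = (\<chi> i j. mink (frechet_derivative \<phi> (at x) (axis i 1))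
                                  (frechet_derivative \<phi> (at x) (axis j 1)))"

definition area_measure :: "'n::finite minkowski set \<Rightarrow> 'n minkowski measure" where
  "area_measure S = (THE M. sets M = sets (restrict_space borel S) \<and>
     (\<forall>U \<phi>. local_parametrization S U \<phi> \<longrightarrow>
        (\<forall>B\<in>sets borel. B \<subseteq> U \<longrightarrow>
           emeasure M (\<phi> ` B) =
             (\<integral>\<^sup>+x. ennreal (sqrt (det (gram_matrix \<phi> x))) * indicator B x \<partial>lborel))))"

definition u_tilde :: "'n::finite minkowski set \<Rightarrow> 'n minkowski \<Rightarrow> real" where
  "u_tilde K X = mink (sinh (radius X) *\<^sub>R radial_field X) (outward_normal K X)"

text \<open>
  The product of \<open>cosh r * \<kappa>\<^sub>i - u\<close> over the principal curvatures counted with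
  multiplicity; the multiplicity of a principal curvature is the dimension of its eigenspace.
\<close>

definition p_n :: "'n::finite minkowski set \<Rightarrow> 'n minkowski \<Rightarrow> real" where
  "p_n K X = (\<Prod>k\<in>principal_curvatures K X.
     (cosh (radius X) * k - u_tilde K X) ^ dim (principal_space K X k))"

definition V :: "'n::finite minkowski set \<Rightarrow> real" where
  "V K = 1 / (real CARD('n) + 1) *
     (LINT X|area_measure (bd K).
        p_n K X / (cosh (radius X) - u_tilde K X) ^ (CARD('n) + 1))"

section \<open>Horospherically convex domains and hyperbolic p-sums\<close>

definition horoball :: "'n::finite euclid1 \<Rightarrow> real \<Rightarrow> 'n minkowski set" where
  "horoball z s = {X \<in> hyp. ln (- mink X (z, 1)) \<le> s}"

text \<open>
  A subset of \<open>hyp\<close> is bounded for the hyperbolic distance iff it is bounded in the ambient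
  Euclidean space.
\<close>

definition h_convex_bounded_domain :: "'n::finite minkowski set \<Rightarrow> bool" where
  "h_convex_bounded_domain \<Omega> \<longleftrightarrow> \<Omega> \<noteq> {} \<and> bounded \<Omega> \<and>
     (\<exists>F \<subseteq> sphere 0 1 \<times> UNIV. \<Omega> = hyp \<inter> (\<Inter>(z, s)\<in>F. horoball z s))"

definition hsupport :: "'n::finite minkowski set \<Rightarrow> 'n euclid1 \<Rightarrow> real" where
  "hsupport \<Omega> z = (SUP X\<in>\<Omega>. ln (- mink X (z, 1)))"

definition domain_of_hsupport :: "('n::finite euclid1 \<Rightarrow> real) \<Rightarrow> 'n minkowski set" where
  "domain_of_hsupport u = (THE \<Omega>. h_convex_bounded_domain \<Omega> \<and>
     (\<forall>z\<in>sphere 0 1. hsupport \<Omega> z = u z))"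

definition hyp_psum ::
  "real \<Rightarrow> real \<Rightarrow> 'n::finite minkowski set \<Rightarrow> real \<Rightarrow> 'n minkowski set \<Rightarrow> 'n minkowski set" where
  "hyp_psum p a K b L = domain_of_hsupport
     (\<lambda>z. 1 / p * ln (a * exp (p * hsupport K z) + b * exp (p * hsupport L z)))"

definition hyp_dilate :: "real \<Rightarrow> 'n::finite minkowski set \<Rightarrow> 'n minkowski set" where
  "hyp_dilate c K = domain_of_hsupport (\<lambda>z. hsupport K z + ln c)"

definition hyp_dilates :: "'n::finite minkowski set \<Rightarrow> 'n minkowski set \<Rightarrow> bool" where
  "hyp_dilates K L \<longleftrightarrow> (\<exists>c\<ge>1. K = hyp_dilate c L \<or> L = hyp_dilate c K)"

end

theory Submission
  imports Defs
begin

text \<open>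
  Identify a point \<open>(x, t)\<close> of \<open>hyp\<close> with the Euclidean ball of centre \<open>- x\<close> and radius \<open>t\<close>, whose
  support function is \<open>t * norm v - x \<bullet> v\<close>. A uniformly h-convex domain becomes a Euclidean convex body,
  whose support function \<open>h\<close> satisfies \<open>hsupport K z = ln (h z)\<close>. In the parametrization of \<open>bd K\<close> by the
  directions \<open>z\<close> of its supporting horospheres the integrand of \<open>V\<close> is a quotient of Gauss map Jacobians,
  so that \<open>V K\<close> is the volume of that body, and the theorem becomes Firey's extension of the
  Brunn-Minkowski inequality to \<open>p\<close>-sums. The conditions \<open>p \<le> 2\<close> and \<open>a + b \<ge> 1\<close> are what makes the
  \<open>p\<close>-sum of two such support functions come from a uniformly h-convex domain again.
\<close>

section \<open>Smooth maps\<close>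

text \<open>The identification rests on \<open>- mink X (z, 1)\<close> = t - x . z for X = (x, t),
  the support function of a ball at a unit vector z. The hypothesis on K is local, a curvature bound
  on a compact connected set, whereas the inequality needs a global fact: each horosphere direction
  touches K in exactly one point. Convexity is not given in advance, so a minimax deformation over
  connected subsets of K supplies it; curvature above 1 makes every first-order contact point a
  strict local maximum of the corresponding functional. The bounds on p and a + b enter in one
  inequality. At z the p-sum is supported from below by a combination \<alpha> h1 + \<beta> h2; the
  combined contact point X' must satisfy \<open>mink X' X' \<le> -1\<close>, and this reduces to a
  tangent-line estimate with the exponent (p - 2) / p \<le> 0. Equality for p > 1 does not go
  through the equality case of Brunn-Minkowski: strict convexity of t^p and the loss of volume when
  a cap is cut off suffice.\<close>

abbreviation fd :: "('a::real_normed_vector \<Rightarrow> 'b::real_normed_vector) \<Rightarrow> 'a \<Rightarrow> 'a \<Rightarrow> 'b" where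
  "fd f x \<equiv> frechet_derivative f (at x)"

lemma Ck_on_Suc_imp: "Ck_on (Suc k) U f \<Longrightarrow> Ck_on k U f"
proof (induction k arbitrary: f)
  case 0
  then show ?case
    by (auto intro!: continuous_at_imp_continuous_on differentiable_imp_continuous_within)
next
  case (Suc k)
  then show ?case by simp
qed

lemma Ck_on_subset: "Ck_on k U f \<Longrightarrow> W \<subseteq> U \<Longrightarrow> Ck_on k W f"
  by (induction k arbitrary: f) (auto intro: continuous_on_subset)

lemma frechet_derivative_cong_open:
  assumes "open U" "x \<in> U" "\<And>y. y \<in> U \<Longrightarrow> f y = g y" "f differentiable (at x)"
  shows "fd g x = fd f x"
proof -
  have "(f has_derivative fd f x) (at x)"
    using assms(4) frechet_derivative_works by blast
  then have "(g has_derivative fd f x) (at x)"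
    using assms(1-3) by (rule has_derivative_transform_within_open)
  then show ?thesis
    using frechet_derivative_at by metis
qed

lemma Ck_on_cong:
  assumes "open U" "Ck_on k U f" "\<And>x. x \<in> U \<Longrightarrow> f x = g x"
  shows "Ck_on k U g"
  using assms(2,3)
proof (induction k arbitrary: f g)
  case 0
  then show ?case by (simp cong: continuous_on_cong)
next
  case (Suc k)
  have d: "g differentiable (at x)" if "x \<in> U" for x
    using Suc.prems that assms(1) unfolding Ck_on.simps differentiable_def
    by (metis has_derivative_transform_within_open)
  have "Ck_on k U (\<lambda>x. fd g x v)" for v
  proof (rule Suc.IH)
    show "Ck_on k U (\<lambda>x. fd f x v)" using Suc.prems by simp
    show "fd f x v = fd g x v" if "x \<in> U" for x
      using frechet_derivative_cong_open[OF assms(1) that, of f g] Suc.prems that by simp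
  qed
  then show ?case using d by simp
qed

text \<open>Any explicit derivative may replace \<open>frechet_derivative\<close>, so the closure
  properties below are inductions on k in which the formula for f' is itself shown to be of class
  C^k.\<close>

lemma Ck_on_SucI:
  assumes "open U" "\<And>x. x \<in> U \<Longrightarrow> (f has_derivative f' x) (at x)"
    "\<And>v. Ck_on k U (\<lambda>x. f' x v)"
  shows "Ck_on (Suc k) U f"
proof -
  have "Ck_on k U (\<lambda>x. fd f x v)" for v
    by (rule Ck_on_cong[OF assms(1) assms(3)[of v]]) (metis assms(2) frechet_derivative_at)
  then show ?thesis using assms(2) by (auto simp: differentiable_def)
qed

lemma Ck_on_SucD:
  assumes "Ck_on (Suc k) U f"
  shows "\<And>x. x \<in> U \<Longrightarrow> (f has_derivative fd f x) (at x)"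
    "\<And>v. Ck_on k U (\<lambda>x. fd f x v)"
  using assms frechet_derivative_works by auto

lemma Ck_on_const: "open U \<Longrightarrow> Ck_on k U (\<lambda>x. c)"
proof (induction k arbitrary: c)
  case (Suc k)
  show ?case by (rule Ck_on_SucI[where f' = "\<lambda>x v. 0"]) (auto intro!: Suc)
qed auto

lemma Ck_on_bounded_linear: "open U \<Longrightarrow> bounded_linear f \<Longrightarrow> Ck_on k U f"
proof (induction k)
  case 0
  then show ?case by (simp add: linear_continuous_on)
next
  case (Suc k)
  show ?case
    by (rule Ck_on_SucI[where f' = "\<lambda>x. f"])
      (auto intro: Suc bounded_linear_imp_has_derivative Ck_on_const)
qed

lemma Ck_on_compose_linear:
  assumes "open U" "bounded_linear L" "Ck_on k U f"
  shows "Ck_on k U (\<lambda>x. L (f x))"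
  using assms(3)
proof (induction k arbitrary: f)
  case 0
  then show ?case
    using assms(2) linear_continuous_on continuous_on_compose2 by (metis Ck_on.simps(1) UNIV_I image_subsetI)
next
  case (Suc k)
  show ?case
    by (rule Ck_on_SucI[where f' = "\<lambda>x v. L (fd f x v)"])
      (auto intro: assms Ck_on_SucD[OF Suc.prems] bounded_linear.has_derivative Suc.IH)
qed

lemma Ck_on_add:
  assumes "open U" "Ck_on k U f" "Ck_on k U g"
  shows "Ck_on k U (\<lambda>x. f x + g x)"
  using assms(2,3)
proof (induction k arbitrary: f g)
  case 0
  then show ?case by (auto intro: continuous_on_add)
next
  case (Suc k)
  show ?case
    by (rule Ck_on_SucI[where f' = "\<lambda>x v. fd f x v + fd g x v"])
      (auto intro: assms(1) Ck_on_SucD[OF Suc.prems(1)] Ck_on_SucD[OF Suc.prems(2)]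
        has_derivative_add Suc.IH)
qed

text \<open>One product rule for all bounded bilinear maps; multiplication, scaling and the inner
  product are instances.\<close>

lemma Ck_on_bilinear:
  assumes "open U" "bounded_bilinear B" "Ck_on k U f" "Ck_on k U g"
  shows "Ck_on k U (\<lambda>x. B (f x) (g x))"
  using assms(3,4)
proof (induction k arbitrary: f g)
  case 0
  then show ?case using bounded_bilinear.continuous_on[OF assms(2)] by auto
next
  case (Suc k)
  show ?case
  proof (rule Ck_on_SucI[where f' = "\<lambda>x v. B (f x) (fd g x v) +
      B (fd f x v) (g x)"])
    show "open U" by (rule assms(1))
    show "((\<lambda>x. B (f x) (g x)) has_derivative (\<lambda>v. B (f x) (fd g x v) +
      B (fd f x v) (g x))) (at x)" if "x \<in> U" for x
      using bounded_bilinear.FDERIV[OF assms(2) Ck_on_SucD(1)[OF Suc.prems(1) that]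
        Ck_on_SucD(1)[OF Suc.prems(2) that]] .
    show "Ck_on k U (\<lambda>x. B (f x) (fd g x v) +
      B (fd f x v) (g x))" for v
      by (intro Ck_on_add assms(1) Suc.IH Ck_on_SucD(2)[OF Suc.prems(1)] Ck_on_SucD(2)[OF Suc.prems(2)]
          Ck_on_Suc_imp[OF Suc.prems(1)] Ck_on_Suc_imp[OF Suc.prems(2)])
  qed
qed

lemma Ck_on_sum:
  assumes "open U" "\<And>i. i \<in> I \<Longrightarrow> Ck_on k U (f i)"
  shows "Ck_on k U (\<lambda>x. \<Sum>i\<in>I. f i x)"
  using assms(2)
  by (induction I rule: infinite_finite_induct) (auto intro: Ck_on_const Ck_on_add assms(1))

lemma linear_sum_Basis:
  fixes L :: "'a::euclidean_space \<Rightarrow> 'b::real_vector"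
  assumes "linear L"
  shows "L v = (\<Sum>b\<in>Basis. (v \<bullet> b) *\<^sub>R L b)"
  using linear_sum[OF assms, of "\<lambda>b. (v \<bullet> b) *\<^sub>R b" Basis]
  by (simp add: linear_scale[OF assms] euclidean_representation)

text \<open>The induction hypothesis speaks of \<open>fd g\<close> in a fixed direction only, so the
  inner derivative is expanded in the basis of the intermediate space: the derivative of the
  composition becomes a finite sum of scalar functions times \<open>fd g (f x) b\<close>. This is
  why the intermediate space is Euclidean.\<close>

lemma Ck_on_compose:
  fixes f :: "'a::real_normed_vector \<Rightarrow> 'b::euclidean_space"
    and g :: "'b \<Rightarrow> 'c::real_normed_vector"
  assumes "open U" "open W" "f ` U \<subseteq> W" "Ck_on k U f" "Ck_on k W g"
  shows "Ck_on k U (\<lambda>x. g (f x))"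
  using assms(4,5)
proof (induction k arbitrary: g)
  case 0
  then show ?case using assms(3) continuous_on_compose2 by (metis Ck_on.simps(1))
next
  case (Suc k)
  let ?f' = "\<lambda>x v. \<Sum>b\<in>Basis. (fd f x v \<bullet> b) *\<^sub>R fd g (f x) b"
  show ?case
  proof (rule Ck_on_SucI[where f' = ?f'])
    show "open U" by (rule assms(1))
    show "((\<lambda>x. g (f x)) has_derivative ?f' x) (at x)" if "x \<in> U" for x
    proof -
      have g: "(g has_derivative fd g (f x)) (at (f x))"
        using Ck_on_SucD(1)[OF Suc.prems(2)] assms(3) that by auto
      have "((\<lambda>x. g (f x)) has_derivative (\<lambda>v. fd g (f x) (fd f x v))) (at x)"
        using diff_chain_at[OF Ck_on_SucD(1)[OF Suc.prems(1) that] g] by (simp add: o_def)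
      moreover have "(\<lambda>v. fd g (f x) (fd f x v)) = ?f' x"
        by (rule ext) (rule linear_sum_Basis[OF has_derivative_linear[OF g]])
      ultimately show ?thesis by simp
    qed
    show "Ck_on k U (\<lambda>x. ?f' x v)" for v
      by (intro Ck_on_sum assms(1) Ck_on_bilinear[OF assms(1) bounded_bilinear_scaleR]
          Ck_on_compose_linear[OF assms(1) bounded_linear_inner_left] Suc.IH
          Ck_on_SucD(2)[OF Suc.prems(1)] Ck_on_SucD(2)[OF Suc.prems(2)]
          Ck_on_Suc_imp[OF Suc.prems(1)])
  qed
qed

lemma Ck_on_local:
  assumes "\<And>x. x \<in> U \<Longrightarrow> \<exists>W. open W \<and> x \<in> W \<and> Ck_on k W f"
  shows "Ck_on k U f"
  using assms
proof (induction k arbitrary: f)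
  case 0
  then have "continuous (at x) f" if "x \<in> U" for x
    using that continuous_on_eq_continuous_at by fastforce
  then show ?case by (simp add: continuous_at_imp_continuous_on)
next
  case (Suc k)
  have "f differentiable (at x)" if "x \<in> U" for x
    using Suc.prems[OF that] by auto
  moreover have "Ck_on k U (\<lambda>x. fd f x v)" for v
  proof (rule Suc.IH)
    fix x assume "x \<in> U"
    then obtain W where "open W" "x \<in> W" "Ck_on (Suc k) W f" using Suc.prems by blast
    then show "\<exists>W. open W \<and> x \<in> W \<and> Ck_on k W (\<lambda>x. fd f x v)"
      by (intro exI[of _ W]) simp
  qed
  ultimately show ?case by simp
qed

lemma smooth_on_subset: "smooth_on U f \<Longrightarrow> W \<subseteq> U \<Longrightarrow> smooth_on W f"
  by (auto simp: smooth_on_def intro: Ck_on_subset)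

lemma smooth_on_cong:
  "open U \<Longrightarrow> smooth_on U f \<Longrightarrow> (\<And>x. x \<in> U \<Longrightarrow> f x = g x) \<Longrightarrow> smooth_on U g"
  unfolding smooth_on_def using Ck_on_cong by blast

lemma smooth_on_local:
  "(\<And>x. x \<in> U \<Longrightarrow> \<exists>W. open W \<and> x \<in> W \<and> smooth_on W f) \<Longrightarrow> smooth_on U f"
  unfolding smooth_on_def using Ck_on_local by metis

lemma smooth_on_const: "open U \<Longrightarrow> smooth_on U (\<lambda>x. c)"
  by (simp add: smooth_on_def Ck_on_const)

lemma smooth_on_bounded_linear: "open U \<Longrightarrow> bounded_linear f \<Longrightarrow> smooth_on U f"
  by (simp add: smooth_on_def Ck_on_bounded_linear)

lemma smooth_on_ident: "open U \<Longrightarrow> smooth_on U (\<lambda>x. x)"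
  by (simp add: smooth_on_bounded_linear)

lemma smooth_on_compose_linear:
  "open U \<Longrightarrow> bounded_linear L \<Longrightarrow> smooth_on U f \<Longrightarrow> smooth_on U (\<lambda>x. L (f x))"
  by (simp add: smooth_on_def Ck_on_compose_linear)

lemma smooth_on_add:
  "open U \<Longrightarrow> smooth_on U f \<Longrightarrow> smooth_on U g \<Longrightarrow> smooth_on U (\<lambda>x. f x + g x)"
  by (simp add: smooth_on_def Ck_on_add)

lemma smooth_on_bilinear:
  "open U \<Longrightarrow> bounded_bilinear B \<Longrightarrow> smooth_on U f \<Longrightarrow> smooth_on U g \<Longrightarrow> smooth_on U (\<lambda>x. B (f x) (g x))"
  by (simp add: smooth_on_def Ck_on_bilinear)

lemma smooth_on_scaleR:
  "open U \<Longrightarrow> smooth_on U f \<Longrightarrow> smooth_on U g \<Longrightarrow> smooth_on U (\<lambda>x. f x *\<^sub>R g x)"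
  by (rule smooth_on_bilinear[OF _ bounded_bilinear_scaleR])

lemma smooth_on_mult:
  fixes f g :: "'a::real_normed_vector \<Rightarrow> real"
  shows "open U \<Longrightarrow> smooth_on U f \<Longrightarrow> smooth_on U g \<Longrightarrow> smooth_on U (\<lambda>x. f x * g x)"
  by (rule smooth_on_bilinear[OF _ bounded_bilinear_mult])

lemma smooth_on_inner:
  fixes f g :: "'a::real_normed_vector \<Rightarrow> 'b::real_inner"
  shows "open U \<Longrightarrow> smooth_on U f \<Longrightarrow> smooth_on U g \<Longrightarrow> smooth_on U (\<lambda>x. f x \<bullet> g x)"
  by (rule smooth_on_bilinear[OF _ bounded_bilinear_inner])

lemma smooth_on_minus: "open U \<Longrightarrow> smooth_on U f \<Longrightarrow> smooth_on U (\<lambda>x. - f x)"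
  by (rule smooth_on_compose_linear[OF _ bounded_linear_minus[OF bounded_linear_ident]])

lemma smooth_on_diff:
  assumes "open U" "smooth_on U f" "smooth_on U g"
  shows "smooth_on U (\<lambda>x. f x - g x)"
  using smooth_on_add[OF assms(1,2) smooth_on_minus[OF assms(1,3)]] by simp

lemma smooth_on_sum:
  "open U \<Longrightarrow> (\<And>i. i \<in> I \<Longrightarrow> smooth_on U (f i)) \<Longrightarrow> smooth_on U (\<lambda>x. \<Sum>i\<in>I. f i x)"
  by (simp add: smooth_on_def Ck_on_sum)

lemma smooth_on_fst: "open U \<Longrightarrow> smooth_on U f \<Longrightarrow> smooth_on U (\<lambda>x. fst (f x))"
  by (rule smooth_on_compose_linear[OF _ bounded_linear_fst])

lemma smooth_on_snd: "open U \<Longrightarrow> smooth_on U f \<Longrightarrow> smooth_on U (\<lambda>x. snd (f x))"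
  by (rule smooth_on_compose_linear[OF _ bounded_linear_snd])

lemma smooth_on_Pair:
  assumes "open U" "smooth_on U f" "smooth_on U g"
  shows "smooth_on U (\<lambda>x. (f x, g x))"
proof -
  have "smooth_on U (\<lambda>x. (f x, 0) + (0, g x))"
    by (intro smooth_on_add assms smooth_on_compose_linear[OF assms(1) _ assms(2), of "\<lambda>x. (x, 0)"]
        smooth_on_compose_linear[OF assms(1) _ assms(3), of "\<lambda>x. (0, x)"]
        bounded_linear_Pair bounded_linear_ident bounded_linear_zero)
  then show ?thesis by simp
qed

lemma smooth_on_compose:
  fixes f :: "'a::real_normed_vector \<Rightarrow> 'b::euclidean_space"
  shows "open U \<Longrightarrow> open W \<Longrightarrow> f ` U \<subseteq> W \<Longrightarrow> smooth_on U f \<Longrightarrow> smooth_on W g \<Longrightarrow> smooth_on U (\<lambda>x. g (f x))"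
  by (simp add: smooth_on_def Ck_on_compose)

text \<open>The family \<open>c * x powr a\<close> is stable under differentiation, so the induction
  runs with c and a arbitrary. Reciprocals and square roots of positive functions are then
  powers.\<close>

lemma Ck_on_powr: "Ck_on k {0<..} (\<lambda>x::real. c * x powr a)"
proof (induction k arbitrary: c a)
  case 0
  show ?case by (auto intro!: continuous_intros)
next
  case (Suc k)
  have "Ck_on k {0<..} (\<lambda>x::real. v * (c * (a * x powr (a - 1))))" for v
    using Suc[of "v * c * a" "a - 1"] by (simp add: mult.assoc)
  then show ?case
    by (intro Ck_on_SucI[where f' = "\<lambda>x v. v * (c * (a * x powr (a - 1)))"])
      (auto intro!: derivative_eq_intros simp: algebra_simps powr_diff)
qed

lemma smooth_on_powr:
  assumes "open U" "smooth_on U f" "\<And>x. x \<in> U \<Longrightarrow> f x > (0::real)"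
  shows "smooth_on U (\<lambda>x. f x powr a)"
  using smooth_on_compose[OF assms(1) open_greaterThan, of f 0 "\<lambda>x. x powr a"] assms Ck_on_powr[of _ 1 a]
  by (auto simp: smooth_on_def)

lemma smooth_on_inverse:
  assumes "open U" "smooth_on U f" and pos: "\<And>x. x \<in> U \<Longrightarrow> f x > (0::real)"
  shows "smooth_on U (\<lambda>x. inverse (f x))"
proof (rule smooth_on_cong[OF assms(1) smooth_on_powr[OF assms, of "-1"]])
  show "f x powr -1 = inverse (f x)" if "x \<in> U" for x
    using pos[OF that] by (simp add: powr_minus)
qed

lemma smooth_on_divide:
  assumes "open U" "smooth_on U f" "smooth_on U g" "\<And>x. x \<in> U \<Longrightarrow> g x > (0::real)"
  shows "smooth_on U (\<lambda>x. f x / g x)"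
  unfolding divide_inverse by (intro smooth_on_mult smooth_on_inverse assms)

lemma smooth_on_sqrt:
  assumes "open U" "smooth_on U f" and pos: "\<And>x. x \<in> U \<Longrightarrow> f x > (0::real)"
  shows "smooth_on U (\<lambda>x. sqrt (f x))"
proof (rule smooth_on_cong[OF assms(1) smooth_on_powr[OF assms, of "1/2"]])
  show "f x powr (1/2) = sqrt (f x)" if "x \<in> U" for x
    using pos[OF that] by (simp add: powr_half_sqrt)
qed

lemma smooth_on_norm:
  fixes f :: "'a::real_normed_vector \<Rightarrow> 'b::real_inner"
  assumes "open U" "smooth_on U f" "\<And>x. x \<in> U \<Longrightarrow> f x \<noteq> 0"
  shows "smooth_on U (\<lambda>x. norm (f x))"
  unfolding norm_eq_sqrt_inner
  by (intro smooth_on_sqrt smooth_on_inner assms) (use assms in auto)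

lemma smooth_on_has_derivative:
  "smooth_on U f \<Longrightarrow> x \<in> U \<Longrightarrow> (f has_derivative fd f x) (at x)"
  unfolding smooth_on_def using Ck_on_SucD(1) by blast

lemma smooth_on_frechet_derivative:
  "smooth_on U f \<Longrightarrow> smooth_on U (\<lambda>x. fd f x v)"
  unfolding smooth_on_def using Ck_on_SucD(2) by blast

lemma smooth_on_continuous_on: "smooth_on U f \<Longrightarrow> continuous_on U f"
  unfolding smooth_on_def using Ck_on.simps(1) by blast

section \<open>Gradient, Hessian and second-order Taylor expansion\<close>

definition gr :: "('a::euclidean_space \<Rightarrow> real) \<Rightarrow> 'a \<Rightarrow> 'a" where
  "gr f x = (\<Sum>b\<in>Basis. fd f x b *\<^sub>R b)"

definition hess :: "('a::euclidean_space \<Rightarrow> real) \<Rightarrow> 'a \<Rightarrow> 'a \<Rightarrow> 'a" where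
  "hess f x = fd (gr f) x"

lemma gr_inner:
  assumes "f differentiable (at x)"
  shows "gr f x \<bullet> v = fd f x v"
proof -
  have "linear (fd f x)"
    using assms linear_frechet_derivative by blast
  from linear_sum_Basis[OF this, of v] show ?thesis
    by (simp add: gr_def inner_sum_left inner_commute[of v] mult.commute)
qed

lemma has_derivative_gr:
  assumes "f differentiable (at x)"
  shows "(f has_derivative (\<lambda>v. gr f x \<bullet> v)) (at x)"
  using assms frechet_derivative_works[of f "at x"] by (simp add: gr_inner eta_contract_eq)

lemma gr_eqI:
  assumes "(f has_derivative (\<lambda>v. g \<bullet> v)) (at x)"
  shows "gr f x = g"
proof -
  have "f differentiable (at x)" using assms by (auto simp: differentiable_def)
  from has_derivative_gr[OF this] assms have "(\<lambda>v. gr f x \<bullet> v) = (\<lambda>v. g \<bullet> v)"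
    by (rule has_derivative_unique)
  then show ?thesis by (metis vector_eq_rdot)
qed

lemma smooth_on_gr: "open U \<Longrightarrow> smooth_on U f \<Longrightarrow> smooth_on U (gr f)"
  unfolding gr_def[abs_def]
  by (intro smooth_on_sum smooth_on_scaleR smooth_on_frechet_derivative smooth_on_const)

lemma smooth_has_derivative_gr:
  "smooth_on U f \<Longrightarrow> x \<in> U \<Longrightarrow> (f has_derivative (\<lambda>v. gr f x \<bullet> v)) (at x)"
  by (rule has_derivative_gr) (use smooth_on_has_derivative in \<open>auto simp: differentiable_def\<close>)

lemma smooth_has_derivative_hess:
  "open U \<Longrightarrow> smooth_on U f \<Longrightarrow> x \<in> U \<Longrightarrow> (gr f has_derivative hess f x) (at x)"
  unfolding hess_def by (rule smooth_on_has_derivative[OF smooth_on_gr])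

lemma linear_hess: "open U \<Longrightarrow> smooth_on U f \<Longrightarrow> x \<in> U \<Longrightarrow> linear (hess f x)"
  using smooth_has_derivative_hess has_derivative_linear by blast

lemma smooth_on_hess: "open U \<Longrightarrow> smooth_on U f \<Longrightarrow> smooth_on U (\<lambda>x. hess f x v)"
  unfolding hess_def by (intro smooth_on_frechet_derivative smooth_on_gr)

lemma smooth_line_derivative:
  assumes "smooth_on U f" "p + s *\<^sub>R u \<in> U"
  shows "((\<lambda>s. f (p + s *\<^sub>R u)) has_derivative (\<lambda>d. d * (gr f (p + s *\<^sub>R u) \<bullet> u))) (at s within S)"
proof -
  have l: "((\<lambda>s. p + s *\<^sub>R u) has_derivative (\<lambda>d. d *\<^sub>R u)) (at s within S)"
    by (auto intro!: derivative_eq_intros)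
  show ?thesis
    using has_derivative_compose[OF l smooth_has_derivative_gr[OF assms]] by simp
qed

lemma smooth_line_derivative_gr:
  assumes "open U" "smooth_on U f" "p + s *\<^sub>R u \<in> U"
  shows "((\<lambda>s. gr f (p + s *\<^sub>R u)) has_derivative (\<lambda>d. d *\<^sub>R hess f (p + s *\<^sub>R u) u)) (at s within S)"
proof -
  have l: "((\<lambda>s. p + s *\<^sub>R u) has_derivative (\<lambda>d. d *\<^sub>R u)) (at s within S)"
    by (auto intro!: derivative_eq_intros)
  show ?thesis
    using has_derivative_compose[OF l smooth_has_derivative_hess[OF assms]]
    by (simp add: linear_scale[OF linear_hess[OF assms]])
qed

text \<open>The mean value theorem in s and then in t turns the second difference over a
  parallelogram into one value of the mixed second derivative.\<close>

lemma mixed_difference_mvt: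
  fixes f :: "'a::euclidean_space \<Rightarrow> real"
  assumes f: "\<And>s t. 0 \<le> s \<Longrightarrow> s \<le> r \<Longrightarrow> 0 \<le> t \<Longrightarrow> t \<le> r \<Longrightarrow> x + s *\<^sub>R u + t *\<^sub>R v \<in> U"
    and U: "open U" "smooth_on U f" and r: "r > 0"
  shows "\<exists>s t. 0 \<le> s \<and> s \<le> r \<and> 0 \<le> t \<and> t \<le> r \<and>
    f (x + r *\<^sub>R u + r *\<^sub>R v) - f (x + r *\<^sub>R u) - f (x + r *\<^sub>R v) + f x
      = r^2 * (hess f (x + s *\<^sub>R u + t *\<^sub>R v) v \<bullet> u)"
proof -
  let ?F = "\<lambda>s. f (x + s *\<^sub>R u + r *\<^sub>R v) - f (x + s *\<^sub>R u)"
  let ?F' = "\<lambda>s d. d * (gr f (x + s *\<^sub>R u + r *\<^sub>R v) \<bullet> u - gr f (x + s *\<^sub>R u) \<bullet> u)"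
  have "(?F has_derivative ?F' s) (at s within {0..r})" if "s \<in> {0..r}" for s
  proof -
    have 1: "(x + r *\<^sub>R v) + s *\<^sub>R u \<in> U" "x + s *\<^sub>R u \<in> U"
      using f[of s r] f[of s 0] that r by (auto simp: algebra_simps)
    have eq: "x + s *\<^sub>R u + r *\<^sub>R v = (x + r *\<^sub>R v) + s *\<^sub>R u" for s by simp
    show ?thesis
      using has_derivative_diff[OF smooth_line_derivative[OF U(2) 1(1)] smooth_line_derivative[OF U(2) 1(2)]]
      unfolding eq by (simp add: right_diff_distrib)
  qed
  then obtain s where s: "s \<in> {0<..<r}" "?F r - ?F 0 = ?F' s (r - 0)"
    using mvt_simple[of 0 r ?F ?F'] r by auto
  let ?G = "\<lambda>t. gr f (x + s *\<^sub>R u + t *\<^sub>R v) \<bullet> u"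
  let ?G' = "\<lambda>t d. d * (hess f (x + s *\<^sub>R u + t *\<^sub>R v) v \<bullet> u)"
  have "(?G has_derivative ?G' t) (at t within {0..r})" if "t \<in> {0..r}" for t
  proof -
    have 1: "x + s *\<^sub>R u + t *\<^sub>R v \<in> U" using f[of s t] that s by auto
    show ?thesis
      using has_derivative_inner_left[OF smooth_line_derivative_gr[OF U 1]] by simp
  qed
  then obtain t where t: "t \<in> {0<..<r}" "?G r - ?G 0 = ?G' t (r - 0)"
    using mvt_simple[of 0 r ?G ?G'] r by auto
  have "?F r - ?F 0 = r^2 * (hess f (x + s *\<^sub>R u + t *\<^sub>R v) v \<bullet> u)"
    using s(2) t(2) by (simp add: power2_eq_square)
  then show ?thesis using s t by (intro exI[of _ s] exI[of _ t]) auto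
qed

text \<open>Schwarz's theorem: the second difference is symmetric in u and v, so it equals r^2 times
  a Hessian value in two ways; continuity of the Hessian gives the limit as r tends to 0.\<close>

lemma hess_symmetric:
  fixes f :: "'a::euclidean_space \<Rightarrow> real"
  assumes U: "open U" "smooth_on U f" "x \<in> U"
  shows "hess f x u \<bullet> v = hess f x v \<bullet> u"
proof -
  obtain e where e: "e > 0" "ball x e \<subseteq> U" using U openE by metis
  \<comment> \<open>The scale r below satisfies r * M < e, so that the parallelograms stay inside
    the ball in either order of u and v.\<close>
  define M where "M = norm u + norm v + 1"
  have M: "M > 0" by (simp add: M_def add_nonneg_pos)
  define r where "r n = e / (2 * M) * inverse (real (Suc n))" for n
  have r: "r n > 0" for n using e M by (simp add: r_def)
  have r0: "r \<longlonglongrightarrow> 0"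
    unfolding r_def using tendsto_mult_right_zero[OF LIMSEQ_inverse_real_of_nat] by blast
  have rM: "r n * M < e" for n
  proof -
    have "r n * M = e / 2 * inverse (real (Suc n))" using M by (simp add: r_def)
    also have "\<dots> \<le> e / 2 * 1" using e by (intro mult_left_mono) (auto simp: inverse_le_1_iff)
    finally show ?thesis using e by simp
  qed
  have bnd: "norm (s *\<^sub>R u' + t *\<^sub>R v') \<le> r n * M"
    if "0 \<le> s" "s \<le> r n" "0 \<le> t" "t \<le> r n" "norm u' + norm v' \<le> M" for s t n and u' v' :: 'a
  proof -
    have "norm (s *\<^sub>R u' + t *\<^sub>R v') \<le> s * norm u' + t * norm v'"
      using norm_triangle_ineq[of "s *\<^sub>R u'" "t *\<^sub>R v'"] that by simp
    also have "\<dots> \<le> r n * norm u' + r n * norm v'"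
      using that by (intro add_mono mult_right_mono) auto
    also have "\<dots> \<le> r n * M" using that(5) r[of n] by (simp add: distrib_left[symmetric])
    finally show ?thesis .
  qed
  have inU: "x + s *\<^sub>R u' + t *\<^sub>R v' \<in> U"
    if "0 \<le> s" "s \<le> r n" "0 \<le> t" "t \<le> r n" "norm u' + norm v' \<le> M" for s t n and u' v' :: 'a
  proof -
    have "dist x (x + s *\<^sub>R u' + t *\<^sub>R v') < e"
      using bnd[OF that] rM[of n] norm_minus_commute[of x "x + s *\<^sub>R u' + t *\<^sub>R v'"]
      by (simp add: dist_norm add.assoc)
    then show ?thesis using e by auto
  qed
  have uv: "norm u + norm v \<le> M" "norm v + norm u \<le> M" by (auto simp: M_def)
  have lim: "(\<lambda>n. hess f (x + s n *\<^sub>R u' + t n *\<^sub>R v') w) \<longlonglongrightarrow> hess f x w"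
    if st: "\<And>n. 0 \<le> s n \<and> s n \<le> r n \<and> 0 \<le> t n \<and> t n \<le> r n" for s t u' v' w
  proof -
    have "s \<longlonglongrightarrow> 0" "t \<longlonglongrightarrow> 0"
      using st by (auto intro!: tendsto_sandwich[OF _ _ tendsto_const r0])
    then have "(\<lambda>n. x + s n *\<^sub>R u' + t n *\<^sub>R v') \<longlonglongrightarrow> x + 0 *\<^sub>R u' + 0 *\<^sub>R v'"
      by (intro tendsto_intros)
    moreover have "isCont (\<lambda>x. hess f x w) x"
      using smooth_on_continuous_on[OF smooth_on_hess[OF U(1,2)]] U continuous_on_eq_continuous_at by blast
    ultimately show ?thesis using isCont_tendsto_compose by fastforce
  qed
  have "\<exists>s t. 0 \<le> s \<and> s \<le> r n \<and> 0 \<le> t \<and> t \<le> r n \<and>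
    f (x + r n *\<^sub>R u + r n *\<^sub>R v) - f (x + r n *\<^sub>R u) - f (x + r n *\<^sub>R v) + f x
      = (r n)^2 * (hess f (x + s *\<^sub>R u + t *\<^sub>R v) v \<bullet> u)" for n
    by (rule mixed_difference_mvt[OF _ U(1,2) r]) (use inU uv in auto)
  then obtain s t where st: "\<And>n. 0 \<le> s n \<and> s n \<le> r n \<and> 0 \<le> t n \<and> t n \<le> r n"
    "\<And>n. f (x + r n *\<^sub>R u + r n *\<^sub>R v) - f (x + r n *\<^sub>R u) - f (x + r n *\<^sub>R v) + f x
      = (r n)^2 * (hess f (x + s n *\<^sub>R u + t n *\<^sub>R v) v \<bullet> u)" by metis
  have "\<exists>s t. 0 \<le> s \<and> s \<le> r n \<and> 0 \<le> t \<and> t \<le> r n \<and>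
    f (x + r n *\<^sub>R v + r n *\<^sub>R u) - f (x + r n *\<^sub>R v) - f (x + r n *\<^sub>R u) + f x
      = (r n)^2 * (hess f (x + s *\<^sub>R v + t *\<^sub>R u) u \<bullet> v)" for n
    by (rule mixed_difference_mvt[OF _ U(1,2) r]) (use inU uv in auto)
  then obtain s' t' where st': "\<And>n. 0 \<le> s' n \<and> s' n \<le> r n \<and> 0 \<le> t' n \<and> t' n \<le> r n"
    "\<And>n. f (x + r n *\<^sub>R v + r n *\<^sub>R u) - f (x + r n *\<^sub>R v) - f (x + r n *\<^sub>R u) + f x
      = (r n)^2 * (hess f (x + s' n *\<^sub>R v + t' n *\<^sub>R u) u \<bullet> v)" by metis
  have eq: "hess f (x + s n *\<^sub>R u + t n *\<^sub>R v) v \<bullet> u = hess f (x + s' n *\<^sub>R v + t' n *\<^sub>R u) u \<bullet> v" for n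
  proof -
    have e: "x + r n *\<^sub>R v + r n *\<^sub>R u = x + r n *\<^sub>R u + r n *\<^sub>R v" by simp
    have "(r n)^2 * (hess f (x + s n *\<^sub>R u + t n *\<^sub>R v) v \<bullet> u) = (r n)^2 * (hess f (x + s' n *\<^sub>R v + t' n *\<^sub>R u) u \<bullet> v)"
      using st(2)[of n] st'(2)[of n] unfolding e by linarith
    then show ?thesis using r[of n] by simp
  qed
  have lim1: "(\<lambda>n. hess f (x + s n *\<^sub>R u + t n *\<^sub>R v) v \<bullet> u) \<longlonglongrightarrow> hess f x v \<bullet> u"
    by (intro tendsto_inner lim st(1) tendsto_const)
  have lim2: "(\<lambda>n. hess f (x + s n *\<^sub>R u + t n *\<^sub>R v) v \<bullet> u) \<longlonglongrightarrow> hess f x u \<bullet> v"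
    unfolding eq by (intro tendsto_inner lim st'(1) tendsto_const)
  show ?thesis by (rule LIMSEQ_unique[OF lim2 lim1])
qed

text \<open>Mean value theorem on the segment for f minus its first- and second-order terms: the
  derivative left over is the linearization error of \<open>gr f\<close> at x, so differentiability
  of the gradient at that point yields the quadratic remainder.\<close>

lemma taylor2:
  fixes f :: "'a::euclidean_space \<Rightarrow> real"
  assumes U: "open U" "smooth_on U f" "x \<in> U" and e: "e > 0"
  shows "\<exists>d>0. \<forall>w. norm w < d \<longrightarrow> x + w \<in> U \<and>
    \<bar>f (x + w) - f x - gr f x \<bullet> w - (hess f x w \<bullet> w) / 2\<bar> \<le> e * (norm w)^2"
proof -
  obtain d0 where d0: "d0 > 0" "ball x d0 \<subseteq> U" using U openE by metis
  obtain d1 where d1: "d1 > 0" "\<And>y. norm (y - x) < d1 \<Longrightarrow>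
      norm (gr f y - gr f x - hess f x (y - x)) \<le> e * norm (y - x)"
    using smooth_has_derivative_hess[OF U] e unfolding has_derivative_at_alt by blast
  interpret L: linear "hess f x" by (rule linear_hess[OF U])
  show ?thesis
  proof (intro exI[of _ "min d0 d1"] conjI allI impI)
    show "min d0 d1 > 0" using d0 d1 by simp
    fix w :: 'a assume w: "norm w < min d0 d1"
    have inU: "x + s *\<^sub>R w \<in> U" if "0 \<le> s" "s \<le> 1" for s
    proof -
      have "norm (s *\<^sub>R w) \<le> 1 * norm w" using that by (simp add: mult_left_le_one_le)
      then show ?thesis using w d0 by (auto simp: dist_norm)
    qed
    show "x + w \<in> U" using inU[of 1] by simp
    let ?F = "\<lambda>s. f (x + s *\<^sub>R w) - s * (gr f x \<bullet> w) - s^2 / 2 * (hess f x w \<bullet> w)"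
    let ?F' = "\<lambda>s d. d * (gr f (x + s *\<^sub>R w) \<bullet> w - gr f x \<bullet> w - s * (hess f x w \<bullet> w))"
    have "(?F has_derivative ?F' s) (at s within {0..1})" if "s \<in> {0..1}" for s
    proof -
      have 1: "((\<lambda>s. s * (gr f x \<bullet> w) + s^2 / 2 * (hess f x w \<bullet> w)) has_derivative
        (\<lambda>d. d * (gr f x \<bullet> w + s * (hess f x w \<bullet> w)))) (at s within {0..1})"
        by (auto intro!: derivative_eq_intros simp: algebra_simps)
      show ?thesis
        using has_derivative_diff[OF smooth_line_derivative[OF U(2) inU[of s]] 1] that
        by (simp add: algebra_simps)
    qed
    then obtain s where s: "s \<in> {0<..<1}" "?F 1 - ?F 0 = ?F' s (1 - 0)"
      using mvt_simple[of 0 1 ?F ?F'] by auto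
    have "\<bar>?F 1 - ?F 0\<bar> = \<bar>(gr f (x + s *\<^sub>R w) - gr f x - hess f x (s *\<^sub>R w)) \<bullet> w\<bar>"
      unfolding s(2) by (simp add: L.scale inner_diff_left)
    also have "\<dots> \<le> norm (gr f (x + s *\<^sub>R w) - gr f x - hess f x (s *\<^sub>R w)) * norm w"
      by (rule Cauchy_Schwarz_ineq2)
    also have "\<dots> \<le> (e * norm (s *\<^sub>R w)) * norm w"
    proof (rule mult_right_mono)
      have "norm (s *\<^sub>R w) \<le> norm w" using s by (simp add: mult_left_le_one_le)
      then have "norm (s *\<^sub>R w) < d1" using w by linarith
      then show "norm (gr f (x + s *\<^sub>R w) - gr f x - hess f x (s *\<^sub>R w)) \<le> e * norm (s *\<^sub>R w)"
        using d1(2)[of "x + s *\<^sub>R w"] by simp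
    qed simp
    also have "\<dots> \<le> (e * norm w) * norm w"
      using s e by (intro mult_right_mono mult_left_mono) (auto simp: mult_left_le_one_le)
    finally show "\<bar>f (x + w) - f x - gr f x \<bullet> w - (hess f x w \<bullet> w) / 2\<bar> \<le> e * (norm w)^2"
      by (simp add: power2_eq_square algebra_simps)
  qed
qed

section \<open>The inverse function theorem\<close>

text \<open>The inverse function theorem for plain linear maps in place of bounded-linear operators.
  Source and target coincide, so an injective derivative at x0 has the required one-sided
  inverse.\<close>

lemma inverse_function_C1:
  fixes f :: "'a::euclidean_space \<Rightarrow> 'a"
  assumes U: "open U" "smooth_on U f" "x0 \<in> U" and inj: "inj (fd f x0)"
  obtains U' W g where "open U'" "U' \<subseteq> U" "x0 \<in> U'" "open W" "f x0 \<in> W" "homeomorphism U' W f g"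
    "\<And>y. y \<in> W \<Longrightarrow> (g has_derivative inv (fd f (g y))) (at y)"
    "\<And>y. y \<in> W \<Longrightarrow> bij (fd f (g y))"
proof -
  define f' where "f' x = Blinfun (fd f x)" for x
  have bl: "bounded_linear (fd f x)" if "x \<in> U" for x
    using smooth_on_has_derivative[OF U(2) that] by (rule has_derivative_bounded_linear)
  have f': "blinfun_apply (f' x) = fd f x" if "x \<in> U" for x
    unfolding f'_def by (rule bounded_linear_Blinfun_apply[OF bl[OF that]])
  have der: "(f has_derivative blinfun_apply (f' x)) (at x)" if "x \<in> U" for x
    using smooth_on_has_derivative[OF U(2) that] f'[OF that] by simp
  have cont: "continuous_on U f'"
  proof (rule continuous_on_blinfun_componentwise)
    fix b :: 'a
    show "continuous_on U (\<lambda>x. blinfun_apply (f' x) b)"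
      using smooth_on_continuous_on[OF smooth_on_frechet_derivative[OF U(2), of b]]
      by (simp add: f' cong: continuous_on_cong)
  qed
  obtain h where h: "linear h" "h \<circ> fd f x0 = id"
    using linear_injective_left_inverse[OF bounded_linear.linear[OF bl[OF U(3)]] inj] by auto
  have bh: "bounded_linear h" using h(1) by (simp add: linear_conv_bounded_linear)
  have "Blinfun h o\<^sub>L f' x0 = id_blinfun"
    by (rule blinfun_eqI)
      (use h(2) f'[OF U(3)] in \<open>simp add: bounded_linear_Blinfun_apply[OF bh] fun_eq_iff\<close>)
  from inverse_function_theorem[OF U(1) der cont U(3) this]
  obtain U' W g g' where W: "open U'" "U' \<subseteq> U" "x0 \<in> U'" "open W" "f x0 \<in> W" "homeomorphism U' W f g"
    "\<And>y. y \<in> W \<Longrightarrow> (g has_derivative (g' y)) (at y)"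
    "\<And>y. y \<in> W \<Longrightarrow> g' y = inv (blinfun_apply (f'(g y)))"
    "\<And>y. y \<in> W \<Longrightarrow> bij (blinfun_apply (f'(g y)))" by blast
  have gU: "g y \<in> U" if "y \<in> W" for y
    using homeomorphism_image2[OF W(6)] W(2) that by blast
  show ?thesis
    by (rule that[of U' W g]) (use W f' gU in auto)
qed

text \<open>The inverse of \<open>fd f y\<close> is differentiated in y without operator calculus:
  F(y, w) = (y, \<open>fd f y w\<close>) has the local inverse (y, v) \<mapsto> (y,
  \<open>inv (fd f y) v\<close>), which the inverse function theorem makes differentiable. With L =
  \<open>fd f\<close> and A its inverse, the product rule then gives - A (D_u L) A v; the double sum
  over the basis is this expression with A applied to constant vectors only.\<close>

lemma has_derivative_inv_frechet:
  fixes f :: "'a::euclidean_space \<Rightarrow> 'a"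
  assumes U: "open U" "smooth_on U f" and bij: "\<And>x. x \<in> U \<Longrightarrow> bij (fd f x)"
    and x: "x \<in> U"
  shows "((\<lambda>y. inv (fd f y) v) has_derivative
    (\<lambda>u. - (\<Sum>b\<in>Basis. \<Sum>c\<in>Basis. ((inv (fd f x) v \<bullet> b) *
       (fd (\<lambda>y. frechet_derivative f (at y) b) x u \<bullet> c)) *\<^sub>R
        inv (fd f x) c))) (at x)"
proof -
  let ?L = "\<lambda>y. fd f y"
  let ?A = "\<lambda>y. inv (?L y)"
  let ?D = "\<lambda>b. fd (\<lambda>y. ?L y b) x"
  have lin: "linear (?L y)" if "y \<in> U" for y
    using smooth_on_has_derivative[OF U(2) that] by (rule has_derivative_linear)
  have linA: "linear (?A y)" if yU: "y \<in> U" for y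
  proof -
    obtain h where h: "linear h" "h \<circ> ?L y = id"
      using linear_injective_left_inverse[OF lin[OF yU]] bij[OF yU] bij_is_inj by auto
    have "?A y w = h w" for w
      using h(2) bij[OF yU] by (metis bij_is_surj comp_apply id_apply surj_f_inv_f)
    then have "?A y = h" by (rule ext)
    then show ?thesis using h(1) by simp
  qed
  have LA: "?L y (?A y w) = w" if "y \<in> U" for y w
    using bij[OF that] by (simp add: bij_is_surj surj_f_inv_f)
  have AL: "?A y (?L y w) = w" if "y \<in> U" for y w
    using bij[OF that] by (simp add: bij_is_inj)
  define F where "F p = (fst p, \<Sum>b\<in>Basis. (snd p \<bullet> b) *\<^sub>R ?L (fst p) b)" for p :: "'a \<times> 'a"
  have F: "F (y, w) = (y, ?L y w)" if "y \<in> U" for y w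
    using linear_sum_Basis[OF lin[OF that], of w] by (simp add: F_def)
  have oU: "open (U \<times> (UNIV::'a set))" using U(1) by (rule open_Times) simp
  have sF: "smooth_on (U \<times> UNIV) F"
    unfolding F_def[abs_def]
    by (intro smooth_on_Pair smooth_on_sum smooth_on_scaleR oU smooth_on_inner smooth_on_fst smooth_on_snd
        smooth_on_ident smooth_on_const
        smooth_on_compose[OF oU U(1) _ smooth_on_fst[OF oU smooth_on_ident[OF oU]]
          smooth_on_frechet_derivative[OF U(2)]]) auto
  have dL: "((\<lambda>y. ?L y b) has_derivative ?D b) (at x)" for b
    by (rule smooth_on_has_derivative[OF smooth_on_frechet_derivative[OF U(2)] x])
  let ?p = "(x, ?A x v)"
  have dF: "(F has_derivative (\<lambda>q. (fst q, \<Sum>b\<in>Basis. (snd ?p \<bullet> b) *\<^sub>R ?D b (fst q) +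
      (snd q \<bullet> b) *\<^sub>R ?L (fst ?p) b))) (at ?p)"
  proof -
    have 1: "((\<lambda>p::'a\<times>'a. ?L (fst p) b) has_derivative (\<lambda>q. ?D b (fst q))) (at ?p)" for b
      using has_derivative_compose[OF has_derivative_fst[OF has_derivative_ident], of "\<lambda>y. ?L y b" "?D b" "?p" UNIV] dL[of b]
      by simp
    have 2: "((\<lambda>p::'a\<times>'a. snd p \<bullet> b) has_derivative (\<lambda>q. snd q \<bullet> b)) (at ?p)" for b
      by (intro derivative_eq_intros) auto
    show ?thesis
      unfolding F_def[abs_def]
      by (intro has_derivative_Pair has_derivative_sum has_derivative_scaleR 1 2 has_derivative_fst has_derivative_ident)
  qed
  have injF: "inj (fd F ?p)"
  proof -
    have eq: "fd F ?p = (\<lambda>q. (fst q, \<Sum>b\<in>Basis. (snd ?p \<bullet> b) *\<^sub>R ?D b (fst q) +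
      (snd q \<bullet> b) *\<^sub>R ?L (fst ?p) b))"
      using frechet_derivative_at[OF dF] by simp
    have "q = 0" if q: "fd F ?p q = 0" for q
    proof -
      have q1: "fst q = 0" using q unfolding eq by (simp add: zero_prod_def)
      have "?D b 0 = 0" for b using linear_0[OF has_derivative_linear[OF dL]] .
      then have "(\<Sum>b\<in>Basis. (snd q \<bullet> b) *\<^sub>R ?L x b) = 0"
        using q q1 unfolding eq by (simp add: zero_prod_def)
      then have "?L x (snd q) = 0" using linear_sum_Basis[OF lin[OF x], of "snd q"] by simp
      then have "snd q = 0" using AL[OF x, of "snd q"] linear_0[OF linA[OF x]] by simp
      with q1 show ?thesis by (simp add: prod_eq_iff)
    qed
    then show ?thesis
      using has_derivative_linear[OF dF] unfolding eq[symmetric] by (simp add: linear_injective_0)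
  qed
  have pU: "?p \<in> U \<times> UNIV" using x by simp
  obtain U' W G where W: "open U'" "U' \<subseteq> U \<times> UNIV" "?p \<in> U'" "open W" "F ?p \<in> W"
      "homeomorphism U' W F G"
    "\<And>y. y \<in> W \<Longrightarrow> (G has_derivative inv (fd F (G y))) (at y)"
    by (rule inverse_function_C1[OF oU sF pU injF]) (rule that, assumption+)
  have Fp: "F ?p = (x, v)" using F[OF x] LA[OF x] by simp
  have GF: "G (y, w) = (y, ?A y w)" if "(y, w) \<in> W" for y w
  proof -
    have 1: "G (y, w) \<in> U'" "F (G (y, w)) = (y, w)"
      using homeomorphism_image2[OF W(6)] homeomorphism_apply2[OF W(6) that] that by auto
    obtain y' w' where g: "G (y, w) = (y', w')" by fastforce
    then have "y' \<in> U" using 1 W(2) by auto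
    then show ?thesis using 1(2) F[of y' w'] AL[of y' w'] g by auto
  qed
  define N where "N = (\<lambda>y. (y, v)) -` W"
  have N: "open N" "x \<in> N"
    unfolding N_def using W(4,5) Fp by (auto intro!: continuous_open_vimage continuous_intros)
  obtain G' where G': "(G has_derivative G') (at (x, v))" using W(5,7) Fp by metis
  have "((\<lambda>y. snd (G (y, v))) has_derivative (\<lambda>u. snd (G' (u, 0)))) (at x)"
    by (rule has_derivative_snd, rule has_derivative_compose[of "\<lambda>y. (y, v)" "\<lambda>u. (u, 0)", OF _ G'])
      (auto intro!: derivative_eq_intros)
  then have dA: "((\<lambda>y. ?A y v) has_derivative (\<lambda>u. snd (G' (u, 0)))) (at x)"
    by (rule has_derivative_transform_within_open[OF _ N]) (auto simp: N_def GF)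
  define A' where "A' u = snd (G' (u, 0))" for u
  have dA: "((\<lambda>y. ?A y v) has_derivative A') (at x)" using dA unfolding A'_def .
  have "((\<lambda>y. \<Sum>b\<in>Basis. (?A y v \<bullet> b) *\<^sub>R ?L y b) has_derivative
     (\<lambda>u. \<Sum>b\<in>Basis. (?A x v \<bullet> b) *\<^sub>R ?D b u + (A' u \<bullet> b) *\<^sub>R ?L x b)) (at x)"
    by (intro has_derivative_sum has_derivative_scaleR has_derivative_inner_left dA dL)
  moreover have "((\<lambda>y. \<Sum>b\<in>Basis. (?A y v \<bullet> b) *\<^sub>R ?L y b) has_derivative (\<lambda>u. 0)) (at x)"
  proof (rule has_derivative_transform_within_open[OF has_derivative_const U(1) x, of v])
    show "v = (\<Sum>b\<in>Basis. (?A y v \<bullet> b) *\<^sub>R ?L y b)" if "y \<in> U" for y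
      using linear_sum_Basis[OF lin[OF that], of "?A y v"] LA[OF that] by simp
  qed
  ultimately have z: "(\<lambda>u. \<Sum>b\<in>Basis. (?A x v \<bullet> b) *\<^sub>R ?D b u + (A' u \<bullet> b) *\<^sub>R ?L x b) = (\<lambda>u. 0)"
    by (rule has_derivative_unique)
  have "A' u = - (\<Sum>b\<in>Basis. \<Sum>c\<in>Basis. ((?A x v \<bullet> b) * (?D b u \<bullet> c)) *\<^sub>R ?A x c)" for u
  proof -
    let ?S = "\<Sum>b\<in>Basis. (?A x v \<bullet> b) *\<^sub>R ?D b u"
    have "?S + ?L x (A' u) = 0"
      using fun_cong[OF z, of u] linear_sum_Basis[OF lin[OF x], of "A' u"] by (simp add: sum.distrib)
    then have "?L x (A' u) = - ?S" by (simp add: add_eq_0_iff)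
    then have "?A x (?L x (A' u)) = ?A x (- ?S)" by (rule arg_cong)
    then have "A' u = - ?A x ?S"
      unfolding AL[OF x] linear_neg[OF linA[OF x]] .
    also have "?A x ?S = (\<Sum>b\<in>Basis. (?A x v \<bullet> b) *\<^sub>R ?A x (?D b u))"
      by (simp add: linear_sum[OF linA[OF x]] linear_scale[OF linA[OF x]])
    also have "\<dots> = (\<Sum>b\<in>Basis. \<Sum>c\<in>Basis. ((?A x v \<bullet> b) * (?D b u \<bullet> c)) *\<^sub>R ?A x c)"
    proof (rule sum.cong[OF refl])
      fix b :: 'a
      have "?A x (?D b u) = (\<Sum>c\<in>Basis. (?D b u \<bullet> c) *\<^sub>R ?A x c)"
        by (rule linear_sum_Basis[OF linA[OF x]])
      then show "(?A x v \<bullet> b) *\<^sub>R ?A x (?D b u) = (\<Sum>c\<in>Basis. ((?A x v \<bullet> b) * (?D b u \<bullet> c)) *\<^sub>R ?A x c)"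
        by (simp add: scaleR_sum_right)
    qed
    finally show ?thesis .
  qed
  then have "A' = (\<lambda>u. - (\<Sum>b\<in>Basis. \<Sum>c\<in>Basis. ((?A x v \<bullet> b) * (?D b u \<bullet> c)) *\<^sub>R ?A x c))"
    by (rule ext)
  with dA show ?thesis by simp
qed

text \<open>The derivative formula involves the inverse on constant vectors only, so class C^k in
  every fixed direction gives class C^(k+1).\<close>

lemma Ck_on_inv_frechet:
  fixes f :: "'a::euclidean_space \<Rightarrow> 'a"
  assumes U: "open U" "smooth_on U f" and bij: "\<And>x. x \<in> U \<Longrightarrow> bij (fd f x)"
  shows "Ck_on k U (\<lambda>y. inv (fd f y) v)"
proof (induction k arbitrary: v)
  case 0
  show ?case
    using has_derivative_continuous[OF has_derivative_inv_frechet[OF U bij]]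
    by (simp add: continuous_at_imp_continuous_on)
next
  case (Suc k)
  have 1: "Ck_on k U (\<lambda>x. inv (fd f x) v \<bullet> b)" for v b
    by (rule Ck_on_compose_linear[OF U(1) bounded_linear_inner_left Suc])
  have 2: "Ck_on k U (\<lambda>x. fd (\<lambda>y. frechet_derivative f (at y) b) x u \<bullet> c)" for u b c
    using smooth_on_frechet_derivative[OF smooth_on_frechet_derivative[OF U(2)]]
    by (intro Ck_on_compose_linear[OF U(1) bounded_linear_inner_left]) (auto simp: smooth_on_def)
  show ?case
    by (rule Ck_on_SucI[OF U(1) has_derivative_inv_frechet[OF U bij]], assumption, assumption,
      intro Ck_on_compose_linear[OF U(1) bounded_linear_minus[OF bounded_linear_ident]]
        Ck_on_sum U(1) Ck_on_bilinear[OF U(1) bounded_bilinear_scaleR]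
        Ck_on_bilinear[OF U(1) bounded_bilinear_mult] 1 2 Suc)
qed

text \<open>Bootstrapping: Dg(y) is the inverse of \<open>fd f\<close> at g(y), hence g of class C^k
  makes Dg of class C^k and g of class C^(k+1).\<close>

lemma smooth_inverse_function:
  fixes f :: "'a::euclidean_space \<Rightarrow> 'a"
  assumes U: "open U" "smooth_on U f" "x0 \<in> U" and inj: "inj (fd f x0)"
  obtains U' W g where "open U'" "U' \<subseteq> U" "x0 \<in> U'" "open W" "f x0 \<in> W" "homeomorphism U' W f g"
    "smooth_on W g"
proof -
  obtain U' W g where W: "open U'" "U' \<subseteq> U" "x0 \<in> U'" "open W" "f x0 \<in> W" "homeomorphism U' W f g"
    "\<And>y. y \<in> W \<Longrightarrow> (g has_derivative inv (fd f (g y))) (at y)"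
    "\<And>y. y \<in> W \<Longrightarrow> bij (fd f (g y))"
    by (rule inverse_function_C1[OF assms]) (rule that, assumption+)
  have bij: "bij (fd f x)" if "x \<in> U'" for x
    using W(8)[of "f x"] homeomorphism_apply1[OF W(6) that] homeomorphism_image1[OF W(6)] that by auto
  have gU: "g ` W \<subseteq> U'" using homeomorphism_image2[OF W(6)] by simp
  have "Ck_on k W g" for k
  proof (induction k)
    case 0
    show ?case using homeomorphism_cont2[OF W(6)] by simp
  next
    case (Suc k)
    show ?case
      by (rule Ck_on_SucI[OF W(4) W(7)], assumption,
        rule Ck_on_compose[OF W(4,1) gU Suc Ck_on_inv_frechet[OF W(1) smooth_on_subset[OF U(2) W(2)] bij]])
  qed
  then have "smooth_on W g" by (simp add: smooth_on_def)
  with W(1-6) show ?thesis by (rule that)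
qed

section \<open>Self-adjoint maps, determinants and change of variables\<close>

text \<open>If Q b were nonzero, a small move from the null vector b against Q b would make the form
  negative.\<close>

lemma selfadjoint_psd_kernel:
  fixes Q :: "'a::real_inner \<Rightarrow> 'a"
  assumes S: "subspace S" and lin: "linear Q" and inv: "\<And>x. x \<in> S \<Longrightarrow> Q x \<in> S"
    and sym: "\<And>x y. x \<in> S \<Longrightarrow> y \<in> S \<Longrightarrow> Q x \<bullet> y = x \<bullet> Q y"
    and psd: "\<And>x. x \<in> S \<Longrightarrow> Q x \<bullet> x \<ge> 0" and b: "b \<in> S" "Q b \<bullet> b = 0"
  shows "Q b = 0"
proof -
  interpret linear Q by (rule lin)
  let ?y = "Q b"
  have y: "?y \<in> S" using inv b by simp
  have *: "0 \<le> 2 * t * (?y \<bullet> ?y) + t^2 * (Q ?y \<bullet> ?y)" for t :: real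
  proof -
    have "b + t *\<^sub>R ?y \<in> S" using S b y by (simp add: subspace_add subspace_scale)
    from psd[OF this] show ?thesis
      using b(2) sym[OF y b(1)] by (simp add: add scale inner_simps power2_eq_square inner_commute algebra_simps)
  qed
  have "?y \<bullet> ?y = 0"
  proof (rule ccontr)
    assume "?y \<bullet> ?y \<noteq> 0"
    then have p: "?y \<bullet> ?y > 0" by (simp add: inner_gt_zero_iff)
    define q where "q = Q ?y \<bullet> ?y"
    have q: "q \<ge> 0" using psd[OF y] by (simp add: q_def)
    \<comment> \<open>The exact minimizer of the quadratic has q in the denominator; q + 1 avoids q
      = 0 and still gives a negative value.\<close>
    let ?t = "- (?y \<bullet> ?y) / (q + 1)"
    have "2 * ?t * (?y \<bullet> ?y) + ?t^2 * q = (?y \<bullet> ?y)^2 / (q + 1) * (q / (q + 1) - 2)"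
      using q by (simp add: power2_eq_square divide_simps) (simp add: algebra_simps)
    also have "\<dots> < 0"
      using p q by (intro mult_pos_neg) (auto simp: divide_less_eq)
    finally show False using *[of ?t] by (simp add: q_def)
  qed
  then show ?thesis by simp
qed

text \<open>Spectral theorem on an invariant subspace, as needed on the orthogonal complement of a
  direction z. A maximizer b of A x . x on the unit sphere of S is an eigenvector, because l - A is
  positive semidefinite on S with null vector b; the complement of b in S is again
  invariant.\<close>

theorem selfadjoint_eigenbasis:
  fixes A :: "'a::euclidean_space \<Rightarrow> 'a"
  assumes "subspace S" "linear A" "\<And>x. x \<in> S \<Longrightarrow> A x \<in> S"
    "\<And>x y. x \<in> S \<Longrightarrow> y \<in> S \<Longrightarrow> A x \<bullet> y = x \<bullet> A y"
  shows "\<exists>B. B \<subseteq> S \<and> pairwise orthogonal B \<and> (\<forall>b\<in>B. norm b = 1) \<and> span B = S \<and> (\<forall>b\<in>B. \<exists>l. A b = l *\<^sub>R b)"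
  using assms
proof (induction "dim S" arbitrary: S rule: less_induct)
  case less
  note S = less.prems(1) and inv = less.prems(3) and sym = less.prems(4)
  interpret linear A by (rule less.prems(2))
  show ?case
  proof (cases "S = {0}")
    case True
    then show ?thesis by (intro exI[of _ "{}"]) auto
  next
    case False
    then obtain s where s: "s \<in> S" "s \<noteq> 0" using subspace_0[OF S] by blast
    have comp: "compact (S \<inter> sphere 0 1)"
      by (intro closed_Int_compact closed_subspace S compact_sphere)
    have "s /\<^sub>R norm s \<in> S \<inter> sphere 0 1" using s S by (simp add: subspace_scale)
    then have ne: "S \<inter> sphere 0 1 \<noteq> {}" by blast
    have "continuous_on (S \<inter> sphere 0 1) (\<lambda>x. A x \<bullet> x)"
      by (intro continuous_intros linear_continuous_on) (use less.prems(2) in \<open>simp add: linear_conv_bounded_linear\<close>)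
    from continuous_attains_sup[OF comp ne this]
    obtain b where b: "b \<in> S" "norm b = 1" and max: "\<And>x. x \<in> S \<Longrightarrow> norm x = 1 \<Longrightarrow> A x \<bullet> x \<le> A b \<bullet> b"
      by auto
    define l where "l = A b \<bullet> b"
    have bb: "b \<bullet> b = 1" using b(2) by (simp add: dot_square_norm)
    let ?Q = "\<lambda>x. l *\<^sub>R x - A x"
    have "?Q b = 0"
    proof (rule selfadjoint_psd_kernel[of S ?Q])
      show "linear ?Q" by (rule linearI) (auto simp: add scale algebra_simps)
      show "?Q x \<in> S" if "x \<in> S" for x using inv that S by (simp add: subspace_diff subspace_scale)
      show "?Q x \<bullet> y = x \<bullet> ?Q y" if "x \<in> S" "y \<in> S" for x y
        using sym[OF that] by (simp add: inner_simps)
      show "?Q x \<bullet> x \<ge> 0" if x: "x \<in> S" for x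
      proof (cases "x = 0")
        case False
        let ?u = "x /\<^sub>R norm x"
        have "A ?u \<bullet> ?u \<le> l" unfolding l_def using x S False by (intro max) (auto simp: subspace_scale)
        then have "A x \<bullet> x \<le> l * (norm x)^2"
          using False by (simp add: scale power2_eq_square divide_simps)
        then show ?thesis by (simp add: inner_diff_left dot_square_norm)
      qed (simp)
      show "?Q b \<bullet> b = 0" by (simp add: inner_diff_left l_def bb)
    qed (use S b in auto)
    then have Ab: "A b = l *\<^sub>R b" by simp
    define S' where "S' = {x \<in> S. x \<bullet> b = 0}"
    have S': "subspace S'" using S unfolding S'_def by (auto simp: subspace_def inner_add_left)
    have "b \<notin> S'" using bb by (simp add: S'_def)
    then have "S' \<subset> S" using b(1) unfolding S'_def by blast
    then have "dim S' < dim S" using S S' by (metis dim_psubset span_eq_iff)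
    have A': "A x \<in> S'" if "x \<in> S'" for x
      using that inv sym[of x b] b Ab by (simp add: S'_def)
    have sym': "A x \<bullet> y = x \<bullet> A y" if "x \<in> S'" "y \<in> S'" for x y
      using that sym by (simp add: S'_def)
    from less.hyps[OF \<open>dim S' < dim S\<close> S' less.prems(2) A' sym']
    obtain B where B: "B \<subseteq> S'" "pairwise orthogonal B" "\<And>b. b \<in> B \<Longrightarrow> norm b = 1" "span B = S'"
      "\<And>b. b \<in> B \<Longrightarrow> \<exists>l. A b = l *\<^sub>R b" by auto
    show ?thesis
    proof (intro exI[of _ "insert b B"] conjI)
      show "insert b B \<subseteq> S" using b B(1) by (auto simp: S'_def)
      show "pairwise orthogonal (insert b B)"
        using B(1,2) by (auto simp: pairwise_insert orthogonal_def S'_def inner_commute)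
      show "\<forall>b\<in>insert b B. norm b = 1" using b B by auto
      show "\<forall>b\<in>insert b B. \<exists>l. A b = l *\<^sub>R b" using Ab B by auto
      show "span (insert b B) = S"
      proof
        show "span (insert b B) \<subseteq> S" using b B(1) S by (intro span_minimal) (auto simp: S'_def)
        show "S \<subseteq> span (insert b B)"
        proof
          fix x assume x: "x \<in> S"
          have "x - (x \<bullet> b) *\<^sub>R b \<in> S'"
            using x b S bb by (simp add: S'_def subspace_diff subspace_scale inner_diff_left)
          then have "x - (x \<bullet> b) *\<^sub>R b \<in> span B" using B(4) by simp
          then show "x \<in> span (insert b B)" by (auto simp: span_insert)
        qed
      qed
    qed
  qed
qed

lemma orthonormal_expansion:
  fixes B :: "'a::euclidean_space set"
  assumes B: "pairwise orthogonal B" "\<And>b. b \<in> B \<Longrightarrow> norm b = 1" and x: "x \<in> span B"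
  shows "finite B" "independent B" "x = (\<Sum>b\<in>B. (x \<bullet> b) *\<^sub>R b)"
proof -
  show ind: "independent B"
    by (rule pairwise_orthogonal_independent[OF B(1)]) (use B(2) in force)
  then show fin: "finite B" by (rule independent_imp_finite)
  have "B \<subseteq> B" and "x \<in> span B" using x by auto
  then obtain u where u: "x = (\<Sum>b\<in>B. u b *\<^sub>R b)" using span_finite[OF fin] by auto
  have "x \<bullet> c = u c" if c: "c \<in> B" for c
  proof -
    have "x \<bullet> c = (\<Sum>b\<in>B. u b * (b \<bullet> c))" by (simp add: u inner_sum_left)
    also have "\<dots> = (\<Sum>b\<in>B. if b = c then u c else 0)"
      using B(1) B(2)[OF c] c
      by (intro sum.cong) (auto simp: pairwise_def orthogonal_def dot_square_norm)
    also have "\<dots> = u c" using fin c by simp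
    finally show ?thesis .
  qed
  then show "x = (\<Sum>b\<in>B. (x \<bullet> b) *\<^sub>R b)" using u by simp
qed

text \<open>Kernels become spans of basis vectors, so multiplicities of principal curvatures can be
  counted in an orthonormal eigenbasis.\<close>

lemma eigenbasis_kernel:
  fixes f :: "'a::euclidean_space \<Rightarrow> 'a"
  assumes B: "pairwise orthogonal B" "\<And>b. b \<in> B \<Longrightarrow> norm b = 1" and lin: "linear f"
    and f: "\<And>b. b \<in> B \<Longrightarrow> f b = m b *\<^sub>R b"
  shows "{x \<in> span B. f x = 0} = span {b \<in> B. m b = 0}"
proof
  interpret linear f by (rule lin)
  show "span {b \<in> B. m b = 0} \<subseteq> {x \<in> span B. f x = 0}"
  proof (rule span_minimal)
    show "subspace {x \<in> span B. f x = 0}"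
      by (auto simp: subspace_def add scale zero span_add span_scale span_zero)
  qed (use f span_base in auto)
  show "{x \<in> span B. f x = 0} \<subseteq> span {b \<in> B. m b = 0}"
  proof
    fix x assume x: "x \<in> {x \<in> span B. f x = 0}"
    then have xs: "x \<in> span B" by simp
    note ex = orthonormal_expansion[OF B xs]
    have z: "(x \<bullet> c) * m c = 0" if c: "c \<in> B" for c
    proof -
      have "f x = (\<Sum>b\<in>B. (x \<bullet> b) *\<^sub>R f b)"
        using linear_sum[OF lin, of "\<lambda>b. (x \<bullet> b) *\<^sub>R b" B] ex(3) linear_scale[OF lin] by simp
      also have "\<dots> = (\<Sum>b\<in>B. ((x \<bullet> b) * m b) *\<^sub>R b)" by (intro sum.cong) (auto simp: f)
      finally have "0 = (\<Sum>b\<in>B. ((x \<bullet> b) * m b) *\<^sub>R b)" using x by simp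
      then show ?thesis using independentD[OF ex(2,1) order_refl, of "\<lambda>b. (x \<bullet> b) * m b" c] c by simp
    qed
    have "x = (\<Sum>b\<in>B. (x \<bullet> b) *\<^sub>R b)" by (rule ex(3))
    also have "\<dots> = (\<Sum>b\<in>{b \<in> B. m b = 0}. (x \<bullet> b) *\<^sub>R b)"
      by (rule sum.mono_neutral_right) (use ex(1) z in auto)
    also have "\<dots> \<in> span {b \<in> B. m b = 0}"
      by (intro span_sum span_scale span_base) auto
    finally show "x \<in> span {b \<in> B. m b = 0}" .
  qed
qed

text \<open>With Q the matrix whose columns are the eigenbasis and D the diagonal one, f Q = Q D;
  orthonormality makes det Q nonzero, so it cancels.\<close>

lemma det_eigenbasis:
  fixes f :: "real^'k \<Rightarrow> real^'k"
  assumes lin: "linear f" and B: "pairwise orthogonal B" "\<And>b. b \<in> B \<Longrightarrow> norm b = 1" "span B = UNIV"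
    and f: "\<And>b. b \<in> B \<Longrightarrow> f b = m b *\<^sub>R b"
  shows "det (matrix f) = (\<Prod>b\<in>B. m b)"
proof -
  have ind: "independent B" and fin: "finite B"
    using orthonormal_expansion[OF B(1,2), of 0] B(3) by auto
  have "card B = dim (UNIV :: (real^'k) set)"
    using dim_eq_card_independent[OF ind] B(3) by (metis dim_span)
  then have "card (UNIV::'k set) = card B" by simp
  then obtain e where e: "bij_betw e (UNIV::'k set) B"
    using finite_same_card_bij[OF finite fin] by blast
  have eB: "e j \<in> B" for j using e by (auto simp: bij_betw_def)
  let ?Q = "(\<chi> i j. e j $ i) :: real^'k^'k" and ?D = "(\<chi> i j. if i = j then m (e i) else 0) :: real^'k^'k"
  have col: "column j ?Q = e j" for j by (simp add: column_def vec_eq_iff)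
  have "transpose ?Q ** ?Q = mat 1"
  proof -
    have "e i \<bullet> e j = (if i = j then 1 else 0)" for i j
    proof (cases "i = j")
      case True
      then show ?thesis using B(2)[OF eB] by (simp add: dot_square_norm)
    next
      case False
      then have "e i \<noteq> e j" using e by (auto simp: bij_betw_def inj_on_def)
      then show ?thesis using B(1) eB False by (auto simp: pairwise_def orthogonal_def)
    qed
    then show ?thesis
      by (simp add: matrix_matrix_mult_def transpose_def mat_def vec_eq_iff inner_vec_def)
  qed
  then have "det (transpose ?Q) * det ?Q = 1" by (metis det_I det_mul)
  then have Q: "det ?Q \<noteq> 0" by auto
  have "matrix f ** ?Q = ?Q ** ?D"
  proof -
    have "(matrix f ** ?Q) $ i $ j = (?Q ** ?D) $ i $ j" for i j
    proof -
      have "(matrix f ** ?Q) $ i $ j = (matrix f *v e j) $ i"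
        by (simp add: matrix_matrix_mult_def matrix_vector_mult_def)
      also have "matrix f *v e j = m (e j) *\<^sub>R e j" using f[OF eB] by (simp add: matrix_works lin)
      also have "(m (e j) *\<^sub>R e j) $ i = (?Q ** ?D) $ i $ j"
        by (simp add: matrix_matrix_mult_def if_distrib cong: if_cong)
      finally show ?thesis .
    qed
    then show ?thesis by (simp add: vec_eq_iff)
  qed
  then have "det (matrix f ** ?Q) = det (?Q ** ?D)" by (rule arg_cong)
  then have "det (matrix f) * det ?Q = det ?Q * det ?D" unfolding det_mul .
  then have "det (matrix f) = det ?D" using Q by simp
  also have "\<dots> = (\<Prod>i\<in>UNIV. m (e i))" by (subst det_diagonal) auto
  also have "\<dots> = (\<Prod>b\<in>B. m b)" by (rule prod.reindex_bij_betw[OF e])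
  finally show ?thesis .
qed

section \<open>Coordinates, determinants and change of variables on an arbitrary Euclidean
  space\<close>

typedef (overloaded) 'a coord = "{..<DIM('a::euclidean_space)}"
  by (rule exI[of _ 0]) simp

instantiation coord :: (euclidean_space) linorder
begin

definition less_eq_coord :: "'a coord \<Rightarrow> 'a coord \<Rightarrow> bool" where
  "less_eq_coord x y \<longleftrightarrow> Rep_coord x \<le> Rep_coord y"

definition less_coord :: "'a coord \<Rightarrow> 'a coord \<Rightarrow> bool" where
  "less_coord x y \<longleftrightarrow> Rep_coord x < Rep_coord y"

instance
  by standard (auto simp: less_eq_coord_def less_coord_def Rep_coord_inject)

end

text \<open>The change of variables theorem lives on \<open>real ^ 'm\<close> with a finite
  well-ordered index type; \<open>coord\<close> is such a type with as many elements as the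
  dimension of the given space.\<close>

instance coord :: (euclidean_space) wellorder
proof
  fix P :: "'a coord \<Rightarrow> bool" and a :: "'a coord"
  assume step: "\<And>x. (\<And>y. y < x \<Longrightarrow> P y) \<Longrightarrow> P x"
  show "P a"
  proof (induction "Rep_coord a" arbitrary: a rule: less_induct)
    case less
    show ?case by (rule step) (rule less, simp add: less_coord_def)
  qed
qed

lemma bij_betw_Rep_coord: "bij_betw Rep_coord (UNIV :: 'a::euclidean_space coord set) {..<DIM('a)}"
  using type_definition.Rep_range[OF type_definition_coord]
  by (auto simp: bij_betw_def inj_on_def Rep_coord_inject)

instance coord :: (euclidean_space) finite
proof
  show "finite (UNIV :: 'a coord set)"
    using bij_betw_finite[OF bij_betw_Rep_coord] by simp
qed

definition coord_axis :: "'a::euclidean_space coord \<Rightarrow> 'a" where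
  "coord_axis = (SOME e. bij_betw e UNIV Basis)"

lemma bij_betw_coord_axis: "bij_betw (coord_axis :: 'a::euclidean_space coord \<Rightarrow> 'a) UNIV Basis"
proof -
  have "card (UNIV :: 'a coord set) = card (Basis :: 'a set)"
    using bij_betw_same_card[OF bij_betw_Rep_coord] by simp
  then have "\<exists>e :: 'a coord \<Rightarrow> 'a. bij_betw e UNIV Basis"
    using finite_same_card_bij[of "UNIV :: 'a coord set" "Basis :: 'a set"] by auto
  then show ?thesis unfolding coord_axis_def by (rule someI_ex)
qed

lemma coord_axis_Basis [simp]: "coord_axis i \<in> Basis"
  using bij_betw_coord_axis by (auto simp: bij_betw_def)

lemma coord_axis_inner: "coord_axis i \<bullet> coord_axis j = (if i = j then 1 else 0)"
proof -
  have "coord_axis i = coord_axis j \<longleftrightarrow> i = j"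
    using bij_betw_coord_axis by (auto simp: bij_betw_def inj_on_def)
  then show ?thesis by (simp add: inner_Basis)
qed

definition to_vec :: "'a::euclidean_space \<Rightarrow> real ^ 'a coord" where
  "to_vec x = (\<chi> i. x \<bullet> coord_axis i)"

definition of_vec :: "real ^ 'a coord \<Rightarrow> 'a::euclidean_space" where
  "of_vec v = (\<Sum>i\<in>UNIV. (v $ i) *\<^sub>R coord_axis i)"

lemma linear_to_vec: "linear to_vec"
  by (rule linearI) (auto simp: to_vec_def vec_eq_iff inner_add_left)

lemma linear_of_vec: "linear of_vec"
  by (rule linearI) (auto simp: of_vec_def scaleR_add_left sum.distrib scaleR_sum_right)

lemma to_of_vec [simp]: "to_vec (of_vec v) = v"
  by (simp add: to_vec_def of_vec_def inner_sum_left coord_axis_inner vec_eq_iff if_distrib cong: if_cong)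

lemma of_to_vec [simp]: "of_vec (to_vec x) = (x::'a::euclidean_space)"
proof -
  have "of_vec (to_vec x) = (\<Sum>b\<in>Basis. (x \<bullet> b) *\<^sub>R b)"
    unfolding to_vec_def of_vec_def using sum.reindex_bij_betw[OF bij_betw_coord_axis, of "\<lambda>b. (x \<bullet> b) *\<^sub>R b"]
    by simp
  then show ?thesis by (simp add: euclidean_representation)
qed

lemma inner_to_vec [simp]: "to_vec x \<bullet> to_vec y = x \<bullet> (y::'a::euclidean_space)"
proof -
  have "to_vec x \<bullet> to_vec y = (\<Sum>b\<in>Basis. (x \<bullet> b) * (y \<bullet> b))"
    unfolding to_vec_def inner_vec_def
    using sum.reindex_bij_betw[OF bij_betw_coord_axis, of "\<lambda>b. (x \<bullet> b) * (y \<bullet> b)"] by simp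
  then show ?thesis by (simp add: euclidean_inner[of x y])
qed

lemma norm_to_vec [simp]: "norm (to_vec x) = norm x"
  by (simp add: norm_eq_sqrt_inner)

lemma bounded_linear_vec: "bounded_linear to_vec" "bounded_linear of_vec"
  using linear_to_vec linear_of_vec by (simp_all add: linear_conv_bounded_linear)

lemma inj_vec: "inj to_vec" "inj of_vec"
  by (rule inj_on_inverseI[where g = of_vec], simp) (rule inj_on_inverseI[where g = to_vec], simp)

lemma to_vec_image_eq_vimage: "to_vec ` S = of_vec -` S"
  by (auto simp: image_iff intro: to_of_vec[symmetric])

lemma measurable_vec [measurable]: "to_vec \<in> borel_measurable borel" "of_vec \<in> borel_measurable borel"
  using bounded_linear_vec by (auto intro!: borel_measurable_continuous_onI linear_continuous_on)

definition lin_det :: "('a::euclidean_space \<Rightarrow> 'a) \<Rightarrow> real" where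
  "lin_det f = det (matrix (\<lambda>v. to_vec (f (of_vec v))))"

lemma linear_vec_conj: "linear f \<Longrightarrow> linear (\<lambda>v. to_vec (f (of_vec v)))"
  using linear_compose[OF linear_compose[OF linear_of_vec] linear_to_vec] by (simp add: o_def)

lemma lin_det_compose:
  assumes "linear f" "linear g"
  shows "lin_det (\<lambda>x. f (g x)) = lin_det f * lin_det g"
proof -
  have "(\<lambda>v. to_vec (f (g (of_vec v)))) = (\<lambda>v. to_vec (f (of_vec v))) \<circ> (\<lambda>v. to_vec (g (of_vec v)))"
    by (simp add: o_def)
  then show ?thesis
    unfolding lin_det_def using assms
    by (simp add: matrix_compose linear_vec_conj det_mul)
qed

lemma lin_det_adjoint:
  assumes "linear f" "\<And>x y. f x \<bullet> y = x \<bullet> g y"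
  shows "lin_det g = lin_det f"
proof -
  let ?f = "\<lambda>v. to_vec (f (of_vec v))" and ?g = "\<lambda>v. to_vec (g (of_vec v))"
  have "u \<bullet> ?g v = ?f u \<bullet> v" for u v
    using assms(2)[of "of_vec u" "of_vec v"] inner_to_vec[of "of_vec u" "g (of_vec v)"] inner_to_vec[of "f (of_vec u)" "of_vec v"]
    by simp
  then have "adjoint ?f = ?g" by (intro adjoint_unique) auto
  then have "matrix ?g = transpose (matrix ?f)"
    using matrix_adjoint[OF linear_vec_conj[OF assms(1)]] by simp
  then show ?thesis unfolding lin_det_def by simp
qed

lemma lin_det_eigenbasis:
  fixes f :: "'a::euclidean_space \<Rightarrow> 'a"
  assumes lin: "linear f" and B: "pairwise orthogonal B" "\<And>b. b \<in> B \<Longrightarrow> norm b = 1" "span B = UNIV"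
    and f: "\<And>b. b \<in> B \<Longrightarrow> f b = m b *\<^sub>R b"
  shows "lin_det f = (\<Prod>b\<in>B. m b)"
proof -
  have "lin_det f = (\<Prod>c\<in>to_vec ` B. m (of_vec c))"
    unfolding lin_det_def
  proof (rule det_eigenbasis)
    show "linear (\<lambda>v. to_vec (f (of_vec v)))" by (rule linear_vec_conj[OF lin])
    show "pairwise orthogonal (to_vec ` B)"
      using B(1) by (auto simp: pairwise_def orthogonal_def)
    show "span (to_vec ` B) = UNIV"
      unfolding linear_span_image[OF linear_to_vec] B(3) by (rule surjI[where f = of_vec]) simp
    show "to_vec (f (of_vec c)) = m (of_vec c) *\<^sub>R c" if "c \<in> to_vec ` B" for c
      using that f by (auto simp: linear_scale[OF linear_to_vec])
  qed (use B in auto)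
  also have "\<dots> = (\<Prod>b\<in>B. m b)"
    by (subst prod.reindex) (auto intro: inj_on_subset[OF inj_vec(1)])
  finally show ?thesis .
qed

lemma lin_det_Basis:
  fixes f :: "'a::euclidean_space \<Rightarrow> 'a"
  assumes "linear f" "\<And>b. b \<in> Basis \<Longrightarrow> f b = m b *\<^sub>R b"
  shows "lin_det f = (\<Prod>b\<in>Basis. m b)"
  by (rule lin_det_eigenbasis) (use assms in \<open>auto simp: pairwise_def orthogonal_Basis orthogonal_def inner_not_same_Basis\<close>)

text \<open>A diagonal map composed with a shear. It occurs as a factor of the Jacobian of a cone
  parametrization (x, s) \<mapsto> s g(x), whose radial direction has a tangential component as
  well.\<close>

lemma lin_det_triangular:
  fixes a :: "'b::euclidean_space"
  assumes r: "r \<noteq> 0"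
  shows "\<bar>lin_det (\<lambda>p::'b \<times> real. (r *\<^sub>R fst p + snd p *\<^sub>R a, c * snd p))\<bar> = \<bar>r\<bar> ^ DIM('b) * \<bar>c\<bar>"
proof -
  let ?S = "\<lambda>a (p::'b \<times> real). (fst p + snd p *\<^sub>R a, snd p)"
  let ?D = "\<lambda>r c (p::'b \<times> real). (r *\<^sub>R fst p, c * snd p)"
  have lS: "linear (?S a)" for a by (rule linearI) (auto simp: algebra_simps scaleR_add_left)
  have lD: "linear (?D r c)" for r c by (rule linearI) (auto simp: algebra_simps)
  have dD: "lin_det (?D r c) = r ^ DIM('b) * c" for r c
  proof -
    have "lin_det (?D r c) = (\<Prod>b\<in>(Basis :: ('b \<times> real) set). if snd b = 0 then r else c)"
      by (rule lin_det_Basis[where m = "\<lambda>b. if snd b = 0 then r else c", OF lD[of r c]]) (auto simp: Basis_prod_def)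
    also have "\<dots> = (\<Prod>b\<in>(\<lambda>u. (u, 0)) ` (Basis :: 'b set). if snd b = (0::real) then r else c) *
        (\<Prod>b\<in>(\<lambda>v. (0::'b, v)) ` (Basis :: real set). if snd b = 0 then r else c)"
      unfolding Basis_prod_def by (rule prod.union_disjoint) auto
    also have "(\<Prod>b\<in>(\<lambda>u. (u, 0)) ` (Basis :: 'b set). if snd b = (0::real) then r else c) = r ^ DIM('b)"
      by (subst prod.reindex) (auto simp: inj_on_def)
    also have "(\<Prod>b\<in>(\<lambda>v. (0::'b, v)) ` (Basis :: real set). if snd b = 0 then r else c) = c"
      by simp
    finally show ?thesis .
  qed
  \<comment> \<open>A shear is conjugate to its inverse by a reflection, hence has determinant of modulus one.\<close>
  have dS: "\<bar>lin_det (?S a)\<bar> = 1" for a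
  proof -
    have "?S (- a) = (\<lambda>p. ?D 1 (-1) (?S a (?D 1 (-1) p)))" by (auto simp: fun_eq_iff)
    then have "lin_det (?S (- a)) = lin_det (?D 1 (-1)) * (lin_det (?S a) * lin_det (?D 1 (-1)))"
      using lin_det_compose[OF lD linear_compose[OF lD[of 1 "-1"] lS[of a], unfolded o_def], of 1 "-1"]
        lin_det_compose[OF lS[of a] lD[of 1 "-1"]] by simp
    then have 1: "lin_det (?S (- a)) = lin_det (?S a)" unfolding dD by simp
    have "?D 1 1 = (\<lambda>p. ?S (- a) (?S a p))" by (auto simp: fun_eq_iff)
    then have "lin_det (?S (- a)) * lin_det (?S a) = 1"
      using lin_det_compose[OF lS[of "- a"] lS[of a]] dD[of 1 1] by simp
    then have "(lin_det (?S a))^2 = 1" unfolding 1 by (simp add: power2_eq_square)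
    then show ?thesis by (auto simp: power2_eq_1_iff)
  qed
  have eq: "(\<lambda>p::'b \<times> real. (r *\<^sub>R fst p + snd p *\<^sub>R a, c * snd p)) = (\<lambda>p. ?D r c (?S (a /\<^sub>R r) p))"
    using r by (auto simp: fun_eq_iff algebra_simps)
  show ?thesis
    unfolding eq lin_det_compose[OF lD lS] by (simp only: abs_mult dD dS power_abs mult_1_right)
qed

text \<open>A unit normal z completes C to a square map Q. Its Gram operator is that of C extended
  by 1, so the square of det Q is the Gram determinant of C; both are read off in one eigenbasis of
  the Gram operator of C.\<close>

lemma lin_det_gram:
  fixes C :: "real^'n \<Rightarrow> (real^'n) \<times> real"
  assumes C: "linear C" and z: "norm z = 1" "\<And>x. C x \<bullet> z = 0"
  shows "(lin_det (\<lambda>p. C (fst p) + snd p *\<^sub>R z))^2 = det (\<chi> i j. C (axis i 1) \<bullet> C (axis j 1))"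
proof -
  let ?Q = "\<lambda>p::(real^'n) \<times> real. C (fst p) + snd p *\<^sub>R z"
  let ?Qt = "\<lambda>v. (adjoint C v, z \<bullet> v)"
  have lQ: "linear ?Q"
    by (rule linearI) (auto simp: linear_add[OF C] linear_scale[OF C] algebra_simps)
  have adj: "?Q p \<bullet> v = p \<bullet> ?Qt v" for p v
    by (simp add: inner_prod_def[of p] inner_add_left adjoint_works[OF C] inner_scaleR_left)
  have lQt: "linear ?Qt"
    by (rule linearI) (auto simp: linear_add[OF adjoint_linear[OF C]] linear_scale[OF adjoint_linear[OF C]] inner_add_right)
  let ?G = "\<lambda>x. adjoint C (C x)"
  have lG: "linear ?G" using linear_compose[OF C adjoint_linear[OF C]] by (simp add: o_def)
  have sG: "?G x \<bullet> y = x \<bullet> ?G y" for x y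
    by (simp add: adjoint_clauses[OF C])
  obtain B where B: "pairwise orthogonal B" "\<And>b. b \<in> B \<Longrightarrow> norm b = 1" "span B = UNIV"
    "\<And>b. b \<in> B \<Longrightarrow> \<exists>l. ?G b = l *\<^sub>R b"
    using selfadjoint_eigenbasis[OF subspace_UNIV lG] sG by auto
  then obtain m where m: "\<And>b. b \<in> B \<Longrightarrow> ?G b = m b *\<^sub>R b" by metis
  have fin: "finite B" using orthonormal_expansion[OF B(1,2), of 0] B(3) by auto
  have "matrix ?G = (\<chi> i j. C (axis i 1) \<bullet> C (axis j 1))"
  proof -
    have "?G (axis j 1) $ i = C (axis i 1) \<bullet> C (axis j 1)" for i j
      using cart_eq_inner_axis[of "?G (axis j 1)" i] by (simp add: adjoint_clauses[OF C] inner_commute)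
    then show ?thesis by (simp add: matrix_def vec_eq_iff)
  qed
  then have dG: "det (\<chi> i j. C (axis i 1) \<bullet> C (axis j 1)) = (\<Prod>b\<in>B. m b)"
    using det_eigenbasis[OF lG B(1-3) m] by simp
  let ?B = "(\<lambda>b. (b, 0::real)) ` B \<union> {(0, 1)}"
  have "lin_det (\<lambda>p. ?Qt (?Q p)) = (\<Prod>b\<in>?B. if snd b = 0 then m (fst b) else 1)"
  proof (rule lin_det_eigenbasis)
    show "linear (\<lambda>p. ?Qt (?Q p))" using linear_compose[OF lQ lQt] by (simp add: o_def)
    show "pairwise orthogonal ?B"
      using B(1) by (auto simp: pairwise_def orthogonal_def inner_prod_def)
    show "norm b = 1" if "b \<in> ?B" for b using that B(2) by (auto simp: norm_Pair)
    show "span ?B = UNIV"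
    proof -
      have "(x, s) \<in> span ?B" for x :: "real^'n" and s :: real
      proof -
        have "x \<in> span B" using B(3) by simp
        from orthonormal_expansion(3)[OF B(1,2) this] have "(x, s) = (\<Sum>b\<in>B. (x \<bullet> b) *\<^sub>R (b, 0)) + s *\<^sub>R (0, 1)"
          by (simp add: prod_eq_iff fst_sum snd_sum)
        also have "\<dots> \<in> span ?B" by (intro span_add span_sum span_scale span_base) auto
        finally show ?thesis .
      qed
      then show ?thesis by auto
    qed
    have az: "adjoint C z = 0"
    proof -
      have "x \<bullet> adjoint C z = 0" for x using z(2)[of x] by (simp add: adjoint_works[OF C])
      then show ?thesis by (metis inner_eq_zero_iff)
    qed
    show "?Qt (?Q b) = (if snd b = 0 then m (fst b) else 1) *\<^sub>R b" if "b \<in> ?B" for b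
      using that m z az by (auto simp: linear_0[OF C] inner_commute dot_square_norm z(2)[unfolded inner_commute[of _ z]])
  qed
  also have "\<dots> = (\<Prod>b\<in>(\<lambda>b. (b, 0::real)) ` B. if snd b = 0 then m (fst b) else 1) * (\<Prod>b\<in>{(0::real^'n, 1::real)}. if snd b = 0 then m (fst b) else 1)"
    by (rule prod.union_disjoint) (use fin in auto)
  also have "\<dots> = (\<Prod>b\<in>B. m b)" by (simp add: prod.reindex inj_on_def)
  finally have "lin_det (\<lambda>p. ?Qt (?Q p)) = (\<Prod>b\<in>B. m b)" .
  moreover have "lin_det (\<lambda>p. ?Qt (?Q p)) = lin_det ?Qt * lin_det ?Q" by (rule lin_det_compose[OF lQt lQ])
  moreover have "lin_det ?Qt = lin_det ?Q" by (rule lin_det_adjoint[OF lQ adj])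
  ultimately show ?thesis using dG by (simp add: power2_eq_square)
qed

text \<open>\<open>to_vec\<close> only relabels coordinates, so it matches boxes with boxes of equal
  volume, and boxes determine Lebesgue measure.\<close>

lemma distr_to_vec: "distr lborel borel to_vec = (lborel :: (real ^ 'a::euclidean_space coord) measure)"
proof (rule lborel_eqI[symmetric])
  fix l u :: "real ^ 'a coord" assume lu: "\<And>b. b \<in> Basis \<Longrightarrow> l \<bullet> b \<le> u \<bullet> b"
  have lu': "l $ i \<le> u $ i" for i using lu[of "axis i 1"] by (simp add: inner_axis)
  have ofv: "of_vec v \<bullet> coord_axis i = v $ i" for v :: "real ^ 'a coord" and i
    using arg_cong[OF to_of_vec[of v], of "\<lambda>w. w $ i"] by (simp add: to_vec_def)
  have basis: "(\<forall>b\<in>Basis. Q b) \<longleftrightarrow> (\<forall>i. Q (coord_axis i))" for Q :: "'a \<Rightarrow> bool"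
    using bij_betw_coord_axis[where 'a = 'a] by (auto simp: bij_betw_def) (metis imageE)
  have "to_vec -` box l u = (box (of_vec l) (of_vec u) :: 'a set)"
    unfolding set_eq_iff vimage_eq mem_box basis
    by (simp add: mem_box_cart ofv to_vec_def mem_box[symmetric])
  then have "emeasure (distr lborel borel to_vec) (box l u) = emeasure lborel (box (of_vec l) (of_vec u) :: 'a set)"
    by (simp add: emeasure_distr)
  also have "\<dots> = ennreal (\<Prod>b\<in>Basis. (of_vec u - of_vec l :: 'a) \<bullet> b)"
    by (rule emeasure_lborel_box) (use basis[of "\<lambda>b. of_vec l \<bullet> b \<le> of_vec u \<bullet> b"] lu' ofv in auto)
  also have "(\<Prod>b\<in>Basis. (of_vec u - of_vec l :: 'a) \<bullet> b) = (\<Prod>i\<in>UNIV. u $ i - l $ i)"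
    using prod.reindex_bij_betw[OF bij_betw_coord_axis, of "\<lambda>b. (of_vec u - of_vec l :: 'a) \<bullet> b"]
    by (simp add: inner_diff_left ofv)
  also have "\<dots> = (\<Prod>b\<in>Basis. (u - l) \<bullet> b)"
    by (simp add: Basis_vec_def prod.UNION_disjoint inner_axis axis_eq_axis)
  finally show "emeasure (distr lborel borel to_vec) (box l u) = ennreal (\<Prod>b\<in>Basis. (u - l) \<bullet> b)" .
qed simp

lemma nn_integral_to_vec:
  assumes [measurable]: "f \<in> borel_measurable borel"
  shows "(\<integral>\<^sup>+x. f x \<partial>lborel) = (\<integral>\<^sup>+v. f (of_vec v) \<partial>lborel)"
proof -
  have "(\<integral>\<^sup>+v. f (of_vec v) \<partial>lborel) = (\<integral>\<^sup>+v. f (of_vec v) \<partial>distr lborel borel to_vec)"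
    by (simp add: distr_to_vec)
  also have "\<dots> = (\<integral>\<^sup>+x. f (of_vec (to_vec x)) \<partial>lborel)" by (rule nn_integral_distr) auto
  finally show ?thesis by simp
qed

text \<open>Bridges nonnegative Borel integrals and absolutely integrable functions with values in
  \<open>real ^ 1\<close>. Finiteness provides integrability on the image side, and G is a Borel
  function on the whole space that agrees with the Jacobian density on S.\<close>

lemma nn_integral_change_of_variables_vec:
  fixes f G :: "real^'m::{finite,wellorder} \<Rightarrow> real"
  assumes S: "S \<in> sets borel" and FS: "F ` S \<in> sets borel"
    and der: "\<And>x. x \<in> S \<Longrightarrow> (F has_derivative F' x) (at x within S)" and inj: "inj_on F S"
    and f: "f \<in> borel_measurable borel" "\<And>y. f y \<ge> 0"
    and G: "G \<in> borel_measurable borel" "\<And>x. G x \<ge> 0" "\<And>x. x \<in> S \<Longrightarrow> G x = \<bar>det (matrix (F' x))\<bar> * f (F x)"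
    and fin: "(\<integral>\<^sup>+y. ennreal (f y) * indicator (F ` S) y \<partial>lborel) < \<infinity>"
  shows "(\<integral>\<^sup>+y. ennreal (f y) * indicator (F ` S) y \<partial>lborel) = (\<integral>\<^sup>+x. ennreal (G x) * indicator S x \<partial>lborel)"
proof -
  have nn: "(\<integral>\<^sup>+y. ennreal (h y) * indicator T y \<partial>lborel) = (\<integral>\<^sup>+y. ennreal (indicator T y * h y) \<partial>lborel)"
    for h :: "real^'m::_ \<Rightarrow> real" and T
    by (intro nn_integral_cong) (auto split: split_indicator)
  have meas: "(\<lambda>y. indicator T y * h y) \<in> borel_measurable borel"
    if "T \<in> sets borel" "h \<in> borel_measurable borel" for h :: "real^'m::_ \<Rightarrow> real" and T
    using that by (intro borel_measurable_times borel_measurable_indicator) auto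
  have si: "set_integrable lebesgue T h" "integral T h = integral\<^sup>L lborel (\<lambda>y. indicator T y * h y)"
    if "T \<in> sets borel" "h \<in> borel_measurable borel" "integrable lborel (\<lambda>y. indicator T y * h y)" for h :: "real^'m::_ \<Rightarrow> real" and T
  proof -
    have m: "(\<lambda>y. indicator T y * h y) \<in> borel_measurable lborel" using meas[OF that(1,2)] by simp
    show 1: "set_integrable lebesgue T h"
      unfolding set_integrable_def using that(3) integrable_completion[OF m] by simp
    show "integral T h = integral\<^sup>L lborel (\<lambda>y. indicator T y * h y)"
      using set_lebesgue_integral_eq_integral(2)[OF 1] integral_completion[OF m]
      by (simp add: set_lebesgue_integral_def)
  qed
  have fi: "integrable lborel (\<lambda>y. indicator (F ` S) y * f y)"
    by (rule integrableI_nonneg) (use meas[OF FS f(1)] f(2) fin nn[of f] in auto)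
  let ?b = "integral (F ` S) f"
  have "(\<lambda>x. vec (f x) :: real ^ 1) absolutely_integrable_on (F ` S) \<and>
      integral (F ` S) (\<lambda>x. vec (f x)) = (vec ?b :: real ^ 1)"
    using si(1)[OF FS f(1) fi] by (simp add: absolutely_integrable_on_1_iff integral_on_1_eq)
  then have "(\<lambda>x. \<bar>det (matrix (F' x))\<bar> *\<^sub>R vec (f (F x)) :: real ^ 1) absolutely_integrable_on S \<and>
      integral S (\<lambda>x. \<bar>det (matrix (F' x))\<bar> *\<^sub>R vec (f (F x))) = (vec ?b :: real ^ 1)"
    by (subst has_absolute_integral_change_of_variables[OF _ der inj]) (use S in auto)
  then have D: "(\<lambda>x. \<bar>det (matrix (F' x))\<bar> * f (F x)) absolutely_integrable_on S"
    "integral S (\<lambda>x. \<bar>det (matrix (F' x))\<bar> * f (F x)) = ?b"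
    by (simp_all add: absolutely_integrable_on_1_iff integral_on_1_eq)
  have eqG: "(\<lambda>x. indicator S x *\<^sub>R (\<bar>det (matrix (F' x))\<bar> * f (F x))) = (\<lambda>x. indicator S x * G x)"
    using G(3) by (auto simp: fun_eq_iff split: split_indicator)
  have mG: "(\<lambda>y. indicator S y * G y) \<in> borel_measurable lborel" using meas[OF S G(1)] by simp
  have Gi: "integrable lborel (\<lambda>x. indicator S x * G x)"
    using D(1) integrable_completion[OF mG] unfolding set_integrable_def eqG by simp
  have "integral S G = ?b" using D(2) G(3) by (metis (no_types, lifting) integral_cong)
  then have eq: "integral\<^sup>L lborel (\<lambda>y. indicator S y * G y) = integral\<^sup>L lborel (\<lambda>y. indicator (F ` S) y * f y)"
    using si(2)[OF S G(1) Gi] si(2)[OF FS f(1) fi] by simp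
  have "(\<integral>\<^sup>+y. ennreal (indicator (F ` S) y * f y) \<partial>lborel) = ennreal (integral\<^sup>L lborel (\<lambda>y. indicator (F ` S) y * f y))"
    by (rule nn_integral_eq_integral[OF fi]) (use f(2) in auto)
  moreover have "(\<integral>\<^sup>+y. ennreal (indicator S y * G y) \<partial>lborel) = ennreal (integral\<^sup>L lborel (\<lambda>y. indicator S y * G y))"
    by (rule nn_integral_eq_integral[OF Gi]) (use G(2) in auto)
  ultimately show ?thesis unfolding nn using eq by simp
qed

theorem nn_integral_change_of_variables:
  fixes f G :: "'a::euclidean_space \<Rightarrow> real" and F :: "'a \<Rightarrow> 'a"
  assumes S: "S \<in> sets borel" and FS: "F ` S \<in> sets borel"
    and der: "\<And>x. x \<in> S \<Longrightarrow> (F has_derivative F' x) (at x)" and inj: "inj_on F S"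
    and f: "f \<in> borel_measurable borel" "\<And>y. f y \<ge> 0"
    and G: "G \<in> borel_measurable borel" "\<And>x. G x \<ge> 0" "\<And>x. x \<in> S \<Longrightarrow> G x = \<bar>lin_det (F' x)\<bar> * f (F x)"
    and fin: "(\<integral>\<^sup>+y. ennreal (f y) * indicator (F ` S) y \<partial>lborel) < \<infinity>"
  shows "(\<integral>\<^sup>+y. ennreal (f y) * indicator (F ` S) y \<partial>lborel) = (\<integral>\<^sup>+x. ennreal (G x) * indicator S x \<partial>lborel)"
proof -
  let ?S = "to_vec ` S" and ?F = "\<lambda>v. to_vec (F (of_vec v))"
  have img: "?F ` ?S = to_vec ` (F ` S)" by (auto simp: image_image)
  have ind: "indicator (to_vec ` T) v = indicator T (of_vec v)" for T :: "'a set" and v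
    unfolding to_vec_image_eq_vimage by (simp add: indicator_def)
  have bor: "to_vec ` T \<in> sets borel" if "T \<in> sets borel" for T :: "'a set"
    unfolding to_vec_image_eq_vimage using measurable_sets_borel[OF measurable_vec(2) that] .
  have tr: "(\<integral>\<^sup>+y. ennreal (h y) * indicator T y \<partial>lborel) = (\<integral>\<^sup>+v. ennreal (h (of_vec v)) * indicator (to_vec ` T) v \<partial>lborel)"
    if [measurable]: "h \<in> borel_measurable borel" "T \<in> sets borel" for h :: "'a \<Rightarrow> real" and T
    unfolding ind by (subst nn_integral_to_vec) auto
  have "(\<integral>\<^sup>+v. ennreal (f (of_vec v)) * indicator (?F ` ?S) v \<partial>lborel) = (\<integral>\<^sup>+v. ennreal (G (of_vec v)) * indicator ?S v \<partial>lborel)"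
  proof (rule nn_integral_change_of_variables_vec)
    show "?S \<in> sets borel" "?F ` ?S \<in> sets borel" unfolding img using bor S FS by auto
    show "(?F has_derivative (\<lambda>w. to_vec (F' (of_vec v) (of_vec w)))) (at v within ?S)" if "v \<in> ?S" for v
    proof -
      have "of_vec v \<in> S" using that by auto
      from der[OF this]
      have "((\<lambda>v. F (of_vec v)) has_derivative (\<lambda>w. F' (of_vec v) (of_vec w))) (at v within ?S)"
        by (rule has_derivative_compose[OF bounded_linear_imp_has_derivative[OF bounded_linear_vec(2)]])
      then show ?thesis by (rule bounded_linear.has_derivative[OF bounded_linear_vec(1)])
    qed
    show "inj_on ?F ?S"
      using inj by (auto simp: inj_on_def dest!: injD[OF inj_vec(1)])
    show "G (of_vec v) = \<bar>det (matrix (\<lambda>w. to_vec (F' (of_vec v) (of_vec w))))\<bar> * f (of_vec (?F v))" if "v \<in> ?S" for v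
      using G(3)[of "of_vec v"] that by (auto simp: lin_det_def)
    show "(\<integral>\<^sup>+v. ennreal (f (of_vec v)) * indicator (?F ` ?S) v \<partial>lborel) < \<infinity>"
      unfolding img tr[OF f(1) FS, symmetric] by (rule fin)
  qed (use f G measurable_compose[OF measurable_vec(2)] in auto)
  then show ?thesis unfolding tr[OF f(1) FS] tr[OF G(1) S] img .
qed

section \<open>The Brunn-Minkowski inequality\<close>

text \<open>Brunn-Minkowski for two boxes with edge lengths x and y: apply the inequality of
  arithmetic and geometric means to x_i / (x_i + y_i) and to y_i / (x_i + y_i), whose arithmetic
  means add up to 1.\<close>

lemma prod_sum_powr_superadditive:
  fixes x y :: "'i \<Rightarrow> real"
  assumes "finite I" "I \<noteq> {}" "\<And>i. i \<in> I \<Longrightarrow> x i > 0" "\<And>i. i \<in> I \<Longrightarrow> y i > 0"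
  shows "prod x I powr (1 / card I) + prod y I powr (1 / card I) \<le> (\<Prod>i\<in>I. x i + y i) powr (1 / card I)"
proof -
  let ?r = "1 / real (card I)" and ?s = "\<lambda>i. x i + y i"
  have card: "card I > 0" using assms by (simp add: card_gt_0_iff)
  have s: "?s i > 0" if "i \<in> I" for i using assms(3,4)[OF that] by simp
  have P: "prod ?s I > 0" by (rule prod_pos) (use s in auto)
  have *: "prod z I powr ?r = (prod ?s I) powr ?r * (\<Prod>i\<in>I. z i / ?s i) powr ?r"
    if "\<And>i. i \<in> I \<Longrightarrow> z i > 0" for z
  proof -
    have "prod z I = prod ?s I * (\<Prod>i\<in>I. z i / ?s i)"
      using P by (simp add: prod_dividef)
    moreover have "(\<Prod>i\<in>I. z i / ?s i) \<ge> 0"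
      by (intro prod_nonneg divide_nonneg_nonneg less_imp_le[OF that] less_imp_le[OF s])
    ultimately show ?thesis using P by (simp add: powr_mult)
  qed
  have "(\<Prod>i\<in>I. x i / ?s i) powr ?r + (\<Prod>i\<in>I. y i / ?s i) powr ?r
      \<le> (\<Sum>i\<in>I. x i / ?s i) / card I + (\<Sum>i\<in>I. y i / ?s i) / card I"
    unfolding sum_divide_distrib
    by (intro add_mono arith_geom_mean divide_nonneg_pos s less_imp_le[OF assms(3)] less_imp_le[OF assms(4)] assms(1,2))
  also have "\<dots> = (\<Sum>i\<in>I. x i / ?s i + y i / ?s i) / card I"
    by (simp add: sum.distrib add_divide_distrib)
  also have "(\<Sum>i\<in>I. x i / ?s i + y i / ?s i) = (\<Sum>i\<in>I. 1)"
    by (intro sum.cong refl) (use s in \<open>simp add: add_divide_distrib[symmetric] less_imp_neq[symmetric]\<close>)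
  finally have le: "(\<Prod>i\<in>I. x i / ?s i) powr ?r + (\<Prod>i\<in>I. y i / ?s i) powr ?r \<le> 1"
    using card by simp
  have "prod x I powr ?r + prod y I powr ?r =
      (prod ?s I) powr ?r * ((\<Prod>i\<in>I. x i / ?s i) powr ?r + (\<Prod>i\<in>I. y i / ?s i) powr ?r)"
    by (simp only: *[of x, OF assms(3)] *[of y, OF assms(4)] distrib_left)
  also have "\<dots> \<le> (prod ?s I) powr ?r * 1"
    by (intro mult_left_mono le) auto
  finally show ?thesis by simp
qed

lemma fmeasurable_lborel_open_bounded:
  fixes A :: "'a::euclidean_space set"
  shows "open A \<Longrightarrow> bounded A \<Longrightarrow> A \<in> fmeasurable lborel"
  using emeasure_bounded_finite[of A] by (intro fmeasurableI) (auto simp: top.not_eq_extremum)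

definition box_family :: "'a::euclidean_space set set \<Rightarrow> bool" where
  "box_family F \<longleftrightarrow> finite F \<and> F \<noteq> {} \<and> (\<forall>S\<in>F. S \<noteq> {} \<and> (\<exists>a b. S = box a b)) \<and> disjoint F"

lemma box_family_Union:
  assumes "box_family F"
  shows "open (\<Union>F)" "bounded (\<Union>F)" "\<Union>F \<noteq> {}" "measure lborel (\<Union>F) > 0" "\<Union>F \<in> fmeasurable lborel"
proof -
  show o: "open (\<Union>F)" using assms by (auto simp: box_family_def intro!: open_Union)
  show b: "bounded (\<Union>F)" using assms unfolding box_family_def by (metis bounded_Union bounded_box)
  show n: "\<Union>F \<noteq> {}" using assms by (auto simp: box_family_def)
  show "\<Union>F \<in> fmeasurable lborel"
    using b o by (intro fmeasurable_lborel_open_bounded)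
  have "\<not> negligible (\<Union>F)" using open_not_negligible[OF o n] .
  then have "measure lebesgue (\<Union>F) \<noteq> 0"
    using o b by (simp add: negligible_iff_measure bounded_set_imp_lmeasurable)
  then have "measure lborel (\<Union>F) \<noteq> 0" using o by (simp add: measure_completion)
  then show "measure lborel (\<Union>F) > 0" using measure_nonneg[of lborel "\<Union>F"] by linarith
qed

definition halfspace_cut :: "'a::euclidean_space \<Rightarrow> 'a set \<Rightarrow> bool" where
  "halfspace_cut i H \<longleftrightarrow> (\<exists>c. H = {x. x \<bullet> i < c} \<or> H = {x. c < x \<bullet> i})"

lemma box_Int_halfspace:
  fixes i :: "'a::euclidean_space"
  assumes "i \<in> Basis" "halfspace_cut i H"
  shows "\<exists>a' b'. box a b \<inter> H = box a' b'"
proof -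
  from assms(2) obtain c where "H = {x. x \<bullet> i < c} \<or> H = {x. c < x \<bullet> i}"
    by (auto simp: halfspace_cut_def)
  then show ?thesis
  proof
    assume "H = {x. x \<bullet> i < c}"
    then have "box a b \<inter> H = box a (\<Sum>j\<in>Basis. (if j = i then min (b \<bullet> i) c else b \<bullet> j) *\<^sub>R j)"
      using assms(1) by (auto simp: box_def split: if_splits)
    then show ?thesis by blast
  next
    assume "H = {x. c < x \<bullet> i}"
    then have "box a b \<inter> H = box (\<Sum>j\<in>Basis. (if j = i then max (a \<bullet> i) c else a \<bullet> j) *\<^sub>R j) b"
      using assms(1) by (auto simp: box_def split: if_splits)
    then show ?thesis by blast
  qed
qed

text \<open>The strict decrease in the last claim, when some box misses the half-space, is what
  drives the induction on the number of boxes.\<close>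

lemma box_family_cut:
  assumes F: "box_family F" and i: "i \<in> Basis" and H: "halfspace_cut i H"
    and ne: "\<Union>F \<inter> H \<noteq> {}"
  defines "F' \<equiv> (\<lambda>S. S \<inter> H) ` F - {{}}"
  shows "box_family F'" "\<Union>F' = \<Union>F \<inter> H" "card F' \<le> card F"
    "S \<in> F \<Longrightarrow> S \<inter> H = {} \<Longrightarrow> card F' < card F"
proof -
  have fin: "finite F" using F by (simp add: box_family_def)
  show U: "\<Union>F' = \<Union>F \<inter> H" by (auto simp: F'_def)
  show "box_family F'"
    unfolding box_family_def
  proof (intro conjI ballI)
    show "finite F'" using fin by (simp add: F'_def)
    show "F' \<noteq> {}" using U ne by auto
    show "S \<noteq> {}" if "S \<in> F'" for S using that by (auto simp: F'_def)
    show "\<exists>a b. S = box a b" if S: "S \<in> F'" for S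
    proof -
      obtain T where T: "T \<in> F" "S = T \<inter> H" using S by (auto simp: F'_def)
      then obtain a b where "T = box a b" using F unfolding box_family_def by blast
      then show ?thesis using box_Int_halfspace[OF i H, of a b] T by auto
    qed
    show "disjoint F'"
    proof (rule disjointI)
      fix S T assume *: "S \<in> F'" "T \<in> F'" "S \<noteq> T"
      then obtain S' T' where "S' \<in> F" "T' \<in> F" "S = S' \<inter> H" "T = T' \<inter> H" by (auto simp: F'_def)
      moreover from this *(3) have "S' \<noteq> T'" by auto
      ultimately show "S \<inter> T = {}" using F unfolding box_family_def disjoint_def by blast
    qed
  qed
  have c: "card ((\<lambda>S. S \<inter> H) ` F) \<le> card F" by (rule card_image_le[OF fin])
  show "card F' \<le> card F"
    using card_mono[of "(\<lambda>S. S \<inter> H) ` F" F'] fin c by (auto simp: F'_def)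
  show "card F' < card F" if "S \<in> F" "S \<inter> H = {}"
  proof -
    have "F' \<subset> (\<lambda>S. S \<inter> H) ` F" 
    proof
      show "F' \<subseteq> (\<lambda>S. S \<inter> H) ` F" by (auto simp: F'_def)
      have "{} \<in> (\<lambda>S. S \<inter> H) ` F" using that by (metis imageI)
      moreover have "{} \<notin> F'" by (simp add: F'_def)
      ultimately show "F' \<noteq> (\<lambda>S. S \<inter> H) ` F" by metis
    qed
    then have "card F' < card ((\<lambda>S. S \<inter> H) ` F)" using fin by (intro psubset_card_mono) auto
    with c show ?thesis by simp
  qed
qed

text \<open>Two disjoint nonempty boxes have disjoint projections to some axis, so a coordinate
  hyperplane has one of them on each side.\<close>

lemma box_family_separate:
  assumes F: "box_family F" and two: "card F \<ge> 2"
  obtains i c S T where "i \<in> Basis" "S \<in> F" "T \<in> F" "S \<inter> {x. c < x \<bullet> i} = {}" "T \<inter> {x. x \<bullet> i < c} = {}"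
    "S \<inter> {x. x \<bullet> i < c} = S" "T \<inter> {x. c < x \<bullet> i} = T"
proof -
  have "\<not> is_singleton F" using two by (simp add: is_singleton_altdef)
  moreover have "F \<noteq> {}" using F by (simp add: box_family_def)
  ultimately obtain S T where ST: "S \<in> F" "T \<in> F" "S \<noteq> T"
    by (metis is_singleton_def is_singletonI' )
  then obtain a b c d where box: "S = box a b" "T = box c d" "S \<noteq> {}" "T \<noteq> {}"
    using F unfolding box_family_def by metis
  have "S \<inter> T = {}" using F ST unfolding box_family_def disjoint_def by auto
  then have "box a b \<inter> box c d = {}" using box by simp
  then obtain i where i: "i \<in> Basis" "b \<bullet> i \<le> c \<bullet> i \<or> d \<bullet> i \<le> a \<bullet> i"
    using box(3,4) unfolding disjoint_interval box(1,2) box_ne_empty by force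
  from i(2) show thesis
  proof
    assume "b \<bullet> i \<le> c \<bullet> i"
    then show thesis
      using box i(1) by (intro that[of i S T "b \<bullet> i"] ST) (force simp: mem_box)+
  next
    assume "d \<bullet> i \<le> a \<bullet> i"
    then show thesis
      using box i(1) by (intro that[of i T S "d \<bullet> i"] ST) (force simp: mem_box)+
  qed
qed

text \<open>The cut-off volume is Lipschitz in the position of the hyperplane, since a slab of a
  bounding box has volume at most its width times the product of the other edges; the intermediate
  value theorem applies.\<close>

lemma bounded_slab_measure_ivt:
  fixes A :: "'a::euclidean_space set"
  assumes A: "open A" "bounded A" and i: "i \<in> Basis" and s: "0 < s" "s < measure lborel A"
  obtains d where "measure lborel (A \<inter> {x. x \<bullet> i < d}) = s"
proof -
  obtain m where m: "A \<subseteq> cbox (-m) m" using bounded_subset_cbox_symmetric[OF A(2)] by auto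
  let ?\<phi> = "\<lambda>d. measure lborel (A \<inter> {x. x \<bullet> i < d})"
  let ?C = "\<Prod>j\<in>Basis - {i}. \<bar>2 * (m \<bullet> j)\<bar>"
  have meas: "A \<inter> {x. x \<bullet> i < d} \<in> fmeasurable lborel" for d
    by (intro fmeasurable_lborel_open_bounded)
      (use A in \<open>auto intro!: open_Int open_halfspace_component_lt\<close>)
  have measB: "A \<inter> {x. x \<bullet> i < d} \<in> sets borel" for d
    using fmeasurableD[OF meas] by simp
  have Lip: "?\<phi> d' - ?\<phi> d \<le> (d' - d) * ?C \<and> ?\<phi> d \<le> ?\<phi> d'" if "d \<le> d'" for d d'
  proof -
    let ?p = "\<Sum>j\<in>Basis. (if j = i then d else - (m \<bullet> j)) *\<^sub>R j"
    let ?q = "\<Sum>j\<in>Basis. (if j = i then d' else m \<bullet> j) *\<^sub>R j"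
    have sub: "A \<inter> {x. x \<bullet> i < d'} \<subseteq> (A \<inter> {x. x \<bullet> i < d}) \<union> cbox ?p ?q"
    proof
      fix x assume x: "x \<in> A \<inter> {x. x \<bullet> i < d'}"
      then have "x \<in> cbox (- m) m" using m by auto
      then have "x \<in> cbox ?p ?q" if "\<not> x \<bullet> i < d" using x that by (auto simp: mem_box)
      then show "x \<in> (A \<inter> {x. x \<bullet> i < d}) \<union> cbox ?p ?q" using x by blast
    qed
    have "?\<phi> d' \<le> measure lborel ((A \<inter> {x. x \<bullet> i < d}) \<union> cbox ?p ?q)"
      by (rule measure_mono_fmeasurable[OF sub]) (use meas measB in \<open>auto intro!: fmeasurable.Un fmeasurable_cbox\<close>)
    also have "\<dots> \<le> ?\<phi> d + measure lborel (cbox ?p ?q)"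
      by (rule measure_Un_le) (use meas measB in auto)
    also have "measure lborel (cbox ?p ?q) \<le> (\<Prod>j\<in>Basis. if j = i then d' - d else \<bar>2 * (m \<bullet> j)\<bar>)"
    proof (cases "\<forall>b\<in>Basis. ?p \<bullet> b \<le> ?q \<bullet> b")
      case True
      then have "measure lborel (cbox ?p ?q) = (\<Prod>b\<in>Basis. (?q - ?p) \<bullet> b)" by (simp add: measure_lborel_cbox_eq)
      also have "\<dots> \<le> (\<Prod>j\<in>Basis. if j = i then d' - d else \<bar>2 * (m \<bullet> j)\<bar>)"
        using True by (intro prod_mono) (auto simp: inner_diff_left)
      finally show ?thesis .
    next
      case False
      have "measure lborel (cbox ?p ?q) = 0" unfolding measure_lborel_cbox_eq by (rule if_not_P[OF False])
      then show ?thesis using that by (auto intro!: prod_nonneg)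
    qed
    also have "(\<Prod>j\<in>Basis. if j = i then d' - d else \<bar>2 * (m \<bullet> j)\<bar>) = (d' - d) * ?C"
      using i by (subst prod.remove[of _ i]) (auto intro!: prod.cong)
    finally have 1: "?\<phi> d' - ?\<phi> d \<le> (d' - d) * ?C" by simp
    have "?\<phi> d \<le> ?\<phi> d'" by (rule measure_mono_fmeasurable) (use that meas measB in auto)
    with 1 show ?thesis by simp
  qed
  have C: "?C \<ge> 0" by (intro prod_nonneg) auto
  have "?C-lipschitz_on UNIV ?\<phi>"
  proof (rule lipschitz_onI[OF _ C])
    fix d d' :: real
    have "\<bar>?\<phi> d - ?\<phi> d'\<bar> \<le> ?C * \<bar>d - d'\<bar>" 
      using Lip[of d d'] Lip[of d' d] by (cases "d \<le> d'") (auto simp: mult.commute)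
    then show "dist (?\<phi> d) (?\<phi> d') \<le> ?C * dist d d'" by (simp add: dist_real_def)
  qed
  then have cont: "continuous_on UNIV ?\<phi>" by (rule lipschitz_on_continuous_on)
  define M where "M = \<bar>m \<bullet> i\<bar> + 1"
  have e: "A \<inter> {x. x \<bullet> i < - M} = {}" "A \<inter> {x. x \<bullet> i < M} = A"
    using m i by (fastforce simp: mem_box M_def)+
  have lo: "?\<phi> (- M) = 0" unfolding e by simp
  have hi: "?\<phi> M = measure lborel A" unfolding e ..
  have MM: "- M \<le> M" by (simp add: M_def)
  have "\<exists>d\<ge>- M. d \<le> M \<and> ?\<phi> d = s"
    by (rule IVT'[OF _ _ MM]) (use lo hi s continuous_on_subset[OF cont] in auto)
  then show thesis using that by blast
qed

lemma measure_halfspace_split: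
  fixes A :: "'a::euclidean_space set"
  assumes A: "open A" "bounded A" and i: "i \<in> Basis"
  shows "measure lborel A = measure lborel (A \<inter> {x. x \<bullet> i < d}) + measure lborel (A \<inter> {x. d < x \<bullet> i})"
proof -
  let ?N = "{x. i \<bullet> x = d}"
  have "i \<noteq> 0" using i nonzero_Basis by blast
  then have N: "?N \<in> null_sets lborel"
    using negligible_hyperplane[of i d] by (simp add: negligible_iff_null_sets null_sets_completion_iff)
  have m: "A \<inter> {x. x \<bullet> i < d} \<in> fmeasurable lborel" "A \<inter> {x. d < x \<bullet> i} \<in> fmeasurable lborel"
    by (intro fmeasurable_lborel_open_bounded;
      use A in \<open>auto intro!: open_Int open_halfspace_component_lt open_halfspace_component_gt\<close>)+
  have "measure lborel A = measure lborel (A - ?N)"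
    using N A by (intro measure_Diff_null_set[symmetric]) auto
  also have "A - ?N = (A \<inter> {x. x \<bullet> i < d}) \<union> (A \<inter> {x. d < x \<bullet> i})"
    by (auto simp: inner_commute)
  also have "measure lborel \<dots> = measure lborel (A \<inter> {x. x \<bullet> i < d}) + measure lborel (A \<inter> {x. d < x \<bullet> i})"
    by (rule measure_Union) (use m in \<open>auto simp: fmeasurable_def\<close>)
  finally show ?thesis .
qed

text \<open>Each point of the sum box splits coordinatewise in the ratio of the edge lengths, so the
  sum box lies in C. Here and below the sum set enters only through a measurable superset C, so its
  own measurability never comes up.\<close>

lemma brunn_minkowski_single_box:
  fixes C :: "'a::euclidean_space set"
  assumes F: "box_family F" "card F = 1" and G: "box_family G" "card G = 1"
    and C: "C \<in> fmeasurable lborel" "\<And>x y. x \<in> \<Union>F \<Longrightarrow> y \<in> \<Union>G \<Longrightarrow> x + y \<in> C"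
  shows "(measure lborel (\<Union>F) powr (1 / DIM('a)) + measure lborel (\<Union>G) powr (1 / DIM('a))) powr DIM('a)
    \<le> measure lborel C"
proof -
  obtain S T where ST: "F = {S}" "G = {T}" using F(2) G(2) by (auto simp: card_1_singleton_iff)
  then obtain a b c d where box: "S = box a b" "T = box c d" "box a b \<noteq> {}" "box c d \<noteq> {}"
    using F(1) G(1) unfolding box_family_def by auto
  have ab: "a \<bullet> i < b \<bullet> i" "c \<bullet> i < d \<bullet> i" if "i \<in> Basis" for i
    using box(3,4) that by (auto simp: box_ne_empty)
  let ?P = "\<Prod>i\<in>Basis. (b - a) \<bullet> i" and ?Q = "\<Prod>i\<in>Basis. (d - c) \<bullet> i"
  have m: "measure lborel (\<Union>F) = ?P" "measure lborel (\<Union>G) = ?Q"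
    unfolding ST box ccpo_Sup_singleton measure_lborel_box_eq
    by (intro if_P ballI less_imp_le ab; assumption)+
  have "box (a + c) (b + d) \<subseteq> C"
  proof
    fix z assume z: "z \<in> box (a + c) (b + d)"
    define x where "x = (\<Sum>i\<in>Basis. (a \<bullet> i + (z \<bullet> i - a \<bullet> i - c \<bullet> i) * ((b \<bullet> i - a \<bullet> i) / (b \<bullet> i - a \<bullet> i + (d \<bullet> i - c \<bullet> i)))) *\<^sub>R i)"
    have *: "a \<bullet> i < x \<bullet> i \<and> x \<bullet> i < b \<bullet> i \<and> c \<bullet> i < (z - x) \<bullet> i \<and> (z - x) \<bullet> i < d \<bullet> i"
      if i: "i \<in> Basis" for i
    proof -
      define p q w where "p = b \<bullet> i - a \<bullet> i" and "q = d \<bullet> i - c \<bullet> i" and "w = z \<bullet> i - a \<bullet> i - c \<bullet> i"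
      have pq: "p > 0" "q > 0" using ab[OF i] by (auto simp: p_def q_def)
      have w: "0 < w" "w < p + q" using z i by (auto simp: w_def p_def q_def mem_box inner_add_left)
      have xi: "x \<bullet> i = a \<bullet> i + w * (p / (p + q))" using i by (simp add: x_def p_def q_def w_def)
      have 1: "0 < w * (p / (p + q))" "0 < w * (q / (p + q))" using w pq by simp_all
      have 2: "w * (p / (p + q)) < p" "w * (q / (p + q)) < q"
        using w pq by (simp_all add: divide_simps mult.commute)
      have 3: "w * (p / (p + q)) + w * (q / (p + q)) = w"
        using pq by (simp add: add_divide_distrib[symmetric] distrib_left[symmetric])
      have "(z - x) \<bullet> i = c \<bullet> i + w * (q / (p + q))"
        using xi 3 by (simp add: inner_diff_left w_def)
      with xi 1 2 show ?thesis by (simp add: p_def q_def)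
    qed
    have "x \<in> \<Union>F" "z - x \<in> \<Union>G" using * unfolding ST box by (auto simp: mem_box)
    from C(2)[OF this] show "z \<in> C" by simp
  qed
  then have "measure lborel (box (a + c) (b + d)) \<le> measure lborel C"
    by (intro measure_mono_fmeasurable C(1)) auto
  also have "measure lborel (box (a + c) (b + d)) = (\<Prod>i\<in>Basis. (b - a) \<bullet> i + (d - c) \<bullet> i)"
    unfolding measure_lborel_box_eq
    by (subst if_P) (auto simp: inner_simps algebra_simps
        intro!: add_mono less_imp_le[OF ab(1)] less_imp_le[OF ab(2)] prod.cong)
  finally have le: "(\<Prod>i\<in>Basis. (b - a) \<bullet> i + (d - c) \<bullet> i) \<le> measure lborel C" .
  have pos: "(\<Prod>i\<in>Basis. (b - a) \<bullet> i + (d - c) \<bullet> i) > 0"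
    using ab by (intro prod_pos) (auto simp: inner_diff_left intro: add_pos_pos)
  have "?P powr (1 / DIM('a)) + ?Q powr (1 / DIM('a)) \<le> (\<Prod>i\<in>Basis. (b - a) \<bullet> i + (d - c) \<bullet> i) powr (1 / DIM('a))"
    by (rule prod_sum_powr_superadditive) (use ab in \<open>auto simp: inner_diff_left\<close>)
  then have "(?P powr (1 / DIM('a)) + ?Q powr (1 / DIM('a))) powr DIM('a) \<le>
      ((\<Prod>i\<in>Basis. (b - a) \<bullet> i + (d - c) \<bullet> i) powr (1 / DIM('a))) powr DIM('a)"
    by (intro powr_mono2) auto
  also have "\<dots> = (\<Prod>i\<in>Basis. (b - a) \<bullet> i + (d - c) \<bullet> i)"
    using pos by (simp add: powr_powr)
  finally show ?thesis using le m by simp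
qed

text \<open>Hadwiger and Ohmann's induction on the total number of boxes. A coordinate hyperplane
  separates two boxes of F; a parallel one cuts G in the same proportion l. The sums of
  corresponding halves lie in disjoint half-spaces, and by homogeneity their lower bounds are l and
  1 - l times the full one.\<close>

lemma brunn_minkowski_boxes:
  fixes C :: "'a::euclidean_space set"
  assumes "box_family F" "box_family G" "C \<in> fmeasurable lborel"
    "\<And>x y. x \<in> \<Union>F \<Longrightarrow> y \<in> \<Union>G \<Longrightarrow> x + y \<in> C"
  shows "(measure lborel (\<Union>F) powr (1 / DIM('a)) + measure lborel (\<Union>G) powr (1 / DIM('a))) powr DIM('a)
    \<le> measure lborel C"
  using assms
proof (induction "card F + card G" arbitrary: F G C rule: less_induct)
  case less
  let ?m = "measure lborel" and ?r = "1 / real DIM('a)"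
  \<comment> \<open>The induction hypothesis is a premise of \<open>step\<close>, which can
    therefore also be applied with F and G interchanged when G is the family with two boxes.\<close>
  have step: "(?m (\<Union>F) powr ?r + ?m (\<Union>G) powr ?r) powr DIM('a) \<le> ?m C"
    if IH: "\<And>F' G' (C::'a set). card F' + card G' < card F + card G \<Longrightarrow> box_family F' \<Longrightarrow> box_family G' \<Longrightarrow>
        C \<in> fmeasurable lborel \<Longrightarrow> (\<And>x y. x \<in> \<Union>F' \<Longrightarrow> y \<in> \<Union>G' \<Longrightarrow> x + y \<in> C) \<Longrightarrow>
        (?m (\<Union>F') powr ?r + ?m (\<Union>G') powr ?r) powr DIM('a) \<le> ?m C"
    and F: "box_family F" and G: "box_family G" and C: "C \<in> fmeasurable lborel"
    and sum: "\<And>x y. x \<in> \<Union>F \<Longrightarrow> y \<in> \<Union>G \<Longrightarrow> x + y \<in> C"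
    and two: "card F \<ge> 2" for F G :: "'a set set" and C :: "'a set"
  proof -
    obtain i c S T where sep: "i \<in> Basis" "S \<in> F" "T \<in> F" "S \<inter> {x. c < x \<bullet> i} = {}" "T \<inter> {x. x \<bullet> i < c} = {}"
      "S \<inter> {x. x \<bullet> i < c} = S" "T \<inter> {x. c < x \<bullet> i} = T"
      by (rule box_family_separate[OF F two])
    have ne: "S \<noteq> {}" "T \<noteq> {}" using F sep(2,3) by (auto simp: box_family_def)
    note UF = box_family_Union[OF F] and UG = box_family_Union[OF G]
    let ?lo = "\<lambda>c. {x::'a. x \<bullet> i < c}" and ?hi = "\<lambda>c. {x::'a. c < x \<bullet> i}"
    have H: "halfspace_cut i (?lo c)" "halfspace_cut i (?hi c)" for c by (auto simp: halfspace_cut_def)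
    have neF: "\<Union>F \<inter> ?lo c \<noteq> {}" "\<Union>F \<inter> ?hi c \<noteq> {}" using sep ne by blast+
    define F1 where "F1 = (\<lambda>S. S \<inter> ?lo c) ` F - {{}}"
    define F2 where "F2 = (\<lambda>S. S \<inter> ?hi c) ` F - {{}}"
    note F1 = box_family_cut[OF F sep(1) H(1) neF(1), folded F1_def]
    note F2 = box_family_cut[OF F sep(1) H(2) neF(2), folded F2_def]
    define l where "l = ?m (\<Union>F1) / ?m (\<Union>F)"
    have splitF: "?m (\<Union>F) = ?m (\<Union>F1) + ?m (\<Union>F2)"
      unfolding F1(2) F2(2) by (rule measure_halfspace_split[OF UF(1,2) sep(1)])
    have pF: "?m (\<Union>F1) > 0" "?m (\<Union>F2) > 0" using box_family_Union(4) F1(1) F2(1) by auto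
    have l: "0 < l" "l < 1" using pF splitF UF(4) by (auto simp: l_def)
    have mF: "?m (\<Union>F1) = l * ?m (\<Union>F)" "?m (\<Union>F2) = (1 - l) * ?m (\<Union>F)"
      using splitF UF(4) by (auto simp: l_def field_simps)
    obtain d where d: "?m (\<Union>G \<inter> ?lo d) = l * ?m (\<Union>G)"
      by (rule bounded_slab_measure_ivt[OF UG(1,2) sep(1), of "l * ?m (\<Union>G)"]) (use l UG(4) in auto)
    have mG2: "?m (\<Union>G \<inter> ?hi d) = (1 - l) * ?m (\<Union>G)"
      using measure_halfspace_split[OF UG(1,2) sep(1), of d] d by (simp add: algebra_simps)
    have "?m (\<Union>G \<inter> ?lo d) > 0" "?m (\<Union>G \<inter> ?hi d) > 0" using d mG2 l UG(4) by simp_all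
    then have neG: "\<Union>G \<inter> ?lo d \<noteq> {}" "\<Union>G \<inter> ?hi d \<noteq> {}" by (metis less_irrefl measure_empty)+
    define G1 where "G1 = (\<lambda>S. S \<inter> ?lo d) ` G - {{}}"
    define G2 where "G2 = (\<lambda>S. S \<inter> ?hi d) ` G - {{}}"
    note G1 = box_family_cut[OF G sep(1) H(1) neG(1), folded G1_def]
    note G2 = box_family_cut[OF G sep(1) H(2) neG(2), folded G2_def]
    have mG: "?m (\<Union>G1) = l * ?m (\<Union>G)" "?m (\<Union>G2) = (1 - l) * ?m (\<Union>G)"
      unfolding G1(2) G2(2) using d mG2 by auto
    have cm: "C \<inter> ?lo (c + d) \<in> fmeasurable lborel" "C \<inter> ?hi (c + d) \<in> fmeasurable lborel"
      using C by (auto intro!: fmeasurable_Int_fmeasurable)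
    have s: "l * (?m (\<Union>F) powr ?r + ?m (\<Union>G) powr ?r) powr DIM('a) = 
       ((l * ?m (\<Union>F)) powr ?r + (l * ?m (\<Union>G)) powr ?r) powr DIM('a)" if "l > 0" for l
    proof -
      have "(l * ?m (\<Union>F)) powr ?r + (l * ?m (\<Union>G)) powr ?r = l powr ?r * (?m (\<Union>F) powr ?r + ?m (\<Union>G) powr ?r)"
        using that by (simp add: powr_mult distrib_left)
      also have "\<dots> powr DIM('a) = (l powr ?r) powr DIM('a) * (?m (\<Union>F) powr ?r + ?m (\<Union>G) powr ?r) powr DIM('a)"
        by (rule powr_mult)
      also have "(l powr ?r) powr DIM('a) = l" using that by (simp add: powr_powr)
      finally show ?thesis by simp
    qed
    have 1: "((l * ?m (\<Union>F)) powr ?r + (l * ?m (\<Union>G)) powr ?r) powr DIM('a) \<le> ?m (C \<inter> ?lo (c + d))"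
      unfolding mF(1)[symmetric] mG(1)[symmetric]
    proof (rule IH[OF _ F1(1) G1(1) cm(1)])
      show "card F1 + card G1 < card F + card G" using F1(4)[OF sep(3,5)] G1(3) by simp
      show "x + y \<in> C \<inter> ?lo (c + d)" if "x \<in> \<Union>F1" "y \<in> \<Union>G1" for x y
        using that sum[of x y] unfolding F1(2) G1(2) by (auto simp: inner_add_left)
    qed
    have 2: "(((1 - l) * ?m (\<Union>F)) powr ?r + ((1 - l) * ?m (\<Union>G)) powr ?r) powr DIM('a) \<le> ?m (C \<inter> ?hi (c + d))"
      unfolding mF(2)[symmetric] mG(2)[symmetric]
    proof (rule IH[OF _ F2(1) G2(1) cm(2)])
      show "card F2 + card G2 < card F + card G" using F2(4)[OF sep(2,4)] G2(3) by simp
      show "x + y \<in> C \<inter> ?hi (c + d)" if "x \<in> \<Union>F2" "y \<in> \<Union>G2" for x y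
        using that sum[of x y] unfolding F2(2) G2(2) by (auto simp: inner_add_left)
    qed
    have "(?m (\<Union>F) powr ?r + ?m (\<Union>G) powr ?r) powr DIM('a) = 
        l * (?m (\<Union>F) powr ?r + ?m (\<Union>G) powr ?r) powr DIM('a) +
        (1 - l) * (?m (\<Union>F) powr ?r + ?m (\<Union>G) powr ?r) powr DIM('a)"
      by (simp add: algebra_simps)
    also have "\<dots> \<le> ?m (C \<inter> ?lo (c + d)) + ?m (C \<inter> ?hi (c + d))"
      using 1 2 s[of l] s[of "1 - l"] l by linarith
    also have "\<dots> = ?m ((C \<inter> ?lo (c + d)) \<union> (C \<inter> ?hi (c + d)))"
      by (rule measure_Union[symmetric]) (use cm in \<open>auto simp: fmeasurable_def\<close>)
    also have "\<dots> \<le> ?m C"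
      by (rule measure_mono_fmeasurable) (use cm C in auto)
    finally show ?thesis .
  qed
  have pos: "card F > 0" "card G > 0" using less.prems(1,2) by (auto simp: box_family_def card_gt_0_iff)
  consider "card F \<ge> 2" | "card G \<ge> 2" | "card F = 1" "card G = 1" using pos by linarith
  then show ?case
  proof cases
    case 1
    show ?thesis
      by (rule step[OF less.hyps less.prems 1])
  next
    case 2
    have "(?m (\<Union>G) powr ?r + ?m (\<Union>F) powr ?r) powr DIM('a) \<le> ?m C"
    proof (rule step[OF less.hyps less.prems(2,1,3) _ 2])
      show "x + y \<in> C" if "x \<in> \<Union>G" "y \<in> \<Union>F" for x y
        using less.prems(4)[OF that(2,1)] by (simp add: add.commute)
    qed (simp_all add: add.commute)
    then show ?thesis by (simp add: add.commute)
  next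
    case 3
    then show ?thesis using brunn_minkowski_single_box less.prems by blast
  qed
qed

text \<open>An open set is a countable union of closed boxes, so finitely many of them carry almost
  all of its volume; a division of that finite union loses only faces when its cells are replaced by
  their interiors.\<close>

lemma inner_box_family:
  fixes A :: "'a::euclidean_space set"
  assumes A: "open A" "bounded A" "A \<noteq> {}" and e: "e > 0"
  shows "\<exists>F. box_family F \<and> \<Union>F \<subseteq> A \<and> measure lborel A - e < measure lborel (\<Union>F)"
proof -
  let ?m = "measure lborel"
  have Af: "A \<in> fmeasurable lborel" using A by (intro fmeasurable_lborel_open_bounded)
  obtain D where D: "countable D" "D \<subseteq> Pow A" "\<And>X. X \<in> D \<Longrightarrow> \<exists>a b. X = cbox a b" "\<Union>D = A"
    using open_countable_Union_open_cbox[OF A(1)] by metis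
  have Dne: "D \<noteq> {}" using D(4) A(3) by auto
  define B where "B n = (\<Union>k\<le>n. from_nat_into D k)" for n :: nat
  have nD: "from_nat_into D k \<in> D" for k by (rule from_nat_into[OF Dne])
  have UB: "(\<Union>n. B n) = A"
  proof -
    have "(\<Union>n. B n) = \<Union>(range (from_nat_into D))" by (auto simp: B_def)
    then show ?thesis using D(4) range_from_nat_into[OF Dne D(1)] by simp
  qed
  have Bm: "B n \<in> sets lborel" for n
    unfolding B_def using D(3)[OF nD] by (intro sets.finite_UN) (auto, metis borel_closed closed_cbox)
  have "(\<lambda>n. emeasure lborel (B n)) \<longlonglongrightarrow> emeasure lborel (\<Union>n. B n)"
    by (rule Lim_emeasure_incseq) (use Bm in \<open>auto simp: incseq_def B_def intro: order_trans\<close>)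
  moreover have "emeasure lborel (B n) = ennreal (?m (B n))" for n
    using Af Bm by (intro emeasure_eq_measure2 fmeasurableI2[OF Af]) (auto simp: UB[symmetric])
  moreover have "emeasure lborel A = ennreal (?m A)" using Af by (rule emeasure_eq_measure2)
  ultimately have "(\<lambda>n. ?m (B n)) \<longlonglongrightarrow> ?m A" by (simp add: UB)
  moreover have mA: "?m A > 0"
  proof -
    have "\<not> negligible A" using open_not_negligible[OF A(1,3)] .
    then have "measure lebesgue A \<noteq> 0"
      using A by (simp add: negligible_iff_measure bounded_set_imp_lmeasurable)
    then have "?m A \<noteq> 0" using A(1) by (simp add: measure_completion)
    then show ?thesis using measure_nonneg[of lborel A] by linarith
  qed
  \<comment> \<open>The maximum with 0 keeps the measure of the finite union positive, hence the
    family of boxes nonempty.\<close>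
  moreover have "max 0 (?m A - e) < ?m A" using e mA by simp
  ultimately have "eventually (\<lambda>n. max 0 (?m A - e) < ?m (B n)) sequentially"
    by (metis order_tendstoD(1))
  then obtain n where n: "?m (B n) > 0" "?m A - e < ?m (B n)"
    unfolding eventually_sequentially by force
  have "finite (from_nat_into D ` {..n})" by simp
  then obtain p where p: "p division_of (B n)"
    using elementary_unions_intervals[of "from_nat_into D ` {..n}"] D(3) nD unfolding B_def by blast
  define F where "F = interior ` p - {{}}"
  have finp: "finite p" using p by (rule division_of_finite)
  have pb: "\<exists>a b. K = cbox a b" if "K \<in> p" for K using p that by blast
  have "B n - \<Union>F \<subseteq> (\<Union>K\<in>p. frontier K)"
  proof
    fix x assume x: "x \<in> B n - \<Union>F"
    then obtain K where K: "K \<in> p" "x \<in> K" using division_ofD(6)[OF p] by auto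
    moreover have "x \<notin> interior K" using x K by (auto simp: F_def)
    ultimately show "x \<in> (\<Union>K\<in>p. frontier K)" using closure_subset by (fastforce simp: frontier_def)
  qed
  moreover have "negligible (\<Union>K\<in>p. frontier K)"
    using finp by (intro negligible_Union) (auto dest!: pb intro!: negligible_convex_frontier)
  ultimately have neg: "negligible (B n - \<Union>F)" using negligible_subset by blast
  have FB: "\<Union>F \<subseteq> B n"
    using division_ofD(6)[OF p] interior_subset by (fastforce simp: F_def)
  have BA: "B n \<subseteq> A" using UB by auto
  have oF: "open (\<Union>F)" by (auto simp: F_def intro!: open_Union)
  have null: "B n - \<Union>F \<in> null_sets lborel"
    using neg Bm[of n] oF by (simp add: negligible_iff_null_sets null_sets_completion_iff)
  have "?m (B n) = ?m (\<Union>F \<union> (B n - \<Union>F))" using FB by (simp add: Un_absorb1)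
  also have "\<dots> = ?m (\<Union>F)" by (rule measure_Un_null_set) (use oF null in auto)
  finally have mF: "?m (B n) = ?m (\<Union>F)" .
  have "box_family F"
    unfolding box_family_def
  proof (intro conjI ballI)
    show "finite F" using finp by (simp add: F_def)
    show "F \<noteq> {}" using n(1) mF by auto
    show "S \<noteq> {}" if "S \<in> F" for S using that by (auto simp: F_def)
    show "\<exists>a b. S = box a b" if S: "S \<in> F" for S
    proof -
      obtain K where "K \<in> p" "S = interior K" using S by (auto simp: F_def)
      then show ?thesis using pb[of K] by (metis interior_cbox)
    qed
    show "disjoint F"
    proof (rule disjointI)
      fix S T assume *: "S \<in> F" "T \<in> F" "S \<noteq> T"
      then obtain K1 K2 where "K1 \<in> p" "K2 \<in> p" "S = interior K1" "T = interior K2" by (auto simp: F_def)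
      then show "S \<inter> T = {}" using division_ofD(5)[OF p, of K1 K2] *(3) by auto
    qed
  qed
  then show ?thesis using FB BA n(2) mF by (intro exI[of _ F]) auto
qed

lemma brunn_minkowski_open:
  fixes A B C :: "'a::euclidean_space set"
  assumes A: "open A" "bounded A" "A \<noteq> {}" and B: "open B" "bounded B" "B \<noteq> {}"
    and C: "C \<in> fmeasurable lborel" "\<And>x y. x \<in> A \<Longrightarrow> y \<in> B \<Longrightarrow> x + y \<in> C"
  shows "(measure lborel A powr (1 / DIM('a)) + measure lborel B powr (1 / DIM('a))) powr DIM('a)
    \<le> measure lborel C"
proof -
  let ?m = "measure lborel" and ?r = "1 / real DIM('a)"
  have fm: "A \<in> fmeasurable lborel" "B \<in> fmeasurable lborel"
    using A B fmeasurable_lborel_open_bounded by auto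
  have "\<exists>F. box_family F \<and> \<Union>F \<subseteq> A \<and> ?m A - inverse (Suc n) < ?m (\<Union>F)" for n :: nat
    by (rule inner_box_family[OF A]) simp
  then obtain F where F: "\<And>n. box_family (F n)" "\<And>n. \<Union>(F n) \<subseteq> A" "\<And>n. ?m A - inverse (Suc n) < ?m (\<Union>(F n))"
    by metis
  have "\<exists>F. box_family F \<and> \<Union>F \<subseteq> B \<and> ?m B - inverse (Suc n) < ?m (\<Union>F)" for n :: nat
    by (rule inner_box_family[OF B]) simp
  then obtain G where G: "\<And>n. box_family (G n)" "\<And>n. \<Union>(G n) \<subseteq> B" "\<And>n. ?m B - inverse (Suc n) < ?m (\<Union>(G n))"
    by metis
  have lim: "(\<lambda>n. ?m (\<Union>(H n))) \<longlonglongrightarrow> ?m S"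
    if "\<And>n. box_family (H n)" "\<And>n. \<Union>(H n) \<subseteq> S" "\<And>n. ?m S - inverse (Suc n) < ?m (\<Union>(H n))" "S \<in> fmeasurable lborel" for H S
  proof (rule tendsto_sandwich[of "\<lambda>n. ?m S - inverse (Suc n)" _ _ "\<lambda>n. ?m S"])
    show "(\<lambda>n. ?m S - inverse (real (Suc n))) \<longlonglongrightarrow> ?m S"
      using tendsto_diff[OF tendsto_const LIMSEQ_inverse_real_of_nat] by simp
    have "?m (\<Union>(H n)) \<le> ?m S" for n
      by (rule measure_mono_fmeasurable) (use that box_family_Union(5)[OF that(1)[of n]] in \<open>auto simp: fmeasurable_def\<close>)
    then show "\<forall>\<^sub>F n in sequentially. ?m (\<Union>(H n)) \<le> ?m S" by simp
  qed (use that(3) in \<open>auto simp: less_imp_le intro!: tendsto_const\<close>)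
  have "(\<lambda>n. (?m (\<Union>(F n)) powr ?r + ?m (\<Union>(G n)) powr ?r) powr DIM('a)) \<longlonglongrightarrow> (?m A powr ?r + ?m B powr ?r) powr DIM('a)"
    by (intro tendsto_powr' tendsto_add lim tendsto_const F G fm) auto
  moreover have "(?m (\<Union>(F n)) powr ?r + ?m (\<Union>(G n)) powr ?r) powr DIM('a) \<le> ?m C" for n
    by (rule brunn_minkowski_boxes[OF F(1) G(1) C(1)]) (use F(2) G(2) C(2) in blast)
  ultimately show ?thesis by (intro LIMSEQ_le_const2) auto
qed

lemma measure_interior_convex:
  fixes A :: "'a::euclidean_space set"
  assumes "compact A" "convex A"
  shows "measure lborel (interior A) = measure lborel A"
proof -
  have "negligible (A - interior A)"
    by (rule negligible_subset[OF negligible_convex_frontier[OF assms(2)]])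
      (use closure_subset in \<open>auto simp: frontier_def\<close>)
  then have "A - interior A \<in> null_sets lborel"
    using assms(1) borel_compact[OF assms(1)] borel_open[OF open_interior[of A]]
    by (simp add: negligible_iff_null_sets null_sets_completion_iff sets.Diff)
  then have "measure lborel (interior A \<union> (A - interior A)) = measure lborel (interior A)"
    by (intro measure_Un_null_set) auto
  moreover have "interior A \<union> (A - interior A) = A" using interior_subset by blast
  ultimately show ?thesis by simp
qed

theorem brunn_minkowski_convex:
  fixes A B C :: "'a::euclidean_space set"
  assumes A: "compact A" "convex A" "interior A \<noteq> {}" and B: "compact B" "convex B" "interior B \<noteq> {}"
    and C: "C \<in> fmeasurable lborel" "\<And>x y. x \<in> A \<Longrightarrow> y \<in> B \<Longrightarrow> x + y \<in> C"
  shows "(measure lborel A powr (1 / DIM('a)) + measure lborel B powr (1 / DIM('a))) powr DIM('a)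
    \<le> measure lborel C"
proof -
  have "bounded (interior A)" "bounded (interior B)"
    using A(1) B(1) compact_imp_bounded bounded_subset interior_subset by metis+
  moreover have "x + y \<in> C" if "x \<in> interior A" "y \<in> interior B" for x y
    using C(2) that interior_subset by blast
  ultimately show ?thesis
    using brunn_minkowski_open[OF open_interior _ A(3) open_interior _ B(3) C(1)] A B
    by (simp add: measure_interior_convex)
qed

text \<open>Points of Minkowski space are nested pairs; quantifiers over them are kept whole from
  here on.\<close>

declare split_paired_All [simp del] split_paired_Ex [simp del]

section \<open>Domains with a given horospherical support function\<close>

lemma mink_add_left: "mink (X + Y) Z = mink X Z + mink Y Z"
  and mink_add_right: "mink Z (X + Y) = mink Z X + mink Z Y"
  and mink_diff_left: "mink (X - Y) Z = mink X Z - mink Y Z"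
  and mink_diff_right: "mink Z (X - Y) = mink Z X - mink Z Y"
  and mink_scale_left: "mink (c *\<^sub>R X) Z = c * mink X Z"
  and mink_scale_right: "mink Z (c *\<^sub>R X) = c * mink Z X"
  and mink_minus_left: "mink (- X) Z = - mink X Z"
  and mink_minus_right: "mink Z (- X) = - mink Z X"
  and mink_zero_left: "mink 0 Z = 0"
  and mink_zero_right: "mink Z 0 = 0"
  by (simp_all add: mink_def algebra_simps inner_simps)

lemmas mink_simps = mink_add_left mink_add_right mink_diff_left mink_diff_right mink_scale_left
  mink_scale_right mink_minus_left mink_minus_right mink_zero_left mink_zero_right

lemma mink_commute: "mink X Y = mink Y X"
  by (simp add: mink_def inner_commute mult.commute)

lemma continuous_on_mink [continuous_intros]:
  "continuous_on S f \<Longrightarrow> continuous_on S g \<Longrightarrow> continuous_on S (\<lambda>x. mink (f x) (g x))"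
  unfolding mink_def by (intro continuous_intros)

lemma tendsto_mink [tendsto_intros]:
  "(f \<longlongrightarrow> a) F \<Longrightarrow> (g \<longlongrightarrow> b) F \<Longrightarrow> ((\<lambda>x. mink (f x) (g x)) \<longlongrightarrow> mink a b) F"
  unfolding mink_def by (intro tendsto_intros)

lemma hyp_norm: "X \<in> hyp \<Longrightarrow> (norm (fst X))^2 = (snd X)^2 - 1"
  by (simp add: hyp_def mink_def dot_square_norm power2_eq_square)

lemma hyp_norm_less: "X \<in> hyp \<Longrightarrow> norm (fst X) < snd X"
proof -
  assume X: "X \<in> hyp"
  then have "(norm (fst X))^2 < (snd X)^2" "snd X \<ge> 0" by (auto simp: hyp_norm hyp_def)
  then show ?thesis using power2_less_imp_less by blast
qed

lemma hyp_ge1: "X \<in> hyp \<Longrightarrow> snd X \<ge> 1"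
proof -
  assume X: "X \<in> hyp"
  have "1^2 \<le> (snd X)^2" using hyp_norm[OF X] zero_le_power2[of "norm (fst X)"] by simp
  then show ?thesis by (rule power2_le_imp_le) (use X in \<open>simp add: hyp_def\<close>)
qed

lemma hyp_mink_null_pos:
  assumes "X \<in> hyp" "norm z = 1"
  shows "- mink X (z, 1) > 0"
proof -
  have "fst X \<bullet> z \<le> norm (fst X) * norm z" by (rule norm_cauchy_schwarz)
  then show ?thesis using hyp_norm_less[OF assms(1)] assms(2) by (simp add: mink_def)
qed

lemma closed_hyp: "closed (hyp :: 'n::finite minkowski set)"
proof -
  have eq: "hyp = {X::'n minkowski. mink X X = -1} \<inter> {X. 0 \<le> snd X}"
  proof -
    have "snd X \<noteq> 0" if "mink X X = -1" for X :: "'n minkowski"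
    proof
      assume "snd X = 0"
      then have "fst X \<bullet> fst X = -1" using that by (simp add: mink_def)
      moreover have "fst X \<bullet> fst X \<ge> 0" by simp
      ultimately show False by linarith
    qed
    then show ?thesis by (fastforce simp: hyp_def)
  qed
  have "closed {X::'n minkowski. mink X X = -1}"
    by (intro closed_Collect_eq continuous_intros)
  moreover have "closed {X::'n minkowski. 0 \<le> snd X}"
    by (intro closed_Collect_le continuous_intros)
  ultimately show ?thesis unfolding eq by (rule closed_Int)
qed

text \<open>Reverse Cauchy-Schwarz for future unit vectors, from an identity that writes the defect
  as a sum of two squares; the same identity settles equality.\<close>

lemma hyp_mink_le:
  assumes "X \<in> hyp" "Y \<in> hyp"
  shows "mink X Y \<le> -1" "mink X Y = -1 \<Longrightarrow> X = Y"
proof -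
  let ?x = "fst X" and ?y = "fst Y" and ?t = "snd X" and ?s = "snd Y"
  have n: "?x \<bullet> ?x = ?t^2 - 1" "?y \<bullet> ?y = ?s^2 - 1"
    using assms by (auto simp: hyp_def mink_def power2_eq_square)
  have ts: "?t > 0" "?s > 0" using assms by (auto simp: hyp_def)
  have key: "2 * ?t * ?s * (- 1 - mink X Y) = (norm (?s *\<^sub>R ?x - ?t *\<^sub>R ?y))^2 + (?t - ?s)^2"
    unfolding power2_norm_eq_inner
    by (simp add: inner_simps inner_commute[of ?y ?x] n mink_def power2_eq_square algebra_simps)
  then have "2 * ?t * ?s * (- 1 - mink X Y) \<ge> 0" by simp
  moreover have "2 * ?t * ?s * (- 1 - mink X Y) < 0" if "mink X Y > -1"
    using ts that by (intro mult_pos_neg) auto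
  ultimately show "mink X Y \<le> -1" by fastforce
  assume "mink X Y = -1"
  then have "(norm (?s *\<^sub>R ?x - ?t *\<^sub>R ?y))^2 + (?t - ?s)^2 = 0" using key by simp
  then have "?t = ?s" "?s *\<^sub>R ?x = ?t *\<^sub>R ?y" by (simp_all add: add_nonneg_eq_0_iff)
  then show "X = Y" using ts by (simp add: prod_eq_iff)
qed

text \<open>Time coordinate t of the boundary point (x, t) whose ball touches the body with support
  function h in direction z. The ball has support function t |v| - x . v, so tangency reads
  \<open>gr h z = t *\<^sub>R z - x\<close>; together with |x|^2 = t^2 - 1 and Euler's relation this
  forces the formula.\<close>

definition tpt :: "('n::finite euclid1 \<Rightarrow> real) \<Rightarrow> 'n euclid1 \<Rightarrow> real" where
  "tpt h z = (gr h z \<bullet> gr h z + 1) / (2 * h z)"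

definition xpt :: "('n::finite euclid1 \<Rightarrow> real) \<Rightarrow> 'n euclid1 \<Rightarrow> 'n minkowski" where
  "xpt h z = (tpt h z *\<^sub>R z - gr h z, tpt h z)"

definition hdom :: "('n::finite euclid1 \<Rightarrow> real) \<Rightarrow> 'n minkowski set" where
  "hdom h = {X \<in> hyp. \<forall>z. norm z = 1 \<longrightarrow> - mink X (z, 1) \<le> h z}"

text \<open>The analytic form of a uniformly h-convex domain: h is the positively homogeneous
  extension of exp of its horospherical support function. \<open>touch_less\<close> says that each
  contact ball stays in the body and meets its support function in one direction only;
  \<open>strict\<close> compares Hessians on the complement of z, where that of the ball is t times
  the identity, and amounts to principal curvatures above 1.\<close>

locale h_body =
  fixes h :: "'n::finite euclid1 \<Rightarrow> real"
  assumes smooth: "smooth_on (- {0}) h"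
    and homog: "\<And>c v. c > 0 \<Longrightarrow> v \<noteq> 0 \<Longrightarrow> h (c *\<^sub>R v) = c * h v"
    and pos: "\<And>z. norm z = 1 \<Longrightarrow> h z > 0"
    and touch_less: "\<And>z w. norm z = 1 \<Longrightarrow> norm w = 1 \<Longrightarrow> w \<noteq> z \<Longrightarrow> - mink (xpt h z) (w, 1) < h w"
    and strict: "\<And>z e. norm z = 1 \<Longrightarrow> e \<bullet> z = 0 \<Longrightarrow> e \<noteq> 0 \<Longrightarrow> hess h z e \<bullet> e > tpt h z * (e \<bullet> e)"
begin

lemma open_punctured: "open (- {0 :: 'n euclid1})"
  by (simp add: open_Compl)

lemma has_derivative_h: "v \<noteq> 0 \<Longrightarrow> (h has_derivative (\<lambda>w. gr h v \<bullet> w)) (at v)"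
  by (rule smooth_has_derivative_gr[OF smooth]) simp

lemma has_derivative_gr_h: "v \<noteq> 0 \<Longrightarrow> (gr h has_derivative hess h v) (at v)"
  by (rule smooth_has_derivative_hess[OF open_punctured smooth]) simp

lemma linear_hess_h: "v \<noteq> 0 \<Longrightarrow> linear (hess h v)"
  by (rule linear_hess[OF open_punctured smooth]) simp

lemma hess_sym: "v \<noteq> 0 \<Longrightarrow> hess h v a \<bullet> b = a \<bullet> hess h v b"
  using hess_symmetric[OF open_punctured smooth, of v a b] by (simp add: inner_commute)

lemma h_pos: "v \<noteq> 0 \<Longrightarrow> h v > 0"
proof -
  assume v: "v \<noteq> 0"
  have "h v = norm v * h (v /\<^sub>R norm v)" using homog[of "norm v" "v /\<^sub>R norm v"] v by simp
  moreover have "h (v /\<^sub>R norm v) > 0" using v by (intro pos) simp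
  ultimately show ?thesis using v by simp
qed

lemma euler: "v \<noteq> 0 \<Longrightarrow> gr h v \<bullet> v = h v"
proof -
  assume v: "v \<noteq> 0"
  have "((\<lambda>c. h (c *\<^sub>R v)) has_derivative (\<lambda>d. gr h (1 *\<^sub>R v) \<bullet> (d *\<^sub>R v))) (at 1)"
    by (rule has_derivative_compose[OF _ has_derivative_h]) (use v in \<open>auto intro!: derivative_eq_intros\<close>)
  moreover have "((\<lambda>c. h (c *\<^sub>R v)) has_derivative (\<lambda>d. d * h v)) (at 1)"
    by (rule has_derivative_transform_within_open[where f = "\<lambda>c. c * h v", OF _ open_greaterThan[of 0]])
      (use v homog in \<open>auto intro!: derivative_eq_intros\<close>)
  ultimately have "(\<lambda>d. gr h (1 *\<^sub>R v) \<bullet> (d *\<^sub>R v)) = (\<lambda>d. d * h v)" by (rule has_derivative_unique)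
  from fun_cong[OF this, of 1] show ?thesis by simp
qed

lemma gr_homog: "c > 0 \<Longrightarrow> v \<noteq> 0 \<Longrightarrow> gr h (c *\<^sub>R v) = gr h v"
proof -
  assume c: "c > 0" and v: "v \<noteq> 0"
  have "((\<lambda>v. h (c *\<^sub>R v)) has_derivative (\<lambda>w. gr h (c *\<^sub>R v) \<bullet> (c *\<^sub>R w))) (at v)"
    by (rule has_derivative_compose[OF _ has_derivative_h]) (use c v in \<open>auto intro!: derivative_eq_intros\<close>)
  moreover have "((\<lambda>v. h (c *\<^sub>R v)) has_derivative (\<lambda>w. c * (gr h v \<bullet> w))) (at v)"
  proof (rule has_derivative_transform_within_open[OF _ open_punctured])
    show "((\<lambda>v. c * h v) has_derivative (\<lambda>w. c * (gr h v \<bullet> w))) (at v)"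
      by (intro derivative_intros has_derivative_h v)
  qed (use v c homog in auto)
  ultimately have eq: "(\<lambda>w. gr h (c *\<^sub>R v) \<bullet> (c *\<^sub>R w)) = (\<lambda>w. c * (gr h v \<bullet> w))"
    by (rule has_derivative_unique)
  have "gr h (c *\<^sub>R v) \<bullet> w = gr h v \<bullet> w" for w using fun_cong[OF eq, of w] c by simp
  then show ?thesis by (metis vector_eq_rdot)
qed

lemma hess_radial: "v \<noteq> 0 \<Longrightarrow> hess h v v = 0"
proof -
  assume v: "v \<noteq> 0"
  have "((\<lambda>c. gr h (c *\<^sub>R v)) has_derivative (\<lambda>d. hess h (1 *\<^sub>R v) (d *\<^sub>R v))) (at 1)"
    by (rule has_derivative_compose[OF _ has_derivative_gr_h]) (use v in \<open>auto intro!: derivative_eq_intros\<close>)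
  moreover have "((\<lambda>c. gr h (c *\<^sub>R v)) has_derivative (\<lambda>d. 0)) (at 1)"
    by (rule has_derivative_transform_within_open[where f = "\<lambda>c. gr h v", OF _ open_greaterThan[of 0]])
      (use v gr_homog in auto)
  ultimately have "(\<lambda>d. hess h (1 *\<^sub>R v) (d *\<^sub>R v)) = (\<lambda>d. 0)" by (rule has_derivative_unique)
  from fun_cong[OF this, of 1] show ?thesis by simp
qed

lemma hess_perp: "v \<noteq> 0 \<Longrightarrow> hess h v a \<bullet> v = 0"
  by (simp add: hess_sym hess_radial)

context
  fixes z :: "'n euclid1"
  assumes z: "norm z = 1"
begin

lemma z0: "z \<noteq> 0" and zz: "z \<bullet> z = 1"
  using z by (auto simp: dot_square_norm)

lemma tpt_eq: "2 * h z * tpt h z = gr h z \<bullet> gr h z + 1"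
  using pos[OF z] by (simp add: tpt_def)

lemma tpt_pos: "tpt h z > 0"
  using pos[OF z] by (simp add: tpt_def add_nonneg_pos)

lemma fst_xpt: "fst (xpt h z) = tpt h z *\<^sub>R z - gr h z" and snd_xpt: "snd (xpt h z) = tpt h z"
  by (simp_all add: xpt_def)

lemma mink_xpt_null: "mink (xpt h z) (z, 1) = - h z"
  by (simp add: mink_def fst_xpt snd_xpt inner_diff_left zz euler[OF z0])

lemma xpt_hyp: "xpt h z \<in> hyp"
proof -
  have "mink (xpt h z) (xpt h z) = gr h z \<bullet> gr h z - 2 * tpt h z * (gr h z \<bullet> z)"
    by (simp add: mink_def fst_xpt snd_xpt inner_simps zz inner_commute algebra_simps)
  also have "\<dots> = -1" using tpt_eq by (simp add: euler[OF z0] algebra_simps)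
  finally show ?thesis using tpt_pos by (simp add: hyp_def snd_xpt)
qed

lemma touch: "norm w = 1 \<Longrightarrow> - mink (xpt h z) (w, 1) \<le> h w"
  using touch_less[OF z, of w] mink_xpt_null by (cases "w = z") auto

lemma xpt_in_hdom: "xpt h z \<in> hdom h"
  using xpt_hyp touch by (simp add: hdom_def)

text \<open>For X = (x, t) in the domain, h(v) - (t |v| - x . v) is nonnegative and vanishes at z,
  so its gradient vanishes there; this and \<open>mink X X = -1\<close> determine X.\<close>

lemma contact:
  assumes X: "X \<in> hdom h" and eq: "- mink X (z, 1) = h z"
  shows "X = xpt h z"
proof -
  have Xh: "X \<in> hyp" using X by (simp add: hdom_def)
  have le: "- mink X (v, norm v) \<le> h v" if v: "v \<noteq> 0" for v
  proof -
    have "- mink X (v /\<^sub>R norm v, 1) \<le> h (v /\<^sub>R norm v)"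
      using X v by (simp add: hdom_def)
    then have "norm v * - mink X (v /\<^sub>R norm v, 1) \<le> norm v * h (v /\<^sub>R norm v)"
      by (rule mult_left_mono) simp
    moreover have "norm v * h (v /\<^sub>R norm v) = h v"
      using homog[of "norm v" "v /\<^sub>R norm v"] v by simp
    moreover have "norm v * - mink X (v /\<^sub>R norm v, 1) = - mink X (v, norm v)"
      using v by (simp add: mink_def algebra_simps)
    ultimately show ?thesis by simp
  qed
  let ?g = "\<lambda>v. h v - (snd X * norm v - fst X \<bullet> v)"
  have d: "(?g has_derivative (\<lambda>w. gr h z \<bullet> w - (snd X * (w \<bullet> z) - fst X \<bullet> w))) (at z)"
  proof -
    have "(norm has_derivative (\<lambda>w. w \<bullet> z)) (at z)"
      using has_derivative_norm[OF z0] z by (simp add: sgn_div_norm)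
    then show ?thesis
      by (intro has_derivative_diff has_derivative_h[OF z0] has_derivative_mult_right has_derivative_inner_right has_derivative_ident)
  qed
  have "(\<lambda>w. gr h z \<bullet> w - (snd X * (w \<bullet> z) - fst X \<bullet> w)) = (\<lambda>w. 0)"
  proof (rule has_derivative_local_min[OF d])
    have "eventually (\<lambda>v. v \<in> - {0}) (at z)"
      using open_punctured z0 by (intro eventually_at_in_open') auto
    then show "eventually (\<lambda>v. ?g z \<le> ?g v) (at z)"
    proof eventually_elim
      case (elim v)
      then show ?case using le[of v] eq z by (simp add: mink_def)
    qed
  qed
  then have "(gr h z - (snd X *\<^sub>R z - fst X)) \<bullet> w = 0" for w
    by (drule_tac fun_cong[where x = w]) (simp add: inner_diff_left inner_scaleR_left inner_commute[of w z])
  then have y: "gr h z = snd X *\<^sub>R z - fst X" by (metis inner_eq_zero_iff right_minus_eq)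
  have xz: "fst X \<bullet> z = snd X - h z" using eq by (simp add: mink_def)
  have "gr h z \<bullet> gr h z = (snd X)^2 - 2 * snd X * (fst X \<bullet> z) + fst X \<bullet> fst X"
    unfolding y by (simp add: inner_simps zz inner_commute power2_eq_square algebra_simps)
  also have "fst X \<bullet> fst X = (snd X)^2 - 1"
    using Xh by (simp add: hyp_def mink_def power2_eq_square)
  finally have "gr h z \<bullet> gr h z + 1 = 2 * h z * snd X"
    unfolding xz by (simp add: power2_eq_square algebra_simps)
  then have "tpt h z = snd X" using pos[OF z] by (simp add: tpt_def)
  then show ?thesis using y by (simp add: xpt_def prod_eq_iff)
qed

end

end

section \<open>Support functions, boundaries and normals of domains\<close>

lemma bdd_above_ln_mink:
  assumes "bounded \<Omega>" "\<Omega> \<subseteq> hyp" "norm z = 1"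
  shows "bdd_above ((\<lambda>X. ln (- mink X (z, 1))) ` \<Omega>)"
proof -
  obtain B where B: "\<And>X. X \<in> \<Omega> \<Longrightarrow> norm X \<le> B" using assms(1) by (auto simp: bounded_iff)
  have "ln (- mink X (z, 1)) \<le> 2 * B" if X: "X \<in> \<Omega>" for X
  proof -
    have p: "- mink X (z, 1) > 0" using hyp_mink_null_pos assms X by blast
    have "- mink X (z, 1) = snd X - fst X \<bullet> z" by (simp add: mink_def)
    also have "\<dots> \<le> norm (snd X) + norm (fst X) * norm z"
      using Cauchy_Schwarz_ineq2[of "fst X" z] unfolding real_norm_def by linarith
    also have "\<dots> \<le> B + B"
      using norm_fst_le[of "fst X" "snd X"] norm_snd_le[of "snd X" "fst X"] B[OF X] assms(3) by simp
    finally have "- mink X (z, 1) \<le> 2 * B" by simp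
    moreover have "ln (- mink X (z, 1)) \<le> - mink X (z, 1)" using ln_bound[OF p] .
    ultimately show ?thesis by simp
  qed
  then show ?thesis by (auto intro!: bdd_aboveI)
qed

text \<open>Any horoball used to define the domain contains the supporting one in the same
  direction. Hence the support function determines the domain, which is the uniqueness behind
  \<open>domain_of_hsupport\<close>.\<close>

lemma h_convex_bounded_domain_eq:
  assumes "h_convex_bounded_domain \<Omega>"
  shows "\<Omega> = {X \<in> hyp. \<forall>z. norm z = 1 \<longrightarrow> ln (- mink X (z, 1)) \<le> hsupport \<Omega> z}"
proof -
  obtain F where F: "F \<subseteq> sphere 0 1 \<times> UNIV" "\<Omega> = hyp \<inter> (\<Inter>(z, s)\<in>F. horoball z s)"
    and ne: "\<Omega> \<noteq> {}" and b: "bounded \<Omega>"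
    using assms by (auto simp: h_convex_bounded_domain_def)
  have sub: "\<Omega> \<subseteq> hyp" using F(2) by blast
  show ?thesis
  proof
    show "\<Omega> \<subseteq> {X \<in> hyp. \<forall>z. norm z = 1 \<longrightarrow> ln (- mink X (z, 1)) \<le> hsupport \<Omega> z}"
      using sub bdd_above_ln_mink[OF b sub] by (auto simp: hsupport_def intro!: cSUP_upper)
    show "{X \<in> hyp. \<forall>z. norm z = 1 \<longrightarrow> ln (- mink X (z, 1)) \<le> hsupport \<Omega> z} \<subseteq> \<Omega>"
    proof
      fix X assume X: "X \<in> {X \<in> hyp. \<forall>z. norm z = 1 \<longrightarrow> ln (- mink X (z, 1)) \<le> hsupport \<Omega> z}"
      have "X \<in> horoball z s" if zs: "(z, s) \<in> F" for z s
      proof -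
        have "norm z = 1" using zs F(1) by auto
        then have "ln (- mink X (z, 1)) \<le> hsupport \<Omega> z" using X by simp
        also have "hsupport \<Omega> z \<le> s"
          unfolding hsupport_def
        proof (rule cSUP_least[OF ne])
          fix Y assume "Y \<in> \<Omega>"
          then have "Y \<in> horoball z s" using F(2) zs by auto
          then show "ln (- mink Y (z, 1)) \<le> s" by (simp add: horoball_def)
        qed
        finally show ?thesis using X by (simp add: horoball_def)
      qed
      then show "X \<in> \<Omega>" using X F(2) by auto
    qed
  qed
qed

lemma domain_of_hsupport_eqI:
  assumes "h_convex_bounded_domain \<Omega>" "\<And>z. norm z = 1 \<Longrightarrow> hsupport \<Omega> z = u z"
  shows "domain_of_hsupport u = \<Omega>"
  unfolding domain_of_hsupport_def
proof (rule the_equality)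
  show "h_convex_bounded_domain \<Omega> \<and> (\<forall>z\<in>sphere 0 1. hsupport \<Omega> z = u z)" using assms by auto
  show "\<Omega>' = \<Omega>" if *: "h_convex_bounded_domain \<Omega>' \<and> (\<forall>z\<in>sphere 0 1. hsupport \<Omega>' z = u z)" for \<Omega>'
  proof -
    have "hsupport \<Omega>' z = hsupport \<Omega> z" if "norm z = 1" for z using * assms(2) that by simp
    then have "{X \<in> hyp. \<forall>z. norm z = 1 \<longrightarrow> ln (- mink X (z, 1)) \<le> hsupport \<Omega>' z} =
        {X \<in> hyp. \<forall>z. norm z = 1 \<longrightarrow> ln (- mink X (z, 1)) \<le> hsupport \<Omega> z}" by auto
    then show ?thesis
      using h_convex_bounded_domain_eq[of \<Omega>'] h_convex_bounded_domain_eq[OF assms(1)] * by simp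
  qed
qed

lemma bd_iff:
  assumes "closed K" "K \<subseteq> hyp"
  shows "X \<in> bd K \<longleftrightarrow> X \<in> K \<and> (\<forall>e>0. \<exists>Y\<in>hyp. dist Y X < e \<and> Y \<notin> K)"
proof -
  have "closedin (top_of_set hyp) K" using assms by (simp add: closed_subset)
  then have c: "(top_of_set hyp) closure_of K = K" by (rule closure_of_closedin)
  have "X \<in> (top_of_set hyp) interior_of K \<longleftrightarrow> (\<exists>e>0. \<forall>Y\<in>hyp. dist Y X < e \<longrightarrow> Y \<in> K)" if X: "X \<in> K"
  proof
    assume "X \<in> (top_of_set hyp) interior_of K"
    then obtain T where T: "openin (top_of_set hyp) T" "X \<in> T" "T \<subseteq> K" by (auto simp: interior_of_def)
    then obtain e where "e > 0" "\<forall>Y\<in>hyp. dist Y X < e \<longrightarrow> Y \<in> T"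
      unfolding openin_euclidean_subtopology_iff by blast
    then show "\<exists>e>0. \<forall>Y\<in>hyp. dist Y X < e \<longrightarrow> Y \<in> K" using T(3) by blast
  next
    assume "\<exists>e>0. \<forall>Y\<in>hyp. dist Y X < e \<longrightarrow> Y \<in> K"
    then obtain e where e: "e > 0" "\<And>Y. Y \<in> hyp \<Longrightarrow> dist Y X < e \<Longrightarrow> Y \<in> K" by blast
    have "openin (top_of_set hyp) (hyp \<inter> ball X e)" by (simp add: openin_open_Int)
    moreover have "hyp \<inter> ball X e \<subseteq> K" using e(2) by (auto simp: dist_commute)
    moreover have "X \<in> hyp \<inter> ball X e" using X assms(2) e(1) by auto
    ultimately show "X \<in> (top_of_set hyp) interior_of K" by (auto simp: interior_of_def)
  qed
  then show ?thesis unfolding bd_def frontier_of_def c by blast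
qed

text \<open>Within a hypersurface the derivative is not unique as a linear map, and
  \<open>frechet_derivative\<close> picks an unknown one; on velocities of curves in S all
  candidates agree.\<close>

lemma frechet_derivative_within_curve:
  fixes f :: "'a::real_normed_vector \<Rightarrow> 'b::real_normed_vector"
  assumes f: "(f has_derivative f') (at X within S)"
    and g: "\<gamma> 0 = X" "e > 0" "\<And>t. \<bar>t\<bar> < e \<Longrightarrow> \<gamma> t \<in> S" "(\<gamma> has_vector_derivative v) (at 0)"
  shows "frechet_derivative f (at X within S) v = f' v"
proof -
  have "f differentiable (at X within S)" using f by (auto simp: differentiable_def)
  then have f2: "(f has_derivative frechet_derivative f (at X within S)) (at X within S)"
    using frechet_derivative_works by blast
  have chain: "((\<lambda>t. f (\<gamma> t)) has_vector_derivative D v) (at 0)" if D: "(f has_derivative D) (at X within S)" for D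
  proof -
    have 1: "(\<gamma> has_derivative (\<lambda>t. t *\<^sub>R v)) (at 0 within {-e<..<e})"
      using g(4) unfolding has_vector_derivative_def by (rule has_derivative_at_withinI)
    have "(f has_derivative D) (at (\<gamma> 0) within \<gamma> ` {-e<..<e})"
      unfolding g(1) by (rule has_derivative_subset[OF D]) (use g(3) in auto)
    from diff_chain_within[OF 1 this]
    have "((\<lambda>t. f (\<gamma> t)) has_derivative (\<lambda>t. D (t *\<^sub>R v))) (at 0 within {-e<..<e})" by (simp add: o_def)
    then have "((\<lambda>t. f (\<gamma> t)) has_derivative (\<lambda>t. D (t *\<^sub>R v))) (at 0)"
      using at_within_open[of "0::real" "{-e<..<e}"] g(2) by simp
    then show ?thesis
      unfolding has_vector_derivative_def by (simp add: linear_scale[OF has_derivative_linear[OF D]])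
  qed
  show ?thesis
    using vector_derivative_unique_at[OF chain[OF f2] chain[OF f]] .
qed

lemma hyp_geodesic_hyp:
  assumes X: "X \<in> hyp" and v: "v \<in> hyp_tangent X" "mink v v = 1" and t: "t \<ge> 0"
  shows "mink (hyp_geodesic X v t) (hyp_geodesic X v t) = -1"
proof -
  have "mink X v = 0" "mink X X = -1" using X v by (auto simp: hyp_def hyp_tangent_def)
  then have "mink (hyp_geodesic X v t) (hyp_geodesic X v t) = (sinh t)^2 - (cosh t)^2"
    using v(2) by (simp add: hyp_geodesic_def mink_simps mink_commute[of v X] power2_eq_square)
  then show ?thesis by (simp add: sinh_square_eq)
qed

text \<open>By \<open>uniq\<close> any other candidate is a multiple of N, hence N or - N, and - N
  is excluded because its geodesic enters K.\<close>

lemma outward_normal_eqI: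
  assumes N: "mink X N = 0" "mink N N = 1" and T: "\<And>u. u \<in> bd_tangent K X \<Longrightarrow> mink N u = 0"
    and uniq: "\<And>w. mink X w = 0 \<Longrightarrow> mink N w = 0 \<Longrightarrow> (\<And>u. u \<in> bd_tangent K X \<Longrightarrow> mink w u = 0) \<Longrightarrow> w = 0"
    and out: "\<exists>e>0. \<forall>t. 0 < t \<and> t < e \<longrightarrow> hyp_geodesic X N t \<notin> K"
    and inside: "\<exists>e>0. \<forall>t. 0 < t \<and> t < e \<longrightarrow> hyp_geodesic X (- N) t \<in> K"
  shows "outward_normal K X = N"
  unfolding outward_normal_def
proof (rule the_equality)
  show "N \<in> hyp_tangent X \<and> mink N N = 1 \<and> (\<forall>w\<in>bd_tangent K X. mink N w = 0) \<and>
     (\<exists>e>0. \<forall>t. 0 < t \<and> t < e \<longrightarrow> hyp_geodesic X N t \<notin> K)"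
    using N T out by (simp add: hyp_tangent_def)
  fix v assume v: "v \<in> hyp_tangent X \<and> mink v v = 1 \<and> (\<forall>w\<in>bd_tangent K X. mink v w = 0) \<and>
     (\<exists>e>0. \<forall>t. 0 < t \<and> t < e \<longrightarrow> hyp_geodesic X v t \<notin> K)"
  have Xv: "mink X v = 0" using v by (simp add: hyp_tangent_def)
  define c where "c = mink v N"
  have "v - c *\<^sub>R N = 0"
    by (rule uniq) (use Xv N v T mink_commute[of N v] in \<open>simp_all add: c_def mink_simps\<close>)
  then have vc: "v = c *\<^sub>R N" by simp
  have "c^2 = 1" using v N(2) unfolding vc by (simp add: mink_simps power2_eq_square)
  then have "c = 1 \<or> c = -1" by (simp add: power2_eq_1_iff)
  moreover have "c \<noteq> -1"
  proof
    assume "c = -1"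
    then have vN: "v = - N" using vc by simp
    obtain e where e: "e > 0" "\<And>t. 0 < t \<Longrightarrow> t < e \<Longrightarrow> hyp_geodesic X (- N) t \<notin> K" using v unfolding vN by blast
    obtain e' where e': "e' > 0" "\<And>t. 0 < t \<Longrightarrow> t < e' \<Longrightarrow> hyp_geodesic X (- N) t \<in> K" using inside by blast
    have "0 < min e e' / 2" "min e e' / 2 < e" "min e e' / 2 < e'" using e(1) e'(1) by auto
    then show False using e(2) e'(2) by blast
  qed
  ultimately show "v = N" using vc by simp
qed

lemma tendsto_hyp_geodesic: "((\<lambda>t. hyp_geodesic X v t) \<longlongrightarrow> X) (at_right 0)"
proof -
  have "((\<lambda>t::real. cosh t) \<longlongrightarrow> cosh 0) (at_right 0)" "((\<lambda>t::real. sinh t) \<longlongrightarrow> sinh 0) (at_right 0)"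
    by (intro tendsto_intros)+
  then have "((\<lambda>t. cosh t *\<^sub>R X + sinh t *\<^sub>R v) \<longlongrightarrow> cosh 0 *\<^sub>R X + sinh 0 *\<^sub>R v) (at_right 0)"
    by (intro tendsto_intros)
  then show ?thesis by (simp add: hyp_geodesic_def)
qed

context h_body
begin

lemma continuous_on_h: "continuous_on (sphere 0 1) h"
  by (rule continuous_on_subset[OF smooth_on_continuous_on[OF smooth]]) auto

lemma exists_unit: "\<exists>z :: 'n euclid1. norm z = 1"
  using vector_choose_size[of 1] by auto

lemma compact_hdom: "compact (hdom h)"
proof -
  have hc: "hdom h = hyp \<inter> (\<Inter>z\<in>sphere 0 1. {X. - mink X (z, 1) \<le> h z})"
    by (auto simp: hdom_def)
  have "closed (hdom h)"
    unfolding hc by (intro closed_Int closed_hyp closed_INT ballI closed_Collect_le continuous_intros)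
  moreover have "bounded (hdom h)"
  proof -
    have "sphere (0::'n euclid1) 1 \<noteq> {}" using vector_choose_size[of 1] by (auto simp: sphere_def dist_norm)
    then obtain z0 where M: "\<And>z. norm z = 1 \<Longrightarrow> h z \<le> h z0"
      using continuous_attains_sup[OF compact_sphere _ continuous_on_h] by (auto simp: sphere_def dist_norm)
    have "norm X \<le> h z0 + 1" if X: "X \<in> hdom h" for X
    proof -
      have Xh: "X \<in> hyp" and le: "\<And>z. norm z = 1 \<Longrightarrow> - mink X (z, 1) \<le> h z" using X by (auto simp: hdom_def)
      have n: "norm X \<le> norm (fst X) + snd X"
        using norm_triangle_ineq[of "(fst X, 0)" "(0, snd X)"] hyp_ge1[OF Xh] by (simp add: norm_Pair)
      obtain z1 :: "'n euclid1" where z1: "norm z1 = 1" using exists_unit by blast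
      show ?thesis
      proof (cases "fst X = 0")
        case True
        then show ?thesis using n le[OF z1] M[OF z1] by (simp add: mink_def)
      next
        case False
        \<comment> \<open>The direction opposite to x gives the value t + |x|, which bounds the
          Euclidean norm of (x, t).\<close>
        let ?z = "- (fst X /\<^sub>R norm (fst X))"
        have "norm ?z = 1" using False by simp
        then have "- mink X (?z, 1) \<le> h z0" using le M order_trans by blast
        moreover have "- mink X (?z, 1) = snd X + norm (fst X)"
          using False by (simp add: mink_def dot_square_norm power2_eq_square)
        ultimately show ?thesis using n by simp
      qed
    qed
    then show ?thesis unfolding bounded_iff by blast
  qed
  ultimately show ?thesis by (simp add: compact_eq_bounded_closed)
qed

lemma hdom_hyp: "hdom h \<subseteq> hyp"
  by (auto simp: hdom_def)

lemma ln_mink_le_iff: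
  assumes "X \<in> hyp" "norm z = 1"
  shows "ln (- mink X (z, 1)) \<le> ln (h z) \<longleftrightarrow> - mink X (z, 1) \<le> h z"
  using hyp_mink_null_pos[OF assms] pos[OF assms(2)] by simp

lemma hdom_h_convex: "h_convex_bounded_domain (hdom h)"
  unfolding h_convex_bounded_domain_def
proof (intro conjI exI)
  show "hdom h \<noteq> {}" using xpt_in_hdom exists_unit by blast
  show "bounded (hdom h)" using compact_hdom compact_imp_bounded by blast
  let ?F = "(\<lambda>z. (z, ln (h z))) ` sphere 0 1"
  show "?F \<subseteq> sphere 0 1 \<times> UNIV" by auto
  show "hdom h = hyp \<inter> (\<Inter>(z, s)\<in>?F. horoball z s)"
  proof (rule set_eqI)
    fix X :: "'n minkowski"
    have "X \<in> hyp \<Longrightarrow> norm z = 1 \<Longrightarrow> X \<in> horoball z (ln (h z)) \<longleftrightarrow> - mink X (z, 1) \<le> h z" for z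
      by (simp add: horoball_def ln_mink_le_iff)
    then show "X \<in> hdom h \<longleftrightarrow> X \<in> hyp \<inter> (\<Inter>(z, s)\<in>?F. horoball z s)"
      unfolding hdom_def by fastforce
  qed
qed

lemma hsupport_hdom:
  assumes z: "norm z = 1"
  shows "hsupport (hdom h) z = ln (h z)"
  unfolding hsupport_def
proof (rule cSup_eq_maximum)
  show "ln (h z) \<in> (\<lambda>X. ln (- mink X (z, 1))) ` hdom h"
    by (rule image_eqI[OF _ xpt_in_hdom[OF z]]) (simp add: mink_xpt_null[OF z])
  show "y \<le> ln (h z)" if "y \<in> (\<lambda>X. ln (- mink X (z, 1))) ` hdom h" for y
    using that ln_mink_le_iff[OF _ z] z by (auto simp: hdom_def)
qed

lemma domain_of_hsupport_eq_hdom: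
  assumes "\<And>z. norm z = 1 \<Longrightarrow> u z = ln (h z)"
  shows "domain_of_hsupport u = hdom h"
  by (rule domain_of_hsupport_eqI[OF hdom_h_convex]) (simp add: hsupport_hdom assms)

text \<open>Outward normal of the supporting horosphere at the contact point:
  \<open>xpt h z - nu z\<close> is a multiple of the null vector of that horosphere, and the factor
  1 / h makes \<open>nu z\<close> a unit vector tangent to \<open>hyp\<close>.\<close>

definition nu :: "'n euclid1 \<Rightarrow> 'n minkowski" where
  "nu z = xpt h z - (1 / h z) *\<^sub>R (z, 1)"

lemma mink_null_null: "norm z = 1 \<Longrightarrow> mink (z, 1) (z, 1) = 0"
  by (simp add: mink_def dot_square_norm)

lemma mink_xpt_xpt: "norm z = 1 \<Longrightarrow> mink (xpt h z) (xpt h z) = -1"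
  using xpt_hyp by (simp add: hyp_def)

lemma mink_nu:
  assumes z: "norm z = 1"
  shows "mink (xpt h z) (nu z) = 0" "mink (nu z) (nu z) = 1" "mink (nu z) (z, 1) = - h z"
  using pos[OF z] mink_xpt_null[OF z] mink_xpt_xpt[OF z] mink_null_null[OF z]
  by (simp_all add: nu_def mink_simps mink_commute[of "(z, 1)" "xpt h z"] del: scaleR_Pair)

lemma mink_null_diff: "norm z = 1 \<Longrightarrow> norm w = 1 \<Longrightarrow> - mink (z, 1) (w, 1) = (norm (w - z))^2 / 2"
  by (simp add: mink_def power2_norm_eq_inner inner_simps inner_commute[of w z])
    (simp add: power2_norm_eq_inner[symmetric])

lemma inj_on_xpt: "inj_on (xpt h) {z. norm z = 1}"
proof (rule inj_onI)
  fix z w assume "z \<in> {z. norm z = 1}" "w \<in> {z. norm z = 1}" "xpt h z = xpt h w"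
  then show "z = w" using touch_less[of w z] mink_xpt_null[of z] by fastforce
qed

end

lemma sphere_curve:
  fixes z e :: "'a::real_inner"
  assumes z: "norm z = 1" and e: "e \<bullet> z = 0"
  shows "\<exists>s. s 0 = z \<and> (\<forall>t. norm (s t) = 1) \<and> (s has_vector_derivative e) (at (0::real))"
proof (intro exI conjI allI)
  let ?u = "e /\<^sub>R norm e"
  let ?s = "\<lambda>t::real. cos (norm e * t) *\<^sub>R z + sin (norm e * t) *\<^sub>R ?u"
  show "?s 0 = z" by simp
  show "norm (?s t) = 1" for t
  proof -
    have zz: "z \<bullet> z = 1" using z by (simp add: dot_square_norm)
    have "(norm (?s t))^2 = 1"
    proof (cases "e = 0")
      case True
      then show ?thesis using z by simp
    next
      case False
      have ee: "?u \<bullet> ?u = 1" "?u \<bullet> z = 0" "z \<bullet> ?u = 0"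
        using False e by (simp_all add: dot_square_norm power2_eq_square inner_commute[of z e])
      have "(norm (?s t))^2 = (cos (norm e * t))^2 * (z \<bullet> z) + (sin (norm e * t))^2 * (?u \<bullet> ?u)
          + 2 * cos (norm e * t) * sin (norm e * t) * (?u \<bullet> z)"
        unfolding power2_norm_eq_inner inner_simps inner_scaleR_left inner_scaleR_right
        using inner_commute[of z e] by (simp add: power2_eq_square algebra_simps)
      then show ?thesis unfolding ee zz by simp
    qed
    then show ?thesis using power2_eq_iff_nonneg[OF norm_ge_zero zero_le_one, of "?s t"] by simp
  qed
  have c: "((\<lambda>t. cos (norm e * t)) has_real_derivative - sin (norm e * 0) * norm e) (at 0)"
    and d: "((\<lambda>t. sin (norm e * t)) has_real_derivative cos (norm e * 0) * norm e) (at 0)"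
    by (auto intro!: derivative_eq_intros)
  have "(?s has_vector_derivative (- sin (norm e * 0) * norm e) *\<^sub>R z + (cos (norm e * 0) * norm e) *\<^sub>R ?u) (at 0)"
    using has_vector_derivative_add[OF has_vector_derivative_scaleR[OF c has_vector_derivative_const[of z]]
        has_vector_derivative_scaleR[OF d has_vector_derivative_const[of ?u]]] by simp
  moreover have "(- sin (norm e * 0) * norm e) *\<^sub>R z + (cos (norm e * 0) * norm e) *\<^sub>R ?u = e"
    by (cases "e = 0") auto
  ultimately show "(?s has_vector_derivative e) (at 0)" by simp
qed

context h_body
begin

text \<open>The left-hand side is the value over w of the point reached after time t on the inward
  geodesic. Near z the quadratic term is paid for by the loss of (1 - exp (-t)) times the value of
  the contact point; away from z compactness leaves a positive gap below h.\<close>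

lemma geodesic_touch:
  assumes z: "norm z = 1"
  obtains e where "e > 0" "\<And>t w. 0 < t \<Longrightarrow> t < e \<Longrightarrow> norm w = 1 \<Longrightarrow>
    exp (- t) * (- mink (xpt h z) (w, 1)) + sinh t / (2 * h z) * (norm (w - z))^2 \<le> h w"
proof -
  let ?s = "\<lambda>w. - mink (xpt h z) (w, 1)"
  have hz: "h z > 0" by (rule pos[OF z])
  have "open {w. 0 < ?s w * h z - (norm (w - z))^2}" by (intro open_Collect_less continuous_intros)
  moreover have "z \<in> {w. 0 < ?s w * h z - (norm (w - z))^2}" using mink_xpt_null[OF z] hz by simp
  ultimately obtain d where d: "d > 0" "ball z d \<subseteq> {w. 0 < ?s w * h z - (norm (w - z))^2}"
    using open_contains_ball_eq by blast
  let ?S = "sphere 0 1 \<inter> {w. d \<le> norm (w - z)}" and ?g = "\<lambda>w. h w + mink (xpt h z) (w, 1)"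
  have comp: "compact ?S"
    by (intro compact_Int_closed compact_sphere closed_Collect_le continuous_intros)
  have cont: "continuous_on ?S ?g"
    by (intro continuous_intros continuous_on_subset[OF continuous_on_h]) auto
  have gpos: "?g w > 0" if w: "w \<in> ?S" for w
  proof -
    have "norm w = 1" "w \<noteq> z" using w d(1) by auto
    from touch_less[OF z this] show ?thesis by linarith
  qed
  obtain g0 where g0: "g0 > 0" "\<And>w. w \<in> ?S \<Longrightarrow> g0 \<le> ?g w"
  proof (cases "?S = {}")
    case True
    then show ?thesis using that[of 1] by simp
  next
    case False
    obtain w0 where "w0 \<in> ?S" "\<And>w. w \<in> ?S \<Longrightarrow> ?g w0 \<le> ?g w"
      using continuous_attains_inf[OF comp False cont] by blast
    then show ?thesis using that gpos by blast
  qed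
  have "((\<lambda>t::real. sinh t / (2 * h z)) \<longlongrightarrow> sinh 0 / (2 * h z)) (at_right 0)"
    by (intro tendsto_intros) (use hz in auto)
  then have "eventually (\<lambda>t. sinh t / (2 * h z) < g0 / 4) (at_right 0)"
    using g0(1) by (intro order_tendstoD(2)) auto
  then obtain e where e: "e > 0" "\<And>t. 0 < t \<Longrightarrow> t < e \<Longrightarrow> sinh t / (2 * h z) < g0 / 4"
    unfolding eventually_at_right_field by auto
  \<comment> \<open>The restriction t < 1 gives exp t \<le> 3, hence the constant 2 in the estimate
    near z.\<close>
  show thesis
  proof (rule that[of "min e 1"])
    fix t :: real and w :: "'n euclid1" assume t: "0 < t" "t < min e 1" and w: "norm w = 1"
    have sp: "?s w > 0" by (rule hyp_mink_null_pos[OF xpt_hyp[OF z] w])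
    let ?r = "sinh t / (2 * h z) * (norm (w - z))^2"
    show "exp (- t) * ?s w + ?r \<le> h w"
    proof (cases "norm (w - z) < d")
      case True
      then have "w \<in> ball z d" by (simp add: dist_norm norm_minus_commute)
      then have n: "(norm (w - z))^2 \<le> ?s w * h z" using d(2) by fastforce
      have sh: "sinh t = (1 - exp (- t)) * ((exp t + 1) / 2)"
        by (simp add: sinh_field_def exp_minus field_simps)
      have "exp t \<le> exp 1" using t by simp
      from order_trans[OF this exp_le] have et: "(exp t + 1) / 2 \<le> 2" by simp
      have "?r = (1 - exp (- t)) * ((exp t + 1) / 2) * ((norm (w - z))^2 / (2 * h z))" unfolding sh by simp
      also have "\<dots> \<le> (1 - exp (- t)) * 2 * ((?s w * h z) / (2 * h z))"
        using t n hz et sp by (intro mult_mono divide_right_mono mult_left_mono) auto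
      also have "\<dots> = (1 - exp (- t)) * ?s w" using hz by simp
      finally have "exp (- t) * ?s w + ?r \<le> ?s w" by (simp add: algebra_simps)
      then show ?thesis using touch[OF z w] by linarith
    next
      case False
      then have 1: "g0 \<le> ?g w" using w by (intro g0(2)) simp
      have "norm (w - z) \<le> 2" using norm_triangle_ineq4[of w z] w z by simp
      then have "(norm (w - z))^2 \<le> 2^2" by (intro power_mono) auto
      then have "?r \<le> (g0 / 4) * 4"
        using e(2)[of t] t g0(1) hz by (intro mult_mono) auto
      moreover have "exp (- t) * ?s w \<le> 1 * ?s w" using t sp by (intro mult_right_mono) auto
      ultimately show ?thesis using 1 by linarith
    qed
  qed (use e in simp)
qed

lemma nu_geodesic:
  assumes z: "norm z = 1"
  shows "t > 0 \<Longrightarrow> hyp_geodesic (xpt h z) (nu z) t \<notin> hdom h"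
    and "\<exists>e>0. \<forall>t. 0 < t \<and> t < e \<longrightarrow> hyp_geodesic (xpt h z) (- nu z) t \<in> hdom h"
proof -
  show "hyp_geodesic (xpt h z) (nu z) t \<notin> hdom h" if t: "t > 0"
  proof
    assume "hyp_geodesic (xpt h z) (nu z) t \<in> hdom h"
    then have "- mink (hyp_geodesic (xpt h z) (nu z) t) (z, 1) \<le> h z" using z by (simp add: hdom_def)
    moreover have "- mink (hyp_geodesic (xpt h z) (nu z) t) (z, 1) = exp t * h z"
      using mink_xpt_null[OF z] mink_nu(3)[OF z] cosh_plus_sinh[of t]
      by (simp add: hyp_geodesic_def mink_simps distrib_right[symmetric] add.commute)
    moreover have "exp t * h z > h z" using pos[OF z] t by simp
    ultimately show False by simp
  qed
  obtain e where e: "e > 0" "\<And>t w. 0 < t \<Longrightarrow> t < e \<Longrightarrow> norm w = 1 \<Longrightarrow>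
    exp (- t) * (- mink (xpt h z) (w, 1)) + sinh t / (2 * h z) * (norm (w - z))^2 \<le> h w"
    by (rule geodesic_touch[OF z]) (rule that, assumption+)
  have "hyp_geodesic (xpt h z) (- nu z) t \<in> hdom h" if t: "0 < t" "t < e" for t
  proof -
    let ?Y = "hyp_geodesic (xpt h z) (- nu z) t"
    have ctst: "cosh t - sinh t = exp (- t)" by (rule cosh_minus_sinh)
    have Y: "?Y = exp (- t) *\<^sub>R xpt h z + (sinh t / h z) *\<^sub>R (z, 1)"
      unfolding ctst[symmetric]
      by (simp add: hyp_geodesic_def nu_def scaleR_diff_left scaleR_diff_right del: scaleR_Pair)
    have q: "mink ?Y ?Y = -1"
      by (rule hyp_geodesic_hyp) (use xpt_hyp[OF z] mink_nu[OF z] t in \<open>auto simp: hyp_tangent_def mink_simps\<close>)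
    have s: "snd ?Y > 0"
      unfolding Y using tpt_pos[OF z] pos[OF z] t
      by (simp add: snd_xpt[OF z]) (intro add_pos_pos; simp)
    have "- mink ?Y (w, 1) \<le> h w" if w: "norm w = 1" for w
    proof -
      have "- mink ?Y (w, 1) = exp (- t) * (- mink (xpt h z) (w, 1)) + (sinh t / h z) * (- mink (z, 1) (w, 1))"
        unfolding Y by (simp add: mink_simps del: scaleR_Pair)
      also have "\<dots> = exp (- t) * (- mink (xpt h z) (w, 1)) + (sinh t / (2 * h z)) * (norm (w - z))^2"
        unfolding mink_null_diff[OF z w] by simp
      also have "\<dots> \<le> h w" by (rule e(2)[OF t w])
      finally show ?thesis .
    qed
    then show ?thesis using q s by (simp add: hdom_def hyp_def)
  qed
  then show "\<exists>e>0. \<forall>t. 0 < t \<and> t < e \<longrightarrow> hyp_geodesic (xpt h z) (- nu z) t \<in> hdom h"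
    using e(1) by blast
qed

text \<open>If X lay on none of the supporting horospheres, compactness of the sphere would leave a
  uniform margin and X would be interior; conversely the normal geodesic leaves the domain at
  once.\<close>

lemma bd_hdom: "bd (hdom h) = xpt h ` {z. norm z = 1}"
proof (rule set_eqI)
  fix X :: "'n minkowski"
  have cl: "closed (hdom h)" using compact_hdom compact_imp_closed by blast
  show "X \<in> bd (hdom h) \<longleftrightarrow> X \<in> xpt h ` {z. norm z = 1}"
  proof
    assume X: "X \<in> bd (hdom h)"
    then have XK: "X \<in> hdom h" and out: "\<And>e. e > 0 \<Longrightarrow> \<exists>Y\<in>hyp. dist Y X < e \<and> Y \<notin> hdom h"
      using bd_iff[OF cl hdom_hyp] by auto
    have "\<exists>z. norm z = 1 \<and> - mink X (z, 1) = h z"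
    proof (rule ccontr)
      assume none: "\<not> ?thesis"
      let ?g = "\<lambda>z. h z + mink X (z, 1)"
      have cont: "continuous_on (sphere 0 1) ?g"
        by (intro continuous_intros continuous_on_h)
      obtain z0 where z0: "norm z0 = 1" "\<And>z. norm z = 1 \<Longrightarrow> ?g z0 \<le> ?g z"
        using continuous_attains_inf[OF compact_sphere _ cont] exists_unit by (auto simp: ex_in_conv[symmetric])
      have "- mink X (z0, 1) \<le> h z0" using XK z0(1) by (simp add: hdom_def)
      moreover have "- mink X (z0, 1) \<noteq> h z0" using none z0(1) by blast
      ultimately have g0: "?g z0 > 0" by linarith
      obtain Y where Y: "Y \<in> hyp" "dist Y X < ?g z0 / 2" "Y \<notin> hdom h"
        using out[of "?g z0 / 2"] g0 by auto
      have "- mink Y (z, 1) \<le> h z" if z: "norm z = 1" for z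
      proof -
        have "- mink Y (z, 1) = - mink X (z, 1) + (snd (Y - X) - fst (Y - X) \<bullet> z)"
          by (simp add: mink_def inner_diff_left)
        moreover have "snd (Y - X) \<le> norm (Y - X)"
          using norm_snd_le[of "snd (Y - X)" "fst (Y - X)"] unfolding prod.collapse real_norm_def by linarith
        moreover have "- (fst (Y - X) \<bullet> z) \<le> norm (Y - X)"
          using Cauchy_Schwarz_ineq2[of "fst (Y - X)" z] norm_fst_le[of "fst (Y - X)" "snd (Y - X)"]
          unfolding prod.collapse z mult_1_right by linarith
        ultimately have "- mink Y (z, 1) \<le> - mink X (z, 1) + 2 * dist Y X" by (simp add: dist_norm)
        then show ?thesis using z0(2)[OF z] Y(2) by argo
      qed
      then show False using Y by (simp add: hdom_def)
    qed
    then show "X \<in> xpt h ` {z. norm z = 1}" using contact[OF _ XK] by blast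
  next
    assume "X \<in> xpt h ` {z. norm z = 1}"
    then obtain z where z: "norm z = 1" "X = xpt h z" by blast
    have "\<exists>Y\<in>hyp. dist Y X < e \<and> Y \<notin> hdom h" if e: "e > 0" for e
    proof -
      have "eventually (\<lambda>t. dist (hyp_geodesic X (nu z) t) X < e) (at_right 0)"
        using tendsto_hyp_geodesic[of X "nu z"] e unfolding tendsto_iff by blast
      moreover have "((\<lambda>t. snd (hyp_geodesic X (nu z) t)) \<longlongrightarrow> snd X) (at_right 0)"
        by (rule tendsto_snd[OF tendsto_hyp_geodesic])
      then have "eventually (\<lambda>t. snd (hyp_geodesic X (nu z) t) > 0) (at_right 0)"
        using tpt_pos[OF z(1)] by (intro order_tendstoD(1)) (auto simp: z(2) snd_xpt[OF z(1)])
      moreover have "eventually (\<lambda>t::real. 0 < t) (at_right 0)" by (simp add: eventually_at_filter)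
      ultimately have "eventually (\<lambda>t. dist (hyp_geodesic X (nu z) t) X < e \<and> snd (hyp_geodesic X (nu z) t) > 0 \<and> 0 < t) (at_right 0)"
        by (intro eventually_conj)
      then obtain t where t: "dist (hyp_geodesic X (nu z) t) X < e" "snd (hyp_geodesic X (nu z) t) > 0" "0 < t"
        using eventually_happens trivial_limit_at_right_real by blast
      have "mink (hyp_geodesic X (nu z) t) (hyp_geodesic X (nu z) t) = -1"
        by (rule hyp_geodesic_hyp)
          (use z xpt_hyp mink_nu[OF z(1)] t(3) in \<open>auto simp: hyp_tangent_def\<close>)
      then have "hyp_geodesic X (nu z) t \<in> hyp" using t(2) by (simp add: hyp_def)
      then show ?thesis using t nu_geodesic(1)[OF z(1) t(3)] z(2) by blast
    qed
    then show "X \<in> bd (hdom h)" using bd_iff[OF cl hdom_hyp] xpt_in_hdom[OF z(1)] z(2) by auto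
  qed
qed

section \<open>Differential geometry of the boundary in the horospherical parametrization\<close>

definition dtp :: "'n euclid1 \<Rightarrow> 'n euclid1 \<Rightarrow> real" where
  "dtp z e = gr h z \<bullet> (hess h z e - tpt h z *\<^sub>R e) / h z"

definition Xd :: "'n euclid1 \<Rightarrow> 'n euclid1 \<Rightarrow> 'n minkowski" where
  "Xd z e = (dtp z e *\<^sub>R z + tpt h z *\<^sub>R e - hess h z e, dtp z e)"

text \<open>Excess of the Hessian of h over that of the contact ball. It is positive on the
  complement of z, and its eigenvalues l there give the principal curvatures 1 + 1 / (h l).\<close>

definition aop :: "'n euclid1 \<Rightarrow> 'n euclid1 \<Rightarrow> 'n euclid1" where
  "aop z e = hess h z e - tpt h z *\<^sub>R e"

definition nud :: "'n euclid1 \<Rightarrow> 'n euclid1 \<Rightarrow> 'n minkowski" where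
  "nud z e = Xd z e - (1 / h z) *\<^sub>R (e, 0) + (gr h z \<bullet> e / (h z)^2) *\<^sub>R (z, 1)"

lemma has_derivative_tpt:
  assumes v: "v \<noteq> 0"
  shows "(tpt h has_derivative dtp v) (at v)"
proof -
  have hp: "h v > 0" by (rule h_pos[OF v])
  have 1: "((\<lambda>z. gr h z \<bullet> gr h z + 1) has_derivative (\<lambda>e. gr h v \<bullet> hess h v e + hess h v e \<bullet> gr h v)) (at v)"
    using has_derivative_add_const[OF has_derivative_inner[OF has_derivative_gr_h[OF v] has_derivative_gr_h[OF v]]] .
  have 2: "((\<lambda>z. 2 * h z) has_derivative (\<lambda>e. 2 * (gr h v \<bullet> e))) (at v)"
    by (intro derivative_intros has_derivative_h v)
  have "((\<lambda>z. (gr h z \<bullet> gr h z + 1) / (2 * h z)) has_derivative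
     (\<lambda>e. ((gr h v \<bullet> hess h v e + hess h v e \<bullet> gr h v) * (2 * h v) - (gr h v \<bullet> gr h v + 1) * (2 * (gr h v \<bullet> e)))
        / ((2 * h v) * (2 * h v)))) (at v)"
    by (rule has_derivative_divide'[OF 1 2]) (use hp in simp)
  moreover have "((gr h v \<bullet> hess h v e + hess h v e \<bullet> gr h v) * (2 * h v) - (gr h v \<bullet> gr h v + 1) * (2 * (gr h v \<bullet> e)))
        / ((2 * h v) * (2 * h v)) = dtp v e" for e
    unfolding dtp_def tpt_def inner_diff_right inner_scaleR_right inner_commute[of "hess h v e"]
    using hp by (simp add: field_simps)
  ultimately show ?thesis unfolding tpt_def[abs_def] by simp
qed

lemma has_derivative_xpt:
  assumes v: "v \<noteq> 0"
  shows "(xpt h has_derivative Xd v) (at v)"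
proof -
  have "((\<lambda>z. (tpt h z *\<^sub>R z - gr h z, tpt h z)) has_derivative
      (\<lambda>e. (tpt h v *\<^sub>R e + dtp v e *\<^sub>R v - hess h v e, dtp v e))) (at v)"
    by (intro has_derivative_Pair has_derivative_diff has_derivative_scaleR has_derivative_tpt
        has_derivative_gr_h has_derivative_ident v)
  then show ?thesis unfolding xpt_def[abs_def] Xd_def[abs_def] by (simp add: add.commute)
qed

lemma smooth_tpt: "smooth_on (- {0}) (tpt h)"
  unfolding tpt_def[abs_def]
  by (intro smooth_on_divide smooth_on_add smooth_on_inner smooth_on_gr smooth_on_mult smooth_on_const
      open_punctured smooth) (use h_pos in auto)

lemma smooth_xpt: "smooth_on (- {0}) (xpt h)"
  unfolding xpt_def[abs_def]
  by (intro smooth_on_Pair smooth_on_diff smooth_on_scaleR smooth_on_gr smooth_tpt smooth smooth_on_ident open_punctured)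

lemma linear_Xd: "v \<noteq> 0 \<Longrightarrow> linear (Xd v)"
  using has_derivative_linear[OF has_derivative_xpt] .

context
  fixes z :: "'n euclid1"
  assumes z: "norm z = 1"
begin

lemma linear_aop: "linear (aop z)"
proof -
  interpret H: linear "hess h z" by (rule linear_hess_h[OF z0[OF z]])
  show ?thesis by (rule linearI) (auto simp: aop_def H.add H.scale algebra_simps)
qed

lemma aop_sym: "aop z a \<bullet> b = a \<bullet> aop z b"
  by (simp add: aop_def inner_simps hess_sym[OF z0[OF z]])

lemma aop_perp: "e \<bullet> z = 0 \<Longrightarrow> aop z e \<bullet> z = 0"
  by (simp add: aop_def inner_diff_left hess_perp[OF z0[OF z]])

lemma aop_pos: "e \<bullet> z = 0 \<Longrightarrow> e \<noteq> 0 \<Longrightarrow> aop z e \<bullet> e > 0"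
  using strict[OF z] by (simp add: aop_def inner_diff_left)

lemma fst_Xd: "fst (Xd z e) = dtp z e *\<^sub>R z - aop z e" and snd_Xd: "snd (Xd z e) = dtp z e"
  by (simp_all add: Xd_def aop_def)

lemma mink_Xd_null: "e \<bullet> z = 0 \<Longrightarrow> mink (Xd z e) (z, 1) = 0"
  by (simp add: mink_def fst_Xd snd_Xd inner_diff_left zz[OF z] aop_perp)

lemma mink_Xd_xpt: "e \<bullet> z = 0 \<Longrightarrow> mink (Xd z e) (xpt h z) = 0"
proof -
  assume e: "e \<bullet> z = 0"
  have "dtp z e * h z = gr h z \<bullet> aop z e" using pos[OF z] by (simp add: dtp_def aop_def)
  moreover have "mink (Xd z e) (xpt h z) = - dtp z e * h z + aop z e \<bullet> gr h z"
    using aop_perp[OF e]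
    by (simp add: mink_def fst_Xd snd_Xd fst_xpt[OF z] snd_xpt[OF z] inner_simps zz[OF z]
        euler[OF z0[OF z]] inner_commute[of z "gr h z"] algebra_simps)
  ultimately show ?thesis by (simp add: inner_commute)
qed

lemma mink_Xd_nu: "e \<bullet> z = 0 \<Longrightarrow> mink (Xd z e) (nu z) = 0"
  by (simp add: nu_def mink_simps mink_Xd_null mink_Xd_xpt del: scaleR_Pair)

text \<open>The z-component and the time component are equal and cancel in \<open>mink\<close>. So
  the induced metric pulls back to the square of \<open>aop z\<close>, whose determinant is
  therefore the area density.\<close>

lemma mink_Xd_Xd: "a \<bullet> z = 0 \<Longrightarrow> b \<bullet> z = 0 \<Longrightarrow> mink (Xd z a) (Xd z b) = aop z a \<bullet> aop z b"
  using aop_perp[of a] aop_perp[of b]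
  by (simp add: mink_def fst_Xd snd_Xd inner_simps zz[OF z] inner_commute[of z "aop z a"] inner_commute[of z "aop z b"])

lemma Xd_radial: "Xd z z = (0, - tpt h z)"
proof -
  have "dtp z z = - tpt h z"
    using pos[OF z] by (simp add: dtp_def hess_radial[OF z0[OF z]] euler[OF z0[OF z]])
  then show ?thesis by (simp add: Xd_def hess_radial[OF z0[OF z]])
qed

lemma aop_eq_0_iff: "e \<bullet> z = 0 \<Longrightarrow> aop z e = 0 \<longleftrightarrow> e = 0"
  using aop_pos[of e] linear_0[OF linear_aop] by force

text \<open>Injective on the whole space and not only on the complement of z: along the ray of z the
  spatial part of \<open>xpt h\<close> is constant while its time coordinate is homogeneous of
  degree -1. A left inverse of \<open>Xd z\<close> is what differentiates the inverse map
  below.\<close>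

lemma inj_Xd: "inj (Xd z)"
  unfolding linear_injective_0[OF linear_Xd[OF z0[OF z]]]
proof (intro allI impI)
  fix e assume *: "Xd z e = 0"
  interpret X: linear "Xd z" by (rule linear_Xd[OF z0[OF z]])
  define p c where "p = e - (e \<bullet> z) *\<^sub>R z" and "c = e \<bullet> z"
  have pz: "p \<bullet> z = 0" by (simp add: p_def inner_diff_left zz[OF z])
  have ep: "e = p + c *\<^sub>R z" by (simp add: p_def c_def)
  have X: "Xd z p + c *\<^sub>R (0, - tpt h z) = 0" using * unfolding ep by (simp add: X.add X.scale Xd_radial)
  then have "dtp z p *\<^sub>R z - aop z p = 0" using fst_Xd[of p] by (simp add: prod_eq_iff)
  then have eq: "dtp z p *\<^sub>R z = aop z p" by simp
  then have "dtp z p = 0" using aop_perp[OF pz] zz[OF z] by (metis inner_scaleR_left mult.right_neutral)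
  then have "p = 0" using eq aop_eq_0_iff[OF pz] by simp
  then have "c *\<^sub>R (0 :: 'n euclid1, - tpt h z) = 0" using X by (simp add: X.zero del: scaleR_Pair)
  then have "c * tpt h z = 0" by (simp add: zero_prod_def)
  then have "c = 0" using tpt_pos[OF z] by simp
  then show "e = 0" using ep \<open>p = 0\<close> by simp
qed

end

lemma has_derivative_nu:
  assumes z: "norm z = 1"
  shows "(nu has_derivative nud z) (at z)"
proof -
  have hp: "h z > 0" by (rule pos[OF z])
  have 1: "((\<lambda>z. 1 / h z) has_derivative (\<lambda>e. - (gr h z \<bullet> e) / (h z)^2)) (at z)"
    by (rule has_derivative_eq_rhs, rule has_derivative_divide'[OF has_derivative_const has_derivative_h[OF z0[OF z]]])
      (use hp in \<open>auto simp: power2_eq_square\<close>)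
  have 2: "((\<lambda>z. (z, 1::real)) has_derivative (\<lambda>e. (e, 0))) (at z)"
    by (intro has_derivative_Pair has_derivative_ident has_derivative_const)
  have "((\<lambda>z. xpt h z - (1 / h z) *\<^sub>R (z, 1)) has_derivative
      (\<lambda>e. Xd z e - ((1 / h z) *\<^sub>R (e, 0) + (- (gr h z \<bullet> e) / (h z)^2) *\<^sub>R (z, 1)))) (at z)"
    by (intro has_derivative_diff has_derivative_xpt z0[OF z] has_derivative_scaleR 1 2)
  moreover have "Xd z e - ((1 / h z) *\<^sub>R (e, 0) + (- (gr h z \<bullet> e) / (h z)^2) *\<^sub>R (z, 1)) = nud z e" for e
    by (simp add: nud_def)
  ultimately show ?thesis unfolding nu_def[abs_def] by (simp only:)
qed

text \<open>The horospherical Gauss map of the boundary.\<close>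

definition Zp :: "'n minkowski \<Rightarrow> 'n euclid1" where
  "Zp = inv_into {z. norm z = 1} (xpt h)"

lemma Zp_xpt: "norm z = 1 \<Longrightarrow> Zp (xpt h z) = z"
  unfolding Zp_def by (rule inv_into_f_f[OF inj_on_xpt]) simp

lemma Zp_bd: "X \<in> bd (hdom h) \<Longrightarrow> norm (Zp X) = 1 \<and> xpt h (Zp X) = X"
  unfolding bd_hdom using Zp_xpt by auto

lemma unit_sphere_eq: "{z :: 'n euclid1. norm z = 1} = sphere 0 1"
  by (rule set_eqI) simp

lemma continuous_on_xpt: "continuous_on {z. norm z = 1} (xpt h)"
  by (rule continuous_on_subset[OF smooth_on_continuous_on[OF smooth_xpt]]) auto

lemma continuous_on_Zp: "continuous_on (bd (hdom h)) Zp"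
  unfolding bd_hdom
  by (rule continuous_on_inv[OF continuous_on_xpt]) (simp_all add: unit_sphere_eq Zp_xpt)

text \<open>A left inverse of \<open>Xd z\<close> is a derivative of the inverse parametrization
  within the boundary, whose continuity comes from compactness of the sphere.\<close>

lemma has_derivative_Zp:
  assumes z: "norm z = 1"
  shows "\<exists>g'. linear g' \<and> g' \<circ> Xd z = id \<and> (Zp has_derivative g') (at (xpt h z) within bd (hdom h))"
proof -
  obtain g' where g': "linear g'" "g' \<circ> Xd z = id"
    using linear_injective_left_inverse[OF linear_Xd[OF z0[OF z]] inj_Xd[OF z]] by blast
  have "(Zp has_derivative g') (at (xpt h z) within xpt h ` {z. norm z = 1})"
  proof (rule has_derivative_inverse_within)
    show "(xpt h has_derivative Xd z) (at z within {z. norm z = 1})"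
      by (rule has_derivative_at_withinI[OF has_derivative_xpt[OF z0[OF z]]])
    show "continuous (at (xpt h z) within xpt h ` {z. norm z = 1}) Zp"
      using continuous_on_Zp z unfolding bd_hdom continuous_on_eq_continuous_within by blast
  qed (use z g' Zp_xpt in auto)
  then show ?thesis using g' unfolding bd_hdom by blast
qed

lemma bd_curve:
  assumes z: "norm z = 1" and e: "e \<bullet> z = 0"
  shows "\<exists>\<gamma>. \<gamma> 0 = xpt h z \<and> (\<forall>t. \<gamma> t \<in> bd (hdom h)) \<and> (\<gamma> has_vector_derivative Xd z e) (at (0::real))"
proof -
  obtain s where s: "s 0 = z" "\<And>t. norm (s t) = 1" "(s has_vector_derivative e) (at (0::real))"
    using sphere_curve[OF z e] by blast
  have "((\<lambda>t. xpt h (s t)) has_derivative (\<lambda>t. Xd z (t *\<^sub>R e))) (at 0)"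
    using has_derivative_compose[OF s(3)[unfolded has_vector_derivative_def], of "xpt h" "Xd z"] has_derivative_xpt[OF z0[OF z]] s(1)
    by simp
  then have "((\<lambda>t. xpt h (s t)) has_vector_derivative Xd z e) (at 0)"
    unfolding has_vector_derivative_def by (simp add: linear_scale[OF linear_Xd[OF z0[OF z]]])
  then show ?thesis using s(1,2) unfolding bd_hdom by (intro exI[of _ "\<lambda>t. xpt h (s t)"]) auto
qed

text \<open>A boundary curve is \<open>xpt h\<close> of the spherical curve traced by
  \<open>Zp\<close>, whose velocity is orthogonal to z; the other inclusion moves z along a great
  circle.\<close>

lemma bd_tangent_hdom:
  assumes z: "norm z = 1"
  shows "bd_tangent (hdom h) (xpt h z) = Xd z ` {e. e \<bullet> z = 0}"
proof (rule set_eqI)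
  fix v
  show "v \<in> bd_tangent (hdom h) (xpt h z) \<longleftrightarrow> v \<in> Xd z ` {e. e \<bullet> z = 0}"
  proof
    assume "v \<in> bd_tangent (hdom h) (xpt h z)"
    then obtain \<gamma> :: "real \<Rightarrow> 'n minkowski" and \<epsilon> where g: "\<epsilon> > 0" "\<gamma> 0 = xpt h z"
      "\<And>t. \<bar>t\<bar> < \<epsilon> \<Longrightarrow> \<gamma> t \<in> bd (hdom h)" "(\<gamma> has_vector_derivative v) (at 0)"
      by (auto simp: bd_tangent_def)
    obtain g' where g': "linear g'" "g' \<circ> Xd z = id" "(Zp has_derivative g') (at (xpt h z) within bd (hdom h))"
      using has_derivative_Zp[OF z] by blast
    let ?I = "{-\<epsilon><..<\<epsilon>}"
    have oI: "open ?I" "0 \<in> ?I" using g(1) by auto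
    have gI: "\<gamma> ` ?I \<subseteq> bd (hdom h)" using g(3) by auto
    have dg: "(\<gamma> has_derivative (\<lambda>t. t *\<^sub>R v)) (at 0 within ?I)"
      using g(4) unfolding has_vector_derivative_def by (rule has_derivative_at_withinI)
    have "(Zp has_derivative g') (at (\<gamma> 0) within \<gamma> ` ?I)"
      unfolding g(2) by (rule has_derivative_subset[OF g'(3) gI])
    from diff_chain_within[OF dg this]
    have dZ: "((\<lambda>t. Zp (\<gamma> t)) has_derivative (\<lambda>t. g' (t *\<^sub>R v))) (at 0)"
      unfolding at_within_open[OF oI(2,1)] by (simp add: o_def)
    define e where "e = g' v"
    have dZ: "((\<lambda>t. Zp (\<gamma> t)) has_derivative (\<lambda>t. t *\<^sub>R e)) (at 0)"
      using dZ by (simp add: linear_scale[OF g'(1)] e_def)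
    have Z0: "Zp (\<gamma> 0) = z" using g(2) Zp_xpt[OF z] by simp
    have "((\<lambda>t. Zp (\<gamma> t) \<bullet> Zp (\<gamma> t)) has_derivative (\<lambda>t. z \<bullet> (t *\<^sub>R e) + (t *\<^sub>R e) \<bullet> z)) (at 0)"
      using has_derivative_inner[OF dZ dZ] Z0 by simp
    moreover have "((\<lambda>t. Zp (\<gamma> t) \<bullet> Zp (\<gamma> t)) has_derivative (\<lambda>t. 0)) (at 0)"
    proof (rule has_derivative_transform_within_open[OF has_derivative_const oI])
      show "1 = Zp (\<gamma> t) \<bullet> Zp (\<gamma> t)" if "t \<in> ?I" for t
      proof -
        have "\<gamma> t \<in> bd (hdom h)" using gI that by blast
        from Zp_bd[OF this] show ?thesis by (simp add: dot_square_norm)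
      qed
    qed
    ultimately have "(\<lambda>t. z \<bullet> (t *\<^sub>R e) + (t *\<^sub>R e) \<bullet> z) = (\<lambda>t::real. 0)" by (rule has_derivative_unique)
    from fun_cong[OF this, of 1] have ez: "e \<bullet> z = 0" by (simp add: inner_commute)
    have "((\<lambda>t. xpt h (Zp (\<gamma> t))) has_derivative (\<lambda>t. Xd z (t *\<^sub>R e))) (at 0)"
      using has_derivative_compose[OF dZ, of "xpt h" "Xd z"] has_derivative_xpt[OF z0[OF z]] Z0 by simp
    then have "(\<gamma> has_derivative (\<lambda>t. Xd z (t *\<^sub>R e))) (at 0)"
      by (rule has_derivative_transform_within_open[OF _ oI]) (use gI Zp_bd in blast)
    with g(4) have "(\<lambda>t. t *\<^sub>R v) = (\<lambda>t. Xd z (t *\<^sub>R e))"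
      unfolding has_vector_derivative_def by (rule has_derivative_unique)
    from fun_cong[OF this, of 1] show "v \<in> Xd z ` {e. e \<bullet> z = 0}" using ez by auto
  next
    assume "v \<in> Xd z ` {e. e \<bullet> z = 0}"
    then obtain e where e: "e \<bullet> z = 0" "v = Xd z e" by auto
    then show "v \<in> bd_tangent (hdom h) (xpt h z)"
      using bd_curve[OF z e(1)] unfolding bd_tangent_def by (auto intro!: exI[of _ "1::real"])
  qed
qed

lemma outward_normal_hdom:
  assumes z: "norm z = 1"
  shows "outward_normal (hdom h) (xpt h z) = nu z"
proof (rule outward_normal_eqI[OF mink_nu(1,2)[OF z] _ _ _ nu_geodesic(2)[OF z]])
  show "mink (nu z) u = 0" if u: "u \<in> bd_tangent (hdom h) (xpt h z)" for u
  proof -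
    obtain e where "e \<bullet> z = 0" "u = Xd z e" using u unfolding bd_tangent_hdom[OF z] by blast
    then show ?thesis using mink_Xd_nu[OF z] mink_commute[of "nu z" "Xd z e"] by simp
  qed
  show "\<exists>e>0. \<forall>t. 0 < t \<and> t < e \<longrightarrow> hyp_geodesic (xpt h z) (nu z) t \<notin> hdom h"
    using nu_geodesic(1)[OF z] by (intro exI[of _ "1::real"]) simp
  fix w assume w: "mink (xpt h z) w = 0" "mink (nu z) w = 0"
    and wu: "\<And>u. u \<in> bd_tangent (hdom h) (xpt h z) \<Longrightarrow> mink w u = 0"
  have wX: "mink w (xpt h z) = 0" and wn: "mink w (nu z) = 0"
    using w mink_commute[of w "xpt h z"] mink_commute[of w "nu z"] by simp_all
  have "mink w ((1 / h z) *\<^sub>R (z, 1)) = 0"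
    using wX wn unfolding nu_def by (simp only: mink_simps)
  then have wz: "fst w \<bullet> z = snd w" using pos[OF z] by (simp add: mink_def)
  have wT: "mink w (Xd z e) = 0" if "e \<bullet> z = 0" for e
    using wu that unfolding bd_tangent_hdom[OF z] by blast
  \<comment> \<open>Since w is orthogonal to (z, 1), it equals (p, 0) up to a multiple of (z, 1)
    with p orthogonal to z. Testing with \<open>Xd z p\<close> gives p . \<open>aop z p\<close> = 0,
    and positivity forces p = 0.\<close>
  define p where "p = fst w - snd w *\<^sub>R z"
  have pz: "p \<bullet> z = 0" using wz zz[OF z] by (simp add: p_def inner_diff_left)
  have "mink w (Xd z p) = - (p \<bullet> aop z p)"
  proof -
    have "fst w = p + snd w *\<^sub>R z" by (simp add: p_def)
    then show ?thesis
      using pz aop_perp[OF z pz] zz[OF z]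
      by (simp add: mink_def fst_Xd[OF z] snd_Xd[OF z] inner_simps inner_commute[of z "aop z p"])
  qed
  then have "p = 0" using wT[OF pz] aop_pos[OF z pz] by (force simp: inner_commute)
  then have w': "w = snd w *\<^sub>R (z, 1)" by (simp add: p_def prod_eq_iff)
  then have "snd w * mink (z, 1) (xpt h z) = 0" using wX by (metis mink_scale_left)
  then have "snd w = 0" using mink_xpt_null[OF z] pos[OF z] by (simp add: mink_commute)
  then have "snd w *\<^sub>R (z, 1::real) = 0" by (simp add: zero_prod_def)
  then show "w = 0" using w' by (rule trans[rotated])
qed

lemma weingarten_hdom:
  assumes z: "norm z = 1" and e: "e \<bullet> z = 0"
  shows "weingarten (hdom h) (xpt h z) (Xd z e) = nud z e"
proof -
  obtain g' where g': "linear g'" "g' \<circ> Xd z = id" "(Zp has_derivative g') (at (xpt h z) within bd (hdom h))"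
    using has_derivative_Zp[OF z] by blast
  have zb: "xpt h z \<in> bd (hdom h)" using z unfolding bd_hdom by blast
  have D: "((\<lambda>X. nu (Zp X)) has_derivative (\<lambda>v. nud z (g' v))) (at (xpt h z) within bd (hdom h))"
    using has_derivative_compose[OF g'(3), of nu "nud z"] has_derivative_nu[OF z] Zp_xpt[OF z] by simp
  have D': "(outward_normal (hdom h) has_derivative (\<lambda>v. nud z (g' v))) (at (xpt h z) within bd (hdom h))"
  proof (rule has_derivative_transform[OF zb _ D])
    show "outward_normal (hdom h) X = nu (Zp X)" if "X \<in> bd (hdom h)" for X
      using outward_normal_hdom[of "Zp X"] Zp_bd[OF that] by simp
  qed
  obtain \<gamma> where g: "\<gamma> 0 = xpt h z \<and> (\<forall>t. \<gamma> t \<in> bd (hdom h)) \<and> (\<gamma> has_vector_derivative Xd z e) (at (0::real))"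
    using bd_curve[OF z e] by (elim exE) (rule that)
  have "frechet_derivative (outward_normal (hdom h)) (at (xpt h z) within bd (hdom h)) (Xd z e) = nud z (g' (Xd z e))"
    by (rule frechet_derivative_within_curve[OF D' _ zero_less_one, of \<gamma>]) (use g in simp_all)
  also have "g' (Xd z e) = e" using fun_cong[OF g'(2), of e] by simp
  finally show ?thesis by (simp add: weingarten_def)
qed

end

lemma cosh_radius: "X \<in> hyp \<Longrightarrow> cosh (radius X) = snd X"
  using hyp_ge1[of X] by (simp add: radius_def hyp_dist_def hyp_origin_def mink_def cosh_arcosh_real)

lemma sinh_radius_radial_field:
  assumes X: "X \<in> hyp"
  shows "sinh (radius X) *\<^sub>R radial_field X = snd X *\<^sub>R X - (0, 1)"
proof -
  have t: "snd X \<ge> 1" by (rule hyp_ge1[OF X])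
  have r: "radius X = arcosh (snd X)" by (simp add: radius_def hyp_dist_def hyp_origin_def mink_def)
  have s: "sinh (radius X) = norm (fst X)"
    using t hyp_norm[OF X] by (simp add: r sinh_arcosh_real real_sqrt_unique)
  have n: "norm (fst X) *\<^sub>R sgn (fst X) = fst X" by (cases "fst X = 0") (simp_all add: sgn_div_norm)
  have "sinh (radius X) *\<^sub>R (cosh (radius X) *\<^sub>R sgn (fst X)) = snd X *\<^sub>R fst X"
    unfolding s cosh_radius[OF X] using n by (metis scaleR_left_commute)
  moreover have "sinh (radius X) * sinh (radius X) = snd X * snd X - 1"
    unfolding s using hyp_norm[OF X] by (simp add: power2_eq_square)
  ultimately show ?thesis by (simp add: radial_field_def prod_eq_iff)
qed

lemma continuous_on_lin_det:
  fixes f :: "'b::topological_space \<Rightarrow> 'a::euclidean_space \<Rightarrow> 'a"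
  assumes "\<And>v. continuous_on S (\<lambda>x. f x v)"
  shows "continuous_on S (\<lambda>x. lin_det (f x))"
proof -
  have 1: "continuous_on S (\<lambda>x. to_vec (f x v) $ i)" for v i
    by (intro continuous_on_component continuous_on_compose2[OF linear_continuous_on[OF bounded_linear_vec(1)] assms]) auto
  show ?thesis
    unfolding lin_det_def det_def matrix_def
    by (intro continuous_on_sum continuous_on_mult continuous_on_prod continuous_on_const) (simp add: 1)
qed

context h_body
begin

section \<open>Principal curvatures and the integrand of V\<close>

definition Ah :: "'n euclid1 \<Rightarrow> 'n euclid1 \<Rightarrow> 'n euclid1" where
  "Ah z e = hess h z e - tpt h z *\<^sub>R e + ((tpt h z + 1) * (e \<bullet> z)) *\<^sub>R z"

text \<open>\<open>Ah z\<close> and \<open>Bh z\<close> act on the complement of z as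
  \<open>aop z\<close> and as the Hessian, and both fix z, so that determinants on the full space
  compute the tangential ones.\<close>

definition Bh :: "'n euclid1 \<Rightarrow> 'n euclid1 \<Rightarrow> 'n euclid1" where
  "Bh z e = hess h z e + (e \<bullet> z) *\<^sub>R z"

text \<open>Relative to the spherical measure, the numerator is n + 1 times the cone volume density
  of the Euclidean body, and the denominator is the area density of the boundary.\<close>

definition dens :: "'n euclid1 \<Rightarrow> real" where
  "dens z = h z * lin_det (Bh z) / lin_det (Ah z)"

lemma linear_Ah: "z \<noteq> 0 \<Longrightarrow> linear (Ah z)" and linear_Bh: "z \<noteq> 0 \<Longrightarrow> linear (Bh z)"
proof -
  assume "z \<noteq> 0"
  then interpret H: linear "hess h z" by (rule linear_hess_h)
  show "linear (Ah z)" by (rule linearI) (auto simp: Ah_def H.add H.scale algebra_simps inner_add_left scaleR_add_left)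
  show "linear (Bh z)" by (rule linearI) (auto simp: Bh_def H.add H.scale algebra_simps inner_add_left scaleR_add_left)
qed

context
  fixes z :: "'n euclid1"
  assumes z: "norm z = 1"
begin

lemma aop_eigenbasis:
  obtains B l where "pairwise orthogonal B" "\<And>b. b \<in> B \<Longrightarrow> norm b = 1" "span B = {e. e \<bullet> z = 0}"
    "\<And>b. b \<in> B \<Longrightarrow> b \<bullet> z = 0" "\<And>b. b \<in> B \<Longrightarrow> aop z b = l b *\<^sub>R b" "\<And>b. b \<in> B \<Longrightarrow> l b > 0"
    "finite B" "card B = CARD('n)"
proof -
  let ?S = "{e. e \<bullet> z = 0}"
  have S: "subspace ?S" by (auto simp: subspace_def inner_add_left)
  have "\<exists>B. B \<subseteq> ?S \<and> pairwise orthogonal B \<and> (\<forall>b\<in>B. norm b = 1) \<and> span B = ?S \<and> (\<forall>b\<in>B. \<exists>l. aop z b = l *\<^sub>R b)"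
  proof (rule selfadjoint_eigenbasis[OF S linear_aop[OF z]])
    show "aop z x \<in> ?S" if "x \<in> ?S" for x using aop_perp[OF z] that by simp
    show "aop z x \<bullet> y = x \<bullet> aop z y" for x y by (rule aop_sym[OF z])
  qed
  then obtain B where B: "B \<subseteq> ?S" "pairwise orthogonal B" "\<forall>b\<in>B. norm b = 1" "span B = ?S"
    "\<forall>b\<in>B. \<exists>l. aop z b = l *\<^sub>R b" by blast
  then obtain l where l: "\<And>b. b \<in> B \<Longrightarrow> aop z b = l b *\<^sub>R b" by metis
  have bz: "b \<bullet> z = 0" if "b \<in> B" for b using B(1) that by blast
  have fin: "finite B" "independent B"
    using orthonormal_expansion(1,2)[OF B(2), of 0] B(3) span_zero by blast+
  have "card B = dim (span B)" using dim_eq_card_independent[OF fin(2)] by simp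
  also have "span B = {e. z \<bullet> e = 0}" using B(4) by (simp add: inner_commute)
  also have "dim \<dots> = CARD('n)" using dim_hyperplane[OF z0[OF z]] by (simp add: DIM_prod)
  finally have card: "card B = CARD('n)" .
  have pos: "l b > 0" if b: "b \<in> B" for b
  proof -
    have bb: "b \<bullet> b = 1" using B(3) b by (simp add: dot_square_norm)
    then have "b \<noteq> 0" by auto
    then have "aop z b \<bullet> b > 0" using aop_pos[OF z bz[OF b]] by simp
    then show ?thesis using l[OF b] bb by simp
  qed
  show thesis
    by (rule that[of B l]) (use B bz l pos fin(1) card in auto)
qed

lemma lin_det_Ah_Bh:
  assumes B: "pairwise orthogonal B" "\<And>b. b \<in> B \<Longrightarrow> norm b = 1" "span B = {e. e \<bullet> z = 0}"
    "\<And>b. b \<in> B \<Longrightarrow> b \<bullet> z = 0" "\<And>b. b \<in> B \<Longrightarrow> aop z b = l b *\<^sub>R b" "finite B"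
  shows "lin_det (Ah z) = (\<Prod>b\<in>B. l b)" "lin_det (Bh z) = (\<Prod>b\<in>B. tpt h z + l b)"
proof -
  have zB: "z \<notin> B"
  proof
    assume "z \<in> B"
    from B(4)[OF this] show False using zz[OF z] by simp
  qed
  have orth: "pairwise orthogonal (insert z B)"
    using B(1,4) by (auto simp: pairwise_insert orthogonal_def inner_commute)
  have nrm: "norm b = 1" if "b \<in> insert z B" for b using B(2) z that by (metis insertE)
  have span: "span (insert z B) = UNIV"
  proof -
    have "x \<in> span (insert z B)" for x
    proof -
      have "x - (x \<bullet> z) *\<^sub>R z \<in> span B" unfolding B(3) by (simp add: inner_diff_left zz[OF z])
      then show ?thesis by (auto simp: span_insert)
    qed
    then show ?thesis by blast
  qed
  have hb: "hess h z b = (tpt h z + l b) *\<^sub>R b" if "b \<in> B" for b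
    using B(5)[OF that] by (simp add: aop_def algebra_simps)
  have "lin_det (Ah z) = (\<Prod>b\<in>insert z B. if b = z then 1 else l b)"
    by (rule lin_det_eigenbasis[OF linear_Ah[OF z0[OF z]] orth nrm span])
      (use zB hb B(4) in \<open>auto simp: Ah_def hess_radial[OF z0[OF z]] zz[OF z] algebra_simps\<close>)
  then show "lin_det (Ah z) = (\<Prod>b\<in>B. l b)"
    using zB B(6) by (simp cong: prod.cong) (auto intro!: prod.cong)
  have "lin_det (Bh z) = (\<Prod>b\<in>insert z B. if b = z then 1 else tpt h z + l b)"
    by (rule lin_det_eigenbasis[OF linear_Bh[OF z0[OF z]] orth nrm span])
      (use zB hb B(4) in \<open>auto simp: Bh_def hess_radial[OF z0[OF z]] zz[OF z]\<close>)
  then show "lin_det (Bh z) = (\<Prod>b\<in>B. tpt h z + l b)"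
    using zB B(6) by (simp cong: prod.cong) (auto intro!: prod.cong)
qed

lemma lin_det_Ah_pos: "lin_det (Ah z) > 0" and lin_det_Bh_pos: "lin_det (Bh z) > 0"
proof -
  obtain B l where B: "pairwise orthogonal B" "\<And>b. b \<in> B \<Longrightarrow> norm b = 1" "span B = {e. e \<bullet> z = 0}"
    "\<And>b. b \<in> B \<Longrightarrow> b \<bullet> z = 0" "\<And>b. b \<in> B \<Longrightarrow> aop z b = l b *\<^sub>R b" "\<And>b. b \<in> B \<Longrightarrow> l b > 0"
    "finite B" "card B = CARD('n)"
    by (rule aop_eigenbasis) blast
  have d: "lin_det (Ah z) = (\<Prod>b\<in>B. l b)" "lin_det (Bh z) = (\<Prod>b\<in>B. tpt h z + l b)"
    by (rule lin_det_Ah_Bh(1)[OF B(1-5,7)], assumption+, rule lin_det_Ah_Bh(2)[OF B(1-5,7)], assumption+)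
  show "lin_det (Ah z) > 0" unfolding d using B(6) by (intro prod_pos) auto
  show "lin_det (Bh z) > 0" unfolding d using B(6) tpt_pos[OF z] by (intro prod_pos add_pos_pos) auto
qed

text \<open>The difference w of both sides is orthogonal to X, so it vanishes as soon as it is a
  multiple of the null vector (z, 1). What remains is the part of w modulo (z, 1), which turns the
  curvature equation into an eigenvalue equation for \<open>aop z\<close>.\<close>

lemma nud_eq_iff:
  assumes e: "e \<bullet> z = 0"
  shows "nud z e = k *\<^sub>R Xd z e \<longleftrightarrow> (k - 1) *\<^sub>R aop z e - (1 / h z) *\<^sub>R e = 0"
proof -
  define w where "w = nud z e - k *\<^sub>R Xd z e"
  have hp: "h z > 0" by (rule pos[OF z])
  have snd_w: "snd w = (1 - k) * dtp z e + gr h z \<bullet> e / (h z)^2"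
    by (simp add: w_def nud_def snd_Xd[OF z] algebra_simps)
  have fst_w: "fst w = (1 - k) *\<^sub>R (dtp z e *\<^sub>R z - aop z e) - (1 / h z) *\<^sub>R e + (gr h z \<bullet> e / (h z)^2) *\<^sub>R z"
    by (simp add: w_def nud_def fst_Xd[OF z] algebra_simps)
  have pw: "fst w - snd w *\<^sub>R z = (k - 1) *\<^sub>R aop z e - (1 / h z) *\<^sub>R e"
    unfolding fst_w snd_w by (simp add: algebra_simps scaleR_add_left scaleR_diff_left)
  have e0: "mink (e, 0) (xpt h z) = - (gr h z \<bullet> e)"
    using e by (simp add: mink_def fst_xpt[OF z] inner_diff_right inner_commute)
  have wX: "mink w (xpt h z) = 0"
    using mink_Xd_xpt[OF z e] mink_xpt_null[OF z] e0 hp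
    by (simp add: w_def nud_def mink_simps mink_commute[of "(z, 1)" "xpt h z"] power2_eq_square del: scaleR_Pair)
  have "w = 0" if "fst w - snd w *\<^sub>R z = 0"
  proof -
    have weq: "w = snd w *\<^sub>R (z, 1)" using that by (simp add: prod_eq_iff)
    have "mink (snd w *\<^sub>R (z, 1)) (xpt h z) = 0" using wX weq by simp
    then have "snd w * h z = 0"
      using mink_xpt_null[OF z] by (simp add: mink_scale_left mink_commute[of "(z, 1)" "xpt h z"] del: scaleR_Pair)
    then have s0: "snd w = 0" using hp by simp
    show ?thesis using weq unfolding s0 by (simp add: zero_prod_def)
  qed
  then have "w = 0 \<longleftrightarrow> fst w - snd w *\<^sub>R z = 0" by auto
  then show ?thesis unfolding pw by (simp add: w_def)
qed

text \<open>For an eigenvalue l of \<open>aop z\<close> one has \<kappa> = 1 + 1 / (h l), and cosh r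
  = t, u = t - 1 / h. Thus each factor of \<open>p_n\<close> is (t + l) / (h l), while cosh r - u =
  1 / h; the powers of h combine to the single factor in \<open>dens\<close>.\<close>

lemma p_n_hdom:
  "p_n (hdom h) (xpt h z) / (cosh (radius (xpt h z)) - u_tilde (hdom h) (xpt h z)) ^ (CARD('n) + 1) = dens z"
proof -
  let ?K = "hdom h" and ?X = "xpt h z" and ?t = "tpt h z"
  have hp: "h z > 0" by (rule pos[OF z])
  obtain B l where B: "pairwise orthogonal B" "\<And>b. b \<in> B \<Longrightarrow> norm b = 1" "span B = {e. e \<bullet> z = 0}"
    "\<And>b. b \<in> B \<Longrightarrow> b \<bullet> z = 0" "\<And>b. b \<in> B \<Longrightarrow> aop z b = l b *\<^sub>R b" "\<And>b. b \<in> B \<Longrightarrow> l b > 0"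
    "finite B" "card B = CARD('n)"
    by (rule aop_eigenbasis) blast
  define \<kappa> where "\<kappa> b = 1 + 1 / (h z * l b)" for b
  have cr: "cosh (radius ?X) = ?t" using cosh_radius[OF xpt_hyp[OF z]] snd_xpt[OF z] by simp
  have ut: "u_tilde ?K ?X = ?t - 1 / h z"
  proof -
    have "u_tilde ?K ?X = mink (snd ?X *\<^sub>R ?X - (0, 1)) (nu z)"
      unfolding u_tilde_def sinh_radius_radial_field[OF xpt_hyp[OF z]] outward_normal_hdom[OF z] ..
    also have "\<dots> = snd (nu z)" using mink_nu(1)[OF z] by (simp add: mink_simps) (simp add: mink_def)
    also have "\<dots> = ?t - 1 / h z" by (simp add: nu_def snd_xpt[OF z])
    finally show ?thesis .
  qed
  have PS: "principal_space ?K ?X k = Xd z ` span {b \<in> B. \<kappa> b = k}" for k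
  proof -
    let ?f = "\<lambda>e. (k - 1) *\<^sub>R aop z e - (1 / h z) *\<^sub>R e"
    have "principal_space ?K ?X k = Xd z ` {e \<in> span B. ?f e = 0}"
    proof (rule set_eqI)
      fix v
      show "v \<in> principal_space ?K ?X k \<longleftrightarrow> v \<in> Xd z ` {e \<in> span B. ?f e = 0}"
        unfolding principal_space_def bd_tangent_hdom[OF z] B(3)
        using weingarten_hdom[OF z] nud_eq_iff by (force simp: image_iff)
    qed
    also have "{e \<in> span B. ?f e = 0} = span {b \<in> B. (k - 1) * l b - 1 / h z = 0}"
    proof (rule eigenbasis_kernel[OF B(1,2)])
      interpret A: linear "aop z" by (rule linear_aop[OF z])
      show "linear ?f" by (rule linearI) (auto simp: A.add A.scale algebra_simps)
    qed (simp_all add: B(5) algebra_simps)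
    also have "{b \<in> B. (k - 1) * l b - 1 / h z = 0} = {b \<in> B. \<kappa> b = k}"
    proof (intro Collect_cong conj_cong refl)
      fix b assume "b \<in> B"
      then have lb: "l b > 0" by (rule B(6))
      have "\<kappa> b = k \<longleftrightarrow> 1 / (h z * l b) = k - 1" by (auto simp: \<kappa>_def)
      also have "\<dots> \<longleftrightarrow> 1 = (k - 1) * (h z * l b)" using lb hp by (simp add: divide_eq_eq)
      also have "\<dots> \<longleftrightarrow> 1 / h z = (k - 1) * l b" using hp by (simp add: divide_eq_eq mult.commute mult.left_commute)
      finally show "(k - 1) * l b - 1 / h z = 0 \<longleftrightarrow> \<kappa> b = k" by auto
    qed
    finally show ?thesis .
  qed
  have d: "lin_det (Ah z) = (\<Prod>b\<in>B. l b)" "lin_det (Bh z) = (\<Prod>b\<in>B. tpt h z + l b)"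
    by (rule lin_det_Ah_Bh(1)[OF B(1-5,7)], assumption+, rule lin_det_Ah_Bh(2)[OF B(1-5,7)], assumption+)
  have ind: "independent B" using orthonormal_expansion(2)[OF B(1,2), of 0] span_zero by blast
  have dimPS: "dim (principal_space ?K ?X k) = card {b \<in> B. \<kappa> b = k}" for k
  proof -
    have "dim (Xd z ` span {b \<in> B. \<kappa> b = k}) = dim (span {b \<in> B. \<kappa> b = k})"
      by (rule dim_image_eq[OF linear_Xd[OF z0[OF z]]]) (rule inj_on_subset[OF inj_Xd[OF z]], simp)
    also have "\<dots> = card {b \<in> B. \<kappa> b = k}"
      using dim_eq_card_independent[OF independent_mono[OF ind]] by simp
    finally show ?thesis unfolding PS .
  qed
  have PC: "principal_curvatures ?K ?X = \<kappa> ` B"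
  proof (rule set_eqI)
    fix k
    show "k \<in> principal_curvatures ?K ?X \<longleftrightarrow> k \<in> \<kappa> ` B"
    proof
      assume "k \<in> principal_curvatures ?K ?X"
      then obtain v where v: "v \<in> Xd z ` span {b \<in> B. \<kappa> b = k}" "v \<noteq> 0"
        unfolding principal_curvatures_def PS by blast
      have "{b \<in> B. \<kappa> b = k} \<noteq> {}"
      proof
        assume E: "{b \<in> B. \<kappa> b = k} = {}"
        have "v = Xd z 0" using v(1) unfolding E by simp
        then show False using v(2) linear_0[OF linear_Xd[OF z0[OF z]]] by simp
      qed
      then show "k \<in> \<kappa> ` B" by blast
    next
      assume "k \<in> \<kappa> ` B"
      then obtain b where b: "b \<in> B" "\<kappa> b = k" by blast
      have "b \<noteq> 0" using B(2)[OF b(1)] by auto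
      then have "Xd z b \<noteq> 0"
        using inj_Xd[OF z] linear_0[OF linear_Xd[OF z0[OF z]]] by (metis injD)
      moreover have "Xd z b \<in> Xd z ` span {b \<in> B. \<kappa> b = k}" using b by (intro imageI span_base) simp
      ultimately show "k \<in> principal_curvatures ?K ?X" unfolding principal_curvatures_def PS by blast
    qed
  qed
  \<comment> \<open>The product over distinct curvatures with multiplicities is regrouped as a
    product over the eigenbasis.\<close>
  have "p_n ?K ?X = (\<Prod>k\<in>\<kappa> ` B. (?t * k - (?t - 1 / h z)) ^ card {b \<in> B. \<kappa> b = k})"
    unfolding p_n_def PC dimPS cr ut ..
  also have "\<dots> = (\<Prod>k\<in>\<kappa> ` B. \<Prod>b\<in>{b \<in> B. \<kappa> b = k}. ?t * \<kappa> b - (?t - 1 / h z))"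
    by (intro prod.cong refl) simp
  also have "\<dots> = (\<Prod>b\<in>B. ?t * \<kappa> b - (?t - 1 / h z))"
    by (rule prod.image_gen[OF B(7), symmetric])
  also have "\<dots> = (\<Prod>b\<in>B. (?t + l b) / (h z * l b))"
  proof (rule prod.cong[OF refl])
    fix b assume b: "b \<in> B"
    have "l b > 0" using B(6)[OF b] .
    then show "?t * \<kappa> b - (?t - 1 / h z) = (?t + l b) / (h z * l b)" using hp by (simp add: \<kappa>_def field_simps)
  qed
  also have "\<dots> = lin_det (Bh z) / (h z ^ CARD('n) * lin_det (Ah z))"
    unfolding d by (simp add: prod_dividef prod.distrib B(8))
  finally have p: "p_n ?K ?X = lin_det (Bh z) / (h z ^ CARD('n) * lin_det (Ah z))" .
  show ?thesis
    unfolding p cr ut dens_def using hp lin_det_Ah_pos by (simp add: power_divide field_simps)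
qed

lemma dens_pos: "dens z > 0"
  using lin_det_Ah_pos lin_det_Bh_pos pos[OF z] by (simp add: dens_def)

end

lemma continuous_on_dens: "continuous_on {z. norm z = 1} dens"
proof -
  have sub: "{z. norm z = 1} \<subseteq> - {0 :: 'n euclid1}" by auto
  have 1: "continuous_on {z. norm z = 1} h" "continuous_on {z. norm z = 1} (tpt h)"
    using smooth smooth_tpt smooth_on_continuous_on continuous_on_subset[OF _ sub] by blast+
  have 2: "continuous_on {z. norm z = 1} (\<lambda>z. hess h z v)" for v
    by (rule continuous_on_subset[OF smooth_on_continuous_on[OF smooth_on_hess[OF open_punctured smooth]] sub])
  have "lin_det (Ah z) \<noteq> 0" if "z \<in> {z. norm z = 1}" for z using that lin_det_Ah_pos[of z] by auto
  then show ?thesis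
    unfolding dens_def[abs_def]
    by (intro continuous_intros 1 continuous_on_lin_det ballI)
      (auto simp: Ah_def[abs_def] Bh_def[abs_def] intro!: continuous_intros 1 2)
qed

end

section \<open>The associated Euclidean body\<close>

text \<open>Radial part of the cone volume. The absolute value keeps the integrand nonnegative off
  the interval.\<close>

lemma nn_integral_power_unit: "(\<integral>\<^sup>+s. ennreal ((real n + 1) * \<bar>s\<bar> ^ n) * indicator {0<..1} s \<partial>lborel) = 1"
proof -
  have "(\<integral>\<^sup>+s. ennreal ((real n + 1) * \<bar>s\<bar> ^ n) * indicator {0<..1} s \<partial>lborel)
      = (\<integral>\<^sup>+s. ennreal ((real n + 1) * s ^ n) * indicator {0..1} s \<partial>lborel)"
    by (intro nn_integral_cong_AE AE_I[of _ _ "{0}"]) (auto split: split_indicator_asm simp: indicator_def)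
  also have "\<dots> = ennreal (1 ^ Suc n - 0 ^ Suc n)"
  proof (rule nn_integral_FTC_Icc)
    show "DERIV (\<lambda>s. s ^ Suc n) s :> (real n + 1) * s ^ n" for s :: real
      using DERIV_pow[of "Suc n" s] by (simp add: add.commute)
  qed auto
  finally show ?thesis by simp
qed

section \<open>Stereographic charts of the unit sphere\<close>

definition stereo :: "real \<Rightarrow> real ^ 'n \<Rightarrow> 'n::finite euclid1" where
  "stereo c x = (1 / (1 + x \<bullet> x)) *\<^sub>R (2 *\<^sub>R x, c * (x \<bullet> x - 1))"

text \<open>For c = 1 and c = -1 the two charts omit opposite poles, namely the points of the sphere
  with c times the last coordinate equal to 1.\<close>

definition stereo_inv :: "real \<Rightarrow> 'n::finite euclid1 \<Rightarrow> real ^ 'n" where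
  "stereo_inv c w = (1 / (1 - c * snd w)) *\<^sub>R fst w"

lemma one_plus_inner_pos: "1 + x \<bullet> x > (0::real)"
  by (simp add: add_pos_nonneg)

lemma norm_stereo: "c^2 = 1 \<Longrightarrow> norm (stereo c x) = 1"
proof -
  assume c: "c^2 = 1"
  let ?q = "x \<bullet> x"
  have "(norm (stereo c x))^2 = (1 / (1 + ?q))^2 * (4 * ?q + c^2 * (?q - 1)^2)"
    unfolding power2_norm_eq_inner by (simp add: stereo_def inner_prod_def power2_eq_square algebra_simps add_divide_distrib diff_divide_distrib)
  also have "4 * ?q + c^2 * (?q - 1)^2 = (1 + ?q)^2" unfolding c by (simp add: power2_eq_square algebra_simps)
  finally have "(norm (stereo c x))^2 = 1" using one_plus_inner_pos[of x] by (simp add: power_divide)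
  then show ?thesis using power2_eq_iff_nonneg[OF norm_ge_zero zero_le_one, of "stereo c x"] by simp
qed

lemma stereo_denom: "c^2 = 1 \<Longrightarrow> 1 - c * snd (stereo c x) = 2 / (1 + x \<bullet> x)"
  using one_plus_inner_pos[of x] by (simp add: stereo_def power2_eq_square field_simps)

lemma stereo_inv_stereo: "c^2 = 1 \<Longrightarrow> stereo_inv c (stereo c x) = x"
proof -
  assume c: "c^2 = 1"
  have f: "fst (stereo c x) = (2 / (1 + x \<bullet> x)) *\<^sub>R x" by (simp add: stereo_def)
  have "(1 / (2 / m)) *\<^sub>R ((2 / m) *\<^sub>R x) = x" if "m > 0" for m :: real using that by simp
  then show ?thesis
    unfolding stereo_inv_def stereo_denom[OF c] f using one_plus_inner_pos[of x] by blast
qed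

lemma stereo_stereo_inv:
  assumes c: "c^2 = 1" and w: "norm w = 1" "c * snd w \<noteq> 1"
  shows "stereo c (stereo_inv c w) = w"
proof -
  let ?d = "1 - c * snd w"
  have d: "?d \<noteq> 0" using w(2) by simp
  have ww: "fst w \<bullet> fst w = 1 - (snd w)^2"
    using w(1) by (simp add: norm_eq_sqrt_inner inner_prod_def power2_eq_square)
  have c2: "(c * snd w)^2 = (snd w)^2" by (simp add: power_mult_distrib c)
  have q: "stereo_inv c w \<bullet> stereo_inv c w = (1 + c * snd w) / ?d"
  proof -
    have "stereo_inv c w \<bullet> stereo_inv c w = (1 - (c * snd w)^2) / ?d^2"
      unfolding c2 by (simp add: stereo_inv_def ww power2_eq_square)
    also have "1 - (c * snd w)^2 = (1 + c * snd w) * ?d" by (simp add: power2_eq_square algebra_simps)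
    finally show ?thesis using d by (simp add: power2_eq_square)
  qed
  have 1: "1 + stereo_inv c w \<bullet> stereo_inv c w = 2 / ?d" unfolding q using d by (simp add: field_simps)
  have 2: "stereo_inv c w \<bullet> stereo_inv c w - 1 = 2 * (c * snd w) / ?d" unfolding q using d by (simp add: field_simps)
  have "(1 / (2 / m)) *\<^sub>R (2 *\<^sub>R ((1 / m) *\<^sub>R u)) = u" if "m \<noteq> 0" for m :: real and u :: "real ^ 'n"
    using that by simp
  from this[OF d] have "fst (stereo c (stereo_inv c w)) = fst w"
    unfolding stereo_def 1 by (simp add: stereo_inv_def)
  moreover have "snd (stereo c (stereo_inv c w)) = c^2 * snd w"
    unfolding stereo_def 1 2 using d by (simp add: power2_eq_square)
  ultimately show ?thesis unfolding c by (simp add: prod_eq_iff)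
qed

lemma snd_stereo_ne: "c^2 = 1 \<Longrightarrow> c * snd (stereo c x) \<noteq> 1"
  using stereo_denom[of c x] one_plus_inner_pos[of x] by auto

lemma smooth_stereo: "smooth_on UNIV (stereo c :: real ^ 'n \<Rightarrow> 'n::finite euclid1)"
  unfolding stereo_def[abs_def]
  by (intro smooth_on_scaleR smooth_on_divide smooth_on_Pair smooth_on_mult smooth_on_diff smooth_on_add
      smooth_on_inner smooth_on_const smooth_on_ident open_UNIV one_plus_inner_pos)

lemma continuous_on_stereo_inv:
  "(\<And>w. w \<in> S \<Longrightarrow> c * snd w \<noteq> 1) \<Longrightarrow> continuous_on S (stereo_inv c)"
  unfolding stereo_inv_def[abs_def] by (intro continuous_intros) (simp_all add: eq_diff_eq)

lemma has_derivative_stereo_inv: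
  fixes w :: "'n::finite euclid1"
  assumes "c * snd w \<noteq> 1"
  shows "\<exists>D. (stereo_inv c has_derivative D) (at w)"
proof -
  have 1: "((\<lambda>w :: 'n euclid1. 1 - c * snd w) has_derivative (\<lambda>e. - (c * snd e))) (at w)"
    by (auto intro!: derivative_eq_intros)
  have "1 - c * snd w \<noteq> 0" using assms by simp
  from has_derivative_scaleR[OF has_derivative_divide'[OF has_derivative_const[of 1] 1 this]
      has_derivative_fst[OF has_derivative_ident]]
  show ?thesis unfolding stereo_inv_def[abs_def] by blast
qed

lemma inj_frechet_stereo:
  assumes c: "c^2 = 1"
  shows "inj (fd (stereo c :: real ^ 'n \<Rightarrow> 'n::finite euclid1) x)"
proof -
  have d: "(stereo c has_derivative fd (stereo c) x) (at x)"
    by (rule smooth_on_has_derivative[OF smooth_stereo]) simp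
  obtain D where D: "(stereo_inv c has_derivative D) (at (stereo c x))"
    using has_derivative_stereo_inv[OF snd_stereo_ne[OF c, of x]] by blast
  have "((\<lambda>x. stereo_inv c (stereo c x)) has_derivative (\<lambda>e. D (fd (stereo c) x e))) (at x)"
    by (rule has_derivative_compose[OF d D])
  then have "((\<lambda>x. x) has_derivative (\<lambda>e. D (fd (stereo c) x e))) (at x)"
    by (simp add: stereo_inv_stereo[OF c])
  then have "(\<lambda>e. D (fd (stereo c) x e)) = (\<lambda>e. e)"
    by (rule has_derivative_unique) (rule has_derivative_ident)
  then show ?thesis by (metis injI)
qed

context h_body
begin

section \<open>Polar coordinates for the body with support function h\<close>

definition Khat :: "'n euclid1 set" where
  "Khat = {v. \<forall>z. norm z = 1 \<longrightarrow> v \<bullet> z \<le> h z}"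

text \<open>The contact ball gives t (1 - z . w) + \<open>gr h z\<close> . w \<le> h(w) with t > 0.
  So \<open>gr h z\<close> lies in the body, and z is its only outer normal direction.\<close>

lemma gr_inner_le:
  assumes z: "norm z = 1" and w: "norm w = 1"
  shows "gr h z \<bullet> w \<le> h w" and "gr h z \<bullet> w = h w \<Longrightarrow> w = z"
proof -
  have S: "- mink (xpt h z) (w, 1) = tpt h z * (1 - z \<bullet> w) + gr h z \<bullet> w"
    by (simp add: mink_def fst_xpt[OF z] snd_xpt[OF z] inner_diff_left algebra_simps)
  have zw: "z \<bullet> w \<le> 1" using norm_cauchy_schwarz[of z w] z w by simp
  have t: "tpt h z > 0" by (rule tpt_pos[OF z])
  have le: "tpt h z * (1 - z \<bullet> w) + gr h z \<bullet> w \<le> h w" using touch[OF z w] unfolding S .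
  moreover have p: "tpt h z * (1 - z \<bullet> w) \<ge> 0" using t zw by simp
  ultimately show "gr h z \<bullet> w \<le> h w" by simp
  assume "gr h z \<bullet> w = h w"
  then have "tpt h z * (1 - z \<bullet> w) = 0" using le p by simp
  then have "z \<bullet> w = 1" using t by simp
  then have "(norm (w - z))^2 = 0"
    using z w by (simp add: power2_norm_eq_inner inner_simps inner_commute[of w z])
      (simp add: power2_norm_eq_inner[symmetric])
  then show "w = z" by simp
qed

text \<open>Choose z maximizing v . w / h(w), with maximum s. Then s h(u) - v . u is nonnegative and
  vanishes at z, and the vanishing of its gradient is v = s \<open>gr h z\<close>.\<close>

lemma polar_exists:
  assumes v: "v \<noteq> 0"
  shows "\<exists>z s. norm z = 1 \<and> s > 0 \<and> v = s *\<^sub>R gr h z"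
proof -
  have cont: "continuous_on (sphere 0 1) (\<lambda>w. v \<bullet> w / h w)"
    by (intro continuous_intros continuous_on_h) (use pos in force)
  have ne: "sphere (0::'n euclid1) 1 \<noteq> {}" using exists_unit by auto
  obtain z where z: "norm z = 1" and max: "\<And>w. norm w = 1 \<Longrightarrow> v \<bullet> w / h w \<le> v \<bullet> z / h z"
    using continuous_attains_sup[OF compact_sphere ne cont] unfolding unit_sphere_eq[symmetric] by blast
  define s where "s = v \<bullet> z / h z"
  have hz: "h z > 0" by (rule pos[OF z])
  have s: "s > 0"
  proof -
    let ?w = "v /\<^sub>R norm v"
    have w: "norm ?w = 1" using v by simp
    have "0 < v \<bullet> ?w / h ?w" using v pos[OF w] by (simp add: dot_square_norm)
    then show ?thesis using max[OF w] by (simp add: s_def)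
  qed
  have le: "v \<bullet> u \<le> s * h u" if u: "u \<noteq> 0" for u
  proof -
    let ?w = "u /\<^sub>R norm u"
    have w: "norm ?w = 1" using u by simp
    have "v \<bullet> ?w \<le> s * h ?w" using max[OF w] pos[OF w] by (simp add: s_def[symmetric] pos_divide_le_eq)
    then have "norm u * (v \<bullet> ?w) \<le> norm u * (s * h ?w)" by (rule mult_left_mono) simp
    also have "\<dots> = s * (norm u * h ?w)" by (rule mult.left_commute)
    also have "norm u * h ?w = h u" using homog[of "norm u" ?w] u by simp
    also have "norm u * (v \<bullet> ?w) = v \<bullet> u" using u by simp
    finally show ?thesis .
  qed
  let ?g = "\<lambda>u. s * h u - v \<bullet> u"
  have d: "(?g has_derivative (\<lambda>e. s * (gr h z \<bullet> e) - v \<bullet> e)) (at z)"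
    by (intro has_derivative_diff has_derivative_mult_right has_derivative_h z0[OF z] has_derivative_inner_right has_derivative_ident)
  have "(\<lambda>e. s * (gr h z \<bullet> e) - v \<bullet> e) = (\<lambda>e. 0)"
  proof (rule has_derivative_local_min[OF d])
    have "eventually (\<lambda>u. u \<in> - {0}) (at z)"
      using open_punctured z0[OF z] by (intro eventually_at_in_open') auto
    then show "eventually (\<lambda>u. ?g z \<le> ?g u) (at z)"
    proof eventually_elim
      case (elim u)
      have "?g z = 0" using hz by (simp add: s_def)
      then show ?case using le[of u] elim by simp
    qed
  qed
  then have "(s *\<^sub>R gr h z - v) \<bullet> e = 0" for e by (drule_tac fun_cong[where x = e]) (simp add: inner_diff_left)
  then have "s *\<^sub>R gr h z = v" by (metis inner_eq_zero_iff right_minus_eq)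
  then show ?thesis using z s by blast
qed

lemma polar_unique:
  assumes z: "norm z = 1" and w: "norm w = 1" and s: "s > 0" and t: "t > 0"
    and eq: "s *\<^sub>R gr h z = t *\<^sub>R gr h w"
  shows "s = t \<and> z = w"
proof -
  have le: "a \<le> b" if "norm x = 1" "norm y = 1" "a > 0" "b > 0" "a *\<^sub>R gr h x = b *\<^sub>R gr h y" for a b x y
  proof -
    have "a * h x = (a *\<^sub>R gr h x) \<bullet> x" using euler[OF z0[OF that(1)]] by simp
    also have "\<dots> = b * (gr h y \<bullet> x)" unfolding that(5) by simp
    also have "\<dots> \<le> b * h x" using gr_inner_le(1)[OF that(2,1)] that(4) by simp
    finally show ?thesis using pos[OF that(1)] by simp
  qed
  have st: "s = t" using le[OF z w s t eq] le[OF w z t s eq[symmetric]] by simp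
  then have "gr h z = gr h w" using eq t by simp
  then have "gr h z \<bullet> w = h w" using euler[OF z0[OF w]] by simp
  then show ?thesis using gr_inner_le(2)[OF z w] st by simp
qed

text \<open>Unit length is demanded for v = 0 too, so that \<open>Pz v\<close> is always a
  direction.\<close>

definition Pz :: "'n euclid1 \<Rightarrow> 'n euclid1" where
  "Pz v = (SOME z. norm z = 1 \<and> (v \<noteq> 0 \<longrightarrow> (\<exists>s>0. v = s *\<^sub>R gr h z)))"

text \<open>The Minkowski gauge of \<open>Khat\<close>, evaluated in the maximizing
  direction.\<close>

definition sc :: "'n euclid1 \<Rightarrow> real" where
  "sc v = v \<bullet> Pz v / h (Pz v)"

lemma Pz: "norm (Pz v) = 1" "v \<noteq> 0 \<Longrightarrow> sc v > 0 \<and> v = sc v *\<^sub>R gr h (Pz v)"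
proof -
  have "\<exists>z. norm z = 1 \<and> (v \<noteq> 0 \<longrightarrow> (\<exists>s>0. v = s *\<^sub>R gr h z))"
    using polar_exists[of v] exists_unit by blast
  from someI_ex[OF this] have P: "norm (Pz v) = 1" "v \<noteq> 0 \<Longrightarrow> \<exists>s>0. v = s *\<^sub>R gr h (Pz v)"
    unfolding Pz_def[symmetric] by blast+
  show "norm (Pz v) = 1" by (rule P(1))
  assume "v \<noteq> 0"
  then obtain s where s: "s > 0" "v = s *\<^sub>R gr h (Pz v)" using P(2) by blast
  have "v \<bullet> Pz v = s * h (Pz v)"
    using arg_cong[OF s(2), of "\<lambda>u. u \<bullet> Pz v"] euler[OF z0[OF P(1)]] by simp
  then have "sc v = s" using pos[OF P(1)] by (simp add: sc_def)
  then show "sc v > 0 \<and> v = sc v *\<^sub>R gr h (Pz v)" using s by simp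
qed

lemma Pz_polar:
  assumes z: "norm z = 1" and s: "s > 0"
  shows "Pz (s *\<^sub>R gr h z) = z" "sc (s *\<^sub>R gr h z) = s" "s *\<^sub>R gr h z \<noteq> 0"
proof -
  have "gr h z \<bullet> z > 0" using euler[OF z0[OF z]] pos[OF z] by simp
  then show ne: "s *\<^sub>R gr h z \<noteq> 0" using s by auto
  have "sc (s *\<^sub>R gr h z) = s \<and> Pz (s *\<^sub>R gr h z) = z"
    using polar_unique[OF Pz(1) z _ s, of "sc (s *\<^sub>R gr h z)" "s *\<^sub>R gr h z"] Pz(2)[OF ne] by simp
  then show "Pz (s *\<^sub>R gr h z) = z" "sc (s *\<^sub>R gr h z) = s" by auto
qed

lemma sc_ge: "norm w = 1 \<Longrightarrow> v \<bullet> w \<le> sc v * h w"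
proof -
  assume w: "norm w = 1"
  show ?thesis
  proof (cases "v = 0")
    case False
    then have "v \<bullet> w = sc v * (gr h (Pz v) \<bullet> w)" using Pz(2)[OF False] by (metis inner_scaleR_left)
    also have "\<dots> \<le> sc v * h w" using gr_inner_le(1)[OF Pz(1) w] Pz(2)[OF False] by (intro mult_left_mono) auto
    finally show ?thesis .
  qed (simp add: sc_def)
qed

lemma sc_eq: "sc v * h (Pz v) = v \<bullet> Pz v"
  using pos[OF Pz(1)[of v]] by (simp add: sc_def)

text \<open>The gauge is the maximum of the linear functionals v . z / h(z), attained at
  \<open>Pz v\<close>. Continuity then follows from convexity on the whole space.\<close>

lemma convex_on_sc: "convex_on UNIV sc"
proof (rule convex_onI)
  fix t :: real and x y :: "'n euclid1" assume t: "0 < t" "t < 1"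
  let ?v = "(1 - t) *\<^sub>R x + t *\<^sub>R y"
  let ?z = "Pz ?v"
  have hp: "h ?z > 0" by (rule pos[OF Pz(1)])
  have "sc ?v * h ?z = (1 - t) * (x \<bullet> ?z) + t * (y \<bullet> ?z)"
    unfolding sc_eq by (simp add: inner_add_left)
  also have "\<dots> \<le> (1 - t) * (sc x * h ?z) + t * (sc y * h ?z)"
    using sc_ge[OF Pz(1)] t by (intro add_mono mult_left_mono) auto
  also have "\<dots> = ((1 - t) * sc x + t * sc y) * h ?z" by (simp add: algebra_simps)
  finally show "sc ?v \<le> (1 - t) * sc x + t * sc y" using hp by simp
qed simp

lemma continuous_on_sc: "continuous_on UNIV sc"
  using convex_on_continuous[OF open_UNIV convex_on_sc] .

lemma continuous_on_gr: "continuous_on {z. norm z = 1} (gr h)"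
  by (rule continuous_on_subset[OF smooth_on_continuous_on[OF smooth_on_gr[OF open_punctured smooth]]]) auto

text \<open>On the compact sphere \<open>gr h\<close> is a continuous injection, hence a
  homeomorphism onto its image, and v / \<open>sc v\<close> lies in that image.\<close>

lemma continuous_on_Pz: "continuous_on (- {0}) Pz"
proof -
  have 1: "continuous_on (gr h ` {z. norm z = 1}) Pz"
  proof (rule continuous_on_inv[OF continuous_on_gr])
    show "compact {z :: 'n euclid1. norm z = 1}" by (simp add: unit_sphere_eq)
    show "\<forall>z\<in>{z. norm z = 1}. Pz (gr h z) = z" using Pz_polar(1)[of _ 1] by simp
  qed
  have sp: "sc v > 0" if "v \<in> - {0}" for v using Pz(2)[of v] that by simp
  have v: "(1 / sc v) *\<^sub>R v = gr h (Pz v)" if "v \<in> - {0}" for v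
    using Pz(2)[of v] that by (metis ComplD inverse_eq_divide less_irrefl real_vector.scale_left_imp_eq scaleR_scaleR left_inverse scaleR_one singletonI)
  have "continuous_on (- {0}) (\<lambda>v. (1 / sc v) *\<^sub>R v)"
    by (intro continuous_intros continuous_on_subset[OF continuous_on_sc]) (use sp in force)+
  then have "continuous_on (- {0}) (\<lambda>v. Pz ((1 / sc v) *\<^sub>R v))"
    by (rule continuous_on_compose2[OF 1]) (use v Pz(1) in auto)
  then show ?thesis
  proof (rule continuous_on_eq)
    show "Pz ((1 / sc v) *\<^sub>R v) = Pz v" if "v \<in> - {0}" for v
      unfolding v[OF that] using Pz_polar(1)[OF Pz(1), of 1 v] by simp
  qed
qed

lemma Khat_sc: "v \<in> Khat \<longleftrightarrow> sc v \<le> 1"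
proof
  assume "v \<in> Khat"
  then have "sc v * h (Pz v) \<le> 1 * h (Pz v)" unfolding sc_eq using Pz(1) by (simp add: Khat_def)
  then show "sc v \<le> 1" using pos[OF Pz(1)] by simp
next
  assume s: "sc v \<le> 1"
  have "v \<bullet> z \<le> h z" if z: "norm z = 1" for z
  proof -
    have "sc v * h z \<le> 1 * h z" using s pos[OF z] by (intro mult_right_mono) auto
    then show ?thesis using sc_ge[OF z, of v] by simp
  qed
  then show "v \<in> Khat" by (simp add: Khat_def)
qed

lemma closed_Khat: "closed Khat"
proof -
  have "Khat = {v. sc v \<le> 1}" using Khat_sc by blast
  then show ?thesis using continuous_on_sc by (simp add: closed_Collect_le continuous_on_const)
qed

lemma bounded_Khat: "bounded Khat"
proof -
  obtain z0 where M: "\<And>z. norm z = 1 \<Longrightarrow> h z \<le> h z0"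
    using continuous_attains_sup[OF compact_sphere _ continuous_on_h] exists_unit unfolding unit_sphere_eq[symmetric] by blast
  have "norm v \<le> \<bar>h z0\<bar>" if v: "v \<in> Khat" for v
  proof (cases "v = 0")
    case False
    let ?w = "v /\<^sub>R norm v"
    have w: "norm ?w = 1" using False by simp
    have "v \<bullet> ?w \<le> h ?w" using v w unfolding Khat_def by blast
    moreover have "v \<bullet> ?w = norm v" using False by (simp add: dot_square_norm power2_eq_square)
    ultimately show ?thesis using M[OF w] by simp
  qed simp
  then show ?thesis unfolding bounded_iff by blast
qed

lemma compact_Khat: "compact Khat"
  using closed_Khat bounded_Khat by (simp add: compact_eq_bounded_closed)

lemma convex_Khat: "convex Khat"
proof -
  have "Khat = (\<Inter>z\<in>{z. norm z = 1}. {v. z \<bullet> v \<le> h z})"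
    by (rule set_eqI) (simp add: Khat_def inner_commute)
  then show ?thesis by (simp add: convex_INT convex_halfspace_le)
qed

lemma Khat_interior: "interior Khat \<noteq> {}"
proof -
  have "open {v. sc v < 1}" using continuous_on_sc by (simp add: open_Collect_less continuous_on_const)
  moreover have "{v. sc v < 1} \<subseteq> Khat" using Khat_sc by (auto simp: less_imp_le)
  moreover have "0 \<in> {v. sc v < 1}" by (simp add: sc_def)
  ultimately show ?thesis using interior_maximal by blast
qed

end

lemma continuous_on_det:
  assumes "\<And>i j. continuous_on S (\<lambda>x. M x $ i $ j)"
  shows "continuous_on S (\<lambda>x. det (M x :: real^'n^'n::finite))"
  unfolding det_def by (intro continuous_intros assms)

lemma range_stereo: "c^2 = 1 \<Longrightarrow> range (stereo c) = {w :: 'n::finite euclid1. norm w = 1 \<and> c * snd w \<noteq> 1}"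
proof (intro set_eqI iffI)
  assume c: "c^2 = 1"
  fix w :: "'n euclid1" assume "w \<in> {w. norm w = 1 \<and> c * snd w \<noteq> 1}"
  then show "w \<in> range (stereo c)" using stereo_stereo_inv[OF c, of w] by (intro image_eqI[of _ _ "stereo_inv c w"]) auto
qed (use norm_stereo snd_stereo_ne in blast)

lemma area_measure_image_sets:
  assumes S: "closed S" and P: "local_parametrization S U \<phi>" and B: "B \<in> sets borel" "B \<subseteq> U"
  shows "\<phi> ` B \<in> sets (restrict_space borel S)"
proof -
  obtain \<psi> where h: "homeomorphism U (\<phi> ` U) \<phi> \<psi>" and op: "openin (top_of_set S) (\<phi> ` U)"
    using P unfolding local_parametrization_def by blast
  obtain T where T: "open T" "\<phi> ` U = S \<inter> T" using op unfolding openin_open by blast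
  have U: "\<phi> ` U \<in> sets borel" unfolding T(2) using S T(1) by (intro sets.Int) auto
  have "\<psi> \<in> borel_measurable (restrict_space borel (\<phi> ` U))"
    by (rule borel_measurable_continuous_on_restrict) (use h in \<open>auto simp: homeomorphism_def\<close>)
  from measurable_sets[OF this B(1)] have "\<psi> -` B \<inter> \<phi> ` U \<in> sets borel"
    using U by (simp add: space_restrict_space sets_restrict_space_iff)
  moreover have "\<psi> -` B \<inter> \<phi> ` U = \<phi> ` B"
    using h B(2) unfolding homeomorphism_def by (fastforce simp: image_iff)
  ultimately show ?thesis using S B(2) T(2) by (auto simp: sets_restrict_space_iff)
qed

context h_body
begin

section \<open>The area measure as the image of a cone measure\<close>

definition rho :: "'n euclid1 \<Rightarrow> real" where
  "rho z = (real CARD('n) + 1) / dens z"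

definition xP :: "'n euclid1 \<Rightarrow> 'n minkowski" where
  "xP v = xpt h (Pz v)"

text \<open>A global candidate for the area measure, so that no local measures have to be glued:
  Lebesgue measure on the body is pushed along rays to the boundary of the domain. The cone over dz
  has volume h det(Hessian) dz / (n + 1) and the area element is det(\<open>aop\<close>) dz, whence
  the density (n + 1) / \<open>dens\<close>.\<close>

definition AM :: "'n minkowski measure" where
  "AM = distr (density lborel (\<lambda>v. ennreal (indicator (Khat - {0}) v * rho (Pz v)))) (restrict_space borel (bd (hdom h))) xP"

lemma rho_pos: "norm z = 1 \<Longrightarrow> rho z > 0"
  using dens_pos[of z] by (simp add: rho_def add_nonneg_pos)

lemma continuous_on_rho: "continuous_on {z. norm z = 1} rho"
  unfolding rho_def[abs_def] by (intro continuous_intros continuous_on_dens) (use dens_pos in force)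

lemma measurable_rho_Pz [measurable]: "(\<lambda>v. rho (Pz v)) \<in> borel_measurable borel"
  by (rule borel_measurable_continuous_countable_exceptions[of "{0}"])
    (use continuous_on_compose2[OF continuous_on_rho continuous_on_Pz] Pz(1) in \<open>simp_all add: image_subset_iff\<close>)

lemma compact_bd: "compact (bd (hdom h))"
  unfolding bd_hdom by (rule compact_continuous_image[OF continuous_on_xpt]) (simp add: unit_sphere_eq)

lemma xP_bd: "xP v \<in> bd (hdom h)"
  unfolding bd_hdom xP_def using Pz(1) by simp

lemma measurable_xP: "xP \<in> borel \<rightarrow>\<^sub>M restrict_space borel (bd (hdom h))"
proof (rule measurable_restrict_space2)
  show "xP \<in> borel_measurable borel"
    by (rule borel_measurable_continuous_countable_exceptions[of "{0}"])
      (use continuous_on_compose2[OF continuous_on_xpt continuous_on_Pz] Pz(1) in \<open>simp_all add: xP_def[abs_def] image_subset_iff\<close>)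
qed (use xP_bd in simp)

lemma sets_Khat: "Khat - {0} \<in> sets borel"
  using closed_Khat by (intro sets.Diff) auto

lemma emeasure_AM:
  assumes A: "A \<in> sets (restrict_space borel (bd (hdom h)))"
  shows "emeasure AM A = (\<integral>\<^sup>+v. ennreal (rho (Pz v)) * indicator {v \<in> Khat - {0}. xP v \<in> A} v \<partial>lborel)"
proof -
  have mA: "xP -` A \<in> sets borel" using measurable_sets[OF measurable_xP A] by simp
  have m: "(\<lambda>v. ennreal (indicator (Khat - {0}) v * rho (Pz v))) \<in> borel_measurable lborel"
    using sets_Khat by (intro measurable_compose[OF _ measurable_ennreal]) simp
  have "emeasure AM A = emeasure (density lborel (\<lambda>v. ennreal (indicator (Khat - {0}) v * rho (Pz v)))) (xP -` A)"
    unfolding AM_def by (subst emeasure_distr) (use measurable_xP A in simp_all)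
  also have "\<dots> = (\<integral>\<^sup>+v. ennreal (indicator (Khat - {0}) v * rho (Pz v)) * indicator (xP -` A) v \<partial>lborel)"
    by (rule emeasure_density[OF m]) (use mA in simp)
  also have "\<dots> = (\<integral>\<^sup>+v. ennreal (rho (Pz v)) * indicator {v \<in> Khat - {0}. xP v \<in> A} v \<partial>lborel)"
    by (intro nn_integral_cong) (auto split: split_indicator)
  finally show ?thesis .
qed

text \<open>Every local parametrization factors through the sphere by \<open>Zp\<close>; area and
  cone volume can then be compared in terms of the spherical derivative D alone.\<close>

lemma parametrization_normal:
  assumes P: "local_parametrization (bd (hdom h)) U \<phi>" and x: "x \<in> U"
  obtains D where "norm (Zp (\<phi> x)) = 1" "\<phi> x = xpt h (Zp (\<phi> x))" "linear D" "inj D"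
    "((\<lambda>x. Zp (\<phi> x)) has_derivative D) (at x)" "\<And>e. D e \<bullet> Zp (\<phi> x) = 0"
    "\<And>e. fd \<phi> x e = Xd (Zp (\<phi> x)) (D e)"
proof -
  let ?z = "Zp (\<phi> x)"
  have U: "open U" and s: "smooth_on U \<phi>" and i: "inj (fd \<phi> x)"
    and im: "\<phi> ` U \<subseteq> bd (hdom h)"
    using P x openin_imp_subset unfolding local_parametrization_def by blast+
  have Z: "norm (Zp (\<phi> y)) = 1 \<and> xpt h (Zp (\<phi> y)) = \<phi> y" if "y \<in> U" for y using Zp_bd im that by blast
  note z = conjunct1[OF Z[OF x]] and zx = conjunct2[OF Z[OF x]]
  obtain g' where g': "linear g'" "(Zp has_derivative g') (at (\<phi> x) within bd (hdom h))"
    using has_derivative_Zp[OF z] unfolding zx by blast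
  have d\<phi>: "(\<phi> has_derivative fd \<phi> x) (at x)"
    by (rule smooth_on_has_derivative[OF s x])
  define D where "D = (\<lambda>e. g' (fd \<phi> x e))"
  have "((\<lambda>x. Zp (\<phi> x)) has_derivative D) (at x within U)"
    unfolding D_def
    by (rule has_derivative_in_compose[OF has_derivative_at_withinI[OF d\<phi>] has_derivative_subset[OF g'(2) im]])
  then have D: "((\<lambda>x. Zp (\<phi> x)) has_derivative D) (at x)" using at_within_open[OF x U] by simp
  have "((\<lambda>x. xpt h (Zp (\<phi> x))) has_derivative (\<lambda>e. Xd ?z (D e))) (at x)"
    by (rule has_derivative_compose[OF D has_derivative_xpt[OF z0[OF z]]])
  then have "(\<phi> has_derivative (\<lambda>e. Xd ?z (D e))) (at x)"
    by (rule has_derivative_transform_within_open[OF _ U x]) (use Z in blast)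
  then have eq: "fd \<phi> x = (\<lambda>e. Xd ?z (D e))" using has_derivative_unique[OF d\<phi>] by blast
  have "((\<lambda>x. Zp (\<phi> x) \<bullet> Zp (\<phi> x)) has_derivative (\<lambda>e. ?z \<bullet> D e + D e \<bullet> ?z)) (at x)"
    by (rule has_derivative_inner[OF D D])
  moreover have "((\<lambda>x. Zp (\<phi> x) \<bullet> Zp (\<phi> x)) has_derivative (\<lambda>e. 0)) (at x)"
  proof (rule has_derivative_transform_within_open[OF has_derivative_const[of 1] U x])
    show "1 = Zp (\<phi> y) \<bullet> Zp (\<phi> y)" if "y \<in> U" for y using zz[OF conjunct1[OF Z[OF that]]] by simp
  qed
  ultimately have "(\<lambda>e. ?z \<bullet> D e + D e \<bullet> ?z) = (\<lambda>e. 0)" by (rule has_derivative_unique)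
  then have perp: "?z \<bullet> D e + D e \<bullet> ?z = 0" for e by (rule fun_cong)
  show thesis
  proof (rule that)
    show "inj D"
    proof (rule injI)
      fix a b assume "D a = D b"
      then show "a = b" by (intro injD[OF i]) (simp add: eq)
    qed
    show "D e \<bullet> ?z = 0" for e using perp[of e] unfolding inner_commute[of ?z "D e"] by simp
  qed (use z zx D eq has_derivative_linear[OF D] in auto)
qed

text \<open>After the Jacobian of the spherical map is split off, the cone contributes s^n h
  det(\<open>Bh z\<close>) and the area contributes det(\<open>Ah z\<close>); \<open>rho\<close>
  balances the two, up to the radial factor n + 1.\<close>

lemma area_density:
  assumes z: "norm z = 1" and D: "linear D" "inj D" "\<And>e. D e \<bullet> z = 0" and s: "s > 0"
  shows "(real CARD('n) + 1) * \<bar>s\<bar> ^ CARD('n) *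
      sqrt (det (\<chi> i j. mink (Xd z (D (axis i 1))) (Xd z (D (axis j 1))))) =
    \<bar>lin_det (\<lambda>p. s *\<^sub>R hess h z (D (fst p)) + snd p *\<^sub>R gr h z)\<bar> * rho z"
proof -
  interpret D: linear D by (rule D(1))
  interpret H: linear "hess h z" by (rule linear_hess_h[OF z0[OF z]])
  interpret A: linear "aop z" by (rule linear_aop[OF z])
  have lin: "linear (\<lambda>e. hess h z (D e))"
    using linear_compose[OF D(1) linear_hess_h[OF z0[OF z]]] by (simp add: o_def)
  have D0: "D e = 0 \<longleftrightarrow> e = 0" for e using D(2) D.inj_iff_eq_0 D.zero by blast
  have iH: "inj (\<lambda>e. hess h z (D e))"
    unfolding linear_injective_0[OF lin]
  proof (intro allI impI)
    fix e assume "hess h z (D e) = 0"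
    then have "\<not> hess h z (D e) \<bullet> D e > tpt h z * (D e \<bullet> D e)" using tpt_pos[OF z] by (simp add: not_less)
    then show "e = 0" using strict[OF z D(3)] D0 by blast
  qed
  \<comment> \<open>Surjectivity onto the complement of z yields \<beta>, a parameter direction that
    produces the tangential part \<open>gr h z - h z *\<^sub>R z\<close> of the radial vector; with
    it the Jacobian factors as \<open>Bh z\<close> after ?R after the triangular map ?T.\<close>
  have "dim (range (\<lambda>e. hess h z (D e))) = CARD('n)"
    using dim_image_eq[OF lin, of UNIV] iH by (simp add: DIM_cart)
  moreover have "dim {e. z \<bullet> e = 0} = CARD('n)"
    using dim_hyperplane[OF z0[OF z]] by (simp add: DIM_cart)
  moreover have "range (\<lambda>e. hess h z (D e)) \<subseteq> {e. z \<bullet> e = 0}"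
    unfolding image_subset_iff using hess_perp[OF z0[OF z]] by (simp add: inner_commute[of z "hess h z _"])
  ultimately have "range (\<lambda>e. hess h z (D e)) = {e. z \<bullet> e = 0}"
    using subspace_dim_equal[OF linear_subspace_image[OF lin subspace_UNIV] subspace_hyperplane] by simp
  moreover have "z \<bullet> (gr h z - h z *\<^sub>R z) = 0"
    using euler[OF z0[OF z]] zz[OF z] by (simp add: inner_diff_right inner_commute[of z "gr h z"])
  ultimately obtain \<beta> where \<beta>: "hess h z (D \<beta>) = gr h z - h z *\<^sub>R z" by (metis (mono_tags, lifting) imageE mem_Collect_eq)
  let ?R = "\<lambda>p::(real^'n) \<times> real. D (fst p) + snd p *\<^sub>R z"
  let ?T = "\<lambda>p::(real^'n) \<times> real. (s *\<^sub>R fst p + snd p *\<^sub>R \<beta>, h z * snd p)"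
  have lR: "linear ?R" by (rule linearI) (auto simp: D.add D.scale algebra_simps)
  have lT: "linear ?T" by (rule linearI) (auto simp: algebra_simps)
  have lB: "linear (Bh z)" and lA: "linear (Ah z)" using linear_Ah linear_Bh z0[OF z] by blast+
  have "s *\<^sub>R hess h z (D (fst p)) + snd p *\<^sub>R gr h z = Bh z (?R (?T p))" for p
    using hess_radial[OF z0[OF z]]
    by (simp add: Bh_def D.add D.scale H.add H.scale \<beta> inner_add_left D(3) zz[OF z] algebra_simps)
  then have "lin_det (\<lambda>p. s *\<^sub>R hess h z (D (fst p)) + snd p *\<^sub>R gr h z) = lin_det (Bh z) * (lin_det ?R * lin_det ?T)"
    using lin_det_compose[OF lB linear_compose[OF lT lR]] lin_det_compose[OF lR lT] by (simp add: o_def)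
  moreover have "\<bar>lin_det ?T\<bar> = s ^ CARD('n) * h z"
    using lin_det_triangular[of s \<beta> "h z"] s pos[OF z] by (simp add: DIM_cart)
  ultimately have l: "\<bar>lin_det (\<lambda>p. s *\<^sub>R hess h z (D (fst p)) + snd p *\<^sub>R gr h z)\<bar> =
      lin_det (Bh z) * (\<bar>lin_det ?R\<bar> * (s ^ CARD('n) * h z))"
    using lin_det_Bh_pos[OF z] by (simp add: abs_mult)
  have lC: "linear (\<lambda>e. aop z (D e))"
    using linear_compose[OF D(1) linear_aop[OF z]] by (simp add: o_def)
  have "aop z (D (fst p)) + snd p *\<^sub>R z = Ah z (?R p)" for p
    using hess_radial[OF z0[OF z]]
    by (simp add: Ah_def aop_def H.add H.scale inner_add_left D(3) zz[OF z] algebra_simps)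
  then have "lin_det (\<lambda>p. aop z (D (fst p)) + snd p *\<^sub>R z) = lin_det (Ah z) * lin_det ?R"
    using lin_det_compose[OF lA lR] by simp
  then have "det (\<chi> i j. mink (Xd z (D (axis i 1))) (Xd z (D (axis j 1)))) = (lin_det (Ah z) * lin_det ?R)^2"
    using lin_det_gram[OF lC z aop_perp[OF z D(3)]] by (simp add: mink_Xd_Xd[OF z D(3) D(3)])
  then have "sqrt (det (\<chi> i j. mink (Xd z (D (axis i 1))) (Xd z (D (axis j 1))))) = lin_det (Ah z) * \<bar>lin_det ?R\<bar>"
    using lin_det_Ah_pos[OF z] by (simp add: abs_mult)
  then show ?thesis unfolding l rho_def dens_def using lin_det_Ah_pos[OF z] lin_det_Bh_pos[OF z] pos[OF z] s by simp
qed

text \<open>Change of variables from pairs (x, s) with x in B and 0 < s \<le> 1 to the part of the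
  body lying over the image of B, under F(x, s) = s \<open>gr h\<close> (\<theta> x) with \<theta>
  the spherical map of the parametrization. Integrating out s leaves the Gram density.\<close>

lemma AM_parametrization:
  assumes P: "local_parametrization (bd (hdom h)) U \<phi>" and B: "B \<in> sets borel" "B \<subseteq> U"
  shows "emeasure AM (\<phi> ` B) = (\<integral>\<^sup>+x. ennreal (sqrt (det (gram_matrix \<phi> x))) * indicator B x \<partial>lborel)"
proof -
  let ?g = "\<lambda>x. sqrt (det (gram_matrix \<phi> x))"
  let ?th = "\<lambda>x. Zp (\<phi> x)"
  define F where "F = (\<lambda>p. snd p *\<^sub>R gr h (?th (fst p)))"
  define F' where "F' = (\<lambda>q. (\<lambda>p. snd q *\<^sub>R hess h (?th (fst q)) (fd ?th (fst q) (fst p)) + snd p *\<^sub>R gr h (?th (fst q))))"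
  \<comment> \<open>The indicator makes G Borel on the whole space, although \<phi> is controlled on
    U only.\<close>
  define G where "G = (\<lambda>p. (real CARD('n) + 1) * \<bar>snd p\<bar> ^ CARD('n) * (indicator U (fst p) *\<^sub>R ?g (fst p)))"
  let ?S = "B \<times> {0<..1::real}"
  have U: "open U" and s: "smooth_on U \<phi>" and inj: "inj_on \<phi> U"
    and im: "\<phi> ` U \<subseteq> bd (hdom h)"
    using P openin_imp_subset unfolding local_parametrization_def homeomorphism_def inj_on_def by (blast, blast, metis, blast)
  have Z: "norm (?th y) = 1 \<and> xpt h (?th y) = \<phi> y" if "y \<in> U" for y using Zp_bd im that by blast
  have mB: "\<phi> ` B \<in> sets (restrict_space borel (bd (hdom h)))"
    by (rule area_measure_image_sets[OF compact_imp_closed[OF compact_bd] P B])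
  have FS: "F ` ?S = {v \<in> Khat - {0}. xP v \<in> \<phi> ` B}"
  proof (intro set_eqI iffI)
    fix v assume "v \<in> F ` ?S"
    then obtain x t where x: "x \<in> B" "0 < t" "t \<le> 1" "v = t *\<^sub>R gr h (?th x)" unfolding F_def by auto
    then have xU: "x \<in> U" using B by blast
    note pp = Pz_polar[OF conjunct1[OF Z[OF xU]] x(2), folded x(4)]
    have "xP v = \<phi> x" unfolding xP_def pp(1) using Z[OF xU] by simp
    then show "v \<in> {v \<in> Khat - {0}. xP v \<in> \<phi> ` B}" using pp x by (simp add: Khat_sc)
  next
    fix v assume v: "v \<in> {v \<in> Khat - {0}. xP v \<in> \<phi> ` B}"
    then obtain x where x: "x \<in> B" "xP v = \<phi> x" by blast
    have "?th x = Pz v" using arg_cong[OF x(2), of Zp] by (simp add: xP_def Zp_xpt Pz(1))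
    then have "v = F (x, sc v)" using Pz(2)[of v] v by (simp add: F_def)
    moreover have "(x, sc v) \<in> ?S" using Pz(2)[of v] v x by (simp add: Khat_sc)
    ultimately show "v \<in> F ` ?S" by blast
  qed
  have FSm: "F ` ?S \<in> sets borel"
  proof -
    have "F ` ?S = (Khat - {0}) \<inter> xP -` (\<phi> ` B)" unfolding FS by auto
    then show ?thesis using measurable_sets[OF measurable_xP mB] sets_Khat by simp
  qed
  have gc: "continuous_on U ?g"
    unfolding gram_matrix_def
    by (intro continuous_on_real_sqrt continuous_on_det)
      (simp add: mink_def, intro continuous_intros smooth_on_continuous_on[OF smooth_on_frechet_derivative[OF s]])
  have gm: "(\<lambda>x. indicator U x *\<^sub>R ?g x) \<in> borel_measurable borel"
    by (rule borel_measurable_continuous_on_indicator) (use U gc in auto)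
  have gmp: "(\<lambda>p. indicator U (fst p) *\<^sub>R ?g (fst p)) \<in> borel_measurable (borel :: ((real^'n) \<times> real) measure)"
    by (rule measurable_compose[OF _ gm]) (intro borel_measurable_continuous_onI continuous_intros)
  have Gm: "G \<in> borel_measurable borel"
    unfolding G_def
    by (rule borel_measurable_times[OF _ gmp]) (intro borel_measurable_continuous_onI continuous_intros)
  have key: "(F has_derivative F' q) (at q) \<and> G q = \<bar>lin_det (F' q)\<bar> * rho (Pz (F q))" if q: "q \<in> ?S" for q
  proof -
    have x: "fst q \<in> U" and t: "snd q > 0" using q B by auto
    obtain D where D: "norm (?th (fst q)) = 1" "linear D" "inj D" "(?th has_derivative D) (at (fst q))"
      "\<And>e. D e \<bullet> ?th (fst q) = 0" "\<And>e. fd \<phi> (fst q) e = Xd (?th (fst q)) (D e)"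
      by (rule parametrization_normal[OF P x]) (rule that)
    have fD: "fd ?th (fst q) = D" using frechet_derivative_at[OF D(4)] by simp
    have d1: "((\<lambda>p::(real^'n) \<times> real. ?th (fst p)) has_derivative (\<lambda>p. D (fst p))) (at q)"
      by (rule has_derivative_compose[OF has_derivative_fst[OF has_derivative_ident] D(4)])
    have d2: "((\<lambda>p::(real^'n) \<times> real. gr h (?th (fst p))) has_derivative (\<lambda>p. hess h (?th (fst q)) (D (fst p)))) (at q)"
      by (rule has_derivative_compose[OF d1 has_derivative_gr_h[OF z0[OF D(1)]]])
    have "(F has_derivative F' q) (at q)"
      unfolding F_def F'_def fD
      by (rule has_derivative_scaleR[OF has_derivative_snd[OF has_derivative_ident] d2])
    moreover have "G q = \<bar>lin_det (F' q)\<bar> * rho (Pz (F q))"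
    proof -
      have gm: "gram_matrix \<phi> (fst q) = (\<chi> i j. mink (Xd (?th (fst q)) (D (axis i 1))) (Xd (?th (fst q)) (D (axis j 1))))"
        by (simp add: gram_matrix_def D(6))
      have "Pz (F q) = ?th (fst q)" unfolding F_def by (rule Pz_polar(1)[OF D(1) t])
      then show ?thesis
        using area_density[OF D(1,2,3,5) t] x unfolding F'_def fD G_def gm by (simp add: mult.assoc)
    qed
    ultimately show ?thesis by blast
  qed
  have injF: "inj_on F ?S"
  proof (rule inj_onI)
    fix p q assume p: "p \<in> ?S" and q: "q \<in> ?S" and eq: "F p = F q"
    have pU: "fst p \<in> U" "snd p > 0" and qU: "fst q \<in> U" "snd q > 0" using p q B by auto
    note P1 = Pz_polar[OF conjunct1[OF Z[OF pU(1)]] pU(2)] and Q1 = Pz_polar[OF conjunct1[OF Z[OF qU(1)]] qU(2)]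
    have "?th (fst p) = ?th (fst q)" "snd p = snd q"
      using P1(1,2) Q1(1,2) eq unfolding F_def by metis+
    then have "\<phi> (fst p) = \<phi> (fst q)" using Z pU qU by metis
    then show "p = q" using inj pU qU \<open>snd p = snd q\<close> unfolding inj_on_def by (metis prod_eqI)
  qed
  obtain C where C: "\<And>z. norm z = 1 \<Longrightarrow> rho z \<le> C"
  proof -
    have "bounded (rho ` {z. norm z = 1})"
      by (intro compact_imp_bounded compact_continuous_image continuous_on_rho) (simp add: unit_sphere_eq)
    then obtain C where "\<forall>y\<in>rho ` {z. norm z = 1}. norm y \<le> C" unfolding bounded_iff by blast
    then have "rho z \<le> C" if "norm z = 1" for z using that by (simp add: image_iff) (metis abs_le_D1)
    then show thesis by (rule that)
  qed
  \<comment> \<open>Both the density \<open>rho\<close>, on the compact sphere, and the body are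
    bounded.\<close>
  have fin: "(\<integral>\<^sup>+y. ennreal (rho (Pz y)) * indicator (F ` ?S) y \<partial>lborel) < \<infinity>"
  proof -
    have "(\<integral>\<^sup>+y. ennreal (rho (Pz y)) * indicator (F ` ?S) y \<partial>lborel) \<le> (\<integral>\<^sup>+y. ennreal C * indicator Khat y \<partial>lborel)"
    proof (intro nn_integral_mono mult_mono)
      show "ennreal (rho (Pz y)) \<le> ennreal C" for y by (rule ennreal_leI[OF C[OF Pz(1)]])
      show "indicator (F ` ?S) y \<le> (indicator Khat y :: ennreal)" for y unfolding FS by (simp split: split_indicator)
    qed simp_all
    also have "\<dots> = ennreal C * emeasure lborel Khat"
      by (rule nn_integral_cmult_indicator) (use closed_Khat in auto)
    also have "\<dots> < \<infinity>" using emeasure_compact_finite[OF compact_Khat] by (simp add: ennreal_mult_less_top)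
    finally show ?thesis .
  qed
  have "emeasure AM (\<phi> ` B) = (\<integral>\<^sup>+v. ennreal (rho (Pz v)) * indicator (F ` ?S) v \<partial>lborel)"
    unfolding FS by (rule emeasure_AM[OF mB])
  also have "\<dots> = (\<integral>\<^sup>+q. ennreal (G q) * indicator ?S q \<partial>lborel)"
  proof (rule nn_integral_change_of_variables[OF _ FSm _ injF measurable_rho_Pz _ Gm _ _ fin, where F' = F'])
    show "?S \<in> sets borel" using B(1) by (intro borel_Times) auto
    show "rho (Pz y) \<ge> 0" for y using rho_pos[OF Pz(1)] less_imp_le by blast
    show "G q \<ge> 0" for q
      unfolding G_def
    proof (intro mult_nonneg_nonneg)
      show "0 \<le> indicator U (fst q) *\<^sub>R ?g (fst q)"
      proof (cases "fst q \<in> U")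
        case True
        obtain D where D: "norm (?th (fst q)) = 1" "linear D" "inj D"
          "\<And>e. D e \<bullet> ?th (fst q) = 0" "\<And>e. fd \<phi> (fst q) e = Xd (?th (fst q)) (D e)"
          by (rule parametrization_normal[OF P True]) (rule that)
        have "(real CARD('n) + 1) * \<bar>1\<bar> ^ CARD('n) * ?g (fst q) \<ge> 0"
          using area_density[OF D(1,2,3,4), of 1] rho_pos[OF D(1)] by (simp add: gram_matrix_def D(5))
        then have "?g (fst q) \<ge> 0" by (simp add: zero_le_mult_iff)
        then show ?thesis by simp
      qed simp
    qed auto
  qed (use key in blast)+
  also have "\<dots> = (\<integral>\<^sup>+q. ennreal (G q) * indicator ?S q \<partial>(lborel \<Otimes>\<^sub>M lborel))" by (simp add: lborel_prod)
  also have "\<dots> = (\<integral>\<^sup>+x. \<integral>\<^sup>+t. ennreal (G (x, t)) * indicator ?S (x, t) \<partial>lborel \<partial>lborel)"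
  proof (rule lborel.nn_integral_fst[symmetric])
    have "?S \<in> sets borel" using B(1) by (intro borel_Times) auto
    then have "(\<lambda>q. ennreal (G q) * indicator ?S q) \<in> borel_measurable borel"
      by (intro borel_measurable_times_ennreal measurable_compose[OF Gm measurable_ennreal]) simp
    then show "(\<lambda>q. ennreal (G q) * indicator ?S q) \<in> borel_measurable (lborel \<Otimes>\<^sub>M lborel)"
      unfolding lborel_prod by simp
  qed
  also have "\<dots> = (\<integral>\<^sup>+x. ennreal (?g x) * indicator B x \<partial>lborel)"
  proof (intro nn_integral_cong)
    fix x :: "real ^ 'n"
    have "(\<integral>\<^sup>+t. ennreal (G (x, t)) * indicator ?S (x, t) \<partial>lborel) =
      (\<integral>\<^sup>+t. (ennreal (?g x) * indicator B x) * (ennreal ((real CARD('n) + 1) * \<bar>t\<bar> ^ CARD('n)) * indicator {0<..1} t) \<partial>lborel)"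
    proof (intro nn_integral_cong)
      fix t :: real
      show "ennreal (G (x, t)) * indicator ?S (x, t) =
        (ennreal (?g x) * indicator B x) * (ennreal ((real CARD('n) + 1) * \<bar>t\<bar> ^ CARD('n)) * indicator {0<..1} t)"
      proof (cases "x \<in> B")
        case True
        have "G (x, t) = ((real CARD('n) + 1) * \<bar>t\<bar> ^ CARD('n)) * ?g x" using True B(2) by (simp add: G_def subset_eq)
        then have "ennreal (G (x, t)) = ennreal ((real CARD('n) + 1) * \<bar>t\<bar> ^ CARD('n)) * ennreal (?g x)"
          by (simp only: ennreal_mult'[of "(real CARD('n) + 1) * \<bar>t\<bar> ^ CARD('n)"] zero_le_mult_iff) (simp add: ennreal_mult')
        then show ?thesis using True by (simp add: mult_ac indicator_def)
      qed simp
    qed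
    also have "\<dots> = ennreal (?g x) * indicator B x"
      by (subst nn_integral_cmult) (simp_all add: nn_integral_power_unit)
    finally show "(\<integral>\<^sup>+t. ennreal (G (x, t)) * indicator ?S (x, t) \<partial>lborel) = ennreal (?g x) * indicator B x" .
  qed
  finally show ?thesis .
qed

lemma local_parametrization_stereo:
  assumes c: "c^2 = 1"
  shows "local_parametrization (bd (hdom h)) UNIV (\<lambda>x. xpt h (stereo c x))"
    and "range (\<lambda>x. xpt h (stereo c x)) = {X \<in> bd (hdom h). c * snd (Zp X) \<noteq> 1}"
proof -
  let ?f = "\<lambda>x. xpt h (stereo c x)"
  have ne: "stereo c x \<noteq> (0::'n euclid1)" for x using norm_stereo[OF c, of x] by auto
  have "range ?f = xpt h ` range (stereo c)" by auto
  then show im: "range ?f = {X \<in> bd (hdom h). c * snd (Zp X) \<noteq> 1}"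
    unfolding bd_hdom range_stereo[OF c] using Zp_xpt by auto
  have sm: "smooth_on UNIV ?f"
    by (rule smooth_on_compose[OF open_UNIV open_punctured _ smooth_stereo smooth_xpt]) (use ne in auto)
  have "openin (top_of_set (bd (hdom h))) (bd (hdom h) \<inter> Zp -` {w. c * snd w \<noteq> 1})"
    by (rule continuous_openin_preimage_gen[OF continuous_on_Zp]) (intro open_Collect_neq continuous_intros)
  then have op: "openin (top_of_set (bd (hdom h))) (range ?f)" unfolding im by (simp add: Int_def vimage_def)
  have "homeomorphism UNIV (range ?f) ?f (\<lambda>X. stereo_inv c (Zp X))"
    unfolding homeomorphism_def
  proof (intro conjI ballI)
    show "continuous_on (range ?f) (\<lambda>X. stereo_inv c (Zp X))"
    proof -
      have "continuous_on {w::'n euclid1. c * snd w \<noteq> 1} (stereo_inv c)"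
        by (rule continuous_on_stereo_inv) simp
      then show ?thesis
        unfolding im by (rule continuous_on_compose2[OF _ continuous_on_subset[OF continuous_on_Zp]]) blast+
    qed
    show "stereo_inv c (Zp (?f x)) = x" for x by (simp add: Zp_xpt norm_stereo[OF c] stereo_inv_stereo[OF c])
    then show "(\<lambda>X. stereo_inv c (Zp X)) ` range ?f = UNIV" by (simp add: image_image)
    show "xpt h (stereo c (stereo_inv c (Zp y))) = y" if "y \<in> range ?f" for y
      using that by (auto simp: Zp_xpt norm_stereo[OF c] stereo_inv_stereo[OF c])
  qed (use smooth_on_continuous_on[OF sm] in auto)
  moreover have "inj (fd ?f x)" for x
  proof -
    have d: "(stereo c has_derivative fd (stereo c) x) (at x)"
      by (rule smooth_on_has_derivative[OF smooth_stereo UNIV_I])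
    have "(?f has_derivative (\<lambda>e. Xd (stereo c x) (fd (stereo c) x e))) (at x)"
      by (rule has_derivative_compose[OF d has_derivative_xpt[OF ne]])
    from frechet_derivative_at[OF this]
    have "fd ?f x = Xd (stereo c x) \<circ> fd (stereo c) x" by (simp add: o_def)
    then show ?thesis using inj_compose[OF inj_Xd[OF norm_stereo[OF c]] inj_frechet_stereo[OF c]] by metis
  qed
  ultimately show "local_parametrization (bd (hdom h)) UNIV ?f"
    unfolding local_parametrization_def using sm op by blast
qed

text \<open>Uniqueness behind the \<open>THE\<close>: the two stereographic charts cover the
  boundary, so a Borel set splits into a part seen by the first chart and a remainder seen by the
  second.\<close>

lemma area_measure_hdom: "area_measure (bd (hdom h)) = AM"
  unfolding area_measure_def
proof (rule the_equality)
  let ?Q = "\<lambda>M. sets M = sets (restrict_space borel (bd (hdom h))) \<and>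
     (\<forall>U \<phi>. local_parametrization (bd (hdom h)) U \<phi> \<longrightarrow>
        (\<forall>B\<in>sets borel. B \<subseteq> U \<longrightarrow>
           emeasure M (\<phi> ` B) =
             (\<integral>\<^sup>+x. ennreal (sqrt (det (gram_matrix \<phi> x))) * indicator B x \<partial>lborel)))"
  show AM: "?Q AM" using AM_parametrization by (simp add: AM_def)
  fix M assume M: "?Q M"
  show "M = AM"
  proof (rule measure_eqI)
    show "sets M = sets AM" using M AM by simp
    fix A assume A: "A \<in> sets M"
    let ?f = "\<lambda>c x. xpt h (stereo c x)"
    have eq: "emeasure M B = emeasure AM B \<and> B \<in> sets M"
      if c: "c^2 = 1" and B: "B = A \<inter> W" "W \<in> sets borel" "B \<subseteq> range (?f c)" for B W and c :: real
    proof -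
      note P = local_parametrization_stereo(1)[OF c]
      have m: "?f c \<in> borel_measurable borel"
        using P unfolding local_parametrization_def by (intro borel_measurable_continuous_onI smooth_on_continuous_on) blast
      have "A \<in> sets borel" using A M compact_imp_closed[OF compact_bd] by (auto simp: sets_restrict_space_iff)
      then have "?f c -` B \<in> sets borel" using measurable_sets[OF m, of "A \<inter> W"] B(1,2) by auto
      moreover have "B = ?f c ` (?f c -` B)" using B(3) by (auto simp: image_iff)
      moreover have "B \<in> sets M" using A B(1,2) M by (auto simp: sets_restrict_space)
      ultimately have 1: "?f c -` B \<in> sets borel" "B \<in> sets M" and BB: "?f c ` (?f c -` B) = B" by simp_all
      show ?thesis
        using M[THEN conjunct2, rule_format, OF P 1(1)] AM[THEN conjunct2, rule_format, OF P 1(1)] 1(2)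
        unfolding BB by simp
    qed
    let ?W = "range (?f 1)"
    have rg: "range (?f c) = {X \<in> bd (hdom h). c * snd (Zp X) \<noteq> 1}" if "c^2 = 1" for c
      by (rule local_parametrization_stereo(2)[OF that])
    have W: "?W \<in> sets borel"
    proof -
      have "openin (top_of_set (bd (hdom h))) ?W"
        using local_parametrization_stereo(1)[of 1] unfolding local_parametrization_def by simp
      then show ?thesis unfolding openin_open using compact_imp_closed[OF compact_bd] by (auto intro!: sets.Int)
    qed
    have "A \<subseteq> bd (hdom h)" using A M by (auto simp: sets_restrict_space)
    then have sub: "A \<inter> - ?W \<subseteq> range (?f (-1))" using rg[of 1] rg[of "-1"] by auto
    have 1: "emeasure M (A \<inter> ?W) = emeasure AM (A \<inter> ?W) \<and> A \<inter> ?W \<in> sets M"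
      by (rule eq[OF _ refl W]) auto
    have 2: "emeasure M (A \<inter> - ?W) = emeasure AM (A \<inter> - ?W) \<and> A \<inter> - ?W \<in> sets M"
      by (rule eq[OF _ refl _ sub]) (use W in auto)
    have A2: "A = (A \<inter> ?W) \<union> (A \<inter> - ?W)" by blast
    have dj: "(A \<inter> ?W) \<inter> (A \<inter> - ?W) = {}" by blast
    have sM: "sets AM = sets M" using M AM by simp
    have "emeasure M A = emeasure M (A \<inter> ?W) + emeasure M (A \<inter> - ?W)"
      by (subst A2, rule plus_emeasure[symmetric]) (use 1 2 dj in blast)+
    also have "\<dots> = emeasure AM (A \<inter> ?W) + emeasure AM (A \<inter> - ?W)" using 1 2 by simp
    also have "\<dots> = emeasure AM A"
      by (subst (3) A2, rule plus_emeasure) (use 1 2 dj sM in blast)+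
    finally show "emeasure M A = emeasure AM A" .
  qed
qed

text \<open>Under the push-forward the integrand \<open>dens\<close> cancels the density
  \<open>rho\<close> up to the constant n + 1, and the point 0 is a null set.\<close>

theorem V_hdom: "V (hdom h) = measure lborel Khat"
proof -
  let ?I = "\<lambda>X. p_n (hdom h) X / (cosh (radius X) - u_tilde (hdom h) X) ^ (CARD('n) + 1)"
  have sp: "space AM = bd (hdom h)" by (simp add: AM_def space_restrict_space)
  have I: "?I X = dens (Zp X)" if "X \<in> space AM" for X
    using p_n_hdom[of "Zp X"] Zp_bd[of X] that unfolding sp by simp
  have m: "(\<lambda>X. dens (Zp X)) \<in> borel_measurable (restrict_space borel (bd (hdom h)))"
    by (intro borel_measurable_continuous_on_restrict continuous_on_compose2[OF continuous_on_dens continuous_on_Zp])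
      (use Zp_bd in auto)
  have "(LINT X|AM. ?I X) = (LINT X|AM. dens (Zp X))"
    by (rule Bochner_Integration.integral_cong[OF refl I])
  also have "\<dots> = (LINT v|density lborel (\<lambda>v. ennreal (indicator (Khat - {0}) v * rho (Pz v))). dens (Zp (xP v)))"
    unfolding AM_def by (rule integral_distr) (use measurable_xP m in simp_all)
  also have "\<dots> = (LINT v|lborel. (indicator (Khat - {0}) v * rho (Pz v)) *\<^sub>R dens (Zp (xP v)))"
  proof (rule integral_density)
    show "(\<lambda>v. dens (Zp (xP v))) \<in> borel_measurable lborel"
      using measurable_compose[OF measurable_xP m] by simp
    show "(\<lambda>v. indicator (Khat - {0}) v * rho (Pz v)) \<in> borel_measurable lborel"
      using sets_Khat by simp
    show "AE v in lborel. 0 \<le> indicator (Khat - {0}) v * rho (Pz v)"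
      using rho_pos[OF Pz(1)] by (intro AE_I2) (simp add: less_imp_le)
  qed
  also have "\<dots> = (LINT v|lborel. (real CARD('n) + 1) * indicator (Khat - {0}) v)"
  proof (rule Bochner_Integration.integral_cong[OF refl])
    fix v
    have "rho (Pz v) * dens (Zp (xP v)) = real CARD('n) + 1"
      using dens_pos[OF Pz(1)[of v]] by (simp add: rho_def xP_def Zp_xpt Pz(1))
    then show "(indicator (Khat - {0}) v * rho (Pz v)) *\<^sub>R dens (Zp (xP v)) = (real CARD('n) + 1) * indicator (Khat - {0}) v"
      by (simp add: mult.assoc)
  qed
  also have "\<dots> = (real CARD('n) + 1) * measure lborel (Khat - {0})" by simp
  also have "measure lborel (Khat - {0}) = measure lborel Khat"
    by (rule measure_Diff_null_set) (use closed_Khat in auto)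
  finally show ?thesis unfolding V_def area_measure_hdom by (simp add: add_nonneg_eq_0_iff field_simps)
qed

end

section \<open>Support functions of uniformly h-convex domains\<close>

definition strict_max_on :: "'a::metric_space set \<Rightarrow> ('a \<Rightarrow> real) \<Rightarrow> 'a \<Rightarrow> bool" where
  "strict_max_on K l X \<longleftrightarrow> (\<exists>r>0. \<forall>Y\<in>K. Y \<noteq> X \<longrightarrow> dist Y X < r \<longrightarrow> l Y < l X)"

text \<open>A deformation supported near X that never lowers l and raises it around X. It is phrased
  with self-maps of K, so that interior and boundary points are treated alike.\<close>

definition pushable :: "'a::metric_space set \<Rightarrow> ('a \<Rightarrow> real) \<Rightarrow> 'a \<Rightarrow> bool" where
  "pushable K l X \<longleftrightarrow> (\<forall>r>0. \<exists>T d. d > 0 \<and> continuous_on K T \<and> T ` K \<subseteq> K \<and>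
     (\<forall>Y\<in>K. T Y = Y \<or> l Y < l (T Y)) \<and> (\<forall>Y\<in>K. dist Y X < d \<longrightarrow> l Y < l (T Y)) \<and>
     (\<forall>Y\<in>K. r \<le> dist Y X \<longrightarrow> T Y = Y))"

text \<open>Deformations that keep the two competing maxima fixed. They compose, and the sets on
  which they raise l are united.\<close>

definition lifting :: "'a::topological_space set \<Rightarrow> ('a \<Rightarrow> real) \<Rightarrow> 'a \<Rightarrow> 'a \<Rightarrow> 'a set \<Rightarrow> ('a \<Rightarrow> 'a) \<Rightarrow> bool" where
  "lifting K l X1 X2 S T \<longleftrightarrow> continuous_on K T \<and> T ` K \<subseteq> K \<and> T X1 = X1 \<and> T X2 = X2 \<and>
     (\<forall>Y\<in>K. T Y = Y \<or> l Y < l (T Y)) \<and> (\<forall>Y\<in>K. Y \<in> S \<longrightarrow> l Y < l (T Y))"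

lemma lifting_compose:
  assumes T: "lifting K l X1 X2 S T" and P: "lifting K l X1 X2 S' P"
  shows "lifting K l X1 X2 (S \<union> S') (\<lambda>Y. T (P Y))"
proof -
  have PK: "P Y \<in> K" if "Y \<in> K" for Y using P that unfolding lifting_def by blast
  have a: "T Z = Z \<or> l Z < l (T Z)" "P Z = Z \<or> l Z < l (P Z)" if "Z \<in> K" for Z
    using T P that unfolding lifting_def by blast+
  have S: "Z \<in> S \<Longrightarrow> l Z < l (T Z)" "Z \<in> S' \<Longrightarrow> l Z < l (P Z)" if "Z \<in> K" for Z
    using T P that unfolding lifting_def by blast+
  have "continuous_on K (\<lambda>Y. T (P Y))" "(\<lambda>Y. T (P Y)) ` K \<subseteq> K" "T (P X1) = X1" "T (P X2) = X2"
    using T P continuous_on_compose2[of K T K P] unfolding lifting_def by auto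
  moreover have "T (P Y) = Y \<or> l Y < l (T (P Y))" if "Y \<in> K" for Y
    using a(2)[OF that] a(1)[OF PK[OF that]] by (metis less_trans)
  moreover have "l Y < l (T (P Y))" if Y: "Y \<in> K" "Y \<in> S \<union> S'" for Y
    using a(2)[OF Y(1)] a(1)[OF PK[OF Y(1)]] S[OF Y(1)] Y(2) by (metis UnE less_trans)
  ultimately show ?thesis unfolding lifting_def by simp
qed

lemma lifting_finite:
  assumes "finite D" "\<And>X. X \<in> D \<Longrightarrow> lifting K l X1 X2 (S X) (T X)"
  shows "\<exists>P. lifting K l X1 X2 (\<Union>X\<in>D. S X) P"
  using assms
proof (induction D)
  case empty
  show ?case by (intro exI[of _ "\<lambda>x. x"]) (simp add: lifting_def)
next
  case (insert X D)
  have "\<exists>P. lifting K l X1 X2 (\<Union>X\<in>D. S X) P" by (rule insert.IH) (rule insert.prems[OF insertI2])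
  then obtain P where P: "lifting K l X1 X2 (\<Union>X\<in>D. S X) P" ..
  show ?case using lifting_compose[OF insert.prems[OF insertI1] P] by (intro exI) simp
qed

text \<open>Let c be the supremum of the levels above which X1 and X2 lie in one connected set. The
  components of X1 at levels just below c intersect in a connected set on which l is at least c.
  None of its points at level exactly c is a strict maximum, so finitely many pushes raise the whole
  set above c, against the choice of c.\<close>

lemma strict_max_unique:
  fixes K :: "'a::euclidean_space set"
  assumes K: "compact K" "connected K" and l: "continuous_on K l"
    and alt: "\<And>Y. Y \<in> K \<Longrightarrow> strict_max_on K l Y \<or> pushable K l Y"
    and X: "X1 \<in> K" "X2 \<in> K" "strict_max_on K l X1" "strict_max_on K l X2"
  shows "X1 = X2"
proof (rule ccontr)
  assume ne: "X1 \<noteq> X2"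
  define A where "A c = {Y \<in> K. l Y \<ge> c}" for c
  define S where "S = {c. \<exists>C. connected C \<and> C \<subseteq> A c \<and> X1 \<in> C \<and> X2 \<in> C}"
  have cA: "compact (A c)" for c
  proof -
    have "closedin (top_of_set K) (K \<inter> l -` {c..})" by (rule continuous_closedin_preimage[OF l]) simp
    then have "closedin (top_of_set K) (A c)" by (simp add: A_def vimage_def Int_def)
    then show ?thesis by (rule closedin_compact[OF K(1)])
  qed
  obtain m where m: "m \<in> K" "\<And>Y. Y \<in> K \<Longrightarrow> l m \<le> l Y"
    using continuous_attains_inf[OF K(1) _ l] X(1) by blast
  have S0: "l m \<in> S" unfolding S_def A_def using K(2) X(1,2) m(2) by blast
  have Sb: "c \<le> l X1" if "c \<in> S" for c using that unfolding S_def A_def by blast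
  then have bdd: "bdd_above S" by (auto simp: bdd_above_def)
  define c where "c = Sup S"
  define C where "C k = connected_component_set (A (c - 1 / real (Suc k))) X1" for k
  define CC where "CC = (\<Inter>k. C k)"
  have C: "compact (C k)" "connected (C k)" "C k \<subseteq> A (c - 1 / real (Suc k))" "X1 \<in> C k" "X2 \<in> C k" for k
  proof -
    have "c - 1 / real (Suc k) < Sup S" unfolding c_def by simp
    then obtain s where s: "s \<in> S" "c - 1 / real (Suc k) < s"
      using less_cSup_iff[OF _ bdd] S0 by blast
    then obtain B where B: "connected B" "B \<subseteq> A s" "X1 \<in> B" "X2 \<in> B" unfolding S_def by blast
    have "A s \<subseteq> A (c - 1 / real (Suc k))" using s(2) by (auto simp: A_def)
    then have "B \<subseteq> C k" unfolding C_def using connected_component_maximal[OF B(3,1)] B(2) by blast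
    then show "X1 \<in> C k" "X2 \<in> C k" using B by auto
    show sub: "C k \<subseteq> A (c - 1 / real (Suc k))" unfolding C_def by (rule connected_component_subset)
    show "connected (C k)" unfolding C_def by (rule connected_connected_component)
    have "closed (C k)" unfolding C_def by (rule closed_connected_component[OF compact_imp_closed[OF cA]])
    then show "compact (C k)" using compact_Int_closed[OF cA, of "C k"] sub by (metis Int_absorb1)
  qed
  have conn: "connected CC"
    unfolding CC_def
  proof (rule connected_nest[OF C(1,2)])
    fix i j :: nat assume "i \<le> j"
    then have "1 / real (Suc j) \<le> 1 / real (Suc i)" by (intro divide_left_mono) auto
    then have "A (c - 1 / real (Suc j)) \<subseteq> A (c - 1 / real (Suc i))" by (auto simp: A_def)
    then show "C j \<subseteq> C i" unfolding C_def by (rule connected_component_mono)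
  qed
  have XC: "X1 \<in> CC" "X2 \<in> CC" unfolding CC_def using C by blast+
  have CK: "CC \<subseteq> K" using C(3)[of 0] unfolding CC_def A_def by blast
  have lC: "c \<le> l Y" if "Y \<in> CC" for Y
  proof (rule ccontr)
    assume "\<not> c \<le> l Y"
    then obtain k where "inverse (real (Suc k)) < c - l Y" using reals_Archimedean[of "c - l Y"] by auto
    moreover have "c - 1 / real (Suc k) \<le> l Y" using that C(3)[of k] unfolding CC_def A_def by blast
    ultimately show False by (simp add: inverse_eq_divide)
  qed
  have compCC: "compact CC" unfolding CC_def using C(1)
    by (intro compact_Inter) auto
  define M where "M = CC \<inter> A c \<inter> {Y \<in> K. l Y \<le> c}"
  have compM: "compact M"
  proof -
    have "closedin (top_of_set K) (K \<inter> l -` {..c})" by (rule continuous_closedin_preimage[OF l]) simp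
    then have "compact {Y \<in> K. l Y \<le> c}" using closedin_compact[OF K(1)] by (simp add: vimage_def Int_def)
    then show ?thesis unfolding M_def by (intro compact_Int compCC cA)
  qed
  have M: "Y \<in> M \<longleftrightarrow> Y \<in> CC \<and> l Y = c" for Y using CK by (auto simp: M_def A_def)
  have no: "\<not> strict_max_on K l Y" if Y: "Y \<in> M" for Y
  proof
    assume "strict_max_on K l Y"
    then obtain r where r: "r > 0" "\<And>Z. Z \<in> K \<Longrightarrow> Z \<noteq> Y \<Longrightarrow> dist Z Y < r \<Longrightarrow> l Z < l Y"
      unfolding strict_max_on_def by blast
    \<comment> \<open>A connected set with two points is perfect, so Y is approached by points of
      CC, where l is at least l Y.\<close>
    have "Y islimpt CC" using connected_imp_perfect[OF conn] Y XC ne unfolding M by blast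
    then obtain Z where "Z \<in> CC" "Z \<noteq> Y" "dist Z Y < r" using r(1) unfolding islimpt_approachable by blast
    then show False using r(2)[of Z] CK lC[of Z] Y unfolding M by fastforce
  qed
  have "\<exists>T d. d > 0 \<and> lifting K l X1 X2 (ball Y d) T" if Y: "Y \<in> M" for Y
  proof -
    have p: "pushable K l Y" using alt[of Y] no[OF Y] Y CK unfolding M by blast
    \<comment> \<open>The push is confined to distances from Y smaller than those of X1 and X2,
      which therefore stay fixed.\<close>
    have "Y \<noteq> X1" "Y \<noteq> X2" using no[OF Y] X by blast+
    then have "min (dist X1 Y) (dist X2 Y) > 0" by simp
    with p obtain T d where T: "d > 0" "continuous_on K T" "T ` K \<subseteq> K"
     "\<forall>Z\<in>K. T Z = Z \<or> l Z < l (T Z)" "\<forall>Z\<in>K. dist Z Y < d \<longrightarrow> l Z < l (T Z)"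
     "\<forall>Z\<in>K. min (dist X1 Y) (dist X2 Y) \<le> dist Z Y \<longrightarrow> T Z = Z" unfolding pushable_def by blast
    have "T X1 = X1" "T X2 = X2" using T(6) X by auto
    then have "lifting K l X1 X2 (ball Y d) T" using T(2-5) by (simp add: lifting_def dist_commute)
    with T(1) show ?thesis by blast
  qed
  then obtain T d where T: "\<And>Y. Y \<in> M \<Longrightarrow> d Y > 0 \<and> lifting K l X1 X2 (ball Y (d Y)) (T Y)"
    by metis
  have cover: "M \<subseteq> (\<Union>Y\<in>M. ball Y (d Y))" using T by (meson UN_I centre_in_ball subsetI)
  obtain D where D: "D \<subseteq> M" "finite D" "M \<subseteq> (\<Union>Y\<in>D. ball Y (d Y))"
    by (rule compactE_image[OF compM _ cover]) (use that in auto)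
  have "\<exists>P. lifting K l X1 X2 (\<Union>Y\<in>D. ball Y (d Y)) P"
    by (rule lifting_finite[OF D(2)]) (use T D(1) in blast)
  then obtain P where "lifting K l X1 X2 (\<Union>Y\<in>D. ball Y (d Y)) P" ..
  then have P: "continuous_on K P" "P ` K \<subseteq> K" "P X1 = X1" "P X2 = X2"
     "\<And>Y. Y \<in> K \<Longrightarrow> P Y = Y \<or> l Y < l (P Y)" "\<And>Y. Y \<in> K \<Longrightarrow> Y \<in> (\<Union>Y\<in>D. ball Y (d Y)) \<Longrightarrow> l Y < l (P Y)"
    unfolding lifting_def by blast+
  have comp: "compact (P ` CC)" and conP: "connected (P ` CC)"
    by (rule compact_continuous_image[OF continuous_on_subset[OF P(1) CK] compCC],
        rule connected_continuous_image[OF continuous_on_subset[OF P(1) CK] conn])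
  have PK: "P ` CC \<subseteq> K" using P(2) CK by blast
  obtain W where W: "W \<in> P ` CC" "\<And>Y. Y \<in> P ` CC \<Longrightarrow> l W \<le> l Y"
    using continuous_attains_inf[OF comp _ continuous_on_subset[OF l PK]] XC by blast
  have "l (P Y) > c" if Y: "Y \<in> CC" for Y
  proof (cases "l Y = c")
    case True
    then have "Y \<in> M" using M Y by blast
    then have "l Y < l (P Y)" using P(6)[of Y] D(3) Y CK by blast
    then show ?thesis using True by simp
  next
    case False
    then have "l Y > c" using lC[OF Y] by simp
    then show ?thesis using P(5)[of Y] Y CK by fastforce
  qed
  then have "l W > c" using W(1) by blast
  moreover have "l W \<in> S" unfolding S_def A_def
  proof (rule CollectI, rule exI[of _ "P ` CC"], intro conjI)
    show "P ` CC \<subseteq> {Y \<in> K. l W \<le> l Y}" using W PK by blast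
    show "X1 \<in> P ` CC" "X2 \<in> P ` CC" using XC P(3,4) by (metis imageI)+
  qed (rule conP)
  then have "l W \<le> c" unfolding c_def using bdd by (rule cSup_upper)
  ultimately show False by simp
qed

text \<open>A mountain pass argument: a critical level between two strict maxima could be pushed up.\<close>

lemma strict_max_global:
  fixes K :: "'a::euclidean_space set"
  assumes K: "compact K" "connected K" and l: "continuous_on K l"
    and alt: "\<And>Y. Y \<in> K \<Longrightarrow> strict_max_on K l Y \<or> pushable K l Y"
    and X: "X \<in> K" "strict_max_on K l X" and Y: "Y \<in> K" "Y \<noteq> X"
  shows "l Y < l X"
proof -
  \<comment> \<open>A global maximum cannot be pushed, so by the alternative it is strict; a second
    point of maximal value would be a second strict maximum.\<close>
  have top: "strict_max_on K l Z" if Z: "Z \<in> K" "\<And>Y. Y \<in> K \<Longrightarrow> l Y \<le> l Z" for Z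
  proof (rule ccontr)
    assume "\<not> strict_max_on K l Z"
    then have "pushable K l Z" using alt Z by blast
    then obtain T d where "d > 0" "T ` K \<subseteq> K" "\<forall>Y\<in>K. dist Y Z < d \<longrightarrow> l Y < l (T Y)"
      unfolding pushable_def by (meson zero_less_one)
    then have "l Z < l (T Z)" "T Z \<in> K" using Z(1) by auto
    then show False using Z(2) by fastforce
  qed
  obtain Z where Z: "Z \<in> K" "\<And>Y. Y \<in> K \<Longrightarrow> l Y \<le> l Z"
    using continuous_attains_sup[OF K(1) _ l] X(1) by blast
  have "Z = X" by (rule strict_max_unique[OF K l alt Z(1) X(1) top[OF Z] X(2)])
  then have le: "l Y \<le> l X" using Z Y by blast
  moreover have "l Y \<noteq> l X"
  proof
    assume eq: "l Y = l X"
    have "strict_max_on K l Y" by (rule top[OF Y(1)]) (use Z \<open>Z = X\<close> eq in simp)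
    then show False using strict_max_unique[OF K l alt Y(1) X(1) _ X(2)] Y(2) by blast
  qed
  ultimately show ?thesis by simp
qed

text \<open>One radius serves all starting points near X and all short times: the directional
  derivative is positive on a ball that contains these segments.\<close>

lemma increase_along:
  fixes f :: "'a::euclidean_space \<Rightarrow> real"
  assumes U: "open U" "smooth_on U f" "X \<in> U" and w: "gr f X \<bullet> w > 0"
  obtains r where "r > 0" "\<And>Y s. dist Y X < r \<Longrightarrow> 0 \<le> s \<Longrightarrow> s < r \<Longrightarrow> Y + s *\<^sub>R w \<in> U"
    "\<And>Y s. dist Y X < r \<Longrightarrow> 0 < s \<Longrightarrow> s < r \<Longrightarrow> f Y < f (Y + s *\<^sub>R w)"
proof -
  have "continuous_on U (\<lambda>x. gr f x \<bullet> w)"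
    by (intro continuous_intros smooth_on_continuous_on[OF smooth_on_gr[OF U(1,2)]])
  then have "openin (top_of_set U) (U \<inter> (\<lambda>x. gr f x \<bullet> w) -` {0<..})"
    by (rule continuous_openin_preimage_gen) simp
  then have op: "open (U \<inter> (\<lambda>x. gr f x \<bullet> w) -` {0<..})" using U(1) openin_open_eq by blast
  obtain q where q: "q > 0" "ball X q \<subseteq> U \<inter> (\<lambda>x. gr f x \<bullet> w) -` {0<..}"
    using open_contains_ball_eq[OF op, of X] U(3) w by auto
  define r where "r = q / (1 + norm w)"
  have n: "1 + norm w > 0" by (simp add: add_pos_nonneg)
  have r: "r > 0" using q(1) n by (simp add: r_def)
  have in_ball: "Y + s *\<^sub>R w \<in> ball X q" if "dist Y X < r" "0 \<le> s" "s < r" for Y s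
  proof -
    have "dist (Y + s *\<^sub>R w) X \<le> dist Y X + s * norm w"
      using norm_triangle_ineq[of "Y - X" "s *\<^sub>R w"] that(2) by (simp add: dist_norm algebra_simps)
    also have "\<dots> < r + r * norm w"
      using that by (intro add_less_le_mono mult_right_mono) auto
    also have "\<dots> = r * (1 + norm w)" by (simp add: algebra_simps)
    also have "\<dots> = q" using n by (simp add: r_def)
    finally show ?thesis by (simp add: dist_commute)
  qed
  show thesis
  proof (rule that[OF r])
    show "Y + s *\<^sub>R w \<in> U" if "dist Y X < r" "0 \<le> s" "s < r" for Y s using in_ball[OF that] q(2) by blast
    fix Y s assume a: "dist Y X < r" "0 < s" "s < r"
    have "f (Y + 0 *\<^sub>R w) < f (Y + s *\<^sub>R w)"
    proof (rule DERIV_pos_imp_increasing[OF a(2), of "\<lambda>t. f (Y + t *\<^sub>R w)"])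
      fix t assume t: "0 \<le> t" "t \<le> s"
      have "Y + t *\<^sub>R w \<in> U \<inter> (\<lambda>x. gr f x \<bullet> w) -` {0<..}" using in_ball[OF a(1) t(1)] t(2) a(3) q(2) by (meson le_less_trans subsetD)
      then show "\<exists>y. ((\<lambda>t. f (Y + t *\<^sub>R w)) has_real_derivative y) (at t) \<and> 0 < y"
        using smooth_line_derivative[OF U(2), of Y t w UNIV]
        by (intro exI[of _ "gr f (Y + t *\<^sub>R w) \<bullet> w"]) (simp add: has_field_derivative_def mult_commute_abs)
    qed
    then show "f Y < f (Y + s *\<^sub>R w)" by simp
  qed
qed

lemma mink_tangent_pos:
  assumes "mink X X < 0" "mink X v = 0" "v \<noteq> 0"
  shows "mink v v > 0"
proof -
  let ?x = "fst X" and ?t = "snd X" and ?u = "fst v" and ?s = "snd v"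
  have x: "?x \<bullet> ?x < ?t^2" using assms(1) by (simp add: mink_def power2_eq_square)
  then have t: "?t^2 > 0" using inner_ge_zero[of ?x] by linarith
  have u: "?u \<noteq> 0"
  proof
    assume "?u = 0"
    then have "?s = 0" using assms(2) t by (simp add: mink_def)
    then show False using \<open>?u = 0\<close> assms(3) by (simp add: prod_eq_iff)
  qed
  have "?t^2 * ?s^2 = (?x \<bullet> ?u)^2" using assms(2) by (simp add: mink_def power_mult_distrib)
  also have "\<dots> \<le> (?x \<bullet> ?x) * (?u \<bullet> ?u)" by (rule Cauchy_Schwarz_ineq)
  also have "\<dots> < ?t^2 * (?u \<bullet> ?u)" using x u by (intro mult_strict_right_mono) simp_all
  finally have "?s^2 < ?u \<bullet> ?u" using t by simp
  then show ?thesis by (simp add: mink_def power2_eq_square)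
qed

section \<open>The future cone, radial projection and deformations of the domain\<close>

definition Cn :: "'n::finite minkowski set" where
  "Cn = {X. mink X X < 0 \<and> snd X > 0}"

text \<open>Radial projection of the future cone to the hyperboloid. Composing with it extends
  functions on \<open>hyp\<close> to open sets of the ambient space, where smoothness is
  defined.\<close>

definition nrm :: "'n::finite minkowski \<Rightarrow> 'n minkowski" where
  "nrm X = (1 / sqrt (- mink X X)) *\<^sub>R X"

definition mgr :: "('n::finite minkowski \<Rightarrow> real) \<Rightarrow> 'n minkowski \<Rightarrow> 'n minkowski" where
  "mgr f X = (fst (gr f X), - snd (gr f X))"

lemma mink_mgr: "mink (mgr f X) v = gr f X \<bullet> v"
  by (simp add: mink_def mgr_def inner_prod_def[of "gr f X"])

lemma open_Cn: "open Cn"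
  unfolding Cn_def by (intro open_Collect_conj open_Collect_less continuous_intros)

lemma hyp_Cn: "hyp \<subseteq> Cn"
  by (auto simp: hyp_def Cn_def)

lemma nrm_hyp: "X \<in> Cn \<Longrightarrow> nrm X \<in> hyp"
  by (simp add: Cn_def nrm_def hyp_def mink_simps)

lemma nrm_ident: "mink X X = -1 \<Longrightarrow> nrm X = X"
  by (simp add: nrm_def)

lemma nrm_scale: "c > 0 \<Longrightarrow> X \<in> Cn \<Longrightarrow> nrm (c *\<^sub>R X) = nrm X"
proof -
  assume c: "c > 0" and X: "X \<in> Cn"
  have "sqrt (- mink (c *\<^sub>R X) (c *\<^sub>R X)) = sqrt (c^2 * (- mink X X))"
    by (simp add: mink_simps power2_eq_square)
  also have "\<dots> = c * sqrt (- mink X X)" using c by (simp only: real_sqrt_mult) simp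
  finally show ?thesis using c by (simp add: nrm_def)
qed

lemma smooth_mink: "open U \<Longrightarrow> smooth_on U f \<Longrightarrow> smooth_on U g \<Longrightarrow> smooth_on U (\<lambda>x. mink (f x) (g x))"
  unfolding mink_def by (intro smooth_on_diff smooth_on_inner smooth_on_mult smooth_on_fst smooth_on_snd)

lemma smooth_nrm: "smooth_on Cn nrm"
  unfolding nrm_def[abs_def]
  by (intro smooth_on_scaleR smooth_on_divide smooth_on_sqrt smooth_on_minus smooth_mink smooth_on_ident smooth_on_const open_Cn)
    (auto simp: Cn_def)

lemma has_derivative_mink:
  "(f has_derivative f') (at x within S) \<Longrightarrow> (g has_derivative g') (at x within S) \<Longrightarrow>
    ((\<lambda>x. mink (f x) (g x)) has_derivative (\<lambda>v. mink (f' v) (g x) + mink (f x) (g' v))) (at x within S)"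
  unfolding mink_def by (auto intro!: derivative_eq_intros simp: algebra_simps)

lemma has_derivative_nrm:
  assumes Y: "mink Y Y = -1"
  shows "(nrm has_derivative (\<lambda>v. v + mink Y v *\<^sub>R Y)) (at Y)"
proof -
  have m: "((\<lambda>X. - mink X X) has_derivative (\<lambda>v. - (mink v Y + mink Y v))) (at Y)"
    by (intro has_derivative_minus has_derivative_mink has_derivative_ident)
  have s: "((\<lambda>x. 1 / sqrt x) has_derivative (\<lambda>d. - d / 2)) (at (- mink Y Y))"
    unfolding Y by (auto intro!: derivative_eq_intros)
  have "((\<lambda>X. 1 / sqrt (- mink X X)) has_derivative (\<lambda>v. - (- (mink v Y + mink Y v)) / 2)) (at Y)"
    by (rule has_derivative_compose[OF m s])
  then have "(nrm has_derivative (\<lambda>v. (1 / sqrt (- mink Y Y)) *\<^sub>R v + (- (- (mink v Y + mink Y v)) / 2) *\<^sub>R Y)) (at Y)"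
    unfolding nrm_def[abs_def] by (rule has_derivative_scaleR[OF _ has_derivative_ident])
  moreover have "(1 / sqrt (- mink Y Y)) *\<^sub>R v + (- (- (mink v Y + mink Y v)) / 2) *\<^sub>R Y = v + mink Y v *\<^sub>R Y" for v
    using mink_commute[of v Y] by (simp add: Y)
  ultimately show ?thesis by simp
qed

lemma gr_linear_nrm:
  assumes Y: "mink Y Y = -1"
  shows "gr (\<lambda>X. mink \<eta> (nrm X)) Y \<bullet> v = mink (\<eta> + mink \<eta> Y *\<^sub>R Y) v"
proof -
  let ?g = "(fst \<eta>, - snd \<eta>) + mink \<eta> Y *\<^sub>R (fst Y, - snd Y)"
  have g: "?g \<bullet> v = mink \<eta> v + mink Y v * mink \<eta> Y" for v
    by (simp add: inner_prod_def[of _ v] mink_def[of _ v] inner_add_left algebra_simps)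
  have "((\<lambda>X. mink \<eta> (nrm X)) has_derivative (\<lambda>v. mink 0 (nrm Y) + mink \<eta> (v + mink Y v *\<^sub>R Y))) (at Y)"
    by (rule has_derivative_mink[OF has_derivative_const has_derivative_nrm[OF Y]])
  moreover have "(\<lambda>v. mink 0 (nrm Y) + mink \<eta> (v + mink Y v *\<^sub>R Y)) = (\<lambda>v. ?g \<bullet> v)"
    unfolding g by (rule ext) (simp add: mink_def[of 0] mink_simps)
  ultimately have "gr (\<lambda>X. mink \<eta> (nrm X)) Y = ?g" by (intro gr_eqI) simp
  then show ?thesis using g by (simp add: mink_simps)
qed

text \<open>The displacement s(Y) w fades out at distance q from X and is followed by projection to
  the hyperboloid; its continuity in Y gives a deformation of all of K.\<close>

lemma pushI:
  assumes K: "K \<subseteq> hyp" and X: "X \<in> K" and r0: "r0 > 0"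
    and key: "\<And>Y s. Y \<in> K \<Longrightarrow> dist Y X < r0 \<Longrightarrow> 0 < s \<Longrightarrow> s < r0 \<Longrightarrow>
      Y + s *\<^sub>R w \<in> Cn \<and> nrm (Y + s *\<^sub>R w) \<in> K \<and> l Y < l (nrm (Y + s *\<^sub>R w))"
  shows "pushable K l X"
  unfolding pushable_def
proof (intro allI impI)
  fix r :: real assume r: "r > 0"
  define q where "q = min r r0"
  \<comment> \<open>Half of the remaining distance stays strictly below r0, as \<open>key\<close>
    demands.\<close>
  define s where "s Y = max 0 (q - dist Y X) / 2" for Y
  have q: "q > 0" using r r0 by (simp add: q_def)
  have s0: "s Y = 0 \<longleftrightarrow> q \<le> dist Y X" and sp: "s Y \<ge> 0" for Y by (auto simp: s_def)
  have id: "nrm Y = Y" if "Y \<in> K" for Y using that K by (intro nrm_ident) (auto simp: hyp_def)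
  have kk: "Y + s Y *\<^sub>R w \<in> Cn \<and> nrm (Y + s Y *\<^sub>R w) \<in> K \<and> l Y < l (nrm (Y + s Y *\<^sub>R w))"
    if "Y \<in> K" "dist Y X < q" for Y
  proof (rule key[OF that(1)])
    show "s Y > 0" "dist Y X < r0" using that(2) by (auto simp: s_def q_def)
    have "q - dist Y X < 2 * r0" using r0 zero_le_dist[of Y X] unfolding q_def by linarith
    then show "s Y < r0" using r0 by (simp add: s_def)
  qed
  have zero: "nrm (Y + s Y *\<^sub>R w) = Y" "Y + s Y *\<^sub>R w = Y" if "Y \<in> K" "\<not> dist Y X < q" for Y
    using that s0[of Y] id[OF that(1)] by auto
  have Cn: "Y + s Y *\<^sub>R w \<in> Cn" if "Y \<in> K" for Y using kk[OF that] zero(2)[OF that] that K hyp_Cn by fastforce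
  have "continuous_on K (\<lambda>Y. nrm (Y + s Y *\<^sub>R w))"
  proof (rule continuous_on_compose2[OF smooth_on_continuous_on[OF smooth_nrm]])
    show "continuous_on K (\<lambda>Y. Y + s Y *\<^sub>R w)" unfolding s_def by (intro continuous_intros) simp
  qed (use Cn in blast)
  moreover have "(\<lambda>Y. nrm (Y + s Y *\<^sub>R w)) ` K \<subseteq> K" using kk zero(1) by (smt (verit) image_subsetI)
  moreover have "\<forall>Y\<in>K. r \<le> dist Y X \<longrightarrow> nrm (Y + s Y *\<^sub>R w) = Y" using zero(1) by (simp add: q_def)
  ultimately show "\<exists>T d. d > 0 \<and> continuous_on K T \<and> T ` K \<subseteq> K \<and>
     (\<forall>Y\<in>K. T Y = Y \<or> l Y < l (T Y)) \<and> (\<forall>Y\<in>K. dist Y X < d \<longrightarrow> l Y < l (T Y)) \<and>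
     (\<forall>Y\<in>K. r \<le> dist Y X \<longrightarrow> T Y = Y)"
    using q kk zero(1) by (intro exI[of _ "\<lambda>Y. nrm (Y + s Y *\<^sub>R w)"] exI[of _ q] conjI ballI impI) (assumption | blast)+
qed

lemma continuous_nrm_near:
  assumes Y: "Y \<in> hyp" and e: "e > 0"
  obtains d where "d > 0" "\<And>X. dist X Y < d \<Longrightarrow> X \<in> Cn \<and> dist (nrm X) Y < e"
proof -
  have "Y \<in> Cn" using Y hyp_Cn by blast
  then have "isCont nrm Y" using smooth_on_continuous_on[OF smooth_nrm] open_Cn continuous_on_eq_continuous_at by blast
  then have "\<forall>\<^sub>F X in at Y. dist (nrm X) (nrm Y) < e" using e unfolding isCont_def tendsto_iff by blast
  then obtain d1 where d1: "d1 > 0" "\<And>X. X \<noteq> Y \<Longrightarrow> dist X Y < d1 \<Longrightarrow> dist (nrm X) (nrm Y) < e"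
    unfolding eventually_at by blast
  obtain d2 where d2: "d2 > 0" "ball Y d2 \<subseteq> Cn" using open_contains_ball_eq[OF open_Cn] \<open>Y \<in> Cn\<close> by blast
  have nY: "nrm Y = Y" using Y by (intro nrm_ident) (simp add: hyp_def)
  show thesis
  proof (rule that[of "min d1 d2"])
    show "X \<in> Cn \<and> dist (nrm X) Y < e" if "dist X Y < min d1 d2" for X
      using d1(2)[of X] d2(2) that nY e by (cases "X = Y") (auto simp: dist_commute)
  qed (use d1 d2 in simp)
qed

lemma push_directionI:
  assumes K: "K \<subseteq> hyp" and Y: "Y \<in> K" and w: "mink (\<eta> + mink \<eta> Y *\<^sub>R Y) w > 0" and r0: "r0 > 0"
    and stay: "\<And>X s. X \<in> K \<Longrightarrow> dist X Y < r0 \<Longrightarrow> 0 < s \<Longrightarrow> s < r0 \<Longrightarrow> nrm (X + s *\<^sub>R w) \<in> K"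
  shows "pushable K (mink \<eta>) Y"
proof -
  have YY: "mink Y Y = -1" and YC: "Y \<in> Cn" using Y K hyp_Cn by (auto simp: hyp_def)
  have g: "gr (\<lambda>X. mink \<eta> (nrm X)) Y \<bullet> w > 0" using w by (simp add: gr_linear_nrm[OF YY])
  have sm: "smooth_on Cn (\<lambda>X. mink \<eta> (nrm X))" by (intro smooth_mink open_Cn smooth_on_const smooth_nrm)
  obtain r where r: "r > 0" "\<And>X s. dist X Y < r \<Longrightarrow> 0 \<le> s \<Longrightarrow> s < r \<Longrightarrow> X + s *\<^sub>R w \<in> Cn"
    "\<And>X s. dist X Y < r \<Longrightarrow> 0 < s \<Longrightarrow> s < r \<Longrightarrow> mink \<eta> (nrm X) < mink \<eta> (nrm (X + s *\<^sub>R w))"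
    by (rule increase_along[OF open_Cn sm YC g]) (rule that, assumption+)
  show ?thesis
  proof (rule pushI[OF K Y, of "min r r0" w])
    fix X s assume X: "X \<in> K" "dist X Y < min r r0" "0 < s" "s < min r r0"
    have "nrm X = X" using X(1) K by (intro nrm_ident) (auto simp: hyp_def)
    then show "X + s *\<^sub>R w \<in> Cn \<and> nrm (X + s *\<^sub>R w) \<in> K \<and> mink \<eta> X < mink \<eta> (nrm (X + s *\<^sub>R w))"
      using r(2)[of X s] r(3)[of X s] stay[of X s] X by simp
  qed (use r(1) r0 in simp)
qed

text \<open>\<open>\<eta> + mink \<eta> Y *\<^sub>R Y\<close> represents the differential of \<eta>
  along the hyperboloid; reversing its time component gives a direction in which \<eta> grows, and
  at an interior point every short displacement stays in K.\<close>

lemma push_interior: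
  assumes K: "closed K" "K \<subseteq> hyp" and Y: "Y \<in> K" "Y \<notin> bd K" and ne: "\<eta> + mink \<eta> Y *\<^sub>R Y \<noteq> 0"
  shows "pushable K (mink \<eta>) Y"
proof -
  let ?xi = "\<eta> + mink \<eta> Y *\<^sub>R Y"
  define w where "w = (fst ?xi, - snd ?xi)"
  obtain e where e: "e > 0" "\<And>X. X \<in> hyp \<Longrightarrow> dist X Y < e \<Longrightarrow> X \<in> K"
    using Y bd_iff[OF K] by blast
  have "mink ?xi w = ?xi \<bullet> ?xi" unfolding w_def by (simp only: mink_def[of ?xi] fst_conv snd_conv inner_prod_def[of ?xi]) (simp add: algebra_simps)
  then have w: "mink ?xi w > 0" using ne by simp
  obtain d where d: "d > 0" "\<And>X. dist X Y < d \<Longrightarrow> X \<in> Cn \<and> dist (nrm X) Y < e"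
    by (rule continuous_nrm_near[OF _ e(1), of Y]) (use Y(1) K(2) in blast, rule that, assumption+)
  have n: "1 + norm w > 0" by (simp add: add_pos_nonneg)
  show ?thesis
  proof (rule push_directionI[OF K(2) Y(1) w, of "d / (1 + norm w)"])
    fix X s assume X: "X \<in> K" "dist X Y < d / (1 + norm w)" "0 < s" "s < d / (1 + norm w)"
    have "dist (X + s *\<^sub>R w) Y \<le> dist X Y + s * norm w"
      using norm_triangle_ineq[of "X - Y" "s *\<^sub>R w"] X(3) by (simp add: dist_norm algebra_simps)
    also have "\<dots> < d / (1 + norm w) + d / (1 + norm w) * norm w" using X by (intro add_less_le_mono mult_right_mono) auto
    also have "\<dots> = d / (1 + norm w) * (1 + norm w)" by (simp only: distrib_left mult_1_right)
    also have "\<dots> = d" using n by simp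
    finally show "nrm (X + s *\<^sub>R w) \<in> K" using d(2) e(2) nrm_hyp by blast
  qed (use d(1) n in simp)
qed

lemma mink_eqI:
  assumes "\<And>v. mink a v = mink b v"
  shows "a = b"
proof -
  have "mink (a - b) (fst (a - b), - snd (a - b)) = 0" using assms by (simp only: mink_diff_left diff_self)
  then have "(a - b) \<bullet> (a - b) = 0" by (simp only: mink_def fst_conv snd_conv inner_prod_def[of "a - b"]) (simp add: algebra_simps)
  then show ?thesis by simp
qed

lemma quadratic_nonneg_linear_zero:
  fixes b c :: real
  assumes "\<And>s. 2 * s * b + s^2 * c \<ge> 0" "c \<ge> 0"
  shows "b = 0"
proof -
  define x where "x = b / (c + 1)"
  have b: "b = x * (c + 1)" using assms(2) by (simp add: x_def)
  have "2 * (- x) * b + (- x)^2 * c \<ge> 0" by (rule assms(1))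
  moreover have "2 * (- x) * b + (- x)^2 * c = - (x^2 * (c + 2))"
    unfolding b by (simp add: power2_eq_square algebra_simps)
  ultimately have "x^2 * (c + 2) \<le> 0" by simp
  then show ?thesis using assms(2) by (simp add: mult_le_0_iff b)
qed

text \<open>A defining function near a boundary point, extended homogeneously of degree 0 to a cone
  U and free of critical points. Its ambient derivatives then describe the hypersurface in
  \<open>hyp\<close>, and its Lorentzian gradient at X is automatically orthogonal to X.\<close>

locale bchart =
  fixes K U :: "'n::finite minkowski set" and f :: "'n minkowski \<Rightarrow> real"
  assumes compact_K: "compact K" and K_hyp: "K \<subseteq> hyp" and open_U: "open U" and U_Cn: "U \<subseteq> Cn"
    and cone: "c > 0 \<Longrightarrow> X \<in> U \<Longrightarrow> c *\<^sub>R X \<in> U"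
    and hom: "c > 0 \<Longrightarrow> X \<in> U \<Longrightarrow> f (c *\<^sub>R X) = f X"
    and smooth_f: "smooth_on U f" and K_U: "K \<inter> U = {Y \<in> hyp \<inter> U. f Y \<le> 0}"
    and gr_ne: "X \<in> U \<Longrightarrow> gr f X \<noteq> 0"
begin

definition Nf :: "'n minkowski \<Rightarrow> 'n minkowski" where
  "Nf X = (1 / sqrt (mink (mgr f X) (mgr f X))) *\<^sub>R mgr f X"

lemma closed_K: "closed K"
  by (rule compact_imp_closed[OF compact_K])

lemma K_iff: "X \<in> U \<Longrightarrow> X \<in> hyp \<Longrightarrow> X \<in> K \<longleftrightarrow> f X \<le> 0"
  using K_U by blast

lemma U_neg: "X \<in> U \<Longrightarrow> mink X X < 0"
  using U_Cn by (auto simp: Cn_def)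

lemma nrm_U:
  assumes "X \<in> U"
  shows "nrm X \<in> U" "nrm X \<in> hyp" "f (nrm X) = f X"
proof -
  have "1 / sqrt (- mink X X) > 0" using U_neg[OF assms] by simp
  then show "nrm X \<in> U" "f (nrm X) = f X" unfolding nrm_def using cone hom assms by blast+
  show "nrm X \<in> hyp" using nrm_hyp U_Cn assms by blast
qed

lemma der_f: "X \<in> U \<Longrightarrow> (f has_derivative (\<lambda>v. gr f X \<bullet> v)) (at X)"
  by (rule smooth_has_derivative_gr[OF smooth_f])

lemma mgr_perp:
  assumes X: "X \<in> U"
  shows "gr f X \<bullet> X = 0"
proof -
  have d: "((\<lambda>s. f (X + s *\<^sub>R X)) has_derivative (\<lambda>d. d * (gr f X \<bullet> X))) (at 0)"
    using smooth_line_derivative[OF smooth_f, of X 0 X UNIV] X by simp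
  have "((\<lambda>s. f (X + s *\<^sub>R X)) has_derivative (\<lambda>d. 0)) (at 0)"
  proof (rule has_derivative_transform_within_open[OF has_derivative_const[of "f X"]])
    show "f X = f (X + s *\<^sub>R X)" if "s \<in> {-1<..}" for s
      using hom[OF _ X, of "1 + s"] that by (simp add: scaleR_add_left)
  qed auto
  then have "(\<lambda>d. d * (gr f X \<bullet> X)) = (\<lambda>d. 0)" by (rule has_derivative_unique[OF d])
  from fun_cong[OF this, of 1] show ?thesis by simp
qed

lemma mgr_pos:
  assumes X: "X \<in> U"
  shows "mink (mgr f X) (mgr f X) > 0"
proof (rule mink_tangent_pos[OF U_neg[OF X]])
  show "mink X (mgr f X) = 0" using mgr_perp[OF X] mink_mgr[of f X X] mink_commute[of X "mgr f X"] by simp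
  show "mgr f X \<noteq> 0" using gr_ne[OF X] by (simp add: mgr_def prod_eq_iff)
qed

lemma Nf:
  assumes X: "X \<in> U"
  shows "mink (Nf X) (Nf X) = 1" "mink (Nf X) X = 0"
    "mink (Nf X) v = (gr f X \<bullet> v) / sqrt (mink (mgr f X) (mgr f X))"
proof -
  show n: "mink (Nf X) v = (gr f X \<bullet> v) / sqrt (mink (mgr f X) (mgr f X))" for v
    by (simp add: Nf_def mink_scale_left mink_mgr)
  show "mink (Nf X) X = 0" unfolding n mgr_perp[OF X] by simp
  show "mink (Nf X) (Nf X) = 1" using mgr_pos[OF X] by (simp add: Nf_def mink_simps)
qed

lemma Nf_zero_iff: "X \<in> U \<Longrightarrow> mink (Nf X) v = 0 \<longleftrightarrow> gr f X \<bullet> v = 0"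
  using mgr_pos[of X] by (simp add: Nf(3))

lemma smooth_mgr: "smooth_on U (mgr f)"
  unfolding mgr_def[abs_def]
  by (intro smooth_on_Pair smooth_on_minus smooth_on_fst smooth_on_snd smooth_on_gr open_U smooth_f)

lemma smooth_Nf: "smooth_on U Nf"
  unfolding Nf_def[abs_def]
  by (intro smooth_on_scaleR smooth_on_divide smooth_on_sqrt smooth_mink smooth_mgr smooth_on_const open_U)
    (use mgr_pos in auto)

lemma der_Nf: "X \<in> U \<Longrightarrow> (Nf has_derivative fd Nf X) (at X)"
  by (rule smooth_on_has_derivative[OF smooth_Nf])

lemma bd_iff_chart:
  assumes Y: "Y \<in> U" "Y \<in> hyp"
  shows "Y \<in> bd K \<longleftrightarrow> f Y = 0"
proof
  assume "Y \<in> bd K"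
  then have YK: "Y \<in> K" and out: "\<And>e. e > 0 \<Longrightarrow> \<exists>Z\<in>hyp. dist Z Y < e \<and> Z \<notin> K"
    unfolding bd_iff[OF closed_K K_hyp] by blast+
  have le: "f Y \<le> 0" using YK Y K_iff by blast
  have "\<not> f Y < 0"
  proof
    assume lt: "f Y < 0"
    have "openin (top_of_set U) (U \<inter> f -` {..<0})"
      by (rule continuous_openin_preimage_gen[OF smooth_on_continuous_on[OF smooth_f]]) simp
    then have "open (U \<inter> f -` {..<0})" using open_U openin_open_eq by blast
    then obtain e where e: "e > 0" "ball Y e \<subseteq> U \<inter> f -` {..<0}"
      using open_contains_ball_eq[of "U \<inter> f -` {..<0}" Y] Y lt by auto
    obtain Z where Z: "Z \<in> hyp" "dist Z Y < e" "Z \<notin> K" using out[OF e(1)] by blast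
    then have "Z \<in> U \<inter> f -` {..<0}" using e(2) by (auto simp: dist_commute)
    then show False using Z K_iff[of Z] by simp
  qed
  then show "f Y = 0" using le by simp
next
  assume f0: "f Y = 0"
  have YK: "Y \<in> K" using f0 Y K_iff by simp
  have "gr f Y \<bullet> gr f Y > 0" using gr_ne[OF Y(1)] by simp
  then obtain r where r: "r > 0" "\<And>X s. dist X Y < r \<Longrightarrow> 0 \<le> s \<Longrightarrow> s < r \<Longrightarrow> X + s *\<^sub>R gr f Y \<in> U"
    "\<And>X s. dist X Y < r \<Longrightarrow> 0 < s \<Longrightarrow> s < r \<Longrightarrow> f X < f (X + s *\<^sub>R gr f Y)"
    by (rule increase_along[OF open_U smooth_f Y(1)]) (rule that, assumption+)
  have "\<exists>Z\<in>hyp. dist Z Y < e \<and> Z \<notin> K" if e: "e > 0" for e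
  proof -
    obtain d where d: "d > 0" "\<And>X. dist X Y < d \<Longrightarrow> X \<in> Cn \<and> dist (nrm X) Y < e"
      by (rule continuous_nrm_near[OF Y(2) e]) (rule that, assumption+)
    define s where "s = min (r / 2) (d / (2 * norm (gr f Y)))"
    have gp: "norm (gr f Y) > 0" using gr_ne[OF Y(1)] by simp
    have s: "0 < s" "s < r" using r(1) d(1) gp by (auto simp: s_def min_def)
    have "s * norm (gr f Y) \<le> (d / (2 * norm (gr f Y))) * norm (gr f Y)" by (intro mult_right_mono) (auto simp: s_def)
    also have "\<dots> < d" using gp d(1) by simp
    finally have dd: "dist (Y + s *\<^sub>R gr f Y) Y < d" using s by (simp add: dist_norm)
    have Z: "Y + s *\<^sub>R gr f Y \<in> U" "f (Y + s *\<^sub>R gr f Y) > 0" using r(2,3)[of Y s] r(1) s f0 by auto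
    have "nrm (Y + s *\<^sub>R gr f Y) \<notin> K" using nrm_U[OF Z(1)] Z(2) K_iff[of "nrm (Y + s *\<^sub>R gr f Y)"] by simp
    then show ?thesis using nrm_U(2)[OF Z(1)] d(2)[OF dd] by blast
  qed
  then show "Y \<in> bd K" unfolding bd_iff[OF closed_K K_hyp] using YK by blast
qed

text \<open>In the plane through Y spanned by v and the gradient m, the inverse function theorem for
  (s, t) \<mapsto> (s, f(Y + s v + t m)) solves f = 0 along a curve with velocity v; projection to
  the hyperboloid preserves f and, v being tangent, the velocity.\<close>

lemma bd_curve_chart:
  assumes Y: "Y \<in> U" "Y \<in> hyp" "f Y = 0" and v: "mink Y v = 0" "gr f Y \<bullet> v = 0"
  shows "v \<in> bd_tangent K Y"
proof -
  let ?m = "gr f Y"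
  define L where "L = (\<lambda>p::real\<times>real. Y + fst p *\<^sub>R v + snd p *\<^sub>R ?m)"
  define P where "P = (\<lambda>p. (fst p, f (L p)))"
  define O' where "O' = L -` U"
  have mm: "?m \<bullet> ?m > 0" using gr_ne[OF Y(1)] by simp
  have cL: "continuous_on UNIV L" unfolding L_def by (intro continuous_intros)
  have O': "open O'" unfolding O'_def by (rule open_vimage[OF open_U cL])
  have sL: "smooth_on O' L" unfolding L_def
    by (intro smooth_on_add smooth_on_scaleR smooth_on_const smooth_on_fst smooth_on_snd smooth_on_ident O')
  have sP: "smooth_on O' P" unfolding P_def
    by (intro smooth_on_Pair smooth_on_fst smooth_on_ident O' smooth_on_compose[OF O' open_U _ sL smooth_f])
      (auto simp: O'_def)
  have L0: "L 0 = Y" by (simp add: L_def)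
  have z: "0 \<in> O'" using Y by (simp add: O'_def L0)
  have dL: "(L has_derivative (\<lambda>p. fst p *\<^sub>R v + snd p *\<^sub>R ?m)) (at p)" for p
    unfolding L_def by (auto intro!: derivative_eq_intros)
  have "(P has_derivative (\<lambda>p. (fst p, ?m \<bullet> (fst p *\<^sub>R v + snd p *\<^sub>R ?m)))) (at 0)"
    unfolding P_def using has_derivative_compose[OF dL[of 0], of f "\<lambda>v. ?m \<bullet> v"] der_f[OF Y(1)]
    by (intro has_derivative_Pair has_derivative_fst has_derivative_ident) (simp add: L0)
  then have fd: "fd P (0) = (\<lambda>p. (fst p, ?m \<bullet> (fst p *\<^sub>R v + snd p *\<^sub>R ?m)))"
    by (rule frechet_derivative_at[symmetric])
  have "inj (fd P (0))"
    unfolding fd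
  proof (rule injI)
    fix p q assume eq: "(fst p, ?m \<bullet> (fst p *\<^sub>R v + snd p *\<^sub>R ?m)) = (fst q, ?m \<bullet> (fst q *\<^sub>R v + snd q *\<^sub>R ?m))"
    then have "snd p * (?m \<bullet> ?m) = snd q * (?m \<bullet> ?m)" by (simp only: prod.inject inner_add_right inner_scaleR_right v(2)) simp
    then show "p = q" using eq mm by (simp add: prod_eq_iff[of p q] del: inner_eq_zero_iff)
  qed
  then obtain O1 W g where g: "open O1" "O1 \<subseteq> O'" "0 \<in> O1" "open W" "P 0 \<in> W" "homeomorphism O1 W P g" "smooth_on W g"
    by (rule smooth_inverse_function[OF O' sP z]) (rule that, assumption+)
  have P0: "P 0 = 0" by (simp add: P_def L0 Y(3) prod_eq_iff)
  have g0: "g 0 = 0" using homeomorphism_apply1[OF g(6,3)] P0 by simp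
  have W0: "0 \<in> W" using g(5) P0 by simp
  obtain e where e: "e > 0" "ball 0 e \<subseteq> W" using open_contains_ball_eq[OF g(4)] W0 by blast
  define c where "c = (\<lambda>s::real. L (g (s, 0)))"
  have W: "(s, 0) \<in> W" if "\<bar>s\<bar> < e" for s using e(2) that by (auto simp: norm_Pair subset_eq)
  have gs: "L (g (s, 0)) \<in> U" "fst (g (s, 0)) = s" "f (L (g (s, 0))) = 0" if "\<bar>s\<bar> < e" for s
  proof -
    have "g (s, 0) \<in> O1" "P (g (s, 0)) = (s, 0)" using homeomorphism_image2[OF g(6)] homeomorphism_apply2[OF g(6) W[OF that]] W[OF that] by blast+
    then show "L (g (s, 0)) \<in> U" "fst (g (s, 0)) = s" "f (L (g (s, 0))) = 0"
      using g(2) by (auto simp: O'_def P_def)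
  qed
  have l: "((\<lambda>s::real. (s, 0::real)) has_derivative (\<lambda>d. (d, 0))) (at 0)"
    by (intro has_derivative_Pair has_derivative_ident has_derivative_const)
  have gd: "(g has_derivative fd g (0)) (at (0, 0))"
    using smooth_on_has_derivative[OF g(7) W0] by (simp add: zero_prod_def)
  define g' where "g' = (\<lambda>d::real. fd g (0) (d, 0))"
  have g': "((\<lambda>s. g (s, 0)) has_derivative g') (at 0)"
    unfolding g'_def by (rule has_derivative_compose[OF l gd])
  have cd: "(c has_derivative (\<lambda>d. fst (g' d) *\<^sub>R v + snd (g' d) *\<^sub>R ?m)) (at 0)"
    unfolding c_def by (rule has_derivative_compose[OF g' dL])
  have "(\<lambda>d. fst (g' d)) = (\<lambda>d. d)"
  proof (rule has_derivative_unique[OF has_derivative_fst[OF g']])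
    show "((\<lambda>s. fst (g (s, 0))) has_derivative (\<lambda>d. d)) (at 0)"
      by (rule has_derivative_transform_within[OF has_derivative_ident e(1)]) (use gs in \<open>auto simp: dist_norm\<close>)
  qed
  then have f1: "fst (g' d) = d" for d by (rule fun_cong)
  have c0: "c 0 = Y" unfolding c_def using g0 L0 by (simp add: zero_prod_def)
  have "(\<lambda>d. ?m \<bullet> (fst (g' d) *\<^sub>R v + snd (g' d) *\<^sub>R ?m)) = (\<lambda>d. 0)"
  proof (rule has_derivative_unique)
    show "((\<lambda>s. f (c s)) has_derivative (\<lambda>d. ?m \<bullet> (fst (g' d) *\<^sub>R v + snd (g' d) *\<^sub>R ?m))) (at 0)"
      by (rule has_derivative_compose[OF cd]) (use der_f[OF Y(1)] c0 in simp)
    show "((\<lambda>s. f (c s)) has_derivative (\<lambda>d. 0)) (at 0)"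
      by (rule has_derivative_transform_within[OF has_derivative_const[of 0] e(1)]) (use gs in \<open>auto simp: dist_norm c_def\<close>)
  qed
  then have "?m \<bullet> (fst (g' d) *\<^sub>R v + snd (g' d) *\<^sub>R ?m) = 0" for d by (rule fun_cong)
  then have s1: "snd (g' d) = 0" for d using mm v(2) by (simp add: inner_add_right)
  have cd': "(c has_derivative (\<lambda>d. d *\<^sub>R v)) (at 0)" using cd by (simp add: f1 s1)
  have YY: "mink Y Y = -1" using Y by (simp add: hyp_def)
  have nd: "(nrm has_derivative (\<lambda>v. v + mink Y v *\<^sub>R Y)) (at (c 0))" unfolding c0 by (rule has_derivative_nrm[OF YY])
  have "((\<lambda>s. nrm (c s)) has_derivative (\<lambda>d. d *\<^sub>R v + mink Y (d *\<^sub>R v) *\<^sub>R Y)) (at 0)"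
    by (rule has_derivative_compose[OF cd' nd])
  then have d: "((\<lambda>s. nrm (c s)) has_vector_derivative v) (at 0)"
    by (simp add: has_vector_derivative_def mink_scale_right v(1))
  have inb: "nrm (c s) \<in> bd K" if "\<bar>s\<bar> < e" for s
    using nrm_U[of "c s"] gs[OF that] bd_iff_chart[of "nrm (c s)"] by (simp add: c_def)
  show ?thesis
    unfolding bd_tangent_def
  proof (intro CollectI exI[of _ "\<lambda>s. nrm (c s)"] exI[of _ e] conjI allI impI)
    show "nrm (c 0) = Y" unfolding c0 by (rule nrm_ident[OF YY])
  qed (fact e(1) d | rule inb, assumption)+
qed

lemma bd_tangent_chart:
  assumes Y: "Y \<in> U" "Y \<in> hyp" "f Y = 0"
  shows "bd_tangent K Y = {v. mink Y v = 0 \<and> mink (Nf Y) v = 0}"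
proof (intro set_eqI iffI)
  fix v assume "v \<in> {v. mink Y v = 0 \<and> mink (Nf Y) v = 0}"
  then show "v \<in> bd_tangent K Y" using bd_curve_chart[OF Y] Nf_zero_iff[OF Y(1)] by simp
next
  fix v assume "v \<in> bd_tangent K Y"
  then obtain \<gamma> e where g: "e > 0" "\<gamma> 0 = Y" "\<And>t. \<bar>t\<bar> < e \<Longrightarrow> \<gamma> t \<in> bd K" "(\<gamma> has_vector_derivative v) (at 0)"
    unfolding bd_tangent_def by blast
  have gd: "(\<gamma> has_derivative (\<lambda>d. d *\<^sub>R v)) (at 0)" using g(4) by (simp add: has_vector_derivative_def)
  have bdK: "bd K \<subseteq> hyp" using bd_iff[OF closed_K K_hyp] K_hyp by blast
  have hy: "mink (\<gamma> t) (\<gamma> t) = -1" if "\<bar>t\<bar> < e" for t using g(3)[OF that] bdK by (auto simp: hyp_def)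
  have "(\<lambda>d. mink (d *\<^sub>R v) (\<gamma> 0) + mink (\<gamma> 0) (d *\<^sub>R v)) = (\<lambda>d. 0)"
  proof (rule has_derivative_unique[OF has_derivative_mink[OF gd gd]])
    show "((\<lambda>t. mink (\<gamma> t) (\<gamma> t)) has_derivative (\<lambda>d. 0)) (at 0)"
      by (rule has_derivative_transform_within[OF has_derivative_const[of "-1"] g(1)]) (use hy in \<open>auto simp: dist_norm\<close>)
  qed
  from fun_cong[OF this, of 1] have 1: "mink Y v = 0" using mink_commute[of v Y] by (simp add: g(2))
  have "isCont \<gamma> 0" using has_derivative_continuous[OF gd] by simp
  then have "\<forall>\<^sub>F t in at 0. \<gamma> t \<in> U" using open_U Y(1) g(2) unfolding isCont_def by (simp add: topological_tendstoD)
  then obtain d where d: "d > 0" "\<And>t. t \<noteq> 0 \<Longrightarrow> dist t 0 < d \<Longrightarrow> \<gamma> t \<in> U" unfolding eventually_at by auto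
  have U: "\<gamma> t \<in> U" if "\<bar>t\<bar> < d" for t using d(2)[of t] that Y(1) g(2) by (cases "t = 0") (auto simp: dist_norm)
  have f0: "f (\<gamma> t) = 0" if "\<bar>t\<bar> < min d e" for t
    using bd_iff_chart[OF U, of t] g(3)[of t] bdK that by auto
  have "(\<lambda>d. gr f Y \<bullet> (d *\<^sub>R v)) = (\<lambda>d. 0)"
  proof (rule has_derivative_unique)
    show "((\<lambda>t. f (\<gamma> t)) has_derivative (\<lambda>d. gr f Y \<bullet> (d *\<^sub>R v))) (at 0)"
      by (rule has_derivative_compose[OF gd]) (use der_f[OF Y(1)] g(2) in simp)
    show "((\<lambda>t. f (\<gamma> t)) has_derivative (\<lambda>d. 0)) (at 0)"
      by (rule has_derivative_transform_within[OF has_derivative_const[of 0], of "min d e"]) (use f0 d(1) g(1) in \<open>auto simp: dist_norm\<close>)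
  qed
  from fun_cong[OF this, of 1] have "gr f Y \<bullet> v = 0" by simp
  then show "v \<in> {v. mink Y v = 0 \<and> mink (Nf Y) v = 0}" using 1 Nf_zero_iff[OF Y(1)] by simp
qed

text \<open>The sign \<sigma> treats the outer and the inner side at once.\<close>

lemma geodesic_side:
  assumes Y: "Y \<in> U" "Y \<in> hyp" "f Y = 0" and s: "\<sigma>^2 = (1::real)"
  shows "\<exists>e>0. \<forall>t. 0 < t \<and> t < e \<longrightarrow> hyp_geodesic Y (\<sigma> *\<^sub>R Nf Y) t \<in> U \<inter> hyp \<and> \<sigma> * f (hyp_geodesic Y (\<sigma> *\<^sub>R Nf Y) t) > 0"
proof -
  let ?g = "hyp_geodesic Y (\<sigma> *\<^sub>R Nf Y)"
  have T: "\<sigma> *\<^sub>R Nf Y \<in> hyp_tangent Y" "mink (\<sigma> *\<^sub>R Nf Y) (\<sigma> *\<^sub>R Nf Y) = 1"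
    using Nf(1,2)[OF Y(1)] s mink_commute[of Y "Nf Y"]
    by (simp_all add: hyp_tangent_def mink_simps power2_eq_square)
  have g0: "?g 0 = Y" by (simp add: hyp_geodesic_def)
  have gd: "(?g has_derivative (\<lambda>d. d *\<^sub>R (\<sigma> *\<^sub>R Nf Y))) (at 0)"
    unfolding hyp_geodesic_def[abs_def] by (auto intro!: derivative_eq_intros)
  have "isCont ?g 0" using has_derivative_continuous[OF gd] by simp
  then have "\<forall>\<^sub>F t in at 0. ?g t \<in> U" using open_U Y(1) g0 unfolding isCont_def by (simp add: topological_tendstoD)
  then obtain d where d: "d > 0" "\<And>t. t \<noteq> 0 \<Longrightarrow> dist t 0 < d \<Longrightarrow> ?g t \<in> U" unfolding eventually_at by auto
  have fY: "(f has_derivative (\<lambda>v. gr f Y \<bullet> v)) (at (?g 0))" using der_f[OF Y(1)] by (simp add: g0)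
  have der: "((\<lambda>t. \<sigma> * f (?g t)) has_real_derivative \<sigma> * (gr f Y \<bullet> (\<sigma> *\<^sub>R Nf Y))) (at 0)"
    using has_derivative_mult_right[OF has_derivative_compose[OF gd fY], of \<sigma>]
    by (simp add: has_field_derivative_def mult_ac mult_commute_abs)
  have "gr f Y \<bullet> Nf Y > 0"
  proof -
    have "gr f Y \<bullet> Nf Y = mink (mgr f Y) (mgr f Y) / sqrt (mink (mgr f Y) (mgr f Y))"
      unfolding mink_mgr[symmetric] by (simp add: Nf_def mink_scale_right)
    then show ?thesis using mgr_pos[OF Y(1)] by simp
  qed
  then have "\<sigma> * (gr f Y \<bullet> (\<sigma> *\<^sub>R Nf Y)) > 0" using s by (simp add: power2_eq_square mult.assoc[symmetric])
  from DERIV_pos_inc_right[OF der this] obtain q where q: "q > 0" "\<And>t. t > 0 \<Longrightarrow> t < q \<Longrightarrow> \<sigma> * f (?g t) > 0"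
    using g0 Y(3) by auto
  have "?g t \<in> U \<inter> hyp \<and> \<sigma> * f (?g t) > 0" if t: "0 < t" "t < min d q" for t
  proof -
    have U: "?g t \<in> U" using d(2)[of t] t by (simp add: dist_norm)
    have "mink (?g t) (?g t) = -1" by (rule hyp_geodesic_hyp[OF Y(2) T]) (use t in simp)
    then have "?g t \<in> hyp" using U U_Cn by (auto simp: hyp_def Cn_def)
    then show ?thesis using U q(2)[of t] t by simp
  qed
  then show ?thesis using d(1) q(1) by (intro exI[of _ "min d q"]) simp
qed

lemma outward_normal_chart:
  assumes Y: "Y \<in> U" "Y \<in> hyp" "f Y = 0"
  shows "outward_normal K Y = Nf Y"
proof (rule outward_normal_eqI)
  show "mink Y (Nf Y) = 0" "mink (Nf Y) (Nf Y) = 1"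
    using Nf(1,2)[OF Y(1)] mink_commute[of Y "Nf Y"] by simp_all
  show "mink (Nf Y) u = 0" if "u \<in> bd_tangent K Y" for u using that unfolding bd_tangent_chart[OF Y] by blast
  show "w = 0" if "mink Y w = 0" "mink (Nf Y) w = 0" "\<And>u. u \<in> bd_tangent K Y \<Longrightarrow> mink w u = 0" for w
  proof -
    have "mink w w = 0" by (rule that(3)) (use that in \<open>simp add: bd_tangent_chart[OF Y]\<close>)
    then show ?thesis using mink_tangent_pos[OF U_neg[OF Y(1)] that(1)] by fastforce
  qed
  have "(1::real)^2 = 1" "(-1::real)^2 = 1" by simp_all
  note side = geodesic_side[OF Y this(1)] geodesic_side[OF Y this(2)]
  show "\<exists>e>0. \<forall>t. 0 < t \<and> t < e \<longrightarrow> hyp_geodesic Y (Nf Y) t \<notin> K"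
    using side(1) K_iff by (simp only: scaleR_one mult_1) (meson IntD1 IntD2 not_less)
  show "\<exists>e>0. \<forall>t. 0 < t \<and> t < e \<longrightarrow> hyp_geodesic Y (- Nf Y) t \<in> K"
    using side(2) K_iff by (simp only: scaleR_minus1_left mult_minus1 neg_0_less_iff_less) (meson IntD1 IntD2 less_imp_le)
qed

lemma weingarten_chart:
  assumes Y: "Y \<in> U" "Y \<in> hyp" "f Y = 0" and v: "v \<in> bd_tangent K Y"
  shows "weingarten K Y v = fd Nf Y v"
proof -
  obtain e where e: "e > 0" "ball Y e \<subseteq> U" using open_contains_ball_eq[OF open_U] Y(1) by blast
  have bdK: "bd K \<subseteq> hyp" using bd_iff[OF closed_K K_hyp] K_hyp by blast
  have eq: "Nf X = outward_normal K X" if "X \<in> bd K" "dist X Y < e" for X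
  proof -
    have U: "X \<in> U" "X \<in> hyp" using that e(2) bdK by (auto simp: dist_commute)
    show ?thesis using outward_normal_chart[OF U] bd_iff_chart[OF U] that(1) by simp
  qed
  have YB: "Y \<in> bd K" using bd_iff_chart[OF Y(1,2)] Y(3) by simp
  have D: "(outward_normal K has_derivative fd Nf Y) (at Y within bd K)"
    by (rule has_derivative_transform_within[OF has_derivative_at_withinI[OF der_Nf[OF Y(1)]] e(1) YB]) (use eq in blast)
  obtain \<gamma> e where g: "e > 0" "\<gamma> 0 = Y" "\<And>t. \<bar>t\<bar> < e \<Longrightarrow> \<gamma> t \<in> bd K" "(\<gamma> has_vector_derivative v) (at 0)"
    using v unfolding bd_tangent_def by blast
  show ?thesis unfolding weingarten_def by (rule frechet_derivative_within_curve[OF D g(2,1,3,4)])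
qed

text \<open>On tangent vectors the second fundamental form is the Hessian of f over the length of
  its gradient: the derivative of the normalizing factor multiplies \<open>mgr f Y\<close>, which is
  orthogonal to w.\<close>

lemma mink_der_Nf:
  assumes Y: "Y \<in> U" and w: "gr f Y \<bullet> w = 0"
  shows "mink (fd Nf Y v) w = (hess f Y v \<bullet> w) / sqrt (mink (mgr f Y) (mgr f Y))"
proof -
  let ?q = "\<lambda>X. 1 / sqrt (mink (mgr f X) (mgr f X))"
  have "smooth_on U ?q"
    by (intro smooth_on_divide smooth_on_sqrt smooth_mink smooth_mgr smooth_on_const open_U) (use mgr_pos in auto)
  from smooth_on_has_derivative[OF this Y]
  have q: "(?q has_derivative fd ?q Y) (at Y)" .
  have gd: "(gr f has_derivative hess f Y) (at Y)" by (rule smooth_has_derivative_hess[OF open_U smooth_f Y])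
  have m: "(mgr f has_derivative (\<lambda>v. (fst (hess f Y v), - snd (hess f Y v)))) (at Y)"
    unfolding mgr_def[abs_def]
    by (intro has_derivative_Pair has_derivative_fst has_derivative_minus has_derivative_snd gd)
  have "(Nf has_derivative (\<lambda>v. ?q Y *\<^sub>R (fst (hess f Y v), - snd (hess f Y v)) + fd ?q Y v *\<^sub>R mgr f Y)) (at Y)"
    unfolding Nf_def[abs_def] by (rule has_derivative_scaleR[OF q m])
  from fun_cong[OF has_derivative_unique[OF der_Nf[OF Y] this], of v]
  have "fd Nf Y v = ?q Y *\<^sub>R (fst (hess f Y v), - snd (hess f Y v)) + fd ?q Y v *\<^sub>R mgr f Y" .
  moreover have "mink (fst (hess f Y v), - snd (hess f Y v)) w = hess f Y v \<bullet> w"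
    by (simp add: mink_def inner_prod_def[of _ w])
  ultimately show ?thesis
    by (simp add: mink_simps mink_mgr w del: scaleR_Pair)
qed

lemma der_Nf_tangent:
  assumes Y: "Y \<in> U" and v: "gr f Y \<bullet> v = 0"
  shows "mink (fd Nf Y v) Y = 0" "mink (fd Nf Y v) (Nf Y) = 0"
proof -
  have "(\<lambda>v. mink (fd Nf Y v) Y + mink (Nf Y) v) = (\<lambda>v. 0)"
  proof (rule has_derivative_unique[OF has_derivative_mink[OF der_Nf[OF Y] has_derivative_ident]])
    show "((\<lambda>x. mink (Nf x) x) has_derivative (\<lambda>v. 0)) (at Y)"
      by (rule has_derivative_transform_within_open[OF has_derivative_const[of 0] open_U Y]) (use Nf(2) in simp)
  qed
  from fun_cong[OF this, of v] show "mink (fd Nf Y v) Y = 0"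
    using Nf_zero_iff[OF Y, THEN iffD2, OF v] by linarith
  have "(\<lambda>v. mink (fd Nf Y v) (Nf Y) + mink (Nf Y) (fd Nf Y v)) = (\<lambda>v. 0)"
  proof (rule has_derivative_unique[OF has_derivative_mink[OF der_Nf[OF Y] der_Nf[OF Y]]])
    show "((\<lambda>x. mink (Nf x) (Nf x)) has_derivative (\<lambda>v. 0)) (at Y)"
      by (rule has_derivative_transform_within_open[OF has_derivative_const[of 1] open_U Y]) (use Nf(1) in simp)
  qed
  from fun_cong[OF this, of v] show "mink (fd Nf Y v) (Nf Y) = 0"
    using mink_commute[of "Nf Y" "fd Nf Y v"] by simp
qed

text \<open>The smallest Rayleigh quotient of the shape operator on the tangent space is attained,
  and stationarity together with symmetry makes it a principal curvature, hence larger than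
  1.\<close>

lemma curvature_gt:
  assumes Y: "Y \<in> U" "Y \<in> hyp" "f Y = 0"
    and pc: "\<And>k. k \<in> principal_curvatures K Y \<Longrightarrow> k > 1"
    and v: "mink Y v = 0" "gr f Y \<bullet> v = 0" "v \<noteq> 0"
  shows "mink (fd Nf Y v) v > mink v v"
proof (rule ccontr)
  let ?D = "fd Nf Y"
  let ?T = "{v. mink Y v = 0 \<and> gr f Y \<bullet> v = 0}"
  let ?S = "?T \<inter> sphere 0 1"
  assume neg: "\<not> mink (?D v) v > mink v v"
  interpret D: linear ?D using has_derivative_linear[OF der_Nf[OF Y(1)]] .
  have pos: "mink u u > 0" if "u \<in> ?T" "u \<noteq> 0" for u using mink_tangent_pos[OF U_neg[OF Y(1)]] that by blast
  have cD: "continuous_on S ?D" for S using has_derivative_bounded_linear[OF der_Nf[OF Y(1)]] by (rule linear_continuous_on)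
  let ?r = "\<lambda>u. mink (?D u) u / mink u u"
  have "continuous_on ?S ?r"
    by (intro continuous_intros cD) (use pos in fastforce)
  moreover have "compact ?S"
  proof (rule closed_Int_compact)
    show "closed ?T" by (intro closed_Collect_conj closed_Collect_eq continuous_intros)
  qed simp
  moreover have vS: "(1 / norm v) *\<^sub>R v \<in> ?S" using v by (simp add: mink_scale_right)
  ultimately obtain v0 where v0: "v0 \<in> ?S" "\<And>u. u \<in> ?S \<Longrightarrow> ?r v0 \<le> ?r u"
    using continuous_attains_inf[of ?S ?r] by blast
  define l where "l = ?r v0"
  have lt: "l * mink u u \<le> mink (?D u) u" if u: "u \<in> ?T" for u
  proof (cases "u = 0")
    case False
    let ?u = "(1 / norm u) *\<^sub>R u"
    have "?u \<in> ?S" using u False by (simp add: mink_scale_right)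
    then have "l \<le> ?r ?u" unfolding l_def by (rule v0(2))
    also have "\<dots> = ?r u" using False by (simp add: D.scale mink_simps)
    finally show ?thesis using pos[OF u False] by (simp add: pos_le_divide_eq)
  qed (simp add: mink_def)
  have v0T: "v0 \<in> ?T" "v0 \<noteq> 0" using v0(1) by auto
  have "l * mink v v \<le> mink v v" using lt[of v] v neg by simp
  then have l1: "l \<le> 1" using pos[of v] v by simp
  have eq0: "mink (?D v0) v0 = l * mink v0 v0" using pos[OF v0T] by (simp add: l_def)
  have sym: "mink (?D a) b = mink (?D b) a" if "a \<in> ?T" "b \<in> ?T" for a b
    using that mink_der_Nf[OF Y(1), of b a] mink_der_Nf[OF Y(1), of a b] hess_symmetric[OF open_U smooth_f Y(1), of a b] by simp
  \<comment> \<open>A nonnegative quadratic polynomial in s that vanishes at 0 has no linear term.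
    So ?u is orthogonal to all tangent vectors, itself included, and vanishes because
    \<open>mink\<close> is definite there.\<close>
  let ?u = "?D v0 - l *\<^sub>R v0"
  have B: "mink ?u w = 0" if w: "w \<in> ?T" for w
  proof (rule quadratic_nonneg_linear_zero)
    fix s :: real
    have "v0 + s *\<^sub>R w \<in> ?T" using v0T w by (simp add: mink_simps inner_add_right)
    from lt[OF this] have "l * mink (v0 + s *\<^sub>R w) (v0 + s *\<^sub>R w) \<le> mink (?D (v0 + s *\<^sub>R w)) (v0 + s *\<^sub>R w)" .
    then show "2 * s * mink ?u w + s^2 * (mink (?D w) w - l * mink w w) \<ge> 0"
      using eq0 sym[OF w v0T(1)] mink_commute[of w v0]
      by (simp add: D.add D.scale mink_simps power2_eq_square algebra_simps)
  qed (use lt[OF w] in simp)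
  have "gr f Y \<bullet> ?D v0 = 0" using der_Nf_tangent(2)[OF Y(1), of v0] v0T
      mink_commute[of "Nf Y" "?D v0"] Nf_zero_iff[OF Y(1)] by simp
  then have uT: "?u \<in> ?T" using der_Nf_tangent(1)[OF Y(1), of v0] v0T mink_commute[of Y "?D v0"]
    by (simp add: mink_simps inner_diff_right)
  have "?u = 0" using B[OF uT] pos[OF uT] by force
  moreover have v0b: "v0 \<in> bd_tangent K Y" using v0T Nf_zero_iff[OF Y(1)] by (simp add: bd_tangent_chart[OF Y])
  ultimately have "v0 \<in> principal_space K Y l" unfolding principal_space_def using weingarten_chart[OF Y v0b] by simp
  then have "l > 1" using pc v0T(2) unfolding principal_curvatures_def by blast
  then show False using l1 by simp
qed

end

context bchart
begin

text \<open>Unless the differentials of \<eta> and f are positively parallel, Cauchy-Schwarz is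
  strict, and the difference of the normalized gradients is a direction in which \<eta> grows while
  f decreases, so that the motion stays in K.\<close>

lemma push_boundary:
  assumes Y: "Y \<in> U" "Y \<in> K" and ne: "\<eta> + mink \<eta> Y *\<^sub>R Y \<noteq> 0"
    and no: "\<And>c. c > 0 \<Longrightarrow> \<eta> + mink \<eta> Y *\<^sub>R Y \<noteq> c *\<^sub>R Nf Y"
  shows "pushable K (mink \<eta>) Y"
proof -
  let ?xi = "\<eta> + mink \<eta> Y *\<^sub>R Y"
  let ?g = "\<lambda>X. mink \<eta> (nrm X)"
  let ?gg = "gr ?g Y" and ?gf = "gr f Y"
  have YY: "mink Y Y = -1" using Y(2) K_hyp by (auto simp: hyp_def)
  have xi: "?gg \<bullet> v = mink ?xi v" for v by (rule gr_linear_nrm[OF YY])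
  have gg: "?gg \<noteq> 0"
  proof
    assume "?gg = 0"
    then have "mink ?xi v = mink 0 v" for v using xi[of v] by (simp add: mink_def[of 0])
    then show False using mink_eqI[of ?xi 0] ne by blast
  qed
  have gf: "?gf \<noteq> 0" by (rule gr_ne[OF Y(1)])
  have CS: "?gg \<bullet> ?gf < norm ?gg * norm ?gf"
  proof (rule ccontr)
    assume "\<not> ?gg \<bullet> ?gf < norm ?gg * norm ?gf"
    then have "?gg \<bullet> ?gf = norm ?gg * norm ?gf" using norm_cauchy_schwarz[of ?gg ?gf] by simp
    then have eq: "norm ?gg *\<^sub>R ?gf = norm ?gf *\<^sub>R ?gg" by (simp only: norm_cauchy_schwarz_eq)
    define k where "k = norm ?gg / norm ?gf * sqrt (mink (mgr f Y) (mgr f Y))"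
    have k: "k > 0" using gg gf mgr_pos[OF Y(1)] by (simp add: k_def)
    have "mink ?xi v = mink (k *\<^sub>R Nf Y) v" for v
    proof -
      have "norm ?gg * (?gf \<bullet> v) = norm ?gf * (?gg \<bullet> v)" using arg_cong[OF eq, of "\<lambda>u. u \<bullet> v"] by simp
      then have "mink ?xi v = norm ?gg / norm ?gf * (?gf \<bullet> v)" using gf by (simp add: xi[symmetric] field_simps)
      also have "\<dots> = mink (k *\<^sub>R Nf Y) v" using mgr_pos[OF Y(1)] by (simp add: k_def mink_scale_left Nf(3)[OF Y(1)])
      finally show ?thesis .
    qed
    then have "?xi = k *\<^sub>R Nf Y" by (rule mink_eqI)
    then show False using no[OF k] by blast
  qed
  define w where "w = (1 / norm ?gg) *\<^sub>R ?gg - (1 / norm ?gf) *\<^sub>R ?gf"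
  have q: "(?gg \<bullet> ?gf) / norm ?gf < norm ?gg" "(?gg \<bullet> ?gf) / norm ?gg < norm ?gf"
    using CS gg gf by (simp_all add: divide_less_eq mult.commute)
  have w1: "?gg \<bullet> w > 0"
    using q(1) gg by (simp add: w_def inner_diff_right dot_square_norm power2_eq_square)
  have w2: "?gf \<bullet> w < 0"
    using q(2) gf by (simp add: w_def inner_diff_right dot_square_norm power2_eq_square inner_commute[of ?gf ?gg])
  have gm: "gr (\<lambda>x. - f x) Y \<bullet> w > 0"
  proof -
    have "gr (\<lambda>x. - f x) Y = - ?gf"
      by (rule gr_eqI) (use has_derivative_minus[OF der_f[OF Y(1)]] in simp)
    then show ?thesis using w2 by simp
  qed
  have sf: "smooth_on U (\<lambda>x. - f x)" by (rule smooth_on_minus[OF open_U smooth_f])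
  obtain r2 where r2: "r2 > 0" "\<And>X s. dist X Y < r2 \<Longrightarrow> 0 \<le> s \<Longrightarrow> s < r2 \<Longrightarrow> X + s *\<^sub>R w \<in> U"
    "\<And>X s. dist X Y < r2 \<Longrightarrow> 0 < s \<Longrightarrow> s < r2 \<Longrightarrow> - f X < - f (X + s *\<^sub>R w)"
    by (rule increase_along[OF open_U sf Y(1) gm]) (rule that, assumption+)
  show ?thesis
  proof (rule push_directionI[OF K_hyp Y(2) w1[unfolded xi] r2(1)])
    fix X s assume X: "X \<in> K" "dist X Y < r2" "0 < s" "s < r2"
    have XU: "X \<in> U" using r2(2)[of X 0] X r2(1) by simp
    have Xf: "f X \<le> 0" using K_iff[OF XU] X(1) K_hyp by blast
    have U: "X + s *\<^sub>R w \<in> U" using r2(2)[of X s] X by simp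
    have "f (nrm (X + s *\<^sub>R w)) \<le> 0" using r2(3)[of X s] X Xf nrm_U(3)[OF U] by simp
    then show "nrm (X + s *\<^sub>R w) \<in> K" using K_iff[OF nrm_U(1,2)[OF U]] by blast
  qed
qed

text \<open>Second-order sufficiency by blow-up. Points Z of K near Y at which \<eta> is not
  smaller, rescaled by t = |Z - Y|, converge to a unit vector v. Membership in \<open>hyp\<close>
  (F1), the value of \<eta> (F2) and f \<le> 0 (F3) make v tangent and give
  \<open>C * ?H v \<le> a * ?A v\<close>, whereas curvature above 1 and a \<le> c give the opposite
  strict inequality.\<close>

lemma strict_max_chart:
  assumes Y: "Y \<in> U" "Y \<in> hyp" "f Y = 0"
    and pc: "\<And>k. k \<in> principal_curvatures K Y \<Longrightarrow> k > 1"
    and c: "c > 0" "\<eta> + mink \<eta> Y *\<^sub>R Y = c *\<^sub>R Nf Y" "mink \<eta> Y \<le> c"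
  shows "strict_max_on K (mink \<eta>) Y"
proof (rule ccontr)
  define a where "a = mink \<eta> Y"
  define m where "m = sqrt (mink (mgr f Y) (mgr f Y))"
  define C where "C = c / m"
  have m: "m > 0" using mgr_pos[OF Y(1)] by (simp add: m_def)
  then have C: "C > 0" using c(1) by (simp add: C_def)
  have YY: "mink Y Y = -1" using Y(2) by (simp add: hyp_def)
  interpret H: linear "hess f Y" by (rule linear_hess[OF open_U smooth_f Y(1)])
  assume "\<not> strict_max_on K (mink \<eta>) Y"
  then have "\<exists>Z. Z \<in> K \<and> Z \<noteq> Y \<and> dist Z Y < 1 / real (Suc k) \<and> mink \<eta> Y \<le> mink \<eta> Z" for k
    unfolding strict_max_on_def not_less[symmetric] by (meson of_nat_0_less_iff zero_less_Suc zero_less_divide_1_iff)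
  then obtain Z where Z: "\<And>k. Z k \<in> K" "\<And>k. Z k \<noteq> Y" "\<And>k. dist (Z k) Y < 1 / real (Suc k)" "\<And>k. mink \<eta> Y \<le> mink \<eta> (Z k)"
    by metis
  define d where "d k = Z k - Y" for k
  have d0: "d \<longlonglongrightarrow> 0" by (rule LIMSEQ_norm_0) (use Z(3) in \<open>simp add: d_def dist_norm\<close>)
  have nd: "norm (d k) > 0" for k using Z(2) by (simp add: d_def)
  have "compact (sphere (0::'n minkowski) 1)" by simp
  moreover have "\<forall>k. (1 / norm (d k)) *\<^sub>R d k \<in> sphere 0 1" using nd by simp
  ultimately obtain v r where v: "v \<in> sphere 0 1" "strict_mono r" "((\<lambda>k. (1 / norm (d k)) *\<^sub>R d k) \<circ> r) \<longlonglongrightarrow> v"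
    unfolding compact_def by meson
  define t where "t k = norm (d (r k))" for k
  define u where "u k = (1 / t k) *\<^sub>R d (r k)" for k
  have u: "u \<longlonglongrightarrow> v" using v(3) by (simp add: u_def[abs_def] t_def o_def)
  have t0: "t \<longlonglongrightarrow> 0" unfolding t_def using LIMSEQ_subseq_LIMSEQ[OF d0 v(2)] by (simp add: o_def tendsto_norm_zero)
  have tp: "t k > 0" for k using nd by (simp add: t_def)
  have du: "d (r k) = t k *\<^sub>R u k" for k using tp[of k] by (simp add: u_def)
  have Zd: "Z (r k) = Y + t k *\<^sub>R u k" for k using du[of k] by (simp add: d_def algebra_simps)
  let ?A = "\<lambda>u. mink u u" and ?G = "\<lambda>u. gr f Y \<bullet> u" and ?H = "\<lambda>u. hess f Y u \<bullet> u"
  have bH: "bounded_linear (hess f Y)" using H.linear_axioms by (rule linear_conv_bounded_linear[THEN iffD1])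
  have lA: "(\<lambda>k. ?A (u k)) \<longlonglongrightarrow> ?A v" and lG: "(\<lambda>k. ?G (u k)) \<longlonglongrightarrow> ?G v" and lY: "(\<lambda>k. mink Y (u k)) \<longlonglongrightarrow> mink Y v"
    by (intro tendsto_intros u)+
  have lH: "(\<lambda>k. ?H (u k)) \<longlonglongrightarrow> ?H v" by (intro tendsto_inner bounded_linear.tendsto[OF bH] u)
  have F1: "mink Y (u k) = - (t k * ?A (u k)) / 2" for k
  proof -
    have "mink (Z (r k)) (Z (r k)) = -1" using Z(1) K_hyp by (auto simp: hyp_def)
    then have "t k * (2 * mink Y (u k) + t k * ?A (u k)) = 0"
      unfolding Zd using mink_commute[of "u k" Y]
      by (simp add: mink_simps YY algebra_simps)
    then show ?thesis using tp[of k] by simp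
  qed
  have F2: "C * ?G (u k) + a * (t k * ?A (u k)) / 2 \<ge> 0" for k
  proof -
    have "t k * mink \<eta> (u k) \<ge> 0" using Z(4)[of "r k"] unfolding Zd by (simp add: mink_simps)
    then have p: "mink \<eta> (u k) \<ge> 0" using tp[of k] by (simp add: zero_le_mult_iff)
    have "\<eta> = c *\<^sub>R Nf Y - a *\<^sub>R Y" using c(2) by (simp add: a_def algebra_simps)
    then have "mink \<eta> (u k) = c * mink (Nf Y) (u k) - a * mink Y (u k)" by (simp add: mink_simps)
    also have "\<dots> = C * ?G (u k) + a * (t k * ?A (u k)) / 2" by (simp add: F1 Nf(3)[OF Y(1)] C_def m_def)
    finally show ?thesis using p by simp
  qed
  have F3: "\<forall>\<^sub>F k in sequentially. ?G (u k) + t k * ?H (u k) / 2 \<le> \<epsilon> * t k" if e: "\<epsilon> > 0" for \<epsilon>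
  proof -
    obtain \<delta> where \<delta>: "\<delta> > 0" "\<And>w. norm w < \<delta> \<Longrightarrow> Y + w \<in> U \<and>
        \<bar>f (Y + w) - f Y - gr f Y \<bullet> w - (hess f Y w \<bullet> w) / 2\<bar> \<le> \<epsilon> * (norm w)^2"
      using taylor2[OF open_U smooth_f Y(1) e] by blast
    have "\<forall>\<^sub>F k in sequentially. t k < \<delta>" using t0 \<delta>(1) by (rule order_tendstoD(2))
    then show ?thesis
    proof eventually_elim
      case (elim k)
      let ?w = "t k *\<^sub>R u k"
      have nw: "norm ?w = t k" using du[of k] by (simp add: t_def)
      have U: "Y + ?w \<in> U" and T: "\<bar>f (Y + ?w) - f Y - gr f Y \<bullet> ?w - (hess f Y ?w \<bullet> ?w) / 2\<bar> \<le> \<epsilon> * (norm ?w)^2"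
        using \<delta>(2)[of ?w] elim nw by auto
      have "Y + ?w \<in> K" using Z(1)[of "r k"] unfolding Zd .
      then have "f (Y + ?w) \<le> 0" using K_iff[OF U] K_hyp by blast
      then have "t k * ?G (u k) + (t k * t k) * ?H (u k) / 2 \<le> \<epsilon> * (t k * t k)"
        using T unfolding nw by (simp add: Y(3) H.scale power2_eq_square abs_le_iff algebra_simps)
      then have "t k * (?G (u k) + t k * ?H (u k) / 2) \<le> t k * (\<epsilon> * t k)" by (simp add: algebra_simps)
      then show ?case using tp[of k] by simp
    qed
  qed
  have tA: "(\<lambda>k. t k * ?A (u k)) \<longlonglongrightarrow> 0" and tH: "(\<lambda>k. t k * ?H (u k)) \<longlonglongrightarrow> 0"
    using tendsto_mult[OF t0 lA] tendsto_mult[OF t0 lH] by simp_all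
  have "(\<lambda>k. - (t k * ?A (u k)) / 2) \<longlonglongrightarrow> - 0 / 2" by (intro tendsto_intros tA) simp
  then have vY: "mink Y v = 0" using LIMSEQ_unique[OF lY] by (simp add: F1)
  have "(\<lambda>k. C * ?G (u k) + a * (t k * ?A (u k)) / 2) \<longlonglongrightarrow> C * ?G v + a * 0 / 2"
    by (intro tendsto_intros lG tA) simp
  then have "C * ?G v + a * 0 / 2 \<ge> 0" by (rule LIMSEQ_le_const) (use F2 in blast)
  then have g1: "?G v \<ge> 0" using C by (simp add: zero_le_mult_iff)
  have "?G v + 0 / 2 \<le> 1 * 0"
  proof (rule tendsto_le[OF sequentially_bot])
    show "(\<lambda>k. 1 * t k) \<longlonglongrightarrow> 1 * 0" by (intro tendsto_intros t0)
    show "(\<lambda>k. ?G (u k) + t k * ?H (u k) / 2) \<longlonglongrightarrow> ?G v + 0 / 2" by (intro tendsto_intros lG tH) simp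
  qed (use F3[of 1] in simp)
  then have g0: "?G v = 0" using g1 by simp
  \<comment> \<open>F2 and C times F3 are combined before the division by t, so that the first-order
    terms cancel.\<close>
  have lim: "C * ?H v - a * ?A v \<le> 2 * C * \<epsilon>" if e: "\<epsilon> > 0" for \<epsilon>
  proof (rule tendsto_upperbound)
    show "(\<lambda>k. C * ?H (u k) - a * ?A (u k)) \<longlonglongrightarrow> C * ?H v - a * ?A v" by (intro tendsto_intros lH lA)
    show "\<forall>\<^sub>F k in sequentially. C * ?H (u k) - a * ?A (u k) \<le> 2 * C * \<epsilon>"
      using F3[OF e]
    proof eventually_elim
      case (elim k)
      have "C * (?G (u k) + t k * ?H (u k) / 2) \<le> C * (\<epsilon> * t k)" using elim C by simp
      then have "t k * (C * ?H (u k) - a * ?A (u k)) \<le> t k * (2 * C * \<epsilon>)" using F2[of k] by (simp add: algebra_simps)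
      then show ?case using tp[of k] by simp
    qed
  qed simp
  have "C * ?H v - a * ?A v \<le> 0"
  proof (rule ccontr)
    assume n: "\<not> C * ?H v - a * ?A v \<le> 0"
    show False using lim[of "(C * ?H v - a * ?A v) / (4 * C)"] n C by (simp add: field_simps)
  qed
  moreover have "C * ?H v > a * ?A v"
  proof -
    have v0: "v \<noteq> 0" using v(1) by auto
    have gt: "mink (fd Nf Y v) v > ?A v" by (rule curvature_gt[OF Y pc vY g0 v0])
    have Av: "?A v > 0" by (rule mink_tangent_pos[OF U_neg[OF Y(1)] vY v0])
    have "a * ?A v \<le> c * ?A v" using c(3) Av by (simp add: a_def)
    also have "\<dots> < c * mink (fd Nf Y v) v" using gt c(1) by simp
    also have "\<dots> = C * ?H v" by (simp add: mink_der_Nf[OF Y(1) g0] C_def m_def)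
    finally show ?thesis .
  qed
  ultimately show False by simp
qed

end

text \<open>The given function is composed with \<open>nrm\<close>; its domain is cut down to
  nonvanishing gradient and then saturated to a cone, which preserves this property because the
  gradient is homogeneous of degree -1.\<close>

lemma bchart_exists:
  assumes K: "smooth_bounded_domain K" and X: "X \<in> bd K"
  obtains U f where "bchart K U f" "X \<in> U"
proof -
  have cK: "compact K" and KH: "K \<subseteq> hyp" and sb: "smooth_boundary K" using K by (auto simp: smooth_bounded_domain_def)
  obtain U0 f0 where U0: "open U0" "X \<in> U0" "smooth_on U0 f0" "K \<inter> U0 = {Y \<in> hyp \<inter> U0. f0 Y \<le> (0::real)}"
    and ex: "\<exists>v\<in>hyp_tangent X. fd f0 X v \<noteq> 0"
    using sb X unfolding smooth_boundary_def by meson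
  obtain v where v: "mink X v = 0" "fd f0 X v \<noteq> 0" using ex by (auto simp: hyp_tangent_def)
  have XH: "X \<in> hyp" using X bd_iff[OF compact_imp_closed[OF cK] KH] KH by blast
  have XX: "mink X X = -1" using XH by (simp add: hyp_def)
  have nX: "nrm X = X" by (rule nrm_ident[OF XX])
  define f where "f = (\<lambda>Y. f0 (nrm Y))"
  have pre: "open {Y \<in> Cn. nrm Y \<in> W}" if "open W" for W
  proof -
    have "openin (top_of_set Cn) (Cn \<inter> nrm -` W)"
      by (rule continuous_openin_preimage_gen[OF smooth_on_continuous_on[OF smooth_nrm] that])
    then have "open (Cn \<inter> nrm -` W)" unfolding openin_open_eq[OF open_Cn] by blast
    then show ?thesis by (simp add: Int_def vimage_def)
  qed
  define U1 where "U1 = {Y \<in> Cn. nrm Y \<in> U0}"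
  have U1: "open U1" unfolding U1_def by (rule pre[OF U0(1)])
  have sf: "smooth_on U1 f"
    unfolding f_def by (rule smooth_on_compose[OF U1 U0(1) _ smooth_on_subset[OF smooth_nrm] U0(3)]) (auto simp: U1_def)
  define U2 where "U2 = U1 \<inter> gr f -` (- {0})"
  have "openin (top_of_set U1) U2"
    unfolding U2_def by (rule continuous_openin_preimage_gen[OF smooth_on_continuous_on[OF smooth_on_gr[OF U1 sf]]]) auto
  then have U2: "open U2" using U1 openin_open_eq by blast
  define U where "U = {Y \<in> Cn. nrm Y \<in> U2}"
  have nn: "nrm (nrm Y) = nrm Y" if "Y \<in> Cn" for Y
    using nrm_hyp[OF that] by (intro nrm_ident) (simp add: hyp_def)
  have UU1: "U \<subseteq> U1" by (auto simp: U_def U2_def U1_def nn)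
  have Cc: "c *\<^sub>R Y \<in> Cn" if "c > 0" "Y \<in> Cn" for c Y
    using that by (simp add: Cn_def mink_simps mult_pos_neg)
  have c1: "c *\<^sub>R Y \<in> U1" "f (c *\<^sub>R Y) = f Y" if "c > 0" "Y \<in> U1" for c Y
    using that Cc[of c Y] nrm_scale[of c Y] unfolding U1_def f_def by simp_all
  have grs: "gr f Y = c *\<^sub>R gr f (c *\<^sub>R Y)" if c: "c > 0" "Y \<in> U1" for c Y
  proof (rule gr_eqI)
    have l: "((\<lambda>Z. c *\<^sub>R Z) has_derivative (\<lambda>v. c *\<^sub>R v)) (at Y)" by (auto intro!: derivative_eq_intros)
    have "((\<lambda>Z. f (c *\<^sub>R Z)) has_derivative (\<lambda>v. gr f (c *\<^sub>R Y) \<bullet> (c *\<^sub>R v))) (at Y)"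
      by (rule has_derivative_compose[OF l smooth_has_derivative_gr[OF sf c1(1)[OF c]]])
    then have "(f has_derivative (\<lambda>v. gr f (c *\<^sub>R Y) \<bullet> (c *\<^sub>R v))) (at Y)"
      by (rule has_derivative_transform_within_open[OF _ U1 c(2)]) (use c1(2)[OF c(1)] in simp)
    then show "(f has_derivative (\<lambda>v. (c *\<^sub>R gr f (c *\<^sub>R Y)) \<bullet> v)) (at Y)" by simp
  qed
  have "bchart K U f"
  proof
    show "open U" unfolding U_def by (rule pre[OF U2])
    show "U \<subseteq> Cn" by (auto simp: U_def)
    show "c *\<^sub>R Y \<in> U" "f (c *\<^sub>R Y) = f Y" if "c > 0" "Y \<in> U" for c Y
      using that Cc[of c Y] nrm_scale[of c Y] unfolding U_def f_def by simp_all
    show "smooth_on U f" by (rule smooth_on_subset[OF sf UU1])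
    show "gr f Y \<noteq> 0" if "Y \<in> U" for Y
    proof -
      have "1 / sqrt (- mink Y Y) > 0" using that by (simp add: U_def Cn_def)
      from grs[OF this, of Y] have "gr f Y = (1 / sqrt (- mink Y Y)) *\<^sub>R gr f (nrm Y)"
        using UU1 that unfolding nrm_def[symmetric] by blast
      then show ?thesis using that by (auto simp: U_def U2_def Cn_def)
    qed
    have h: "Y \<in> U \<Longrightarrow> Y \<in> hyp \<Longrightarrow> Y \<in> U0 \<and> f Y = f0 Y" for Y
      using UU1 nrm_ident[of Y] by (auto simp: U1_def f_def hyp_def)
    show "K \<inter> U = {Y \<in> hyp \<inter> U. f Y \<le> 0}"
    proof (intro set_eqI iffI)
      fix Y assume "Y \<in> K \<inter> U"
      then have "Y \<in> U" "Y \<in> hyp" "Y \<in> K" using KH by blast+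
      then show "Y \<in> {Y \<in> hyp \<inter> U. f Y \<le> 0}" using h[of Y] U0(4) by (simp add: set_eq_iff) blast
    next
      fix Y assume "Y \<in> {Y \<in> hyp \<inter> U. f Y \<le> 0}"
      then have "Y \<in> U" "Y \<in> hyp" "f Y \<le> 0" by blast+
      then show "Y \<in> K \<inter> U" using h[of Y] U0(4) by (simp add: set_eq_iff) blast
    qed
  qed (fact cK KH)+
  moreover have "X \<in> U"
  proof -
    have XU1: "X \<in> U1" using U0(2) XH hyp_Cn by (auto simp: U1_def nX)
    have nd: "(f0 has_derivative fd f0 X) (at (nrm X))"
      unfolding nX by (rule smooth_on_has_derivative[OF U0(3,2)])
    have "(f has_derivative (\<lambda>v. fd f0 X (v + mink X v *\<^sub>R X))) (at X)"
      unfolding f_def by (rule has_derivative_compose[OF has_derivative_nrm[OF XX] nd])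
    from fun_cong[OF has_derivative_unique[OF smooth_has_derivative_gr[OF sf XU1] this], of v]
    have "gr f X \<bullet> v \<noteq> 0" using v by simp
    then have "gr f X \<noteq> 0" by auto
    then show ?thesis using XU1 by (simp add: U_def U2_def nX U1_def)
  qed
  ultimately show thesis by (rule that)
qed

section \<open>Contact of horospheres with a uniformly h-convex domain\<close>

definition et :: "'n::finite euclid1 \<Rightarrow> 'n minkowski" where
  "et z = (- z, -1)"

lemma mink_et: "mink (et z) X = - mink X (z, 1)"
  by (simp add: et_def mink_def inner_commute)

lemma et_null: "norm z = 1 \<Longrightarrow> mink (et z) (et z) = 0"
  by (simp add: et_def mink_def dot_square_norm)

text \<open>X - N is null and pairs to -1 with the future vector X, whereas a past null vector would
  pair nonnegatively; hence it points to the future.\<close>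

lemma normal_null:
  assumes X: "X \<in> hyp" and N: "mink N N = 1" "mink N X = 0"
  shows "mink X (X - N) = -1" "snd (X - N) > 0" "norm (fst (X - N)) = snd (X - N)"
proof -
  define q where "q = X - N"
  have XX: "mink X X = -1" using X by (simp add: hyp_def)
  have XN: "mink X N = 0" using N(2) mink_commute[of X N] by simp
  have 1: "mink X q = -1" using XX XN by (simp add: q_def mink_diff_right)
  have "mink q q = 0" using XX XN N by (simp add: q_def mink_simps)
  then have sq: "(norm (fst q))^2 = (snd q)^2"
    by (simp add: mink_def[of q q] dot_square_norm power2_eq_square)
  have sp: "snd q > 0"
  proof (rule ccontr)
    assume a: "\<not> snd q > 0"
    have n: "norm (fst q) = - snd q" by (rule power2_eq_imp_eq) (use sq a in auto)
    have "- (norm (fst X) * norm (fst q)) \<le> fst X \<bullet> fst q"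
      using norm_cauchy_schwarz[of "- fst X" "fst q"] by simp
    moreover have "norm (fst X) * norm (fst q) \<le> snd X * norm (fst q)"
      using hyp_norm_less[OF X] by (intro mult_right_mono) simp_all
    moreover have "mink X q = fst X \<bullet> fst q + snd X * norm (fst q)" unfolding n by (simp add: mink_def)
    ultimately show False using 1 by linarith
  qed
  have "norm (fst q) = snd q" by (rule power2_eq_imp_eq[OF sq]) (use sp in auto)
  with 1 sp show "mink X (X - N) = -1" "snd (X - N) > 0" "norm (fst (X - N)) = snd (X - N)"
    unfolding q_def by blast+
qed

lemma norm_mink_et: "v \<noteq> 0 \<Longrightarrow> norm v * mink (et ((1 / norm v) *\<^sub>R v)) Z = - mink Z (v, norm v)"
  unfolding mink_et by (simp add: mink_def algebra_simps)

text \<open>First-order condition for a maximum of \<open>mink (et z)\<close> on K at X: the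
  differential along \<open>hyp\<close> is a positive multiple of the outward normal, and the
  multiple can only be the value \<open>mink (et z) X\<close>.\<close>

definition contactP :: "'n::finite minkowski set \<Rightarrow> 'n minkowski \<Rightarrow> 'n euclid1 \<Rightarrow> bool" where
  "contactP K X z \<longleftrightarrow> X \<in> bd K \<and>
    et z + mink (et z) X *\<^sub>R X = mink (et z) X *\<^sub>R outward_normal K X"

lemma contactP_iff:
  "contactP K X z \<longleftrightarrow> X \<in> bd K \<and> (z, 1) = mink (et z) X *\<^sub>R (X - outward_normal K X)"
proof -
  have g: "a + b = d \<longleftrightarrow> - a = b - d" for a b d :: "'a minkowski"
  proof
    assume "- a = b - d"
    then have "a = - (b - d)" by (metis minus_minus)
    then show "a + b = d" by simp
  qed auto
  have "(z, 1) = - et z" by (simp add: et_def)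
  then show ?thesis unfolding contactP_def g scaleR_diff_right by (simp only:)
qed

lemma contactP_direction:
  assumes "contactP K X z" "contactP K X w"
  shows "z = w"
proof -
  let ?q = "X - outward_normal K X"
  obtain c d where cd: "(z, 1) = c *\<^sub>R ?q" "(w, 1) = d *\<^sub>R ?q" using assms unfolding contactP_iff by blast
  have 1: "z = c *\<^sub>R fst ?q" "1 = c * snd ?q" "w = d *\<^sub>R fst ?q" "1 = d * snd ?q"
    using arg_cong[OF cd(1), of fst] arg_cong[OF cd(1), of snd] arg_cong[OF cd(2), of fst] arg_cong[OF cd(2), of snd] by simp_all
  have "c = d" using 1(2,4) by (metis mult_cancel_right mult_zero_right zero_neq_one)
  then show ?thesis unfolding 1(1,3) by simp
qed

context
  fixes K :: "'n::finite minkowski set"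
  assumes K: "smooth_bounded_domain K" and hc: "uniformly_h_convex K"
begin

lemma cK: "compact K" and KH: "K \<subseteq> hyp" and connK: "connected K" and clK: "closed K" and neK: "K \<noteq> {}"
  using K compact_imp_closed[of K] interior_of_subset[of "top_of_set hyp" K] by (auto simp: smooth_bounded_domain_def)

lemma bdK: "X \<in> bd K \<Longrightarrow> X \<in> K" "X \<in> bd K \<Longrightarrow> X \<in> hyp"
  using bd_iff[OF clK KH] KH by blast+

lemma pcK: "X \<in> bd K \<Longrightarrow> k \<in> principal_curvatures K X \<Longrightarrow> k > 1"
  using hc unfolding uniformly_h_convex_def by fastforce

lemma chart:
  assumes X: "X \<in> bd K"
  obtains U f where "bchart K U f" "X \<in> U" "f X = 0" "outward_normal K X = bchart.Nf f X"
proof -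
  obtain U f where c: "bchart K U f" "X \<in> U" by (rule bchart_exists[OF K X])
  interpret bchart K U f by (rule c(1))
  have "f X = 0" using bd_iff_chart[OF c(2) bdK(2)[OF X]] X by blast
  then show thesis using that[OF c] outward_normal_chart[OF c(2) bdK(2)[OF X]] by blast
qed

lemma normal_bd:
  assumes X: "X \<in> bd K"
  shows "mink (outward_normal K X) (outward_normal K X) = 1" "mink (outward_normal K X) X = 0"
proof -
  obtain U f where c: "bchart K U f" "X \<in> U" "f X = 0" "outward_normal K X = bchart.Nf f X" by (rule chart[OF X])
  interpret bchart K U f by (rule c(1))
  show "mink (outward_normal K X) (outward_normal K X) = 1" "mink (outward_normal K X) X = 0"
    unfolding c(4) by (rule Nf(1,2)[OF c(2)])+
qed

lemma push_dichotomy: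
  assumes Y: "Y \<in> K" and ne: "\<eta> + mink \<eta> Y *\<^sub>R Y \<noteq> 0" and np: "\<not> pushable K (mink \<eta>) Y"
  shows "Y \<in> bd K \<and> (\<exists>c>0. \<eta> + mink \<eta> Y *\<^sub>R Y = c *\<^sub>R outward_normal K Y)"
proof -
  have B: "Y \<in> bd K" using push_interior[OF clK KH Y _ ne] np by blast
  obtain U f where c: "bchart K U f" "Y \<in> U" "f Y = 0" "outward_normal K Y = bchart.Nf f Y" by (rule chart[OF B])
  interpret bchart K U f by (rule c(1))
  show ?thesis using push_boundary[OF c(2) Y ne] np B unfolding c(4) by blast
qed

lemma not_pushable_max:
  assumes "Y \<in> K" "\<And>X. X \<in> K \<Longrightarrow> l X \<le> l Y"
  shows "\<not> pushable K l Y"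
proof
  assume "pushable K l Y"
  then obtain T d where "d > 0" "T ` K \<subseteq> K" "\<forall>X\<in>K. dist X Y < d \<longrightarrow> l X < l (T X)"
    unfolding pushable_def by (meson zero_less_one)
  then have "l Y < l (T Y)" "T Y \<in> K" using assms(1) by auto
  then show False using assms(2) by fastforce
qed

text \<open>Since \<open>et z\<close> is null, the differential along \<open>hyp\<close> has
  Lorentzian length \<open>mink (et z) X\<close>; this fixes the multiple of a unit normal.\<close>

lemma et_xi:
  assumes X: "X \<in> hyp" and z: "norm z = 1"
  shows "mink (et z) X > 0" "et z + mink (et z) X *\<^sub>R X \<noteq> 0"
    "c > 0 \<Longrightarrow> mink N N = 1 \<Longrightarrow> et z + mink (et z) X *\<^sub>R X = c *\<^sub>R N \<Longrightarrow> c = mink (et z) X"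
proof -
  let ?l = "mink (et z) X" and ?xi = "et z + mink (et z) X *\<^sub>R X"
  show l: "?l > 0" unfolding mink_et by (rule hyp_mink_null_pos[OF X z])
  have XX: "mink X X = -1" using X by (simp add: hyp_def)
  have q: "mink ?xi ?xi = ?l^2"
    using mink_commute[of X "et z"]
    by (simp add: mink_simps et_null[OF z] XX power2_eq_square)
  show "?xi \<noteq> 0"
  proof
    assume "?xi = 0"
    then have "mink ?xi ?xi = 0" by (simp add: mink_def)
    then show False using q l by simp
  qed
  assume c: "c > 0" "mink N N = 1" "?xi = c *\<^sub>R N"
  have "c^2 = ?l^2" using q unfolding c(3) by (simp add: mink_simps c(2) power2_eq_square)
  then show "c = ?l" using c(1) l by (simp add: power2_eq_iff_nonneg)
qed

lemma contact_strict:
  assumes c: "contactP K X z" and z: "norm z = 1"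
  shows "strict_max_on K (mink (et z)) X"
proof -
  have B: "X \<in> bd K" and eq: "et z + mink (et z) X *\<^sub>R X = mink (et z) X *\<^sub>R outward_normal K X"
    using c unfolding contactP_def by blast+
  obtain U f where f: "bchart K U f" "X \<in> U" "f X = 0" "outward_normal K X = bchart.Nf f X" by (rule chart[OF B])
  interpret bchart K U f by (rule f(1))
  show ?thesis
    by (rule strict_max_chart[OF f(2) bdK(2)[OF B] f(3) pcK[OF B] et_xi(1)[OF bdK(2)[OF B] z] eq[unfolded f(4)] order_refl])
qed

lemma push_imp_contact:
  assumes Y: "Y \<in> K" and z: "norm z = 1" and np: "\<not> pushable K (mink (et z)) Y"
  shows "contactP K Y z"
proof -
  have H: "Y \<in> hyp" using Y KH by blast
  obtain c where c: "Y \<in> bd K" "c > 0" "et z + mink (et z) Y *\<^sub>R Y = c *\<^sub>R outward_normal K Y"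
    using push_dichotomy[OF Y et_xi(2)[OF H z] np] by blast
  then show ?thesis using et_xi(3)[OF H z c(2) normal_bd(1)[OF c(1)] c(3)] unfolding contactP_def by simp
qed

text \<open>Every point of K is a contact point, hence a strict local maximum, or can be pushed. The
  mountain pass argument thus turns the local contact condition into a unique global
  maximum.\<close>

lemma contact_less:
  assumes c: "contactP K X z" and z: "norm z = 1" and Y: "Y \<in> K" "Y \<noteq> X"
  shows "mink (et z) Y < mink (et z) X"
proof (rule strict_max_global[OF cK connK _ _ _ contact_strict[OF c z] Y])
  show "continuous_on K (mink (et z))" by (intro continuous_intros)
  show "X \<in> K" using c bdK unfolding contactP_def by blast
  show "strict_max_on K (mink (et z)) Y \<or> pushable K (mink (et z)) Y" if "Y \<in> K" for Y
    using push_imp_contact[OF that z] contact_strict[OF _ z] by blast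
qed

lemma contact_unique: "contactP K X z \<Longrightarrow> contactP K Y z \<Longrightarrow> norm z = 1 \<Longrightarrow> X = Y"
  using contact_less[of X z Y] contact_less[of Y z X] bdK unfolding contactP_def by fastforce

lemma contact_exists:
  assumes z: "norm z = 1"
  shows "\<exists>X. contactP K X z"
proof -
  have "continuous_on K (mink (et z))" by (intro continuous_intros)
  then obtain X where X: "X \<in> K" "\<And>Y. Y \<in> K \<Longrightarrow> mink (et z) Y \<le> mink (et z) X"
    using continuous_attains_sup[OF cK neK] by blast
  have "\<not> pushable K (mink (et z)) X" by (rule not_pushable_max[OF X(1)]) (rule X(2))
  then show ?thesis using push_imp_contact[OF X(1) z] by blast
qed

text \<open>Scaled to time coordinate 1, the null vector q has the form (z, 1) with z a unit vector;
  \<open>mink X q = -1\<close> identifies the scaling factor with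
  \<open>mink (et z) X\<close>.\<close>

lemma contact_of_bd:
  assumes X: "X \<in> bd K" and q: "q = X - outward_normal K X"
  shows "contactP K X ((1 / norm (fst q)) *\<^sub>R fst q)"
proof -
  note nn = normal_null[OF bdK(2)[OF X] normal_bd[OF X], folded q]
  define z where "z = (1 / norm (fst q)) *\<^sub>R fst q"
  have np: "norm (fst q) > 0" using nn by simp
  have q2: "q = norm (fst q) *\<^sub>R (z, 1)" using np nn(3) by (simp add: z_def prod_eq_iff)
  have "mink X q = norm (fst q) * mink X (z, 1)" using arg_cong[OF q2, of "mink X"] by (simp only: mink_scale_right)
  then have "mink (et z) X = 1 / norm (fst q)" using nn(1) np by (simp add: mink_et field_simps)
  then have "mink (et z) X *\<^sub>R q = (z, 1)"
    using np arg_cong[OF q2, of "\<lambda>u. (1 / norm (fst q)) *\<^sub>R u"] by (simp del: scaleR_Pair)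
  then show ?thesis unfolding contactP_iff z_def[symmetric] using X q by simp
qed

text \<open>Defined for all nonzero v through the direction of v, so that derivatives can be taken
  on an open set.\<close>

definition XX :: "'n euclid1 \<Rightarrow> 'n minkowski" where
  "XX v = (SOME X. contactP K X ((1 / norm v) *\<^sub>R v))"

definition hK :: "'n euclid1 \<Rightarrow> real" where
  "hK v = - mink (XX v) (v, norm v)"

lemma XX: "v \<noteq> 0 \<Longrightarrow> contactP K (XX v) ((1 / norm v) *\<^sub>R v)"
  unfolding XX_def by (rule someI_ex[OF contact_exists]) simp

lemma XX_eqI: "v \<noteq> 0 \<Longrightarrow> contactP K X ((1 / norm v) *\<^sub>R v) \<Longrightarrow> XX v = X"
  by (rule contact_unique[OF XX]) simp_all

lemma XX_bd: "v \<noteq> 0 \<Longrightarrow> XX v \<in> bd K"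
  using XX unfolding contactP_def by blast

lemma hK_ge: "v \<noteq> 0 \<Longrightarrow> Y \<in> K \<Longrightarrow> - mink Y (v, norm v) \<le> hK v"
proof -
  assume v: "v \<noteq> 0" and Y: "Y \<in> K"
  let ?z = "(1 / norm v) *\<^sub>R v"
  have z: "norm ?z = 1" using v by simp
  have "mink (et ?z) Y \<le> mink (et ?z) (XX v)"
    using contact_less[OF XX[OF v] z Y] by (cases "Y = XX v") auto
  then have "norm v * mink (et ?z) Y \<le> norm v * mink (et ?z) (XX v)" by (intro mult_left_mono) auto
  moreover have "norm v * mink (et ?z) Z = - mink Z (v, norm v)" for Z
    by (rule norm_mink_et[OF v])
  ultimately show ?thesis by (simp add: hK_def)
qed

lemma hK_unit: "norm z = 1 \<Longrightarrow> hK z = mink (et z) (XX z)"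
  by (simp add: hK_def mink_et)

lemma hK_pos: "v \<noteq> 0 \<Longrightarrow> hK v > 0"
proof -
  assume v: "v \<noteq> 0"
  have "- mink (XX v) ((1 / norm v) *\<^sub>R v, 1) > 0"
    by (rule hyp_mink_null_pos[OF bdK(2)[OF XX_bd[OF v]]]) (use v in simp)
  then have "norm v * (- mink (XX v) ((1 / norm v) *\<^sub>R v, 1)) > 0" using v by (intro mult_pos_pos) auto
  then show ?thesis using v by (simp add: hK_def mink_def algebra_simps)
qed

lemma XX_scale: "c > 0 \<Longrightarrow> XX (c *\<^sub>R v) = XX v"
  by (simp add: XX_def)

lemma hK_homog: "c > 0 \<Longrightarrow> hK (c *\<^sub>R v) = c * hK v"
  by (simp add: hK_def XX_scale mink_def algebra_simps)

lemma null_direction: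
  assumes v: "v \<noteq> 0"
  shows "(v, norm v) = hK v *\<^sub>R (XX v - outward_normal K (XX v))"
proof -
  let ?z = "(1 / norm v) *\<^sub>R v"
  have "(?z, 1) = mink (et ?z) (XX v) *\<^sub>R (XX v - outward_normal K (XX v))"
    using XX[OF v] unfolding contactP_iff by blast
  then have "norm v *\<^sub>R (?z, 1) = (norm v * mink (et ?z) (XX v)) *\<^sub>R (XX v - outward_normal K (XX v))" by simp
  moreover have "norm v *\<^sub>R (?z, 1::real) = (v, norm v)" using v by simp
  moreover have "norm v * mink (et ?z) (XX v) = hK v" unfolding hK_def by (rule norm_mink_et[OF v])
  ultimately show ?thesis by simp
qed

text \<open>The contact point depends smoothly on the direction: it solves \<open>E X = (z, 0)\<close> for a map \<open>E\<close>
  whose derivative is injective because the Weingarten map does not have the eigenvalue 1.\<close>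

lemma local_XX:
  assumes v0: "v0 \<noteq> 0"
  obtains U f S where "bchart K U f" "open S" "v0 \<in> S" "S \<subseteq> - {0}" "smooth_on S XX" "XX ` S \<subseteq> U"
proof -
  define X0 where "X0 = XX v0"
  let ?z0 = "(1 / norm v0) *\<^sub>R v0"
  have B0: "X0 \<in> bd K" unfolding X0_def by (rule XX_bd[OF v0])
  have H0: "X0 \<in> hyp" by (rule bdK(2)[OF B0])
  obtain U f where c: "bchart K U f" "X0 \<in> U" "f X0 = 0" "outward_normal K X0 = bchart.Nf f X0" by (rule chart[OF B0])
  interpret bchart K U f by (rule c(1))
  define Zf where "Zf X = fst (X - Nf X)" for X
  define U1 where "U1 = U \<inter> (\<lambda>X. (Zf X, f X)) -` ((- {0}) \<times> {-1<..<1})"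
  have sZ: "smooth_on U Zf" unfolding Zf_def
    by (intro smooth_on_fst smooth_on_diff smooth_on_ident smooth_Nf open_U)
  have "openin (top_of_set U) U1"
    unfolding U1_def
    by (intro continuous_openin_preimage_gen continuous_on_Pair smooth_on_continuous_on[OF sZ] smooth_on_continuous_on[OF smooth_f]
        open_Times) auto
  then have U1: "open U1" using openin_open_eq[OF open_U] by blast
  have U1U: "U1 \<subseteq> U" and U1p: "X \<in> U1 \<Longrightarrow> Zf X \<noteq> 0 \<and> \<bar>f X\<bar> < 1" for X by (auto simp: U1_def)
  define zt where "zt X = (1 / norm (Zf X)) *\<^sub>R Zf X" for X
  have szt: "smooth_on U1 zt" unfolding zt_def
    by (intro smooth_on_scaleR smooth_on_divide smooth_on_const smooth_on_norm smooth_on_subset[OF sZ U1U] U1)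
      (use U1p in simp_all)
  \<comment> \<open>Because |f| < 1 on U1 and zt is a unit vector, the factor 1 + f makes the length
    of the first component detect f = 0; the second component detects the hyperboloid. Near X0 the
    equation E X = (z, 0) with |z| = 1 thus characterizes contact points.\<close>
  define E where "E X = ((1 + f X) *\<^sub>R zt X, mink X X + 1)" for X
  have sE: "smooth_on U1 E" unfolding E_def
    by (intro smooth_on_Pair smooth_on_scaleR smooth_on_add smooth_on_const smooth_mink smooth_on_ident U1 szt smooth_on_subset[OF smooth_f U1U])
  have null: "mink X (X - Nf X) = -1" "snd (X - Nf X) > 0" "norm (Zf X) = snd (X - Nf X)" if "X \<in> U" "X \<in> hyp" for X
    unfolding Zf_def using normal_null[OF that(2) Nf(1,2)[OF that(1)]] by blast+
  have X1: "X0 \<in> U1" using c null[OF c(2) H0] by (auto simp: U1_def)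
  have zt0: "zt X0 = ?z0"
  proof -
    have q: "X0 - outward_normal K X0 = X0 - Nf X0" unfolding c(4) by simp
    have "contactP K X0 (zt X0)" using contact_of_bd[OF B0 q[symmetric]] unfolding zt_def Zf_def .
    then show ?thesis by (rule contactP_direction) (use XX[OF v0] in \<open>simp add: X0_def\<close>)
  qed
  have E0: "E X0 = (?z0, 0)" using zt0 c(3) H0 by (simp add: E_def hyp_def)
  let ?D = "fd Nf X0"
  define dz where "dz = fd zt X0"
  have ztd: "(zt has_derivative dz) (at X0)" unfolding dz_def by (rule smooth_on_has_derivative[OF szt X1])
  have Zd: "(Zf has_derivative (\<lambda>w. fst (w - ?D w))) (at X0)"
    unfolding Zf_def by (intro has_derivative_fst has_derivative_diff has_derivative_ident der_Nf[OF c(2)])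
  have Ed: "(E has_derivative (\<lambda>w. ((1 + f X0) *\<^sub>R dz w + (gr f X0 \<bullet> w) *\<^sub>R zt X0, mink w X0 + mink X0 w))) (at X0)"
  proof -
    have a: "((\<lambda>X. 1 + f X) has_derivative (\<lambda>w. gr f X0 \<bullet> w)) (at X0)"
      using has_derivative_add[OF has_derivative_const[of 1] der_f[OF c(2)]] by simp
    have b: "((\<lambda>X. mink X X + 1) has_derivative (\<lambda>w. mink w X0 + mink X0 w)) (at X0)"
      using has_derivative_add[OF has_derivative_mink[OF has_derivative_ident has_derivative_ident] has_derivative_const[of 1]] by simp
    show ?thesis unfolding E_def by (rule has_derivative_Pair[OF has_derivative_scaleR[OF a ztd] b])
  qed
  have fdE: "fd E X0 = (\<lambda>w. ((1 + f X0) *\<^sub>R dz w + (gr f X0 \<bullet> w) *\<^sub>R zt X0, mink w X0 + mink X0 w))"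
    by (rule frechet_derivative_at[OF Ed, symmetric])
  have ztn: "zt X \<bullet> zt X = 1" if "X \<in> U1" for X
    using U1p[OF that] by (simp add: zt_def dot_square_norm power2_eq_square)
  have ztp: "zt X0 \<bullet> dz w = 0" for w
  proof -
    have "(\<lambda>w. zt X0 \<bullet> dz w + dz w \<bullet> zt X0) = (\<lambda>w. 0)"
    proof (rule has_derivative_unique[OF has_derivative_inner[OF ztd ztd]])
      show "((\<lambda>x. zt x \<bullet> zt x) has_derivative (\<lambda>w. 0)) (at X0)"
        by (rule has_derivative_transform_within_open[OF has_derivative_const[of 1] U1 X1]) (use ztn in simp)
    qed
    from fun_cong[OF this, of w] show ?thesis by (simp add: inner_commute[of "dz w"])
  qed
  have injE: "inj (fd E X0)"
    unfolding linear_injective_0[OF has_derivative_linear[OF smooth_on_has_derivative[OF sE X1]]]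
  proof (intro allI impI)
    fix w assume "fd E X0 w = 0"
    then have w: "dz w + (gr f X0 \<bullet> w) *\<^sub>R zt X0 = 0" "mink w X0 + mink X0 w = 0"
      by (simp_all add: fdE c(3) zero_prod_def)
    have Xw: "mink X0 w = 0" using w(2) mink_commute[of w X0] by simp
    have "zt X0 \<bullet> (dz w + (gr f X0 \<bullet> w) *\<^sub>R zt X0) = 0" unfolding w(1) by simp
    then have gw: "gr f X0 \<bullet> w = 0" by (simp add: inner_add_right ztp ztn[OF X1])
    then have dz0: "dz w = 0" using w(1) by simp
    define m where "m = fd (\<lambda>X. norm (Zf X)) X0 w"
    have nd: "((\<lambda>X. norm (Zf X)) has_derivative fd (\<lambda>X. norm (Zf X)) X0) (at X0)"
      by (rule smooth_on_has_derivative[OF smooth_on_norm[OF U1 smooth_on_subset[OF sZ U1U]] X1]) (use U1p in simp)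
    have "((\<lambda>X. norm (Zf X) *\<^sub>R zt X) has_derivative (\<lambda>w. norm (Zf X0) *\<^sub>R dz w + fd (\<lambda>X. norm (Zf X)) X0 w *\<^sub>R zt X0)) (at X0)"
      by (rule has_derivative_scaleR[OF nd ztd])
    then have "(Zf has_derivative (\<lambda>w. norm (Zf X0) *\<^sub>R dz w + fd (\<lambda>X. norm (Zf X)) X0 w *\<^sub>R zt X0)) (at X0)"
      by (rule has_derivative_transform_within_open[OF _ U1 X1]) (use U1p in \<open>simp add: zt_def\<close>)
    from fun_cong[OF has_derivative_unique[OF Zd this], of w]
    have fq: "fst (w - ?D w) = m *\<^sub>R zt X0" by (simp only: dz0 m_def) simp
    \<comment> \<open>A kernel vector w is tangent to the boundary and leaves the direction
      unchanged to first order. Then w - D w is parallel to the null vector X0 - N but orthogonal to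
      X0, so it vanishes, and D w = w contradicts curvature above 1 unless w = 0.\<close>
    let ?q = "w - ?D w" and ?p = "X0 - Nf X0"
    note np = null[OF c(2) H0]
    have Nw: "mink (Nf X0) w = 0" using Nf_zero_iff[OF c(2)] gw by blast
    have qX: "mink ?q X0 = 0" and qN: "mink ?q (Nf X0) = 0"
      using der_Nf_tangent[OF c(2) gw] Xw Nw mink_commute[of w X0] mink_commute[of w "Nf X0"] by (simp_all add: mink_diff_left)
    then have "mink ?q ?p = 0" by (simp add: mink_diff_right)
    then have "fst ?q \<bullet> fst ?p = snd ?q * snd ?p" by (simp only: mink_def)
    moreover have "fst ?p = norm (Zf X0) *\<^sub>R zt X0" using U1p[OF X1] by (simp add: zt_def Zf_def)
    ultimately have "m * snd ?p = snd ?q * snd ?p" using np(3) ztn[OF X1] by (simp only: fq) simp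
    then have sq: "snd ?q = m" using np(2) by simp
    have "?q = (m / snd ?p) *\<^sub>R ?p"
    proof (rule prod_eqI)
      show "fst ?q = fst ((m / snd ?p) *\<^sub>R ?p)"
        unfolding fq fst_scaleR \<open>fst ?p = norm (Zf X0) *\<^sub>R zt X0\<close> np(3) using np(2) by simp
      show "snd ?q = snd ((m / snd ?p) *\<^sub>R ?p)" unfolding sq snd_scaleR using np(2) by simp
    qed
    then have "mink X0 ?q = (m / snd ?p) * mink X0 ?p" by (metis mink_scale_right)
    then have "m / snd ?p = 0" using qX mink_commute[of X0 ?q] np(1) by simp
    with \<open>?q = (m / snd ?p) *\<^sub>R ?p\<close> have "?q = 0" by (metis scaleR_zero_left)
    then have Dw: "?D w = w" by simp
    show "w = 0"
    proof (rule ccontr)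
      assume "w \<noteq> 0"
      from curvature_gt[OF c(2) H0 c(3) pcK[OF B0] Xw gw this] show False unfolding Dw by simp
    qed
  qed
  obtain U' W g where g: "open U'" "U' \<subseteq> U1" "X0 \<in> U'" "open W" "E X0 \<in> W" "homeomorphism U' W E g" "smooth_on W g"
    by (rule smooth_inverse_function[OF U1 sE X1 injE]) (rule that, assumption+)
  let ?P = "\<lambda>v::'n euclid1. ((1 / norm v) *\<^sub>R v, 0::real)"
  have sP: "smooth_on (- {0}) ?P"
    by (intro smooth_on_Pair smooth_on_scaleR smooth_on_divide smooth_on_norm smooth_on_const smooth_on_ident) auto
  define S where "S = - {0} \<inter> ?P -` W"
  have oc: "open (- {0 :: 'n euclid1})" by auto
  have "openin (top_of_set (- {0})) S"
    unfolding S_def by (rule continuous_openin_preimage_gen[OF smooth_on_continuous_on[OF sP] g(4)])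
  then have S: "open S" using openin_open_eq[OF oc] by blast
  have v0S: "v0 \<in> S" using v0 g(5) unfolding E0 S_def by simp
  have loc: "XX v = g (?P v) \<and> g (?P v) \<in> U" if v: "v \<in> S" for v
  proof -
    define Y where "Y = g (?P v)"
    have v0: "v \<noteq> 0" and W: "?P v \<in> W" using v by (auto simp: S_def)
    have Y: "Y \<in> U'" "E Y = ?P v"
      using homeomorphism_image2[OF g(6)] homeomorphism_apply2[OF g(6) W] W unfolding Y_def by blast+
    have Y1: "Y \<in> U1" and YU: "Y \<in> U" using Y(1) g(2) U1U by blast+
    have e: "(1 + f Y) *\<^sub>R zt Y = (1 / norm v) *\<^sub>R v" "mink Y Y = -1" using Y(2) by (simp_all add: E_def)
    have YH: "Y \<in> hyp" using e(2) YU U_Cn by (auto simp: hyp_def Cn_def)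
    have "norm ((1 + f Y) *\<^sub>R zt Y) = 1" unfolding e(1) using v0 by simp
    moreover have "norm (zt Y) = 1" using ztn[OF Y1] by (simp add: norm_eq_1)
    ultimately have f0: "f Y = 0" using U1p[OF Y1] by (simp add: abs_if split: if_splits)
    have B: "Y \<in> bd K" using bd_iff_chart[OF YU YH] f0 by simp
    have q: "Y - Nf Y = Y - outward_normal K Y" by (simp add: outward_normal_chart[OF YU YH f0])
    have "contactP K Y (zt Y)" using contact_of_bd[OF B q] unfolding zt_def Zf_def .
    moreover have "zt Y = (1 / norm v) *\<^sub>R v" using e(1) f0 by simp
    ultimately have "XX v = Y" using XX_eqI[OF v0] by simp
    then show ?thesis using YU by (simp add: Y_def)
  qed
  have sS: "smooth_on S XX"
  proof (rule smooth_on_cong[OF S])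
    show "smooth_on S (\<lambda>v. g (?P v))"
      by (rule smooth_on_compose[OF S g(4) _ smooth_on_subset[OF sP] g(7)]) (auto simp: S_def)
  qed (use loc in simp)
  have "XX ` S \<subseteq> U" using loc by (auto simp del: split_paired_all)
  then show thesis by (intro that[OF c(1) S v0S _ sS]) (auto simp: S_def)
qed

lemma smooth_XX: "smooth_on (- {0}) XX"
proof (rule smooth_on_local)
  fix v assume "v \<in> - {0 :: 'n euclid1}"
  then have "v \<noteq> 0" by simp
  then obtain U f S where "bchart K U f" "open S" "v \<in> S" "S \<subseteq> - {0}" "smooth_on S XX" "XX ` S \<subseteq> U" by (rule local_XX)
  then show "\<exists>W. open W \<and> v \<in> W \<and> smooth_on W XX" by blast
qed

lemma open_punct: "open (- {0 :: 'n euclid1})"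
  by auto

lemma smooth_hK: "smooth_on (- {0}) hK"
  unfolding hK_def[abs_def]
  by (intro smooth_on_minus smooth_mink smooth_XX smooth_on_Pair smooth_on_ident smooth_on_norm open_punct) auto

text \<open>The point \<open>XX v\<close> lies in K and so bounds hK from below in every direction,
  with equality at v; the difference is minimal at v and its gradient vanishes there.\<close>

lemma gr_hK:
  assumes v: "v \<noteq> 0"
  shows "gr hK v = (snd (XX v) / norm v) *\<^sub>R v - fst (XX v)"
proof -
  let ?X = "XX v"
  let ?k = "\<lambda>w. hK w + mink ?X (w, norm w)"
  have d: "(hK has_derivative (\<lambda>e. gr hK v \<bullet> e)) (at v)"
    by (rule smooth_has_derivative_gr[OF smooth_hK]) (use v in simp)
  have n: "(norm has_derivative (\<lambda>e. (v \<bullet> e) / norm v)) (at v)"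
    using has_derivative_norm[OF v] by (simp add: inner_commute sgn_div_norm divide_inverse mult.commute)
  have m: "((\<lambda>w. mink ?X (w, norm w)) has_derivative (\<lambda>e. fst ?X \<bullet> e - snd ?X * ((v \<bullet> e) / norm v))) (at v)"
    unfolding mink_def fst_conv snd_conv by (intro has_derivative_diff has_derivative_mult_right n has_derivative_inner_right has_derivative_ident)
  have "(\<lambda>e. gr hK v \<bullet> e + (fst ?X \<bullet> e - snd ?X * ((v \<bullet> e) / norm v))) = (\<lambda>e. 0)"
  proof (rule differential_zero_maxmin[OF _ open_punct has_derivative_add[OF d m]])
    have XK: "?X \<in> K" by (rule bdK(1)[OF XX_bd[OF v]])
    have "?k v \<le> ?k w" if "w \<in> - {0}" for w using hK_ge[OF _ XK, of w] that by (simp add: hK_def)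
    then show "(\<forall>w\<in>- {0}. ?k w \<le> ?k v) \<or> (\<forall>w\<in>- {0}. ?k v \<le> ?k w)" by blast
  qed (use v in simp)
  from fun_cong[OF this] have z: "gr hK v \<bullet> e + (fst ?X \<bullet> e - snd ?X * ((v \<bullet> e) / norm v)) = 0" for e .
  have "(gr hK v - ((snd ?X / norm v) *\<^sub>R v - fst ?X)) \<bullet> e = 0" for e
    using z[of e] by (simp add: inner_diff_left algebra_simps)
  from this[of "gr hK v - ((snd ?X / norm v) *\<^sub>R v - fst ?X)"] show ?thesis by simp
qed

lemma xpt_hK:
  assumes z: "norm z = 1"
  shows "xpt hK z = XX z" "tpt hK z = snd (XX z)"
proof -
  let ?x = "fst (XX z)" and ?t = "snd (XX z)"
  have z0: "z \<noteq> 0" using z by auto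
  have g: "gr hK z = ?t *\<^sub>R z - ?x" using gr_hK[OF z0] z by simp
  have h: "hK z = ?t - ?x \<bullet> z" using z by (simp add: hK_def mink_def)
  have H: "?x \<bullet> ?x - ?t * ?t = -1" using bdK(2)[OF XX_bd[OF z0]] by (simp add: hyp_def mink_def)
  have "z \<bullet> z = 1" using z by (simp add: dot_square_norm)
  then have "gr hK z \<bullet> gr hK z + 1 = 2 * ?t * hK z"
    using H unfolding g h by (simp add: inner_simps inner_commute[of z ?x] algebra_simps)
  then show t: "tpt hK z = ?t" using hK_pos[OF z0] by (simp add: tpt_def)
  show "xpt hK z = XX z" unfolding xpt_def t g by (simp add: prod_eq_iff)
qed

text \<open>Differentiate (v, |v|) = hK(v) (X - N) in direction e and pair with the derivative w of
  the contact point: the terms along X - N drop out and \<open>mink (e, 0) w\<close> equals h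
  (\<open>mink w w\<close> - \<open>mink (D w) w\<close>), negative by curvature above 1. The same
  quantity is t |e|^2 minus the Hessian term.\<close>

lemma strict_hK:
  assumes z: "norm z = 1" and e: "e \<bullet> z = 0" "e \<noteq> 0"
  shows "hess hK z e \<bullet> e > tpt hK z * (e \<bullet> e)"
proof -
  have z0: "z \<noteq> 0" using z by auto
  have zz: "z \<bullet> z = 1" using z by (simp add: dot_square_norm)
  have ze: "z \<bullet> e = 0" using e(1) by (simp add: inner_commute)
  obtain U f S where S: "bchart K U f" "open S" "z \<in> S" "S \<subseteq> - {0}" "smooth_on S XX" "XX ` S \<subseteq> U" using z0 by (rule local_XX)
  interpret bchart K U f by (rule S(1))
  let ?X = "XX z"
  define X' where "X' = fd XX z"
  have Xd: "(XX has_derivative X') (at z)" unfolding X'_def by (rule smooth_on_has_derivative[OF S(5,3)])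
  define w where "w = X' e"
  have SU: "XX v \<in> U" "XX v \<in> hyp" "f (XX v) = 0" "XX v \<in> bd K" if "v \<in> S" for v
  proof -
    have v0: "v \<noteq> 0" using S(4) that by auto
    show "XX v \<in> U" using S(6) that by blast
    moreover show "XX v \<in> bd K" by (rule XX_bd[OF v0])
    moreover show "XX v \<in> hyp" by (rule bdK(2)[OF XX_bd[OF v0]])
    ultimately show "f (XX v) = 0" using bd_iff_chart by blast
  qed
  note Z = SU[OF S(3)]
  have "(\<lambda>e. mink (X' e) ?X + mink ?X (X' e)) = (\<lambda>e. 0)"
  proof (rule has_derivative_unique[OF has_derivative_mink[OF Xd Xd]])
    show "((\<lambda>v. mink (XX v) (XX v)) has_derivative (\<lambda>e. 0)) (at z)"
      by (rule has_derivative_transform_within_open[OF has_derivative_const[of "-1"] S(2,3)]) (use SU(2) in \<open>simp add: hyp_def\<close>)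
  qed
  from fun_cong[OF this, of e] have Xw: "mink ?X w = 0" using mink_commute[of w ?X] by (simp add: w_def)
  have "(\<lambda>e. gr f ?X \<bullet> X' e) = (\<lambda>e. 0)"
  proof (rule has_derivative_unique[OF has_derivative_compose[OF Xd der_f[OF Z(1)]]])
    show "((\<lambda>v. f (XX v)) has_derivative (\<lambda>e. 0)) (at z)"
      by (rule has_derivative_transform_within_open[OF has_derivative_const[of 0] S(2,3)]) (use SU(3) in simp)
  qed
  from fun_cong[OF this, of e] have gw: "gr f ?X \<bullet> w = 0" by (simp add: w_def)
  have Nw: "mink (Nf ?X) w = 0" using Nf_zero_iff[OF Z(1)] gw by blast
  let ?D = "fd Nf ?X"
  have nd: "(norm has_derivative (\<lambda>e. z \<bullet> e)) (at z)"
    using has_derivative_norm[OF z0] z by (simp add: inner_commute sgn_div_norm)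
  have hd: "(hK has_derivative (\<lambda>e. gr hK z \<bullet> e)) (at z)"
    by (rule smooth_has_derivative_gr[OF smooth_hK]) (use z0 in simp)
  have "(\<lambda>e. (e, z \<bullet> e)) = (\<lambda>e. hK z *\<^sub>R (X' e - ?D (X' e)) + (gr hK z \<bullet> e) *\<^sub>R (?X - Nf ?X))"
  proof (rule has_derivative_unique)
    show "((\<lambda>v. (v, norm v)) has_derivative (\<lambda>e. (e, z \<bullet> e))) (at z)"
      by (intro has_derivative_Pair has_derivative_ident nd)
    have "((\<lambda>v. hK v *\<^sub>R (XX v - Nf (XX v))) has_derivative
        (\<lambda>e. hK z *\<^sub>R (X' e - ?D (X' e)) + (gr hK z \<bullet> e) *\<^sub>R (?X - Nf ?X))) (at z)"
      by (intro has_derivative_scaleR[OF hd] has_derivative_diff Xd has_derivative_compose[OF Xd der_Nf[OF Z(1)]])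
    then show "((\<lambda>v. (v, norm v)) has_derivative
        (\<lambda>e. hK z *\<^sub>R (X' e - ?D (X' e)) + (gr hK z \<bullet> e) *\<^sub>R (?X - Nf ?X))) (at z)"
    proof (rule has_derivative_transform_within_open[OF _ S(2,3)])
      fix v assume v: "v \<in> S"
      then have "v \<noteq> 0" using S(4) by auto
      from null_direction[OF this] show "hK v *\<^sub>R (XX v - Nf (XX v)) = (v, norm v)"
        using outward_normal_chart[OF SU(1,2,3)[OF v]] by simp
    qed
  qed
  from fun_cong[OF this, of e]
  have id: "(e, 0) = hK z *\<^sub>R (w - ?D w) + (gr hK z \<bullet> e) *\<^sub>R (?X - Nf ?X)" by (simp only: w_def ze)
  have w0: "w \<noteq> 0"
  proof
    assume "w = 0"
    moreover have "?D 0 = 0" by (rule linear_0[OF has_derivative_linear[OF der_Nf[OF Z(1)]]])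
    ultimately have id2: "(e, 0) = (gr hK z \<bullet> e) *\<^sub>R (?X - Nf ?X)" using id by simp
    have "snd (?X - Nf ?X) > 0" by (rule normal_null(2)[OF Z(2) Nf(1,2)[OF Z(1)]])
    moreover have "(gr hK z \<bullet> e) * snd (?X - Nf ?X) = 0" using arg_cong[OF id2, of snd] by simp
    ultimately have "gr hK z \<bullet> e = 0" by simp
    then have "(e, 0::real) = 0" using id2 by simp
    then show False using e(2) by (simp add: zero_prod_def)
  qed
  have "mink (e, 0) w = hK z * (mink w w - mink (?D w) w)"
    unfolding id using Xw Nw by (simp add: mink_simps)
  moreover have "mink w w < mink (?D w) w" by (rule curvature_gt[OF Z(1,2,3) pcK[OF Z(4)] Xw gw w0])
  ultimately have neg: "e \<bullet> fst w < 0" using hK_pos[OF z0] by (simp add: mink_def mult_pos_neg)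
  have fd: "((\<lambda>v. (snd (XX v) / norm v) *\<^sub>R v - fst (XX v)) has_derivative
      (\<lambda>e. snd ?X *\<^sub>R e + (snd (X' e) - snd ?X * (z \<bullet> e)) *\<^sub>R z - fst (X' e))) (at z)"
  proof -
    have "((\<lambda>v. snd (XX v) / norm v) has_derivative
        (\<lambda>e. (snd (X' e) * norm z - snd ?X * (z \<bullet> e)) / (norm z * norm z))) (at z)"
      by (rule has_derivative_divide'[OF has_derivative_snd[OF Xd] nd]) (use z0 in simp)
    then have q: "((\<lambda>v. snd (XX v) / norm v) has_derivative (\<lambda>e. snd (X' e) - snd ?X * (z \<bullet> e))) (at z)"
      using z by simp
    show ?thesis
      using has_derivative_diff[OF has_derivative_scaleR[OF q has_derivative_ident] has_derivative_fst[OF Xd]] z by simp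
  qed
  have gd: "(gr hK has_derivative hess hK z) (at z)"
    by (rule smooth_has_derivative_hess[OF open_punct smooth_hK]) (use z0 in simp)
  have "(gr hK has_derivative (\<lambda>e. snd ?X *\<^sub>R e + (snd (X' e) - snd ?X * (z \<bullet> e)) *\<^sub>R z - fst (X' e))) (at z)"
  proof (rule has_derivative_transform_within_open[OF fd S(2,3)])
    show "(snd (XX v) / norm v) *\<^sub>R v - fst (XX v) = gr hK v" if "v \<in> S" for v
      by (rule gr_hK[symmetric]) (use that S(4) in auto)
  qed
  from fun_cong[OF has_derivative_unique[OF gd this], of e]
  have "hess hK z e = snd ?X *\<^sub>R e + snd w *\<^sub>R z - fst w" by (simp add: w_def ze)
  then have "hess hK z e \<bullet> e = snd ?X * (e \<bullet> e) - e \<bullet> fst w"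
    using ze by (simp add: inner_simps inner_commute[of "fst w" e])
  then show ?thesis using neg unfolding xpt_hK(2)[OF z] by simp
qed

lemma h_body_hK: "h_body hK"
proof
  show "smooth_on (- {0}) hK" by (rule smooth_hK)
  show "hK (c *\<^sub>R v) = c * hK v" if "c > 0" "v \<noteq> 0" for c v by (rule hK_homog[OF that(1)])
  show "hK z > 0" if "norm z = 1" for z by (rule hK_pos) (use that in auto)
  show "- mink (xpt hK z) (w, 1) < hK w" if z: "norm z = 1" and w: "norm w = 1" and ne: "w \<noteq> z" for z w
  proof -
    have z0: "z \<noteq> 0" and w0: "w \<noteq> 0" using z w by auto
    have c: "contactP K (XX w) w" using XX[OF w0] w by simp
    have "XX z \<noteq> XX w"
      using contactP_direction[OF c, of z] XX[OF z0] z ne by fastforce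
    from contact_less[OF c w bdK(1)[OF XX_bd[OF z0]] this] show ?thesis
      unfolding xpt_hK(1)[OF z] hK_unit[OF w] mink_et .
  qed
  show "hess hK z e \<bullet> e > tpt hK z * (e \<bullet> e)" if "norm z = 1" "e \<bullet> z = 0" "e \<noteq> 0" for z e
    by (rule strict_hK[OF that])
qed

text \<open>A point X of \<open>hdom hK\<close> outside K would have a nearest point Y in K. The
  first-order condition there makes the geodesic to X leave along the outward normal, and the
  horosphere touching K at Y then excludes X.\<close>

lemma K_eq_hdom: "K = hdom hK"
proof (intro set_eqI iffI)
  fix X assume X: "X \<in> K"
  have "- mink X (z, 1) \<le> hK z" if z: "norm z = 1" for z
  proof -
    have "z \<noteq> 0" using z by auto
    from hK_ge[OF this X] show ?thesis using z by simp
  qed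
  then show "X \<in> hdom hK" using X KH by (auto simp: hdom_def)
next
  fix X assume X: "X \<in> hdom hK"
  then have XH: "X \<in> hyp" and le: "\<And>z. norm z = 1 \<Longrightarrow> - mink X (z, 1) \<le> hK z" by (auto simp: hdom_def)
  show "X \<in> K"
  proof (rule ccontr)
    assume n: "X \<notin> K"
    have "continuous_on K (mink X)" by (intro continuous_intros)
    then obtain Y where Y: "Y \<in> K" "\<And>Z. Z \<in> K \<Longrightarrow> mink X Z \<le> mink X Y"
      using continuous_attains_sup[OF cK neK] by blast
    have YH: "Y \<in> hyp" using Y(1) KH by blast
    have YY: "mink Y Y = -1" using YH by (simp add: hyp_def)
    have m: "mink X Y < -1" using hyp_mink_le[OF XH YH] n Y(1) by fastforce
    have "X + mink X Y *\<^sub>R Y \<noteq> 0"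
    proof
      assume "X + mink X Y *\<^sub>R Y = 0"
      then have "mink X (X + mink X Y *\<^sub>R Y) = 0" by (simp add: mink_def)
      then have "(mink X Y)^2 = 1" using XH by (simp add: mink_simps hyp_def power2_eq_square)
      then show False using m by (simp add: power2_eq_1_iff)
    qed
    moreover have "\<not> pushable K (mink X) Y" by (rule not_pushable_max[OF Y(1)]) (rule Y(2))
    ultimately obtain c where c: "Y \<in> bd K" "c > 0" "X + mink X Y *\<^sub>R Y = c *\<^sub>R outward_normal K Y"
      using push_dichotomy[OF Y(1)] by blast
    let ?q = "Y - outward_normal K Y"
    define z where "z = (1 / norm (fst ?q)) *\<^sub>R fst ?q"
    note nn = normal_null[OF YH normal_bd[OF c(1)]]
    have z: "norm z = 1" using nn(2,3) by (simp add: z_def)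
    then have z0: "z \<noteq> 0" by auto
    have cP: "contactP K Y z" unfolding z_def by (rule contact_of_bd[OF c(1) refl])
    have "XX z = Y" by (rule XX_eqI[OF z0]) (use cP z in simp)
    then have q: "(z, 1) = hK z *\<^sub>R ?q" using null_direction[OF z0] z by simp
    have Xq: "mink X ?q = mink X Y - c"
    proof -
      have "mink X (outward_normal K Y) + mink X Y * mink Y (outward_normal K Y) = c"
        using arg_cong[OF c(3), of "\<lambda>u. mink u (outward_normal K Y)"] normal_bd(1)[OF c(1)] by (simp add: mink_simps)
      then show ?thesis using normal_bd(2)[OF c(1)] mink_commute[of Y "outward_normal K Y"] by (simp add: mink_diff_right)
    qed
    have "- mink X (z, 1) = hK z * (c - mink X Y)" unfolding q mink_scale_right Xq by (simp add: algebra_simps)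
    moreover have "hK z * (c - mink X Y) > hK z * 1" using hK_pos[OF z0] m c(2) by (intro mult_strict_left_mono) auto
    ultimately show False using le[OF z] by simp
  qed
qed

end

theorem uniformly_h_convex_imp_h_body:
  assumes "smooth_bounded_domain K" "uniformly_h_convex K"
  shows "\<exists>h. h_body h \<and> K = hdom h"
  using h_body_hK[OF assms] K_eq_hdom[OF assms] by blast

section \<open>Sums of support functions\<close>

lemma bernoulli_powr_less:
  fixes p t :: real
  assumes p: "1 < p" and t: "t > 0" "t \<noteq> 1"
  shows "1 + p * (t - 1) < t powr p"
proof -
  let ?f = "\<lambda>t. t powr p - 1 - p * (t - 1)"
  have d: "(?f has_real_derivative p * (x powr (p - 1) - 1)) (at x)" if "x > 0" for x
    using that by (auto intro!: derivative_eq_intros simp: algebra_simps)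
  have c: "continuous_on {l..u} ?f" if "l > 0" for l u
    using that by (intro continuous_intros) auto
  have "?f 1 < ?f t"
  proof (cases "t > 1")
    case True
    show ?thesis
    proof (rule DERIV_pos_imp_increasing_open[OF True _ c])
      fix x :: real assume x: "1 < x" "x < t"
      have "1 powr (p - 1) < x powr (p - 1)" using x p by (intro powr_less_mono2) auto
      then show "\<exists>y. (?f has_real_derivative y) (at x) \<and> 0 < y"
        using d[of x] x p by (intro exI[of _ "p * (x powr (p - 1) - 1)"]) simp
    qed simp
  next
    case False
    then have lt: "t < 1" using t by simp
    show ?thesis
    proof (rule DERIV_neg_imp_decreasing_open[OF lt _ c])
      fix x :: real assume x: "t < x" "x < 1"
      have "x powr (p - 1) < 1 powr (p - 1)" using x p t by (intro powr_less_mono2) auto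
      then show "\<exists>y. (?f has_real_derivative y) (at x) \<and> y < 0"
        using d[of x] x t p by (intro exI[of _ "p * (x powr (p - 1) - 1)"]) (simp add: mult_pos_neg)
    qed (use t in simp)
  qed
  then show ?thesis by simp
qed

lemma bernoulli_powr: "1 \<le> p \<Longrightarrow> t > 0 \<Longrightarrow> 1 + p * (t - 1) \<le> t powr (p::real)"
  using bernoulli_powr_less[of p t] by (cases "p = 1"; cases "t = 1") auto

lemma bernoulli_powr_neg:
  fixes r u :: real
  assumes "r \<le> 0" "u > 0"
  shows "1 + r * (u - 1) \<le> u powr r"
proof -
  have "r * (u - 1) \<le> r * ln u" using assms ln_le_minus_one[of u] by (intro mult_left_mono_neg) auto
  moreover have "u powr r = exp (r * ln u)" using assms(2) by (simp add: powr_def)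
  ultimately show ?thesis using exp_ge_add_one_self[of "r * ln u"] by linarith
qed

definition psum :: "real \<Rightarrow> real \<Rightarrow> real \<Rightarrow> real \<Rightarrow> real \<Rightarrow> real" where
  "psum p a b x y = (a * x powr p + b * y powr p) powr (1 / p)"

lemma psum_pos: "a \<ge> 0 \<Longrightarrow> b \<ge> 0 \<Longrightarrow> a + b > 0 \<Longrightarrow> x > 0 \<Longrightarrow> y > 0 \<Longrightarrow> a * x powr p + b * y powr p > (0::real)"
  by (cases "a = 0") (auto intro!: add_pos_nonneg)

lemma psum_powr: "1 \<le> p \<Longrightarrow> a \<ge> 0 \<Longrightarrow> b \<ge> 0 \<Longrightarrow> psum p a b x y powr p = a * x powr p + b * y powr p"
  by (simp add: psum_def powr_powr)

lemma psum_scale: "1 \<le> p \<Longrightarrow> a \<ge> 0 \<Longrightarrow> b \<ge> 0 \<Longrightarrow> c > 0 \<Longrightarrow> x > 0 \<Longrightarrow> y > 0 \<Longrightarrow> psum p a b (c * x) (c * y) = c * psum p a b x y"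
proof -
  assume a: "1 \<le> p" "a \<ge> 0" "b \<ge> 0" "c > 0" "x > 0" "y > 0"
  have "a * (c * x) powr p + b * (c * y) powr p = c powr p * (a * x powr p + b * y powr p)"
    using a by (simp add: powr_mult algebra_simps)
  then show ?thesis using a by (simp add: psum_def powr_mult powr_powr)
qed

text \<open>\<alpha> and \<beta> are the partial derivatives of \<open>psum\<close> at (x, y). The
  linear function they define lies below the convex homogeneous \<open>psum\<close> and, for p > 1
  and a, b > 0, touches it only along the ray of (x, y). The last estimate is the one that makes
  combined contact points admissible.\<close>

lemma psum_support:
  assumes p: "1 \<le> p" and ab: "a \<ge> 0" "b \<ge> 0" "a + b > 0" and x: "x > 0" and y: "y > 0"
  obtains \<alpha> \<beta> where "\<alpha> \<ge> 0" "\<beta> \<ge> 0" "a > 0 \<Longrightarrow> \<alpha> > 0" "b > 0 \<Longrightarrow> \<beta> > 0" "\<alpha> + \<beta> > 0"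
    "\<alpha> * x + \<beta> * y = psum p a b x y"
    "\<And>q r. q > 0 \<Longrightarrow> r > 0 \<Longrightarrow> \<alpha> * q + \<beta> * r \<le> psum p a b q r"
    "\<And>q r. 1 < p \<Longrightarrow> a > 0 \<Longrightarrow> b > 0 \<Longrightarrow> q > 0 \<Longrightarrow> r > 0 \<Longrightarrow> \<alpha> * q + \<beta> * r = psum p a b q r \<Longrightarrow> q / x = r / y"
    "p \<le> 2 \<Longrightarrow> a + b \<ge> 1 \<Longrightarrow> psum p a b x y * (\<alpha> / x + \<beta> / y) \<ge> 1"
proof -
  define M where "M = psum p a b x y"
  have M: "M > 0" using psum_pos[OF ab x y, of p] by (simp add: M_def psum_def)
  define s where "s = x / M"
  define t where "t = y / M"
  have st: "s > 0" "t > 0" using x y M by (simp_all add: s_def t_def)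
  have one: "a * s powr p + b * t powr p = 1"
  proof -
    have "M powr p * (a * s powr p + b * t powr p) = a * x powr p + b * y powr p"
      using x y M by (simp add: s_def t_def powr_divide algebra_simps)
    also have "\<dots> = M powr p" unfolding M_def psum_powr[OF p ab(1,2)] ..
    finally show ?thesis using M by simp
  qed
  define \<alpha> where "\<alpha> = a * s powr (p - 1)"
  define \<beta> where "\<beta> = b * t powr (p - 1)"
  have al: "\<alpha> * s = a * s powr p" "\<beta> * t = b * t powr p"
    using st by (simp_all add: \<alpha>_def \<beta>_def powr_diff)
  have gap: "\<alpha> * q + \<beta> * r \<le> psum p a b q r \<and> (1 < p \<longrightarrow> a > 0 \<longrightarrow> b > 0 \<longrightarrow> q / x \<noteq> r / y \<longrightarrow> \<alpha> * q + \<beta> * r < psum p a b q r)"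
    if q: "q > 0" "r > 0" for q r
  proof -
    define m where "m = \<alpha> * q + \<beta> * r"
    have m: "m > 0"
      unfolding m_def using ab st q by (cases "a = 0") (auto simp: \<alpha>_def \<beta>_def intro!: add_pos_nonneg mult_pos_pos mult_nonneg_nonneg)
    define u where "u = q / (s * m)"
    define v where "v = r / (t * m)"
    have uv: "u > 0" "v > 0" using q st m by (simp_all add: u_def v_def)
    \<comment> \<open>The weights ?A and ?B add up to 1 and u, v have weighted mean 1, so what
      follows is Jensen's inequality for t^p through the tangent line at 1.\<close>
    let ?A = "a * s powr p" and ?B = "b * t powr p"
    have mean: "?A * u + ?B * v = 1"
    proof -
      have "?A * u + ?B * v = (\<alpha> * q + \<beta> * r) / m" unfolding al[symmetric] using st m by (simp add: u_def v_def field_simps)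
      then show ?thesis using m by (simp add: m_def)
    qed
    have tot: "?A * u powr p + ?B * v powr p = (a * q powr p + b * r powr p) / m powr p"
      using st q m by (simp add: u_def v_def powr_divide powr_mult field_simps)
    have lin: "?A * (1 + p * (u - 1)) + ?B * (1 + p * (v - 1)) = 1"
    proof -
      have "?A * (1 + p * (u - 1)) + ?B * (1 + p * (v - 1)) = (?A + ?B) + p * ((?A * u + ?B * v) - (?A + ?B))"
        by (simp add: algebra_simps)
      then show ?thesis unfolding mean one by simp
    qed
    have AB: "?A \<ge> 0" "?B \<ge> 0" using ab by simp_all
    have le: "1 \<le> ?A * u powr p + ?B * v powr p"
      using add_mono[OF mult_left_mono[OF bernoulli_powr[OF p uv(1)] AB(1)] mult_left_mono[OF bernoulli_powr[OF p uv(2)] AB(2)]]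
      unfolding lin .
    have fin: "m = (m powr p) powr (1 / p)" using p m by (simp add: powr_powr)
    have "m powr p \<le> a * q powr p + b * r powr p" using le m unfolding tot by (simp add: pos_le_divide_eq)
    then have "(m powr p) powr (1 / p) \<le> psum p a b q r" unfolding psum_def using p by (intro powr_mono2) auto
    then have 1: "m \<le> psum p a b q r" using fin by simp
    have "m < psum p a b q r" if h: "1 < p" "a > 0" "b > 0" "q / x \<noteq> r / y"
    proof -
      have "u \<noteq> 1 \<or> v \<noteq> 1"
      proof (rule ccontr)
        assume "\<not> (u \<noteq> 1 \<or> v \<noteq> 1)"
        then have "q = s * m" "r = t * m" using st m by (simp_all add: u_def v_def)
        then have "q / x = m / M" "r / y = m / M" using x y by (simp_all add: s_def t_def)
        then show False using h(4) by simp
      qed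
      have ABp: "?A > 0" "?B > 0" using h st by simp_all
      have ge: "?A * (1 + p * (u - 1)) \<le> ?A * u powr p" "?B * (1 + p * (v - 1)) \<le> ?B * v powr p"
        using bernoulli_powr[OF p uv(1)] bernoulli_powr[OF p uv(2)] AB by (simp_all add: mult_left_mono)
      have "1 < ?A * u powr p + ?B * v powr p"
      proof (cases "u = 1")
        case False
        then have "?A * (1 + p * (u - 1)) < ?A * u powr p" using bernoulli_powr_less[OF h(1) uv(1)] ABp by (intro mult_strict_left_mono) auto
        then show ?thesis using ge lin by linarith
      next
        case True
        then have "v \<noteq> 1" using \<open>u \<noteq> 1 \<or> v \<noteq> 1\<close> by blast
        then have "?B * (1 + p * (v - 1)) < ?B * v powr p" using bernoulli_powr_less[OF h(1) uv(2)] ABp by (intro mult_strict_left_mono) auto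
        then show ?thesis using ge lin by linarith
      qed
      then have "m powr p < a * q powr p + b * r powr p" using m unfolding tot by (simp add: pos_less_divide_eq)
      then have "(m powr p) powr (1 / p) < psum p a b q r" unfolding psum_def using p by (intro powr_less_mono2) auto
      then show ?thesis using fin by simp
    qed
    then show ?thesis using 1 unfolding m_def by blast
  qed
  show thesis
  proof (rule that)
    show "\<alpha> \<ge> 0" "\<beta> \<ge> 0" using ab by (simp_all add: \<alpha>_def \<beta>_def)
    show "a > 0 \<Longrightarrow> \<alpha> > 0" "b > 0 \<Longrightarrow> \<beta> > 0" using st by (simp_all add: \<alpha>_def \<beta>_def)
    show "\<alpha> + \<beta> > 0" using ab st by (cases "a = 0") (auto simp: \<alpha>_def \<beta>_def intro!: add_pos_nonneg)
    have "\<alpha> * x + \<beta> * y = M * (\<alpha> * s + \<beta> * t)" using M by (simp add: s_def t_def algebra_simps)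
    then show "\<alpha> * x + \<beta> * y = psum p a b x y" unfolding al one by (simp add: M_def)
    show "\<alpha> * q + \<beta> * r \<le> psum p a b q r" if "q > 0" "r > 0" for q r using gap[OF that] by blast
    show "q / x = r / y" if "1 < p" "a > 0" "b > 0" "q > 0" "r > 0" "\<alpha> * q + \<beta> * r = psum p a b q r" for q r
      using gap[OF that(4,5)] that by fastforce
    assume p2: "p \<le> 2" and s1: "a + b \<ge> 1"
    \<comment> \<open>Tangent line at 1 of S \<mapsto> S^r with S = w^p and r = (p - 2) / p; p \<le>
      2 makes r nonpositive.\<close>
    have k: "1 + (p - 2) / p * (w powr p - 1) \<le> w powr (p - 2)" if "w > 0" for w
      using bernoulli_powr_neg[of "(p - 2) / p" "w powr p"] p p2 that by (simp add: powr_powr divide_nonpos_pos)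
    have e: "M * (\<alpha> / x + \<beta> / y) = a * s powr (p - 2) + b * t powr (p - 2)"
    proof -
      have "w powr (p - 1) / w = w powr (p - 2)" if "w > 0" for w
      proof -
        have "w powr (p - 1) = w powr (p - 2) * w" using that powr_add[of w "p - 2" 1] by simp
        then show ?thesis using that by (simp add: field_simps)
      qed
      then have "\<alpha> / s = a * s powr (p - 2)" "\<beta> / t = b * t powr (p - 2)"
        using st by (simp_all add: \<alpha>_def \<beta>_def times_divide_eq_right[symmetric] del: times_divide_eq_right)
      moreover have "M * (\<alpha> / x + \<beta> / y) = \<alpha> / s + \<beta> / t" using x y M by (simp add: s_def t_def field_simps)
      ultimately show ?thesis by simp
    qed
    \<comment> \<open>This is the weighted sum of the two tangent lines; it equals 1 exactly when a
      + b = 1.\<close>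
    have "1 \<le> (a + b) * (2 / p) - (2 - p) / p"
    proof -
      have "1 * (2 / p) \<le> (a + b) * (2 / p)" using s1 p by (intro mult_right_mono) auto
      moreover have "2 / p - (2 - p) / p = 1" using p by (simp add: diff_divide_distrib[symmetric])
      ultimately show ?thesis by linarith
    qed
    also have "\<dots> = a * (1 + (p - 2) / p * (s powr p - 1)) + b * (1 + (p - 2) / p * (t powr p - 1))"
    proof -
      have "a * (1 + (p - 2) / p * (s powr p - 1)) + b * (1 + (p - 2) / p * (t powr p - 1)) =
        (a + b) * (1 - (p - 2) / p) + (p - 2) / p * (a * s powr p + b * t powr p)"
      proof -
        have "a * (1 + c * (S - 1)) + b * (1 + c * (T - 1)) = (a + b) * (1 - c) + c * (a * S + b * T)" for c S T :: real
          by (simp add: algebra_simps)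
        then show ?thesis .
      qed
      then show ?thesis unfolding one using p by (simp add: field_simps)
    qed
    also have "\<dots> \<le> a * s powr (p - 2) + b * t powr (p - 2)"
      using ab st by (intro add_mono mult_left_mono k) auto
    finally show "psum p a b x y * (\<alpha> / x + \<beta> / y) \<ge> 1" unfolding M_def[symmetric] e .
  qed
qed

lemma gr_hess_lincomb:
  fixes f g :: "'a::euclidean_space \<Rightarrow> real"
  assumes U: "open U" "smooth_on U f" "smooth_on U g" "x \<in> U"
  shows "gr (\<lambda>x. a * f x + b * g x) x = a *\<^sub>R gr f x + b *\<^sub>R gr g x"
    and "hess (\<lambda>x. a * f x + b * g x) x e = a *\<^sub>R hess f x e + b *\<^sub>R hess g x e"
proof -
  let ?k = "\<lambda>x. a * f x + b * g x"
  have g: "gr ?k y = a *\<^sub>R gr f y + b *\<^sub>R gr g y" if y: "y \<in> U" for y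
  proof (rule gr_eqI)
    show "(?k has_derivative (\<lambda>v. (a *\<^sub>R gr f y + b *\<^sub>R gr g y) \<bullet> v)) (at y)"
      using has_derivative_add[OF has_derivative_mult_right[OF smooth_has_derivative_gr[OF U(2) y], of a]
          has_derivative_mult_right[OF smooth_has_derivative_gr[OF U(3) y], of b]] by (simp add: inner_add_left)
  qed
  show "gr ?k x = a *\<^sub>R gr f x + b *\<^sub>R gr g x" by (rule g[OF U(4)])
  have sk: "smooth_on U ?k" by (intro smooth_on_add smooth_on_mult smooth_on_const U)
  have "((\<lambda>y. a *\<^sub>R gr f y + b *\<^sub>R gr g y) has_derivative (\<lambda>e. a *\<^sub>R hess f x e + b *\<^sub>R hess g x e)) (at x)"
    by (intro has_derivative_add has_derivative_scaleR_right smooth_has_derivative_hess[OF U(1)] U(2-4))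
  then have "(gr ?k has_derivative (\<lambda>e. a *\<^sub>R hess f x e + b *\<^sub>R hess g x e)) (at x)"
    by (rule has_derivative_transform_within_open[OF _ U(1,4)]) (use g in simp)
  from fun_cong[OF has_derivative_unique[OF smooth_has_derivative_hess[OF U(1) sk U(4)] this], of e]
  show "hess ?k x e = a *\<^sub>R hess f x e + b *\<^sub>R hess g x e" .
qed

text \<open>f - g has a minimum at x: its gradient vanishes, and the Taylor expansion bounds its
  Hessian from below by an arbitrarily small negative amount.\<close>

lemma second_order_touch:
  fixes f g :: "'a::euclidean_space \<Rightarrow> real"
  assumes U: "open U" "smooth_on U f" "smooth_on U g" "x \<in> U" and eq: "g x = f x" and le: "\<And>y. y \<in> U \<Longrightarrow> g y \<le> f y"
  shows "gr f x = gr g x" "hess g x e \<bullet> e \<le> hess f x e \<bullet> e"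
proof -
  let ?k = "\<lambda>x. 1 * f x + (-1) * g x"
  note lc = gr_hess_lincomb[OF U, of 1 "-1"]
  have sk: "smooth_on U ?k" by (intro smooth_on_add smooth_on_mult smooth_on_const U)
  have k: "0 \<le> ?k y" if "y \<in> U" for y using le[OF that] by simp
  have "(\<lambda>v. gr ?k x \<bullet> v) = (\<lambda>v. 0)"
    by (rule differential_zero_maxmin[OF U(4,1) smooth_has_derivative_gr[OF sk U(4)]]) (use k eq in simp)
  from fun_cong[OF this, of "gr ?k x"] have g: "gr ?k x = 0" by simp
  then show "gr f x = gr g x" unfolding lc(1) by simp
  interpret linear "hess ?k x" by (rule linear_hess[OF U(1) sk U(4)])
  let ?H = "hess ?k x e \<bullet> e"
  have "- ?H \<le> 2 * (norm e)^2 * \<epsilon>" if \<epsilon>: "\<epsilon> > 0" for \<epsilon>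
  proof -
    obtain d where d: "d > 0" "\<And>w. norm w < d \<Longrightarrow> x + w \<in> U \<and> \<bar>?k (x + w) - ?k x - gr ?k x \<bullet> w - (hess ?k x w \<bullet> w) / 2\<bar> \<le> \<epsilon> * (norm w)^2"
      using taylor2[OF U(1) sk U(4) \<epsilon>] by blast
    define s where "s = d / (1 + norm e)"
    have n: "1 + norm e > 0" by (simp add: add_pos_nonneg)
    have s: "s > 0" using d(1) n by (simp add: s_def)
    have "norm (s *\<^sub>R e) < s * (1 + norm e)" using s by simp
    also have "\<dots> = d" using n by (simp add: s_def)
    finally have w: "norm (s *\<^sub>R e) < d" .
    have "- ((hess ?k x (s *\<^sub>R e) \<bullet> (s *\<^sub>R e)) / 2) \<le> \<epsilon> * (norm (s *\<^sub>R e))^2"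
      using d(2)[OF w] k[of "x + s *\<^sub>R e"] eq g by (simp add: abs_le_iff)
    then have "s^2 * (- ?H) \<le> s^2 * (2 * (norm e)^2 * \<epsilon>)"
      unfolding scale by (simp add: power2_eq_square algebra_simps)
    then show ?thesis using s by (simp only: mult_le_cancel_left_pos[OF zero_less_power])
  qed
  then have small: "- ?H \<le> 2 * (norm e)^2 * \<epsilon>" if "\<epsilon> > 0" for \<epsilon> using that by blast
  have "((\<lambda>\<epsilon>. 2 * (norm e)^2 * \<epsilon>) \<longlongrightarrow> 2 * (norm e)^2 * 0) (at_right 0)" by (intro tendsto_intros)
  then have "- ?H \<le> 2 * (norm e)^2 * 0"
    by (rule tendsto_lowerbound) (use small in \<open>auto simp: eventually_at_filter\<close>)
  then have "0 \<le> ?H" by simp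
  then show "hess g x e \<bullet> e \<le> hess f x e \<bullet> e" unfolding lc(2) by (simp add: inner_diff_left)
qed

text \<open>The hyperbolic distance of two points is at least the distance of the horospheres through them.\<close>

lemma mink_le_horo:
  assumes X: "X \<in> hyp" and Y: "Y \<in> hyp" and z: "norm z = 1" and x: "x = - mink X (z, 1)" and y: "y = - mink Y (z, 1)"
  shows "2 * mink X Y \<le> - (x / y + y / x)"
proof -
  have p: "x > 0" "y > 0" unfolding x y using hyp_mink_null_pos X Y z by blast+
  \<comment> \<open>This difference is orthogonal to the null vector (z, 1), hence not timelike;
    expanding its square gives the estimate.\<close>
  let ?v = "(1 / x) *\<^sub>R X - (1 / y) *\<^sub>R Y"
  have "mink ?v (z, 1) = 0" using p x y by (simp add: mink_simps field_simps)
  then have s: "snd ?v = fst ?v \<bullet> z" by (simp add: mink_def)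
  have "(fst ?v \<bullet> z)^2 \<le> (fst ?v \<bullet> fst ?v) * (z \<bullet> z)" by (rule Cauchy_Schwarz_ineq)
  then have "mink ?v ?v \<ge> 0" using z unfolding mink_def[of ?v ?v] s by (simp add: dot_square_norm power2_eq_square)
  moreover have "mink ?v ?v = - 1 / (x * x) - 1 / (y * y) - 2 * mink X Y / (x * y)"
    using X Y mink_commute[of Y X]
    by (simp add: mink_simps hyp_def add_divide_distrib diff_divide_distrib mult.commute)
  ultimately have "(- 1 / (x * x) - 1 / (y * y) - 2 * mink X Y / (x * y)) * (x * y) \<ge> 0" using p by simp
  moreover have "(- 1 / (x * x) - 1 / (y * y) - 2 * mink X Y / (x * y)) * (x * y) = - (y / x) - x / y - 2 * mink X Y"
    using p by (simp add: left_diff_distrib)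
  ultimately show ?thesis by linarith
qed

text \<open>At z the combination g = \<alpha> h1 + \<beta> h2 touches the p-sum from below, so
  gradients agree and Hessians are ordered. The point X' = \<alpha> X + \<beta> Y has square at most
  -1; subtracting a nonnegative multiple of (z, 1) puts it on the hyperboloid and only shrinks its
  ball, the tangency at z being kept. Strict contact and the Hessian bound then pass from h1 and h2
  through g to the p-sum.\<close>

lemma h_body_psum:
  fixes h1 h2 :: "'n::finite euclid1 \<Rightarrow> real"
  assumes h1: "h_body h1" and h2: "h_body h2" and p: "1 \<le> p" "p \<le> 2" and ab: "a \<ge> 0" "b \<ge> 0" "a + b \<ge> 1"
  shows "h_body (\<lambda>v. psum p a b (h1 v) (h2 v))"
proof -
  interpret A: h_body h1 by (rule h1)
  interpret B: h_body h2 by (rule h2)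
  let ?h = "\<lambda>v. psum p a b (h1 v) (h2 v)"
  have ab0: "a + b > 0" using ab by simp
  have pp: "a * h1 v powr p + b * h2 v powr p > 0" if "v \<noteq> 0" for v
    using psum_pos[OF ab(1,2) ab0] A.h_pos B.h_pos that by blast
  have hp: "?h v > 0" if "v \<noteq> 0" for v using pp[OF that] by (simp add: psum_def)
  have sm: "smooth_on (- {0}) ?h"
    unfolding psum_def
    by (intro smooth_on_powr smooth_on_add smooth_on_mult smooth_on_const A.smooth B.smooth A.open_punctured)
      (use pp A.h_pos B.h_pos in auto)
  have key: "(\<forall>w. norm w = 1 \<longrightarrow> w \<noteq> z \<longrightarrow> - mink (xpt ?h z) (w, 1) < ?h w) \<and>
      (\<forall>e. e \<bullet> z = 0 \<longrightarrow> e \<noteq> 0 \<longrightarrow> hess ?h z e \<bullet> e > tpt ?h z * (e \<bullet> e))" if z: "norm z = 1" for z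
  proof -
    have z0: "z \<noteq> 0" using z by auto
    have zU: "z \<in> - {0}" using z0 by simp
    have zz: "z \<bullet> z = 1" using z by (simp add: dot_square_norm)
    let ?x = "h1 z" and ?y = "h2 z" and ?m = "?h z"
    let ?X = "xpt h1 z" and ?Y = "xpt h2 z"
    have xy: "?x > 0" "?y > 0" "?m > 0" using A.pos[OF z] B.pos[OF z] hp[OF z0] by auto
    obtain \<alpha> \<beta> where al: "\<alpha> \<ge> 0" "\<beta> \<ge> 0" "\<alpha> + \<beta> > 0" "\<alpha> * ?x + \<beta> * ?y = ?m"
      "\<And>q r. q > 0 \<Longrightarrow> r > 0 \<Longrightarrow> \<alpha> * q + \<beta> * r \<le> psum p a b q r"
      "p \<le> 2 \<Longrightarrow> a + b \<ge> 1 \<Longrightarrow> ?m * (\<alpha> / ?x + \<beta> / ?y) \<ge> 1"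
      by (rule psum_support[OF p(1) ab(1,2) ab0 xy(1,2)]) (rule that, assumption+)
    let ?g = "\<lambda>v. \<alpha> * h1 v + \<beta> * h2 v"
    have sg: "smooth_on (- {0}) ?g"
      by (intro smooth_on_add smooth_on_mult smooth_on_const A.smooth B.smooth A.open_punctured)
    have le: "?g v \<le> ?h v" if "v \<in> - {0}" for v using al(5) A.h_pos B.h_pos that by simp
    have so: "gr ?h z = gr ?g z" "hess ?g z e \<bullet> e \<le> hess ?h z e \<bullet> e" for e
      by (rule second_order_touch[OF A.open_punctured sm sg zU al(4)], rule le, assumption)+
    note lc = gr_hess_lincomb[OF A.open_punctured A.smooth B.smooth zU]
    define X' where "X' = \<alpha> *\<^sub>R ?X + \<beta> *\<^sub>R ?Y"
    have ht: "- mink X' (w, 1) = \<alpha> * (- mink ?X (w, 1)) + \<beta> * (- mink ?Y (w, 1))" for w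
      by (simp add: X'_def mink_simps)
    have htz: "- mink X' (z, 1) = ?m" unfolding ht A.mink_xpt_null[OF z] B.mink_xpt_null[OF z] using al(4) by simp
    \<comment> \<open>The shift for which X' - \<eta> (z, 1) has square -1: (z, 1) is null and pairs
      with X' to minus the p-sum at z.\<close>
    define \<eta> where "\<eta> = (- 1 - mink X' X') / (2 * ?m)"
    have "mink X' X' \<le> -1"
    proof -
      have m: "2 * mink ?X ?Y \<le> - (?x / ?y + ?y / ?x)"
        by (rule mink_le_horo[OF A.xpt_hyp[OF z] B.xpt_hyp[OF z] z]) (simp_all add: A.mink_xpt_null[OF z] B.mink_xpt_null[OF z])
      have "mink X' X' = - (\<alpha> * \<alpha>) - \<beta> * \<beta> + \<alpha> * \<beta> * (2 * mink ?X ?Y)"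
        using A.xpt_hyp[OF z] B.xpt_hyp[OF z] mink_commute[of ?Y ?X]
        by (simp add: X'_def mink_simps hyp_def algebra_simps)
      also have "\<dots> \<le> - (\<alpha> * \<alpha>) - \<beta> * \<beta> + \<alpha> * \<beta> * (- (?x / ?y + ?y / ?x))"
        using m al(1,2) by (intro add_left_mono mult_left_mono) auto
      \<comment> \<open>With the horosphere estimate in place of the mixed term, the quadratic form
        factors into the product bounded in \<open>psum_support\<close>.\<close>
      also have "\<dots> = - ((\<alpha> * ?x + \<beta> * ?y) * (\<alpha> / ?x + \<beta> / ?y))" using xy by (simp add: field_simps)
      also have "\<dots> \<le> -1" unfolding al(4) using al(6) p ab by simp
      finally show ?thesis .
    qed
    then have eta: "\<eta> \<ge> 0" and eta2: "2 * \<eta> * ?m = - 1 - mink X' X'" using xy by (simp_all add: \<eta>_def)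
    have grh: "gr ?h z = snd X' *\<^sub>R z - fst X'"
    proof -
      have g: "gr h1 z = snd ?X *\<^sub>R z - fst ?X" "gr h2 z = snd ?Y *\<^sub>R z - fst ?Y" by (simp_all add: xpt_def)
      show ?thesis unfolding so(1) lc(1) g by (simp add: X'_def scaleR_add_left scaleR_diff_right)
    qed
    have tz: "snd X' - fst X' \<bullet> z = ?m" using htz by (simp add: mink_def)
    have "gr ?h z \<bullet> gr ?h z + 1 = 2 * ?m * (snd X' - \<eta>)"
    proof -
      have "gr ?h z \<bullet> gr ?h z + 1 = 2 * snd X' * (snd X' - fst X' \<bullet> z) + mink X' X' + 1"
        unfolding grh mink_def by (simp add: inner_simps zz inner_commute[of z "fst X'"] algebra_simps)
      then show ?thesis unfolding tz using eta2 by (simp add: algebra_simps)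
    qed
    then have tp: "tpt ?h z = snd X' - \<eta>" using xy by (simp add: tpt_def)
    have xp: "xpt ?h z = X' - \<eta> *\<^sub>R (z, 1)"
      by (rule prod_eqI) (simp_all add: xpt_def tp grh scaleR_diff_left)
    have mixed: "\<alpha> * x + \<beta> * y < \<alpha> * x' + \<beta> * y'" if "x < x'" "y < y'" for x y x' y' :: real
    proof (cases "\<alpha> = 0")
      case True
      then show ?thesis using that al(3) by simp
    next
      case False
      then show ?thesis using that al(1,2) by (intro add_less_le_mono mult_strict_left_mono mult_left_mono) auto
    qed
    have "- mink (xpt ?h z) (w, 1) < ?h w" if w: "norm w = 1" "w \<noteq> z" for w
    proof -
      have w0: "w \<noteq> 0" using w(1) by auto
      have "z \<bullet> w \<le> 1" using norm_cauchy_schwarz[of z w] z w(1) by simp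
      then have n: "\<eta> * mink (z, 1) (w, 1) \<le> 0" using eta by (simp add: mink_def mult_nonneg_nonpos)
      have "- mink (xpt ?h z) (w, 1) = - mink X' (w, 1) + \<eta> * mink (z, 1) (w, 1)"
        unfolding xp by (simp add: mink_simps del: scaleR_Pair)
      also have "\<dots> \<le> - mink X' (w, 1)" using n by simp
      also have "\<dots> < ?g w" unfolding ht by (rule mixed[OF A.touch_less[OF z w] B.touch_less[OF z w]])
      also have "\<dots> \<le> ?h w" by (rule le) (use w0 in simp)
      finally show ?thesis .
    qed
    moreover have "hess ?h z e \<bullet> e > tpt ?h z * (e \<bullet> e)" if e: "e \<bullet> z = 0" "e \<noteq> 0" for e
    proof -
      have s: "hess h1 z e \<bullet> e > tpt h1 z * (e \<bullet> e)" "hess h2 z e \<bullet> e > tpt h2 z * (e \<bullet> e)"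
        using A.strict[OF z e] B.strict[OF z e] by blast+
      have sX: "snd X' = \<alpha> * tpt h1 z + \<beta> * tpt h2 z" by (simp add: X'_def xpt_def)
      have "tpt ?h z * (e \<bullet> e) \<le> snd X' * (e \<bullet> e)" unfolding tp using eta by (intro mult_right_mono) auto
      also have "\<dots> = \<alpha> * (tpt h1 z * (e \<bullet> e)) + \<beta> * (tpt h2 z * (e \<bullet> e))" unfolding sX by (simp add: algebra_simps)
      also have "\<dots> < \<alpha> * (hess h1 z e \<bullet> e) + \<beta> * (hess h2 z e \<bullet> e)"
        by (rule mixed[OF s])
      also have "\<dots> = hess ?g z e \<bullet> e" unfolding lc(2) by (simp add: inner_add_left)
      also have "\<dots> \<le> hess ?h z e \<bullet> e" by (rule so(2))
      finally show ?thesis .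
    qed
    ultimately show ?thesis by blast
  qed
  show ?thesis
  proof
    show "smooth_on (- {0}) ?h" by (rule sm)
    show "?h (c *\<^sub>R v) = c * ?h v" if "c > 0" "v \<noteq> 0" for c v
      using psum_scale[OF p(1) ab(1,2) that(1) A.h_pos[OF that(2)] B.h_pos[OF that(2)]] A.homog[OF that] B.homog[OF that] by simp
    show "?h z > 0" if "norm z = 1" for z by (rule hp) (use that in auto)
  qed (use key in blast)+
qed

section \<open>Volumes of combinations of the associated bodies\<close>

lemma measure_lborel_scale:
  fixes S :: "'a::euclidean_space set"
  assumes c: "c > 0" and S: "S \<in> sets borel"
  shows "(\<lambda>x. c *\<^sub>R x) ` S \<in> sets borel" "measure lborel ((\<lambda>x. c *\<^sub>R x) ` S) = c ^ DIM('a) * measure lborel S"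
proof -
  have eq: "(\<lambda>x. c *\<^sub>R x) ` S = (\<lambda>x. (1 / c) *\<^sub>R x) -` S"
  proof (intro set_eqI iffI)
    fix y assume "y \<in> (\<lambda>x. (1 / c) *\<^sub>R x) -` S"
    then show "y \<in> (\<lambda>x. c *\<^sub>R x) ` S" using c by (intro image_eqI[of _ _ "(1 / c) *\<^sub>R y"]) auto
  qed (use c in auto)
  have m: "(\<lambda>x::'a. d *\<^sub>R x) \<in> borel_measurable borel" for d
    by (intro borel_measurable_continuous_onI continuous_intros)
  show B: "(\<lambda>x. c *\<^sub>R x) ` S \<in> sets borel" unfolding eq using measurable_sets[OF m S] by simp
  have "emeasure lborel ((\<lambda>x. c *\<^sub>R x) ` S) =
      emeasure (density (distr lborel borel (\<lambda>x. 0 + c *\<^sub>R x)) (\<lambda>_. ennreal (\<bar>c\<bar> ^ DIM('a)))) ((\<lambda>x. c *\<^sub>R x) ` S)"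
    by (rule arg_cong[OF lborel_affine, of c "\<lambda>M. emeasure M ((\<lambda>x. c *\<^sub>R x) ` S)"]) (use c in simp)
  also have "\<dots> = ennreal (c ^ DIM('a)) * emeasure (distr lborel borel (\<lambda>x. c *\<^sub>R x)) ((\<lambda>x. c *\<^sub>R x) ` S)"
    using c B by (simp add: emeasure_density_const)
  also have "emeasure (distr lborel borel (\<lambda>x. c *\<^sub>R x)) ((\<lambda>x. c *\<^sub>R x) ` S) = emeasure lborel ((\<lambda>x. c *\<^sub>R x) -` ((\<lambda>x. c *\<^sub>R x) ` S))"
    using B m[of c] by (subst emeasure_distr) simp_all
  also have "(\<lambda>x. c *\<^sub>R x) -` ((\<lambda>x. c *\<^sub>R x) ` S) = S" using c by auto
  finally show "measure lborel ((\<lambda>x. c *\<^sub>R x) ` S) = c ^ DIM('a) * measure lborel S"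
    using c by (simp add: measure_def enn2real_mult)
qed

lemma measure_open_pos:
  fixes S :: "'a::euclidean_space set"
  assumes S: "open S" "S \<noteq> {}" and sub: "S \<subseteq> T" and T: "T \<in> fmeasurable lborel"
  shows "measure lborel T > 0"
proof -
  obtain x where "x \<in> S" using S(2) by blast
  then obtain a b where ab: "x \<in> box a b" "cbox a b \<subseteq> S" using open_contains_cbox[OF S(1)] by blast
  have "box a b \<noteq> {}" using ab(1) by blast
  then have "0 < measure lborel (cbox a b)" by (intro content_pos_lt) (simp add: box_ne_empty)
  also have "\<dots> \<le> measure lborel T" using ab(2) sub by (intro measure_mono_fmeasurable[OF _ _ T]) auto
  finally show ?thesis .
qed

text \<open>A zero coefficient is treated separately because a set scaled by 0 has empty interior;
  in that case C contains a scaled copy of the other body.\<close>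

lemma brunn_minkowski_combination:
  fixes A B C :: "'a::euclidean_space set"
  assumes A: "compact A" "convex A" "interior A \<noteq> {}" and B: "compact B" "convex B" "interior B \<noteq> {}"
    and C: "C \<in> fmeasurable lborel" "\<And>x y. x \<in> A \<Longrightarrow> y \<in> B \<Longrightarrow> \<alpha> *\<^sub>R x + \<beta> *\<^sub>R y \<in> C"
    and ab: "\<alpha> \<ge> 0" "\<beta> \<ge> 0" "\<alpha> + \<beta> > 0"
  shows "\<alpha> * measure lborel A powr (1 / DIM('a)) + \<beta> * measure lborel B powr (1 / DIM('a)) \<le> measure lborel C powr (1 / DIM('a))"
proof -
  let ?d = "real DIM('a)"
  let ?s = "\<lambda>c. (\<lambda>x::'a. c *\<^sub>R x)"
  have d: "?d > 0" by simp
  have root: "(c ^ DIM('a) * m) powr (1 / ?d) = c * m powr (1 / ?d)" if "c > 0" "m \<ge> 0" for c m :: real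
    using that d by (simp add: powr_mult powr_realpow[symmetric] powr_powr)
  have scale: "measure lborel (?s c ` S) powr (1 / ?d) = c * measure lborel S powr (1 / ?d)"
    if "c > 0" "compact S" for c and S :: "'a set"
    using measure_lborel_scale(2)[OF that(1), of S] compact_imp_closed[OF that(2)] root[OF that(1)] by simp
  have mono: "measure lborel S powr (1 / ?d) \<le> measure lborel C powr (1 / ?d)" if "S \<subseteq> C" "compact S" for S
    by (intro powr_mono2 measure_mono_fmeasurable[OF that(1) _ C(1)]) (use compact_imp_closed[OF that(2)] in auto)
  have cs: "compact (?s c ` S)" if "compact S" for c S by (rule compact_scaling[OF that])
  have ints: "interior (?s c ` S) \<noteq> {}" if "c > 0" "interior S \<noteq> {}" for c S
  proof -
    have "?s c ` interior S \<subseteq> interior (?s c ` S)"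
      by (rule interior_maximal) (use that(1) interior_subset in \<open>auto intro: open_scaling\<close>)
    then show ?thesis using that(2) by (metis image_is_empty subset_empty)
  qed
  have ne: "A \<noteq> {}" "B \<noteq> {}" using A(3) B(3) interior_subset by blast+
  consider "\<alpha> = 0" "\<beta> > 0" | "\<alpha> > 0" "\<beta> = 0" | "\<alpha> > 0" "\<beta> > 0" using ab by fastforce
  then show ?thesis
  proof cases
    case 1
    obtain x where "x \<in> A" using ne(1) by blast
    then have "\<beta> *\<^sub>R y \<in> C" if "y \<in> B" for y using C(2)[of x y] that 1(1) by simp
    then have "?s \<beta> ` B \<subseteq> C" by blast
    from mono[OF this cs[OF B(1)]] show ?thesis using scale[OF 1(2) B(1)] 1(1) by simp
  next
    case 2
    obtain y where "y \<in> B" using ne(2) by blast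
    then have "\<alpha> *\<^sub>R x \<in> C" if "x \<in> A" for x using C(2)[of x y] that 2(2) by simp
    then have "?s \<alpha> ` A \<subseteq> C" by blast
    from mono[OF this cs[OF A(1)]] show ?thesis using scale[OF 2(1) A(1)] 2(2) by simp
  next
    case 3
    let ?l = "\<alpha> * measure lborel A powr (1 / ?d) + \<beta> * measure lborel B powr (1 / ?d)"
    have "(measure lborel (?s \<alpha> ` A) powr (1 / ?d) + measure lborel (?s \<beta> ` B) powr (1 / ?d)) powr ?d \<le> measure lborel C"
      by (rule brunn_minkowski_convex[OF cs[OF A(1)] convex_scaling[OF A(2)] ints[OF 3(1) A(3)] cs[OF B(1)] convex_scaling[OF B(2)] ints[OF 3(2) B(3)] C(1)])
        (use C(2) in blast)
    then have "?l powr ?d \<le> measure lborel C" unfolding scale[OF 3(1) A(1)] scale[OF 3(2) B(1)] .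
    then have "(?l powr ?d) powr (1 / ?d) \<le> measure lborel C powr (1 / ?d)" by (intro powr_mono2) auto
    moreover have "(?l powr ?d) powr (1 / ?d) = ?l" using 3 d by (simp add: powr_powr)
    ultimately show ?thesis by simp
  qed
qed

text \<open>Volume radius of the body, a quantity homogeneous of degree 1 in h, so that p-sums of
  functions and of volumes can be compared directly.\<close>

definition kap :: "('n::finite euclid1 \<Rightarrow> real) \<Rightarrow> real" where
  "kap h = measure lborel (h_body.Khat h) powr (1 / DIM('n euclid1))"

lemma kap_pos:
  assumes "h_body h"
  shows "kap h > 0"
proof -
  interpret h_body h by (rule assms)
  have "measure lborel Khat > 0"
    by (rule measure_open_pos[OF open_interior Khat_interior interior_subset fmeasurable_compact[OF compact_Khat]])
  then show ?thesis by (simp add: kap_def)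
qed

lemma V_powr:
  assumes "h_body (h :: 'n::finite euclid1 \<Rightarrow> real)"
  shows "V (hdom h) powr (p / (real CARD('n) + 1)) = kap h powr p"
  by (simp add: h_body.V_hdom[OF assms] kap_def powr_powr add.commute)

lemma kap_scale:
  fixes h h' :: "'n::finite euclid1 \<Rightarrow> real"
  assumes h: "h_body h" and h': "h_body h'" and c: "c > 0" and eq: "\<And>z. norm z = 1 \<Longrightarrow> h' z = c * h z"
  shows "kap h' = c * kap h"
proof -
  interpret h_body h by (rule h)
  have "h_body.Khat h' = (\<lambda>x. c *\<^sub>R x) ` Khat"
  proof (intro set_eqI iffI)
    fix v assume "v \<in> h_body.Khat h'"
    then have "v \<bullet> z \<le> c * h z" if "norm z = 1" for z
      using eq[OF that] that unfolding h_body.Khat_def[OF h'] by auto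
    then have "(1 / c) *\<^sub>R v \<in> Khat" using c by (simp add: Khat_def field_simps)
    then show "v \<in> (\<lambda>x. c *\<^sub>R x) ` Khat" using c by (intro image_eqI[of _ _ "(1 / c) *\<^sub>R v"]) auto
  next
    fix v assume "v \<in> (\<lambda>x. c *\<^sub>R x) ` Khat"
    then obtain x where x: "x \<in> Khat" "v = c *\<^sub>R x" by (elim imageE)
    then show "v \<in> h_body.Khat h'" unfolding h_body.Khat_def[OF h'] using c eq by (simp add: Khat_def)
  qed
  then have m: "measure lborel (h_body.Khat h') = c ^ DIM('n euclid1) * measure lborel Khat"
    using measure_lborel_scale(2)[OF c, of Khat] closed_Khat by simp
  have "(c ^ DIM('n euclid1) * measure lborel Khat) powr (1 / DIM('n euclid1)) = c * measure lborel Khat powr (1 / DIM('n euclid1))"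
    using c by (simp add: powr_mult powr_realpow[symmetric] powr_powr del: DIM_prod)
  then show ?thesis unfolding kap_def m .
qed

context
  fixes h1 h2 :: "'n::finite euclid1 \<Rightarrow> real" and p a b :: real
  assumes h1: "h_body h1" and h2: "h_body h2" and p: "1 \<le> p" "p \<le> 2" and ab: "a \<ge> 0" "b \<ge> 0" "a + b \<ge> 1"
begin

abbreviation "hs \<equiv> \<lambda>v. psum p a b (h1 v) (h2 v)"

lemma hs: "h_body hs"
  by (rule h_body_psum[OF h1 h2 p ab])

text \<open>Firey's reduction of the \<open>p\<close>-sum inequality to the Brunn-Minkowski inequality: the \<open>p\<close>-sum
  contains the linear combination that is optimal for the two volume radii.\<close>

lemma kap_psum:
  shows "psum p a b (kap h1) (kap h2) \<le> kap hs"
    and "1 < p \<Longrightarrow> a > 0 \<Longrightarrow> b > 0 \<Longrightarrow> kap hs = psum p a b (kap h1) (kap h2) \<Longrightarrow> norm z = 1 \<Longrightarrow>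
      h1 z = kap h1 / kap h2 * h2 z"
proof -
  interpret A: h_body h1 by (rule h1)
  interpret B: h_body h2 by (rule h2)
  interpret C: h_body hs by (rule hs)
  have ab0: "a + b > 0" using ab by simp
  obtain \<alpha> \<beta> where al: "\<alpha> \<ge> 0" "\<beta> \<ge> 0" "\<alpha> + \<beta> > 0" "\<alpha> * kap h1 + \<beta> * kap h2 = psum p a b (kap h1) (kap h2)"
      "\<And>q r. q > 0 \<Longrightarrow> r > 0 \<Longrightarrow> \<alpha> * q + \<beta> * r \<le> psum p a b q r"
    "\<And>q r. 1 < p \<Longrightarrow> a > 0 \<Longrightarrow> b > 0 \<Longrightarrow> q > 0 \<Longrightarrow> r > 0 \<Longrightarrow> \<alpha> * q + \<beta> * r = psum p a b q r \<Longrightarrow> q / kap h1 = r / kap h2"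
    by (rule psum_support[OF p(1) ab(1,2) ab0 kap_pos[OF h1] kap_pos[OF h2]]) (rule that, assumption+)
  have le: "(\<alpha> *\<^sub>R x + \<beta> *\<^sub>R y) \<bullet> z \<le> \<alpha> * h1 z + \<beta> * h2 z" if "x \<in> A.Khat" "y \<in> B.Khat" "norm z = 1" for x y z
    using that al(1,2) unfolding A.Khat_def B.Khat_def by (simp add: inner_add_left) (intro add_mono mult_left_mono, auto)
  have hz: "\<alpha> * h1 z + \<beta> * h2 z \<le> hs z" if "norm z = 1" for z
    by (rule al(5)[OF A.pos[OF that] B.pos[OF that]])
  have sub: "\<alpha> *\<^sub>R x + \<beta> *\<^sub>R y \<in> C.Khat" if "x \<in> A.Khat" "y \<in> B.Khat" for x y
    unfolding C.Khat_def using le[OF that] hz by fastforce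
  have bm: "psum p a b (kap h1) (kap h2) \<le> measure lborel S powr (1 / DIM('n euclid1))"
    if "S \<in> fmeasurable lborel" "\<And>x y. x \<in> A.Khat \<Longrightarrow> y \<in> B.Khat \<Longrightarrow> \<alpha> *\<^sub>R x + \<beta> *\<^sub>R y \<in> S" for S
    unfolding al(4)[symmetric] unfolding kap_def
    by (rule brunn_minkowski_combination[OF A.compact_Khat A.convex_Khat A.Khat_interior B.compact_Khat B.convex_Khat B.Khat_interior that(1) _ al(1-3)])
      (rule that(2), assumption+)
  have fm: "C.Khat \<in> fmeasurable lborel" by (rule fmeasurable_compact[OF C.compact_Khat])
  show "psum p a b (kap h1) (kap h2) \<le> kap hs" unfolding kap_def[of hs] by (rule bm[OF fm sub])
  assume pp: "1 < p" "a > 0" "b > 0" and eq: "kap hs = psum p a b (kap h1) (kap h2)" and z: "norm z = 1"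
  \<comment> \<open>If the combination were smaller at z, the half-space v . z \<le> c0 would cut a
    cap of positive volume off the p-sum without losing any point \<alpha> x + \<beta> y, and
    Brunn-Minkowski for the remaining set would contradict the equality.\<close>
  have "\<alpha> * h1 z + \<beta> * h2 z = hs z"
  proof (rule ccontr)
    assume "\<not> \<alpha> * h1 z + \<beta> * h2 z = hs z"
    then have lt: "\<alpha> * h1 z + \<beta> * h2 z < hs z" using hz[OF z] by simp
    define c0 where "c0 = \<alpha> * h1 z + \<beta> * h2 z"
    define S where "S = C.Khat \<inter> {v. v \<bullet> z \<le> c0}"
    define H where "H = interior C.Khat \<inter> {v. c0 < v \<bullet> z}"
    have S: "compact S" unfolding S_def by (intro compact_Int_closed C.compact_Khat closed_Collect_le continuous_intros)
    have oH: "open H" unfolding H_def by (intro open_Int open_interior open_Collect_less continuous_intros)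
    have "gr hs z \<in> C.Khat" unfolding C.Khat_def using C.gr_inner_le(1)[OF z] by simp
    then have "gr hs z \<in> closure (interior C.Khat)"
      using convex_closure_interior[OF C.convex_Khat C.Khat_interior] closure_subset by blast
    moreover have "gr hs z \<in> {v. c0 < v \<bullet> z}" using lt C.euler[OF C.z0[OF z]] by (simp add: c0_def)
    ultimately have "{v. c0 < v \<bullet> z} \<inter> closure (interior C.Khat) \<noteq> {}" by blast
    moreover have "open {v. c0 < v \<bullet> z}" by (intro open_Collect_less continuous_intros)
    ultimately have nH: "H \<noteq> {}" unfolding H_def using open_Int_closure_eq_empty by blast
    have HK: "H \<subseteq> C.Khat" unfolding H_def using interior_subset by blast
    have dj: "S \<inter> H = {}" unfolding S_def H_def by auto
    have fS: "S \<in> fmeasurable lborel" by (rule fmeasurable_compact[OF S])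
    have fH: "H \<in> fmeasurable lborel" by (rule fmeasurableI2[OF fm HK]) (use oH in simp)
    have "psum p a b (kap h1) (kap h2) \<le> measure lborel S powr (1 / DIM('n euclid1))"
      by (rule bm[OF fS]) (use sub le[OF _ _ z] in \<open>simp add: S_def c0_def\<close>)
    also have "\<dots> < measure lborel C.Khat powr (1 / DIM('n euclid1))"
    proof (rule powr_less_mono2)
      have "measure lborel S < measure lborel S + measure lborel H" using measure_open_pos[OF oH nH order_refl fH] by simp
      also have "\<dots> = measure lborel (S \<union> H)" using measure_Un2[OF fS fH] dj by (simp add: Diff_triv Int_commute)
      also have "\<dots> \<le> measure lborel C.Khat"
        by (rule measure_mono_fmeasurable[OF _ _ fm]) (use HK fmeasurableD[OF fS] fmeasurableD[OF fH] in \<open>auto simp: S_def\<close>)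
      finally show "measure lborel S < measure lborel C.Khat" .
    qed auto
    finally show False using eq by (simp add: kap_def)
  qed
  \<comment> \<open>The supporting linear function of \<open>psum\<close> at the volume radii
    touches also at (h1 z, h2 z), which must therefore lie on the same ray.\<close>
  from al(6)[OF pp A.pos[OF z] B.pos[OF z] this] have "h1 z / kap h1 = h2 z / kap h2" .
  then show "h1 z = kap h1 / kap h2 * h2 z" using kap_pos[OF h1] kap_pos[OF h2] by (simp add: field_simps)
qed

text \<open>The p-sum of proportional functions is a multiple of one of them, and \<open>kap\<close>
  scales by the same factor.\<close>

lemma kap_psum_dilate:
  assumes c: "c > 0" "\<And>z. norm z = 1 \<Longrightarrow> h1 z = c * h2 z"
  shows "kap hs = psum p a b (kap h1) (kap h2)"
proof -
  interpret B: h_body h2 by (rule h2)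
  have g: "psum p a b c 1 > 0" using psum_pos[OF ab(1,2) _ c(1), of 1 p] ab(3) by (simp add: psum_def)
  have sc: "psum p a b (c * t) t = psum p a b c 1 * t" if "t > 0" for t
    using psum_scale[OF p(1) ab(1,2) that c(1), of 1] by (simp add: mult.commute)
  have k1: "kap h1 = c * kap h2" by (rule kap_scale[OF h2 h1 c])
  have "kap hs = psum p a b c 1 * kap h2"
    by (rule kap_scale[OF h2 hs g]) (simp add: c(2) sc[OF B.pos])
  then show ?thesis unfolding k1 sc[OF kap_pos[OF h2]] .
qed

lemma hyp_psum_hdom: "hyp_psum p a (hdom h1) b (hdom h2) = hdom hs"
  unfolding hyp_psum_def
proof (rule h_body.domain_of_hsupport_eq_hdom[OF hs])
  fix z :: "'n euclid1" assume z: "norm z = 1"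
  show "1 / p * ln (a * exp (p * hsupport (hdom h1) z) + b * exp (p * hsupport (hdom h2) z)) = ln (hs z)"
    using h_body.pos[OF h1 z] h_body.pos[OF h2 z] psum_pos[OF ab(1,2) _ h_body.pos[OF h1 z] h_body.pos[OF h2 z], of p] ab(3)
    by (simp add: h_body.hsupport_hdom[OF h1 z] h_body.hsupport_hdom[OF h2 z] psum_def ln_powr powr_def[symmetric] powr_def)
qed

end

text \<open>To read off support functions from the dilate, c h2 must itself belong to a domain: it
  is the p-sum with exponent 1 and coefficients c and 0, for which the condition on the coefficients
  is exactly c \<ge> 1.\<close>

lemma hyp_dilate_hdom:
  fixes h1 h2 :: "'n::finite euclid1 \<Rightarrow> real"
  assumes h1: "h_body h1" and h2: "h_body h2" and c: "c \<ge> 1"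
  shows "hdom h1 = hyp_dilate c (hdom h2) \<longleftrightarrow> (\<forall>z. norm z = 1 \<longrightarrow> h1 z = c * h2 z)"
proof
  have lnz: "hsupport (hdom h2) z + ln c = ln (c * h2 z)" if "norm z = 1" for z
    using h_body.pos[OF h2 that] c by (simp add: h_body.hsupport_hdom[OF h2 that] ln_mult)
  {
    assume "\<forall>z. norm z = 1 \<longrightarrow> h1 z = c * h2 z"
    then show "hdom h1 = hyp_dilate c (hdom h2)"
      unfolding hyp_dilate_def by (intro h_body.domain_of_hsupport_eq_hdom[OF h1, symmetric]) (simp add: lnz)
  }
  assume eq: "hdom h1 = hyp_dilate c (hdom h2)"
  let ?h = "\<lambda>v. psum 1 c 0 (h2 v) (h2 v)"
  have h: "h_body ?h" by (rule h_body_psum[OF h2 h2]) (use c in auto)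
  have hz: "?h z = c * h2 z" if "norm z = 1" for z
    using h_body.pos[OF h2 that] c by (simp add: psum_def)
  have "hyp_dilate c (hdom h2) = hdom ?h"
    unfolding hyp_dilate_def by (rule h_body.domain_of_hsupport_eq_hdom[OF h]) (simp add: lnz hz)
  then have "hsupport (hdom h1) z = hsupport (hdom ?h) z" for z using eq by simp
  then have "ln (h1 z) = ln (?h z)" if "norm z = 1" for z
    using h_body.hsupport_hdom[OF h1 that] h_body.hsupport_hdom[OF h that] by metis
  then show "\<forall>z. norm z = 1 \<longrightarrow> h1 z = c * h2 z"
    using h_body.pos[OF h1] h_body.pos[OF h] hz by (metis ln_inj_iff)
qed

lemma hyp_dilates_hdom:
  fixes h1 h2 :: "'n::finite euclid1 \<Rightarrow> real"
  assumes h1: "h_body h1" and h2: "h_body h2"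
  shows "hyp_dilates (hdom h1) (hdom h2) \<longleftrightarrow> (\<exists>c>0. \<forall>z. norm z = 1 \<longrightarrow> h1 z = c * h2 z)"
proof
  assume "hyp_dilates (hdom h1) (hdom h2)"
  then obtain c where c: "c \<ge> 1" "hdom h1 = hyp_dilate c (hdom h2) \<or> hdom h2 = hyp_dilate c (hdom h1)"
    unfolding hyp_dilates_def by blast
  from c(2) show "\<exists>c>0. \<forall>z. norm z = 1 \<longrightarrow> h1 z = c * h2 z"
  proof
    assume "hdom h1 = hyp_dilate c (hdom h2)"
    then show ?thesis using hyp_dilate_hdom[OF h1 h2 c(1)] c(1) by (intro exI[of _ c]) simp
  next
    assume "hdom h2 = hyp_dilate c (hdom h1)"
    then show ?thesis using hyp_dilate_hdom[OF h2 h1 c(1)] c(1) by (intro exI[of _ "1 / c"]) simp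
  qed
next
  assume "\<exists>c>0. \<forall>z. norm z = 1 \<longrightarrow> h1 z = c * h2 z"
  then obtain c where c: "c > 0" "\<forall>z. norm z = 1 \<longrightarrow> h1 z = c * h2 z" by blast
  show "hyp_dilates (hdom h1) (hdom h2)"
  proof (cases "c \<ge> 1")
    case True
    then show ?thesis using hyp_dilate_hdom[OF h1 h2 True] c(2) unfolding hyp_dilates_def by blast
  next
    case False
    \<comment> \<open>A ratio below 1 is a dilation in the opposite direction.\<close>
    have i: "1 / c \<ge> 1" using False c(1) by simp
    have "\<forall>z. norm z = 1 \<longrightarrow> h2 z = (1 / c) * h1 z" using c by simp
    then show ?thesis using hyp_dilate_hdom[OF h2 h1 i] i unfolding hyp_dilates_def by blast
  qed
qed

theorem theorem12p4:
  fixes K L \<Omega> :: "'n::finite minkowski set" and p a b q :: real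
  assumes "1 \<le> p" "p \<le> 2" "a \<ge> 0" "b \<ge> 0" "a + b \<ge> 1"
    and "smooth_bounded_domain K" "uniformly_h_convex K"
    and "smooth_bounded_domain L" "uniformly_h_convex L"
    and "\<Omega> = hyp_psum p a K b L"
    and "q = p / (real CARD('n) + 1)"
  shows "V \<Omega> powr q \<ge> a * V K powr q + b * V L powr q \<and>
    (p = 1 \<longrightarrow> hyp_dilates K L \<longrightarrow>
       V \<Omega> powr q = a * V K powr q + b * V L powr q) \<and>
    (1 < p \<and> a * b \<noteq> 0 \<longrightarrow>
       (V \<Omega> powr q = a * V K powr q + b * V L powr q \<longleftrightarrow> hyp_dilates K L))"
proof -
  note p = assms(1,2) and ab = assms(3-5)
  obtain h1 where h1: "h_body h1" and K: "K = hdom h1" using uniformly_h_convex_imp_h_body[OF assms(6,7)] by blast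
  obtain h2 where h2: "h_body h2" and L: "L = hdom h2" using uniformly_h_convex_imp_h_body[OF assms(8,9)] by blast
  let ?h = "\<lambda>v. psum p a b (h1 v) (h2 v)"
  have h: "h_body ?h" by (rule h_body_psum[OF h1 h2 p ab])
  have \<Omega>: "\<Omega> = hdom ?h" unfolding assms(10) K L by (rule hyp_psum_hdom[OF h1 h2 p ab])
  have V: "V K powr q = kap h1 powr p" "V L powr q = kap h2 powr p" "V \<Omega> powr q = kap ?h powr p"
    unfolding K L \<Omega> assms(11) using V_powr h1 h2 h by blast+
  have sum: "a * V K powr q + b * V L powr q = psum p a b (kap h1) (kap h2) powr p"
    unfolding V by (rule psum_powr[OF p(1) ab(1,2), symmetric])
  have nn: "psum p a b (kap h1) (kap h2) \<ge> 0" "kap ?h \<ge> 0" by (simp_all add: psum_def kap_def)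
  have ineq: "a * V K powr q + b * V L powr q \<le> V \<Omega> powr q"
    unfolding sum V(3) by (rule powr_mono2) (use p nn kap_psum(1)[OF h1 h2 p ab] in auto)
  have dil: "hyp_dilates K L \<longleftrightarrow> (\<exists>c>0. \<forall>z. norm z = 1 \<longrightarrow> h1 z = c * h2 z)"
    unfolding K L by (rule hyp_dilates_hdom[OF h1 h2])
  have eq1: "V \<Omega> powr q = a * V K powr q + b * V L powr q" if "hyp_dilates K L"
  proof -
    obtain c where c: "c > 0" "\<forall>z. norm z = 1 \<longrightarrow> h1 z = c * h2 z" using \<open>hyp_dilates K L\<close> dil by blast
    have "kap ?h = psum p a b (kap h1) (kap h2)"
      by (rule kap_psum_dilate[OF h1 h2 p ab c(1)]) (use c(2) in blast)
    then show ?thesis unfolding sum V(3) by simp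
  qed
  have eq2: "hyp_dilates K L" if h: "1 < p" "a * b \<noteq> 0" and e: "V \<Omega> powr q = a * V K powr q + b * V L powr q"
  proof -
    have ab': "a > 0" "b > 0" using h(2) ab by auto
    have pk: "kap ?h powr p = psum p a b (kap h1) (kap h2) powr p" using e unfolding sum V(3) .
    have k: "kap ?h = psum p a b (kap h1) (kap h2)" using arg_cong[OF pk, of "\<lambda>x. x powr (1 / p)"] nn p by (simp add: powr_powr)
    have "h1 z = kap h1 / kap h2 * h2 z" if "norm z = 1" for z
      by (rule kap_psum(2)[OF h1 h2 p ab h(1) ab' k that])
    then show ?thesis unfolding dil using kap_pos[OF h1] kap_pos[OF h2] by (intro exI[of _ "kap h1 / kap h2"]) simp
  qed
  show ?thesis using ineq eq1 eq2 by blast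
qed

end
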